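(* Let $M$ be a smooth manifold, $X$ a vector field on $M$ and $f$ a real-valued function on $M$, both depending smoothly and 1-periodically on time, i.e. $X_t$ and $f_t$ for $t\in S^1=\mathbb{R}/\mathbb{Z}$. Let $x_0:S^1\to M$ be a non-degenerate 1-periodic orbit of the vector field $fX$ (in particular, it is assumed that $x_0^*TM\to S^1$ is trivial). Then there is $\tau_0>0$ such that for every delay $\tau\in\mathbb{R}$ with $|\tau|\le\tau_0$ there exists a (locally unique) smooth 1-periodic solution $x_\tau:S^1\to M$ of the delay equation $$\partial_t x(t)=f_t(x(t-\tau))\cdot X_t(x(t))\qquad\text{for all } t\in S^1 .$$ Moreover, the parametrization $\tau\mapsto x_\tau$ is smooth.
   Context: A 1-periodic orbit of the time-dependent vector field $fX$ (meaning $(fX)_t(p)=f_t(p)X_t(p)$) is a map $x:S^1\to M$ with $\partial_t x(t)=f_t(x(t))X_t(x(t))$ for all $t$. Let $\Phi_{fX}^t$ denote the flow of $fX$ starting at time $0$. A 1-periodic orbit $x$ of $fX$ such that the bundle $x^*TM\to S^1$ is trivial is called non-degenerate if the linearized time-1-map $\mathrm{d}\Phi_{fX}^1(x(0)):T_{x(0)}M\to T_{x(0)}M$ does not have $1$ as an eigenvalue. The family $(x_\tau)$ extends the given orbit, i.e. its member at $\tau=0$ is $x_0$. "Locally unique" means: there is a neighborhood of $(0,x_0)$ in $\mathbb{R}\times W^{1,2}(S^1,M)$ in which the pairs $(\tau,x)$ with $x$ a 1-periodic solution of the delay equation with delay $\tau$ are exactly the pairs $(\tau,x_\tau)$ (for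 $\tau$ near $0$). "The parametrization is smooth" means that $\tau\mapsto x_\tau$ is a $C^\infty$ map into $W^{1+m,2}(S^1,M)$ for every $m\ge 0$. *)

theory Defs
  imports "HOL-Analysis.Analysis"
begin

section \<open>Smooth maps between open subsets of Euclidean spaces\<close>

text \<open>The set \<open>S\<close> is meant to be open. In finite dimension, continuity of all iterated directional
  derivatives together with Frechet differentiability at every stage is the usual class \<open>C\<^sup>k\<close>.\<close>

primrec Ck_on :: "nat \<Rightarrow> 'a::euclidean_space set \<Rightarrow> ('a \<Rightarrow> 'b::real_normed_vector) \<Rightarrow> bool" where
  "Ck_on 0 S f \<longleftrightarrow> continuous_on S f"
| "Ck_on (Suc k) S f \<longleftrightarrow>
     (\<forall>x\<in>S. f differentiable (at x)) \<and> (\<forall>v. Ck_on k S (\<lambda>x. frechet_derivative f (at x) v))"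

definition smooth_on :: "'a::euclidean_space set \<Rightarrow> ('a \<Rightarrow> 'b::real_normed_vector) \<Rightarrow> bool" where
  "smooth_on S f \<longleftrightarrow> (\<forall>k. Ck_on k S f)"

section \<open>Smooth manifolds, tangent vectors, velocities\<close>

text \<open>A smooth manifold without boundary is a Hausdorff, second countable type \<open>'m\<close> with a smooth
  atlas, modelled on the Euclidean space \<open>'e\<close>. A chart is a pair of its domain and its coordinate
  map; the coordinate map is unspecified off the domain.\<close>

type_synonym ('m, 'e) chart = "'m set \<times> ('m \<Rightarrow> 'e)"

definition is_chart :: "('m::topological_space, 'e::euclidean_space) chart \<Rightarrow> bool" where
  "is_chart c \<longleftrightarrow> open (fst c) \<and> open (snd c ` fst c) \<and>
     homeomorphism (fst c) (snd c ` fst c) (snd c) (inv_into (fst c) (snd c))"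

abbreviation chart_inv :: "('m, 'e) chart \<Rightarrow> 'e \<Rightarrow> 'm" where
  "chart_inv c \<equiv> inv_into (fst c) (snd c)"

definition smooth_atlas ::
  "('m::{t2_space, second_countable_topology}, 'e::euclidean_space) chart set \<Rightarrow> bool" where
  "smooth_atlas A \<longleftrightarrow> (\<forall>c\<in>A. is_chart c) \<and> (\<Union>c\<in>A. fst c) = UNIV \<and>
     (\<forall>c\<in>A. \<forall>d\<in>A. smooth_on (snd c ` (fst c \<inter> fst d)) (snd d \<circ> chart_inv c))"

text \<open>A tangent vector at \<open>p\<close> is the family of its coordinate representatives, one for every chart
  of the atlas around \<open>p\<close>, related by the derivatives of the transition maps; it is set to \<open>0\<close> at
  all other pairs, so that equality of functions is equality of tangent vectors and the vector
  space operations are pointwise.\<close>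

type_synonym ('m, 'e) tangent_vector = "('m, 'e) chart \<Rightarrow> 'e"

definition tangent_space ::
  "('m, 'e::euclidean_space) chart set \<Rightarrow> 'm \<Rightarrow> ('m, 'e) tangent_vector set" where
  "tangent_space A p = {v.
     (\<forall>c. \<not> (c \<in> A \<and> p \<in> fst c) \<longrightarrow> v c = 0) \<and>
     (\<forall>c\<in>A. \<forall>d\<in>A. p \<in> fst c \<and> p \<in> fst d \<longrightarrow>
        v d = frechet_derivative (snd d \<circ> chart_inv c) (at (snd c p)) (v c))}"

definition tangent_scale :: "real \<Rightarrow> ('m, 'e::euclidean_space) tangent_vector \<Rightarrow> ('m, 'e) tangent_vector" where
  "tangent_scale r v = (\<lambda>c. r *\<^sub>R v c)"

text \<open>The differential at \<open>p\<close> of a self-map \<open>F\<close> of the manifold. By the chain rule it does not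
  depend on the chart chosen around \<open>p\<close>.\<close>

definition differential ::
  "('m, 'e::euclidean_space) chart set \<Rightarrow> ('m \<Rightarrow> 'm) \<Rightarrow> 'm \<Rightarrow>
     ('m, 'e) tangent_vector \<Rightarrow> ('m, 'e) tangent_vector" where
  "differential A F p v = (let c = (SOME c. c \<in> A \<and> p \<in> fst c) in
     (\<lambda>d. if d \<in> A \<and> F p \<in> fst d
          then frechet_derivative (snd d \<circ> F \<circ> chart_inv c) (at (snd c p)) (v c) else 0))"

text \<open>Time-dependent functions and vector fields that are smooth in time and space jointly.
  Here and below, objects on \<open>S\<^sup>1 = \<real>/\<int>\<close> are 1-periodic objects on \<open>\<real>\<close>.\<close>

definition smooth_periodic_function ::
  "('m, 'e::euclidean_space) chart set \<Rightarrow> (real \<Rightarrow> 'm \<Rightarrow> real) \<Rightarrow> bool" where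
  "smooth_periodic_function A f \<longleftrightarrow> (\<forall>t. f (t + 1) = f t) \<and>
     (\<forall>c\<in>A. smooth_on (UNIV \<times> snd c ` fst c) (\<lambda>(t, y). f t (chart_inv c y)))"

definition smooth_periodic_vector_field ::
  "('m, 'e::euclidean_space) chart set \<Rightarrow> (real \<Rightarrow> 'm \<Rightarrow> ('m, 'e) tangent_vector) \<Rightarrow> bool" where
  "smooth_periodic_vector_field A X \<longleftrightarrow> (\<forall>t. X (t + 1) = X t) \<and>
     (\<forall>t p. X t p \<in> tangent_space A p) \<and>
     (\<forall>c\<in>A. smooth_on (UNIV \<times> snd c ` fst c) (\<lambda>(t, y). X t (chart_inv c y) c))"

text \<open>The curve \<open>x\<close> has velocity \<open>v\<close> at time \<open>t\<close>, relative to times in \<open>S\<close>. Continuity of the curve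
  is required separately, since coordinate maps are unspecified off their domains.\<close>

definition has_velocity ::
  "('m::topological_space, 'e::euclidean_space) chart set \<Rightarrow> (real \<Rightarrow> 'm) \<Rightarrow>
     ('m, 'e) tangent_vector \<Rightarrow> real \<Rightarrow> real set \<Rightarrow> bool" where
  "has_velocity A x v t S \<longleftrightarrow> continuous (at t within S) x \<and> v \<in> tangent_space A (x t) \<and>
     (\<forall>c\<in>A. x t \<in> fst c \<longrightarrow> ((snd c \<circ> x) has_vector_derivative v c) (at t within S))"

section \<open>Periodic orbits and non-degeneracy\<close>

definition integral_curve_on ::
  "('m::topological_space, 'e::euclidean_space) chart set \<Rightarrow> (real \<Rightarrow> 'm \<Rightarrow> ('m, 'e) tangent_vector) \<Rightarrow>
     real set \<Rightarrow> (real \<Rightarrow> 'm) \<Rightarrow> bool" where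
  "integral_curve_on A Y S x \<longleftrightarrow> (\<forall>t\<in>S. has_velocity A x (Y t (x t)) t S)"

definition periodic_orbit ::
  "('m::topological_space, 'e::euclidean_space) chart set \<Rightarrow> (real \<Rightarrow> 'm \<Rightarrow> ('m, 'e) tangent_vector) \<Rightarrow>
     (real \<Rightarrow> 'm) \<Rightarrow> bool" where
  "periodic_orbit A Y x \<longleftrightarrow> (\<forall>t. x (t + 1) = x t) \<and> integral_curve_on A Y UNIV x"

text \<open>The flow of \<open>Y\<close> starting at time \<open>0\<close>: the value at time \<open>t\<close> of the integral curve through \<open>p\<close>
  at time \<open>0\<close>. It is unspecified where that integral curve does not exist up to time \<open>t\<close>.\<close>

definition flow ::
  "('m::topological_space, 'e::euclidean_space) chart set \<Rightarrow> (real \<Rightarrow> 'm \<Rightarrow> ('m, 'e) tangent_vector) \<Rightarrow>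
     real \<Rightarrow> 'm \<Rightarrow> 'm" where
  "flow A Y t p =
     (THE q. \<exists>x. integral_curve_on A Y (closed_segment 0 t) x \<and> x 0 = p \<and> x t = q)"

text \<open>Triviality of the pulled back bundle \<open>x\<^sup>*TM\<close> over \<open>S\<^sup>1\<close>: a continuous 1-periodic family of linear
  isomorphisms from the model space onto the tangent spaces along \<open>x\<close>.\<close>

definition trivial_pullback ::
  "('m::topological_space, 'e::euclidean_space) chart set \<Rightarrow> (real \<Rightarrow> 'm) \<Rightarrow> bool" where
  "trivial_pullback A x \<longleftrightarrow> (\<exists>E :: real \<Rightarrow> 'e \<Rightarrow> ('m, 'e) tangent_vector.
     (\<forall>t. E (t + 1) = E t) \<and>
     (\<forall>t. bij_betw (E t) UNIV (tangent_space A (x t)) \<and> (\<forall>c. linear (\<lambda>w. E t w c))) \<and>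
     (\<forall>c\<in>A. \<forall>w. continuous_on {t. x t \<in> fst c} (\<lambda>t. E t w c)))"

definition nondegenerate_orbit ::
  "('m::topological_space, 'e::euclidean_space) chart set \<Rightarrow> (real \<Rightarrow> 'm \<Rightarrow> ('m, 'e) tangent_vector) \<Rightarrow>
     (real \<Rightarrow> 'm) \<Rightarrow> bool" where
  "nondegenerate_orbit A Y x \<longleftrightarrow> periodic_orbit A Y x \<and> trivial_pullback A x \<and>
     \<not> (\<exists>v\<in>tangent_space A (x 0). v \<noteq> (\<lambda>c. 0) \<and> differential A (flow A Y 1) (x 0) v = v)"

section \<open>The delay equation\<close>

definition delay_solution ::
  "('m::topological_space, 'e::euclidean_space) chart set \<Rightarrow> (real \<Rightarrow> 'm \<Rightarrow> real) \<Rightarrow>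
     (real \<Rightarrow> 'm \<Rightarrow> ('m, 'e) tangent_vector) \<Rightarrow> real \<Rightarrow> (real \<Rightarrow> 'm) \<Rightarrow> bool" where
  "delay_solution A f X \<tau> x \<longleftrightarrow> (\<forall>t. x (t + 1) = x t) \<and>
     (\<forall>t. has_velocity A x (tangent_scale (f t (x (t - \<tau>))) (X t (x t))) t UNIV)"

definition smooth_loop ::
  "('m::topological_space, 'e::euclidean_space) chart set \<Rightarrow> (real \<Rightarrow> 'm) \<Rightarrow> bool" where
  "smooth_loop A x \<longleftrightarrow> (\<forall>t. x (t + 1) = x t) \<and> continuous_on UNIV x \<and>
     (\<forall>c\<in>A. smooth_on {t. x t \<in> fst c} (snd c \<circ> x))"

section \<open>Sobolev spaces \<open>W\<^sup>k\<^sup>,\<^sup>2\<close> on a compact interval\<close>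

definition L2_on :: "real \<Rightarrow> real \<Rightarrow> (real \<Rightarrow> 'e::euclidean_space) \<Rightarrow> bool" where
  "L2_on a b u \<longleftrightarrow> set_borel_measurable lborel {a..b} u \<and>
     set_integrable lborel {a..b} (\<lambda>t. (norm (u t))\<^sup>2)"

definition test_function :: "real \<Rightarrow> real \<Rightarrow> (real \<Rightarrow> real) \<Rightarrow> bool" where
  "test_function a b \<psi> \<longleftrightarrow> \<psi> C1_differentiable_on UNIV \<and>
     (\<exists>a' b'. a < a' \<and> b' < b \<and> (\<forall>t. t \<notin> {a'..b'} \<longrightarrow> \<psi> t = 0))"

definition has_weak_derivative ::
  "real \<Rightarrow> real \<Rightarrow> (real \<Rightarrow> 'e::euclidean_space) \<Rightarrow> (real \<Rightarrow> 'e) \<Rightarrow> bool" where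
  "has_weak_derivative a b u v \<longleftrightarrow> (\<forall>\<psi>. test_function a b \<psi> \<longrightarrow>
     (LINT t:{a..b}|lborel. deriv \<psi> t *\<^sub>R u t) = - (LINT t:{a..b}|lborel. \<psi> t *\<^sub>R v t))"

primrec sobolev_on :: "nat \<Rightarrow> real \<Rightarrow> real \<Rightarrow> (real \<Rightarrow> 'e::euclidean_space) \<Rightarrow> bool" where
  "sobolev_on 0 a b u \<longleftrightarrow> L2_on a b u"
| "sobolev_on (Suc k) a b u \<longleftrightarrow> L2_on a b u \<and> (\<exists>v. has_weak_derivative a b u v \<and> sobolev_on k a b v)"

text \<open>A square integrable weak derivative is unique up to null sets, so the norm below does not
  depend on the choice made here.\<close>

definition weak_derivative ::
  "real \<Rightarrow> real \<Rightarrow> (real \<Rightarrow> 'e::euclidean_space) \<Rightarrow> real \<Rightarrow> 'e" where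
  "weak_derivative a b u = (SOME v. L2_on a b v \<and> has_weak_derivative a b u v)"

definition sobolev_norm :: "nat \<Rightarrow> real \<Rightarrow> real \<Rightarrow> (real \<Rightarrow> 'e::euclidean_space) \<Rightarrow> real" where
  "sobolev_norm k a b u =
     sqrt (\<Sum>j\<le>k. LINT t:{a..b}|lborel. (norm ((weak_derivative a b ^^ j) u t))\<^sup>2)"

text \<open>A curve \<open>g\<close>, defined on a set \<open>J\<close> of reals without isolated points, is \<open>C\<^sup>\<infinity>\<close> into
  \<open>W\<^sup>k\<^sup>,\<^sup>2([a,b])\<close>: there are iterated derivatives \<open>D j\<close>, the difference quotients converging in the
  Sobolev norm.\<close>

definition smooth_curve_sobolev ::
  "nat \<Rightarrow> real \<Rightarrow> real \<Rightarrow> real set \<Rightarrow> (real \<Rightarrow> real \<Rightarrow> 'e::euclidean_space) \<Rightarrow> bool" where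
  "smooth_curve_sobolev k a b J g \<longleftrightarrow> (\<exists>D :: nat \<Rightarrow> real \<Rightarrow> real \<Rightarrow> 'e.
     (\<forall>\<tau>\<in>J. D 0 \<tau> = g \<tau>) \<and>
     (\<forall>j. \<forall>\<tau>\<in>J. sobolev_on k a b (D j \<tau>) \<and>
        ((\<lambda>\<sigma>. sobolev_norm k a b
            (\<lambda>t. (1 / (\<sigma> - \<tau>)) *\<^sub>R (D j \<sigma> t - D j \<tau> t) - D (Suc j) \<tau> t)) \<longlongrightarrow> 0)
          (at \<tau> within J)))"

section \<open>The Hilbert manifold \<open>W\<^sup>k\<^sup>,\<^sup>2(S\<^sup>1, M)\<close> for \<open>k \<ge> 1\<close>\<close>

text \<open>Elements are represented by their continuous representatives. Cutting \<open>S\<^sup>1\<close> into finitely many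
  intervals, each mapped by a given loop into a chart domain, identifies a neighbourhood of the loop
  with a closed submanifold (matching conditions at the end points) of a finite product of spaces
  \<open>W\<^sup>k\<^sup>,\<^sup>2([a,b], 'e)\<close>. Hence the topology is generated by conditions on such pieces, and a curve is
  smooth iff its pieces in charts are.\<close>

definition sobolev_loops ::
  "nat \<Rightarrow> ('m::topological_space, 'e::euclidean_space) chart set \<Rightarrow> (real \<Rightarrow> 'm) set" where
  "sobolev_loops k A = {x. (\<forall>t. x (t + 1) = x t) \<and> continuous_on UNIV x \<and>
     (\<forall>c\<in>A. \<forall>a b. a < b \<and> x ` {a..b} \<subseteq> fst c \<longrightarrow> sobolev_on k a b (snd c \<circ> x))}"

definition sobolev_nbhd ::
  "nat \<Rightarrow> ('m::topological_space, 'e::euclidean_space) chart set \<Rightarrow> (real \<Rightarrow> 'm) \<Rightarrow>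
     ('m, 'e) chart \<Rightarrow> real \<Rightarrow> real \<Rightarrow> real \<Rightarrow> (real \<Rightarrow> 'm) set" where
  "sobolev_nbhd k A u c a b \<epsilon> = {v \<in> sobolev_loops k A. v ` {a..b} \<subseteq> fst c \<and>
     sobolev_norm k a b (\<lambda>t. snd c (v t) - snd c (u t)) < \<epsilon>}"

definition sobolev_loop_topology ::
  "nat \<Rightarrow> ('m::topological_space, 'e::euclidean_space) chart set \<Rightarrow> (real \<Rightarrow> 'm) topology" where
  "sobolev_loop_topology k A = topology_generated_by
     {sobolev_nbhd k A u c a b \<epsilon> | u c a b \<epsilon>.
        u \<in> sobolev_loops k A \<and> c \<in> A \<and> a < b \<and> u ` {a..b} \<subseteq> fst c \<and> \<epsilon> > 0}"

definition smooth_curve_sobolev_loops ::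
  "nat \<Rightarrow> ('m::topological_space, 'e::euclidean_space) chart set \<Rightarrow> real set \<Rightarrow>
     (real \<Rightarrow> real \<Rightarrow> 'm) \<Rightarrow> bool" where
  "smooth_curve_sobolev_loops k A J \<gamma> \<longleftrightarrow> (\<forall>\<tau>\<in>J. \<gamma> \<tau> \<in> sobolev_loops k A) \<and>
     (\<forall>\<sigma>\<in>J. \<forall>c\<in>A. \<forall>a b. a < b \<and> \<gamma> \<sigma> ` {a..b} \<subseteq> fst c \<longrightarrow>
        (\<exists>e>0. (\<forall>\<tau>\<in>J \<inter> ball \<sigma> e. \<gamma> \<tau> ` {a..b} \<subseteq> fst c) \<and>
           smooth_curve_sobolev k a b (J \<inter> ball \<sigma> e) (\<lambda>\<tau>. snd c \<circ> \<gamma> \<tau>)))"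

end

theory Submission
 imports Defs
begin

text \<open>
 The flow of \<open>fX\<close> along \<open>x\<^sub>0\<close>, corrected by a cut-off in time, gives maps \<open>\<Psi>\<^sub>t\<close> such that \<open>x(t) = \<Psi>\<^sub>t(y(t))\<close>
 turns the loops near \<open>x\<^sub>0\<close> into the small curves \<open>y\<close> in Euclidean space with \<open>y(t) = Q(y(t+1))\<close>, where \<open>Q\<close> is
 the linearized time-1-map. The delay equation becomes \<open>y'(t) = G(\<tau>, t, y(t-\<tau>), y(t))\<close>, and at \<open>\<tau> = 0\<close>,
 \<open>y = 0\<close> the linearization of \<open>G\<close> vanishes on the diagonal. Since \<open>1\<close> is not an eigenvalue of \<open>Q\<close>, a
 curve \<open>y\<close> of this kind is determined, and bounded, by its derivative; so the equation is a contraction in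
 \<open>y'\<close>, which gives existence and local uniqueness. The shift \<open>y \<mapsto> y(\<cdot> - \<tau>)\<close> is not
 differentiable in \<open>\<tau>\<close> on a fixed function space. Smoothness in \<open>(\<tau>, t)\<close> is therefore obtained from the
 difference quotients: they form a Cauchy family, and their limit solves an equation of the same type.
\<close>

section \<open>Calculus of \<open>C\<^sup>k\<close> maps\<close>

text \<open>The unknown is \<open>y'\<close> because of the delay:
  \<open>y(t - \<tau>) - y(t)\<close> is at most a multiple of \<open>\<bar>\<tau>\<bar>\<close>
  times a bound of \<open>y'\<close>, so the delayed argument differs from the present one by a
  small amount although no second derivative is available. What is left of the linearization is its
  value on the diagonal, and this vanishes because nearby starting values yield orbits of the same
  field. The return map of these orbits is nonlinear; the cut-off trades it for its derivative
  \<open>Q\<close> at the price of an error that vanishes to first order at the orbit. The condition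
  on \<open>y\<close> thereby becomes linear, so curves can be subtracted, integrated and
  differentiated without leaving their class. Differentiating the equation in \<tau> changes its
  inhomogeneous part and not its linearization. One contraction constant therefore serves all
  orders, and smoothness of every order holds on the same interval of delays. All estimates are
  uniform ones on compact time intervals. Sobolev norms enter at the end only: they are bounded by
  uniform norms of derivatives, and the embedding into continuous curves turns uniform local
  uniqueness into the stated one.\<close>

abbreviation fderiv :: "('a::real_normed_vector \<Rightarrow> 'b::real_normed_vector) \<Rightarrow> 'a \<Rightarrow> 'a \<Rightarrow> 'b" where
 "fderiv f x \<equiv> frechet_derivative f (at x)"

lemma Ck_on_subset: "Ck_on k S f \<Longrightarrow> T \<subseteq> S \<Longrightarrow> Ck_on k T f"
 by (induction k arbitrary: f) (auto intro: continuous_on_subset)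

lemma Ck_on_cong:
 assumes "open S" "\<And>x. x \<in> S \<Longrightarrow> f x = g x"
 shows "Ck_on k S f = Ck_on k S g"
proof -
 have "Ck_on k S g" if "Ck_on k S f" "\<And>x. x \<in> S \<Longrightarrow> f x = g x" for f g :: "'a \<Rightarrow> 'b"
  using that
 proof (induction k arbitrary: f g)
  case 0
  then show ?case using continuous_on_cong by force
 next
  case (Suc k)
  have "fderiv f x = fderiv g x" if "x \<in> S" for x
   using Suc.prems that \<open>open S\<close>
   by (intro frechet_derivative_transform_within_open[of f x S]) auto
  moreover have "g differentiable (at x)" if "x \<in> S" for x
  proof -
   obtain D where "(f has_derivative D) (at x)"
    using Suc.prems(1) \<open>x \<in> S\<close> by (force simp: differentiable_def)
   then have "(g has_derivative D) (at x)"
    using has_derivative_transform_within_open[OF _ \<open>open S\<close> that] Suc.prems(2) by blast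
   then show ?thesis by (auto simp: differentiable_def)
  qed
  ultimately show ?case
   using Suc.prems(1) Suc.IH[of "\<lambda>x. fderiv f x v" "\<lambda>x. fderiv g x v" for v]
   by auto
 qed
 then show ?thesis using assms(2) by (metis (full_types))
qed

lemma Ck_on_Suc_D: "Ck_on (Suc k) S f \<Longrightarrow> Ck_on k S f"
proof (induction k arbitrary: f)
 case 0
 then show ?case
  by (auto intro!: continuous_at_imp_continuous_on differentiable_imp_continuous_within)
qed auto

lemma Ck_on_le: "Ck_on k S f \<Longrightarrow> j \<le> k \<Longrightarrow> Ck_on j S f"
proof (induction k)
 case (Suc k)
 then show ?case using Ck_on_Suc_D[of k S f] by (cases "j = Suc k") auto
qed simp

lemma Ck_on_continuous: "Ck_on k S f \<Longrightarrow> continuous_on S f"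
 using Ck_on_le[of k S f 0] by simp

lemma Ck_on_has_derivative:
 "Ck_on (Suc k) S f \<Longrightarrow> x \<in> S \<Longrightarrow> (f has_derivative fderiv f x) (at x)"
 by (simp add: frechet_derivative_works[symmetric])

lemma C1_has_derivative:
 "Ck_on 1 S f \<Longrightarrow> x \<in> S \<Longrightarrow> (f has_derivative fderiv f x) (at x)"
 using Ck_on_has_derivative[of 0 S f] by simp

lemma Ck_on_locally:
 assumes "\<And>x. x \<in> S \<Longrightarrow> \<exists>T. open T \<and> x \<in> T \<and> Ck_on k T f"
 shows "Ck_on k S f"
 using assms
proof (induction k arbitrary: f)
 case 0
 have "isCont f x" if "x \<in> S" for x
  using 0[OF that] by (auto simp: continuous_on_eq_continuous_at)
 then show ?case by (simp add: continuous_at_imp_continuous_on)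
next
 case (Suc k)
 have "f differentiable (at x)" if "x \<in> S" for x
  using Suc.prems[OF that] by auto
 moreover have "Ck_on k S (\<lambda>x. fderiv f x v)" for v
 proof (rule Suc.IH)
  fix x assume "x \<in> S"
  from Suc.prems[OF this] show "\<exists>T. open T \<and> x \<in> T \<and> Ck_on k T (\<lambda>x. fderiv f x v)"
   by auto
 qed
 ultimately show ?case by simp
qed

lemma Ck_on_const [simp]: "Ck_on k S (\<lambda>x. c)"
 by (induction k arbitrary: c) auto

lemma frechet_derivative_bounded_linear:
 "bounded_linear L \<Longrightarrow> fderiv L x = L"
 using frechet_derivative_at bounded_linear_imp_has_derivative by metis

lemma Ck_on_bounded_linear: "bounded_linear f \<Longrightarrow> Ck_on k S f"
 by (cases k)
  (auto simp: frechet_derivative_bounded_linear bounded_linear_imp_differentiable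
    intro: linear_continuous_on)

lemma Ck_on_id [simp]: "Ck_on k S (\<lambda>x. x)"
 by (simp add: Ck_on_bounded_linear)

lemma Ck_on_SucI:
 assumes "open S" and D: "\<And>x. x \<in> S \<Longrightarrow> (f has_derivative D x) (at x)"
  and "\<And>v. Ck_on k S (\<lambda>x. D x v)"
 shows "Ck_on (Suc k) S f"
proof -
 have "Ck_on k S (\<lambda>x. fderiv f x v) = Ck_on k S (\<lambda>x. D x v)" for v
  using frechet_derivative_at[OF D] by (intro Ck_on_cong) (auto simp: assms(1))
 then show ?thesis using assms by (auto simp: differentiable_def)
qed

lemma Ck_on_SucE:
 assumes "Ck_on (Suc k) S f"
 obtains D where "\<And>x. x \<in> S \<Longrightarrow> (f has_derivative D x) (at x)" "\<And>v. Ck_on k S (\<lambda>x. D x v)"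
  "\<And>x. D x = fderiv f x"
 using assms Ck_on_has_derivative[OF assms] by (metis Ck_on.simps(2))

lemma Ck_on_add:
 assumes "open S" "Ck_on k S f" "Ck_on k S g"
 shows "Ck_on k S (\<lambda>x. f x + g x)"
 using assms(2,3)
proof (induction k arbitrary: f g)
 case 0
 then show ?case by (simp add: continuous_on_add)
next
 case (Suc k)
 obtain F where F: "\<And>x. x \<in> S \<Longrightarrow> (f has_derivative F x) (at x)" "\<And>v. Ck_on k S (\<lambda>x. F x v)"
  using Suc.prems(1) by (rule Ck_on_SucE) blast
 obtain G where G: "\<And>x. x \<in> S \<Longrightarrow> (g has_derivative G x) (at x)" "\<And>v. Ck_on k S (\<lambda>x. G x v)"
  using Suc.prems(2) by (rule Ck_on_SucE) blast
 show ?case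
  by (rule Ck_on_SucI[where D = "\<lambda>x v. F x v + G x v"])
   (auto intro!: derivative_eq_intros F G Suc.IH assms(1))
qed

lemma Ck_on_bilinear:
 assumes B: "bounded_bilinear B" and "open S" "Ck_on k S f" "Ck_on k S g"
 shows "Ck_on k S (\<lambda>x. B (f x) (g x))"
 using assms(3,4)
proof (induction k arbitrary: f g)
 case 0
 then show ?case using bounded_bilinear.continuous_on[OF B] by simp
next
 case (Suc k)
 obtain F where F: "\<And>x. x \<in> S \<Longrightarrow> (f has_derivative F x) (at x)" "\<And>v. Ck_on k S (\<lambda>x. F x v)"
  using Suc.prems(1) by (rule Ck_on_SucE) blast
 obtain G where G: "\<And>x. x \<in> S \<Longrightarrow> (g has_derivative G x) (at x)" "\<And>v. Ck_on k S (\<lambda>x. G x v)"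
  using Suc.prems(2) by (rule Ck_on_SucE) blast
 show ?case
  by (rule Ck_on_SucI[where D = "\<lambda>x v. B (f x) (G x v) + B (F x v) (g x)"])
   (auto intro!: bounded_bilinear.FDERIV[OF B] F G Ck_on_add Suc.IH assms(2)
     Ck_on_Suc_D[OF Suc.prems(1)] Ck_on_Suc_D[OF Suc.prems(2)])
qed

lemmas Ck_on_scaleR = Ck_on_bilinear[OF bounded_bilinear_scaleR]
lemmas Ck_on_inner = Ck_on_bilinear[OF bounded_bilinear_inner]

lemma Ck_on_linear:
 assumes L: "bounded_linear L" and "open S" "Ck_on k S f"
 shows "Ck_on k S (\<lambda>x. L (f x))"
 using assms(3)
proof (induction k arbitrary: f)
 case 0
 then show ?case using bounded_linear.continuous_on[OF L] by simp
next
 case (Suc k)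
 obtain F where F: "\<And>x. x \<in> S \<Longrightarrow> (f has_derivative F x) (at x)" "\<And>v. Ck_on k S (\<lambda>x. F x v)"
  using Suc.prems(1) by (rule Ck_on_SucE) blast
 show ?case
  by (rule Ck_on_SucI[where D = "\<lambda>x v. L (F x v)"])
   (auto intro!: bounded_linear.has_derivative[OF L] F Suc.IH assms(2))
qed

lemma Ck_on_minus: "open S \<Longrightarrow> Ck_on k S f \<Longrightarrow> Ck_on k S (\<lambda>x. - f x)"
 by (rule Ck_on_linear[OF bounded_linear_minus[OF bounded_linear_ident]])

lemma Ck_on_diff:
 "open S \<Longrightarrow> Ck_on k S f \<Longrightarrow> Ck_on k S g \<Longrightarrow> Ck_on k S (\<lambda>x. f x - g x)"
 using Ck_on_add[of S k f "\<lambda>x. - g x"] Ck_on_minus by auto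

lemma Ck_on_sum:
 "open S \<Longrightarrow> (\<And>i. i \<in> A \<Longrightarrow> Ck_on k S (f i)) \<Longrightarrow> Ck_on k S (\<lambda>x. \<Sum>i\<in>A. f i x)"
 by (induction A rule: infinite_finite_induct) (auto intro: Ck_on_add)

lemma Ck_on_Pair:
 fixes f :: "'a::euclidean_space \<Rightarrow> 'b::real_normed_vector" and g :: "'a \<Rightarrow> 'c::real_normed_vector"
 assumes "open S" "Ck_on k S f" "Ck_on k S g"
 shows "Ck_on k S (\<lambda>x. (f x, g x))"
proof -
 have "Ck_on k S (\<lambda>x. (f x, 0) + (0, g x))"
  by (intro Ck_on_add Ck_on_linear[of "\<lambda>u. (u, 0)"] Ck_on_linear[of "\<lambda>u. (0, u)"] assms
    bounded_linear_Pair bounded_linear_ident bounded_linear_zero)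
 then show ?thesis by simp
qed

lemma Ck_on_fst: "open S \<Longrightarrow> Ck_on k S f \<Longrightarrow> Ck_on k S (\<lambda>x. fst (f x))"
 and Ck_on_snd: "open S \<Longrightarrow> Ck_on k S f \<Longrightarrow> Ck_on k S (\<lambda>x. snd (f x))"
 by (auto intro: Ck_on_linear bounded_linear_fst bounded_linear_snd)

lemma linear_basis_expansion:
 assumes "linear (D :: 'a::euclidean_space \<Rightarrow> 'b::real_normed_vector)"
 shows "D w = (\<Sum>b\<in>Basis. (w \<bullet> b) *\<^sub>R D b)"
proof -
 have "D w = D (\<Sum>b\<in>Basis. (w \<bullet> b) *\<^sub>R b)" by (simp add: euclidean_representation)
 then show ?thesis by (simp add: linear_sum[OF assms] linear_scale[OF assms])
qed

text \<open>The chain rule produces the derivative of \<open>g\<close> in the moving direction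
  \<open>F x v\<close>, whereas \<open>Ck_on\<close> speaks of fixed directions. Expanding the
  direction in the basis gives a sum of products to which the induction hypothesis applies.\<close>

lemma Ck_on_compose:
 fixes f :: "'a::euclidean_space \<Rightarrow> 'b::euclidean_space" and g :: "'b \<Rightarrow> 'c::real_normed_vector"
 assumes "open S" "open T" "Ck_on k S f" "Ck_on k T g" "\<And>x. x \<in> S \<Longrightarrow> f x \<in> T"
 shows "Ck_on k S (\<lambda>x. g (f x))"
 using assms(3,4)
proof (induction k arbitrary: g)
 case 0
 then show ?case using assms(5) by (auto intro: continuous_on_compose2)
next
 case (Suc k)
 obtain F where F: "\<And>x. x \<in> S \<Longrightarrow> (f has_derivative F x) (at x)" "\<And>v. Ck_on k S (\<lambda>x. F x v)"
  using Suc.prems(1) by (rule Ck_on_SucE) blast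
 obtain G where G: "\<And>x. x \<in> T \<Longrightarrow> (g has_derivative G x) (at x)" "\<And>v. Ck_on k T (\<lambda>x. G x v)"
  using Suc.prems(2) by (rule Ck_on_SucE) blast
 show ?case
 proof (rule Ck_on_SucI[OF \<open>open S\<close>])
  fix x assume "x \<in> S"
  have "((\<lambda>x. g (f x)) has_derivative (\<lambda>v. G (f x) (F x v))) (at x)"
   using has_derivative_compose[OF F(1) G(1)] \<open>x \<in> S\<close> assms(5) by blast
  moreover have "G (f x) (F x v) = (\<Sum>b\<in>Basis. (F x v \<bullet> b) *\<^sub>R G (f x) b)" for v
   using linear_basis_expansion has_derivative_linear G(1) \<open>x \<in> S\<close> assms(5) by blast
  ultimately show "((\<lambda>x. g (f x)) has_derivative (\<lambda>v. \<Sum>b\<in>Basis. (F x v \<bullet> b) *\<^sub>R G (f x) b)) (at x)"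
   by simp
 next
  show "Ck_on k S (\<lambda>x. \<Sum>b\<in>Basis. (F x v \<bullet> b) *\<^sub>R G (f x) b)" for v
   using Suc.IH[OF Ck_on_Suc_D[OF Suc.prems(1)] G(2)]
   by (intro Ck_on_sum Ck_on_scaleR Ck_on_inner assms(1) F(2) Ck_on_const)
 qed
qed

lemma Ck_on_frechet_derivative_apply:
 fixes f :: "'a::euclidean_space \<Rightarrow> 'b::euclidean_space" and g :: "'b \<Rightarrow> 'c::real_normed_vector"
 assumes "open S" "open T" "Ck_on k S f" "Ck_on (Suc k) T g" "\<And>x. x \<in> S \<Longrightarrow> f x \<in> T" "Ck_on k S w"
 shows "Ck_on k S (\<lambda>x. fderiv g (f x) (w x))"
proof -
 have "Ck_on k S (\<lambda>x. \<Sum>b\<in>Basis. (w x \<bullet> b) *\<^sub>R fderiv g (f x) b)"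
 proof (intro Ck_on_sum Ck_on_scaleR Ck_on_inner Ck_on_const assms(1,6))
  show "Ck_on k S (\<lambda>x. fderiv g (f x) b)" for b
   using Ck_on_compose[OF assms(1,2,3), of "\<lambda>y. fderiv g y b"] assms(4,5) by simp
 qed
 moreover have "fderiv g (f x) (w x) = (\<Sum>b\<in>Basis. (w x \<bullet> b) *\<^sub>R fderiv g (f x) b)"
  if "x \<in> S" for x
  using linear_basis_expansion has_derivative_linear Ck_on_has_derivative[OF assms(4)] assms(5) that by blast
 ultimately show ?thesis using Ck_on_cong[OF \<open>open S\<close>] by (metis (no_types, lifting))
qed

text \<open>The mean value inequality for \<open>f\<close> minus an affine map with slope
  \<open>c\<close>. With \<open>c = 0\<close> it bounds an increment; with \<open>c\<close> the
  derivative at one point it measures the deviation from linearity.\<close>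

lemma vector_mvt_bound:
 fixes f :: "real \<Rightarrow> 'b::real_normed_vector"
 assumes "\<And>x. x \<in> closed_segment a b \<Longrightarrow> (f has_vector_derivative f' x) (at x within closed_segment a b)"
  and "\<And>x. x \<in> closed_segment a b \<Longrightarrow> norm (f' x - c) \<le> B"
 shows "norm (f b - f a - (b - a) *\<^sub>R c) \<le> B * \<bar>b - a\<bar>"
proof -
 have "norm ((f b - b *\<^sub>R c) - (f a - a *\<^sub>R c)) \<le> B * norm (b - a)"
 proof (rule differentiable_bound[where S = "closed_segment a b" and f' = "\<lambda>x h. h *\<^sub>R (f' x - c)"])
  fix x assume x: "x \<in> closed_segment a b"
  show "((\<lambda>x. f x - x *\<^sub>R c) has_derivative (\<lambda>h. h *\<^sub>R (f' x - c))) (at x within closed_segment a b)"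
   using assms(1)[OF x] unfolding has_vector_derivative_def
   by (auto intro!: derivative_eq_intros simp: algebra_simps)
  show "onorm (\<lambda>h. h *\<^sub>R (f' x - c)) \<le> B"
   using assms(2)[OF x] by (intro onorm_le) (auto simp: mult.commute[of B] mult_left_mono)
 qed auto
 then show ?thesis by (simp add: algebra_simps)
qed

text \<open>The increment from \<open>x\<close> to \<open>x + h\<close> is made one coordinate at a
  time; in each step the mean value inequality compares the partial derivative with its value at
  \<open>x\<close>.\<close>

lemma has_derivative_continuous_partials:
 fixes f :: "'a::euclidean_space \<Rightarrow> 'b::real_normed_vector"
 assumes "open S" "x \<in> S"
  and der: "\<And>b x. b \<in> Basis \<Longrightarrow> x \<in> S \<Longrightarrow> ((\<lambda>s. f (x + s *\<^sub>R b)) has_vector_derivative g b x) (at 0)"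
  and cont: "\<And>b. b \<in> Basis \<Longrightarrow> continuous_on S (g b)"
 shows "(f has_derivative (\<lambda>h. \<Sum>b\<in>Basis. (h \<bullet> b) *\<^sub>R g b x)) (at x)"
proof -
 have der': "((\<lambda>s. f (y + s *\<^sub>R b)) has_vector_derivative g b (y + r *\<^sub>R b)) (at r)"
  if "b \<in> Basis" "y + r *\<^sub>R b \<in> S" for b y r
 proof -
  have "((\<lambda>s. f (y + r *\<^sub>R b + s *\<^sub>R b)) \<circ> (\<lambda>s. s - r) has_vector_derivative 1 *\<^sub>R g b (y + r *\<^sub>R b)) (at r)"
   by (rule vector_diff_chain_at) (use der[OF that] in \<open>auto intro!: derivative_eq_intros\<close>)
  then show ?thesis by (simp add: o_def algebra_simps)
 qed
 have main: "\<exists>d>0. \<forall>h. norm h < d \<longrightarrow> norm (f (x + (\<Sum>b\<in>B. (h \<bullet> b) *\<^sub>R b)) - f x - (\<Sum>b\<in>B. (h \<bullet> b) *\<^sub>R g b x)) \<le> e * norm h"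
  if "finite B" "B \<subseteq> Basis" "e > 0" for B e
  using that
 proof (induction B arbitrary: e rule: finite_induct)
  case empty
  then show ?case by (intro exI[of _ 1]) auto
 next
  case (insert b B)
  obtain d1 where d1: "d1 > 0" "\<And>h. norm h < d1 \<Longrightarrow> norm (f (x + (\<Sum>b\<in>B. (h \<bullet> b) *\<^sub>R b)) - f x - (\<Sum>b\<in>B. (h \<bullet> b) *\<^sub>R g b x)) \<le> e/2 * norm h"
   using insert.IH[of "e/2"] insert.prems by auto
  have b: "b \<in> Basis" using insert by auto
  have "isCont (g b) x" using cont[OF b] assms(1,2) by (simp add: continuous_on_eq_continuous_at)
  then obtain d2 where d2: "d2 > 0" "\<And>y. dist y x < d2 \<Longrightarrow> dist (g b y) (g b x) < e/2"
   unfolding continuous_at_eps_delta using insert.prems by (metis half_gt_zero)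
  obtain d3 where d3: "d3 > 0" "ball x d3 \<subseteq> S" using assms openE by blast
  \<comment> \<open>At most as many coordinates as the dimension have been changed, each by at most
    \<open>norm h\<close>, and one more is under way; so every intermediate point is within
    \<open>n * norm h\<close> of \<open>x\<close>.\<close>
  define n where "n = real (card (Basis::'a set)) + 1"
  have n: "n > 0" by (simp add: n_def)
  define d where "d = Min {d1, d2 / n, d3 / n}"
  have "d > 0" using d1 d2 d3 n by (auto simp: d_def)
  moreover have "norm (f (x + (\<Sum>b\<in>insert b B. (h \<bullet> b) *\<^sub>R b)) - f x - (\<Sum>b\<in>insert b B. (h \<bullet> b) *\<^sub>R g b x)) \<le> e * norm h"
   if h: "norm h < d" for h
  proof -
   define y where "y = x + (\<Sum>b\<in>B. (h \<bullet> b) *\<^sub>R b)"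
   have nh: "n * norm h < d2" "n * norm h < d3" "norm h < d1"
    using h n by (auto simp: d_def field_simps)
   have near: "norm (y + r *\<^sub>R b - x) \<le> n * norm h" if "\<bar>r\<bar> \<le> norm h" for r
   proof -
    have "norm (y + r *\<^sub>R b - x) \<le> norm (\<Sum>b\<in>B. (h \<bullet> b) *\<^sub>R b) + norm (r *\<^sub>R b)"
     unfolding y_def by (metis add_diff_cancel_left' norm_triangle_ineq add.assoc)
    also have "norm (\<Sum>b\<in>B. (h \<bullet> b) *\<^sub>R b) \<le> (\<Sum>b\<in>B. norm h)"
     using insert.prems Basis_le_norm by (intro sum_norm_le) (force simp: subset_iff)
    also have "\<dots> \<le> real (card (Basis::'a set)) * norm h"
     using insert.prems card_mono[of "Basis::'a set" B] by (simp add: mult_right_mono)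
    also have "norm (r *\<^sub>R b) \<le> norm h" using b that by simp
    finally show ?thesis by (simp add: n_def algebra_simps)
   qed
   have seg: "\<bar>r\<bar> \<le> norm h" if "r \<in> closed_segment 0 (h \<bullet> b)" for r
    using that Basis_le_norm[OF b, of h] by (auto simp: closed_segment_eq_real_ivl split: if_splits)
   have "norm (f (y + (h \<bullet> b) *\<^sub>R b) - f (y + 0 *\<^sub>R b) - (h \<bullet> b - 0) *\<^sub>R g b x) \<le> (e/2) * \<bar>h \<bullet> b - 0\<bar>"
   proof (rule vector_mvt_bound[where f = "\<lambda>r. f (y + r *\<^sub>R b)" and f' = "\<lambda>r. g b (y + r *\<^sub>R b)"])
    fix r assume r: "r \<in> closed_segment 0 (h \<bullet> b)"
    have nr: "norm (y + r *\<^sub>R b - x) \<le> n * norm h" using near seg[OF r] by blast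
    then have "y + r *\<^sub>R b \<in> S" using d3 nh by (auto simp: dist_norm norm_minus_commute subset_iff)
    then show "((\<lambda>s. f (y + s *\<^sub>R b)) has_vector_derivative g b (y + r *\<^sub>R b)) (at r within closed_segment 0 (h \<bullet> b))"
     using der'[OF b] has_vector_derivative_at_within by blast
    show "norm (g b (y + r *\<^sub>R b) - g b x) \<le> e / 2"
     using d2(2)[of "y + r *\<^sub>R b"] nr nh by (auto simp: dist_norm)
   qed
   moreover have "(e/2) * \<bar>h \<bullet> b - 0\<bar> \<le> e/2 * norm h"
    using Basis_le_norm[OF b, of h] insert.prems by (intro mult_left_mono) auto
   moreover have "norm (f y - f x - (\<Sum>b\<in>B. (h \<bullet> b) *\<^sub>R g b x)) \<le> e/2 * norm h"
    unfolding y_def using d1(2) nh(3) by blast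
   moreover have "f (x + (\<Sum>b\<in>insert b B. (h \<bullet> b) *\<^sub>R b)) - f x - (\<Sum>b\<in>insert b B. (h \<bullet> b) *\<^sub>R g b x)
    = (f (y + (h \<bullet> b) *\<^sub>R b) - f (y + 0 *\<^sub>R b) - (h \<bullet> b - 0) *\<^sub>R g b x) + (f y - f x - (\<Sum>b\<in>B. (h \<bullet> b) *\<^sub>R g b x))"
    using insert by (simp add: y_def algebra_simps)
   moreover have "e/2 * norm h + e/2 * norm h = e * norm h" by simp
   ultimately show ?thesis by (smt (verit) norm_triangle_ineq)
  qed
  ultimately show ?case by blast
 qed
 show ?thesis
  unfolding has_derivative_at_alt
 proof (intro conjI allI impI)
  show "bounded_linear (\<lambda>h. \<Sum>b\<in>Basis. (h \<bullet> b) *\<^sub>R g b x)"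
   by (intro bounded_linear_sum bounded_linear_compose[OF bounded_linear_scaleR_left] bounded_linear_inner_left)
  fix e :: real assume "e > 0"
  then obtain d where d: "d > 0" "\<And>h. norm h < d \<Longrightarrow> norm (f (x + h) - f x - (\<Sum>b\<in>Basis. (h \<bullet> b) *\<^sub>R g b x)) \<le> e * norm h"
   using main[of Basis e] by (auto simp: euclidean_representation)
  show "\<exists>d>0. \<forall>y. norm (y - x) < d \<longrightarrow> norm (f y - f x - (\<Sum>b\<in>Basis. ((y - x) \<bullet> b) *\<^sub>R g b x)) \<le> e * norm (y - x)"
   using d(1) d(2)[of "y - x" for y] by (intro exI[of _ d]) auto
 qed
qed

text \<open>For a function of parameter and time this reduces joint smoothness to the parameter
  derivatives and the time derivative, which are obtained by unrelated arguments.\<close>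

lemma Ck_on_Suc_partials:
 fixes f :: "'a::euclidean_space \<Rightarrow> 'b::real_normed_vector"
 assumes "open S"
  and der: "\<And>b x. b \<in> Basis \<Longrightarrow> x \<in> S \<Longrightarrow> ((\<lambda>s. f (x + s *\<^sub>R b)) has_vector_derivative g b x) (at 0)"
  and Ck: "\<And>b. b \<in> Basis \<Longrightarrow> Ck_on k S (g b)"
 shows "Ck_on (Suc k) S f"
proof (rule Ck_on_SucI[OF \<open>open S\<close>])
 show "(f has_derivative (\<lambda>h. \<Sum>b\<in>Basis. (h \<bullet> b) *\<^sub>R g b x)) (at x)" if "x \<in> S" for x
  using that by (rule has_derivative_continuous_partials[OF assms(1) _ der]) (auto intro: Ck_on_continuous[OF Ck])
 show "Ck_on k S (\<lambda>x. \<Sum>b\<in>Basis. (v \<bullet> b) *\<^sub>R g b x)" for v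
  by (intro Ck_on_sum Ck_on_scaleR Ck Ck_on_const assms(1))
qed


text \<open>Formally \<open>L (v') = w' - (L') v\<close>. This is an equation with the same
  \<open>L\<close> and a right-hand side of one order less, so induction on \<open>k\<close> applies
  and the inverse of \<open>L\<close> never has to be differentiated.\<close>

lemma Ck_on_solve_linear:
 fixes L :: "'a::euclidean_space \<Rightarrow> 'e::euclidean_space \<Rightarrow> 'e"
 assumes "open S" and lin: "\<And>x. x \<in> S \<Longrightarrow> linear (L x)" and inj: "\<And>x. x \<in> S \<Longrightarrow> inj (L x)"
  and "\<And>h. Ck_on k S (\<lambda>x. L x h)" "Ck_on k S w" "\<And>x. x \<in> S \<Longrightarrow> L x (v x) = w x"
 shows "Ck_on k S v"
 using assms(4-)
proof (induction k arbitrary: w v)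
 \<comment> \<open>A lower bound of \<open>L x\<close> persists near \<open>x\<close>, since the
   values on the basis control the operator. It turns estimates of \<open>L x' z\<close> into
   estimates of \<open>z\<close>.\<close>
 have lower: "\<exists>c>0. eventually (\<lambda>x'. \<forall>h. c * norm h \<le> norm (L x' h)) (at x)"
  if xS: "x \<in> S" and cont: "\<And>h. continuous_on S (\<lambda>x. L x h)" for x
 proof -
  obtain c where c: "c > 0" "\<And>h. c * norm h \<le> norm (L x h)"
   using linear_inj_bounded_below_pos[OF lin[OF xS] inj[OF xS]] by metis
  define e where "e x' = (\<Sum>b\<in>Basis. norm (L x' b - L x b))" for x'
  have "(\<lambda>x'. e x') \<midarrow>x\<rightarrow> (\<Sum>b\<in>Basis. norm (L x b - L x b))"
   unfolding e_def using cont \<open>x \<in> S\<close> assms(1)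
   by (intro tendsto_intros) (auto simp: continuous_on_eq_continuous_at isCont_def)
  then have "eventually (\<lambda>x'. e x' < c / 2) (at x)"
   using c(1) by (intro order_tendstoD) auto
  moreover have "eventually (\<lambda>x'. x' \<in> S) (at x)"
   using assms(1) \<open>x \<in> S\<close> by (simp add: eventually_at_in_open')
  ultimately have "eventually (\<lambda>x'. \<forall>h. c / 2 * norm h \<le> norm (L x' h)) (at x)"
  proof eventually_elim
   case (elim x')
   show ?case
   proof
    fix h
    have "norm (L x' h - L x h) = norm (\<Sum>b\<in>Basis. (h \<bullet> b) *\<^sub>R (L x' b - L x b))"
     using linear_basis_expansion[OF lin, of x' h] linear_basis_expansion[OF lin, of x h] elim(2) \<open>x \<in> S\<close>
     by (simp add: scaleR_diff_right sum_subtractf)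
    also have "\<dots> \<le> (\<Sum>b\<in>Basis. norm h * norm (L x' b - L x b))"
     by (intro sum_norm_le) (simp add: Basis_le_norm mult_right_mono)
    also have "\<dots> = norm h * e x'" by (simp add: e_def sum_distrib_left)
    also have "\<dots> \<le> norm h * (c / 2)" using elim(1) by (intro mult_left_mono) auto
    finally have "norm (L x h) \<le> norm (L x' h) + c / 2 * norm h"
     using norm_triangle_ineq2[of "L x h" "L x' h"] by (simp add: norm_minus_commute mult.commute)
    then show "c / 2 * norm h \<le> norm (L x' h)" using c(2)[of h] by simp
   qed
  qed
  then show ?thesis using c(1) by (intro exI[of _ "c / 2"]) simp
 qed
 {
  case 0
  have "(v \<longlongrightarrow> v x) (at x)" if x: "x \<in> S" for x
  proof -
   obtain c where c: "c > 0" "eventually (\<lambda>x'. \<forall>h. c * norm h \<le> norm (L x' h)) (at x)"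
    using lower[OF x] 0 by auto
   have ev: "eventually (\<lambda>x'. norm (v x' - v x) \<le> norm (w x' - L x' (v x)) / c) (at x)"
    using c(2) eventually_at_in_open'[OF assms(1) x]
   proof eventually_elim
    case (elim x')
    have "c * norm (v x' - v x) \<le> norm (L x' (v x' - v x))" using elim by blast
    also have "\<dots> = norm (w x' - L x' (v x))"
     using elim 0(3) lin by (simp add: linear_diff)
    finally show ?case using c(1) by (simp add: field_simps)
   qed
   have "((\<lambda>x'. norm (w x' - L x' (v x)) / c) \<longlongrightarrow> norm (w x - L x (v x)) / c) (at x)"
    using 0(1)[of "v x"] 0(2) x assms(1) c(1)
    by (intro tendsto_intros) (auto simp: continuous_on_eq_continuous_at isCont_def)
   then have "((\<lambda>x'. norm (w x' - L x' (v x)) / c) \<longlongrightarrow> 0) (at x)" using 0(3) x by simp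
   from Lim_null_comparison[OF ev this] show ?thesis by (simp add: LIM_zero_iff)
  qed
  then show ?case
   using assms(1) by (simp add: continuous_on_eq_continuous_at isCont_def)
 next
  case (Suc k)
  have vk: "Ck_on k S v" using Suc.IH[of w v] Suc.prems Ck_on_Suc_D by blast
  define DL where "DL x u = fderiv (\<lambda>x. L x u) x" for x u
  define Dw where "Dw x = fderiv w x" for x
  have DL: "((\<lambda>x. L x u) has_derivative DL x u) (at x)" if "x \<in> S" for x u
   using Ck_on_has_derivative[OF Suc.prems(1) that] by (simp add: DL_def)
  have Dw: "(w has_derivative Dw x) (at x)" if "x \<in> S" for x
   using Ck_on_has_derivative[OF Suc.prems(2) that] by (simp add: Dw_def)
  define D where "D x h = inv (L x) (Dw x h - DL x (v x) h)" for x h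
  have LD: "L x (D x h) = Dw x h - DL x (v x) h" if "x \<in> S" for x h
   using linear_injective_imp_surjective[OF lin inj] that by (simp add: D_def surj_f_inv_f)
  have linD: "linear (D x)" if "x \<in> S" for x
  proof -
   have "linear (inv (L x))" using inj_linear_imp_inv_linear[OF lin inj] that by blast
   then show ?thesis
    unfolding D_def using has_derivative_linear[OF Dw[OF that]] has_derivative_linear[OF DL[OF that]]
    by (intro linearI) (simp_all add: linear_add linear_scale linear_diff algebra_simps)
  qed
  have cont: "continuous_on S (\<lambda>x. L x h)" for h using Ck_on_continuous[OF Suc.prems(1)] .
  have der: "(v has_derivative D x) (at x)" if x: "x \<in> S" for x
   unfolding has_derivative_iff_norm
  proof
   show blD: "bounded_linear (D x)" using linD[OF x] linear_conv_bounded_linear by blast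
   obtain C where C: "\<And>h. norm (D x h) \<le> norm h * C" "C > 0" using bounded_linear.pos_bounded[OF blD] by blast
   obtain c where c: "c > 0" "eventually (\<lambda>x'. \<forall>h. c * norm h \<le> norm (L x' h)) (at x)"
    using lower[OF x cont] by auto
   \<comment> \<open>With \<open>v\<close> frozen at \<open>x\<close> one has \<open>r x = 0\<close>
     and \<open>L y (v y - v x) = r y\<close>, so differentiability of \<open>r\<close> passes to
     \<open>v\<close> through the lower bound.\<close>
   define r where "r x' = w x' - L x' (v x)" for x'
   have "(r has_derivative (\<lambda>h. Dw x h - DL x (v x) h)) (at x)"
    unfolding r_def using Dw[OF x] DL[OF x] by (intro derivative_intros) auto
   then have r: "((\<lambda>y. norm (r y - r x - (\<lambda>h. Dw x h - DL x (v x) h) (y - x)) / norm (y - x)) \<longlongrightarrow> 0) (at x)"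
    unfolding has_derivative_iff_norm by simp
   define e where "e x' = (\<Sum>b\<in>Basis. norm (L x' b - L x b))" for x'
   have "(\<lambda>x'. e x') \<midarrow>x\<rightarrow> (\<Sum>b\<in>Basis. norm (L x b - L x b))"
    unfolding e_def using cont \<open>x \<in> S\<close> assms(1)
    by (intro tendsto_intros) (auto simp: continuous_on_eq_continuous_at isCont_def)
   then have e: "(e \<longlongrightarrow> 0) (at x)" by simp
   have ev: "eventually (\<lambda>y. norm (norm (v y - v x - D x (y - x)) / norm (y - x)) \<le>
     (norm (r y - r x - (\<lambda>h. Dw x h - DL x (v x) h) (y - x)) / norm (y - x) + C * e y) / c) (at x)"
    using c(2) eventually_at_in_open[OF assms(1) x]
   proof eventually_elim
    case (elim y)
    define z where "z = D x (y - x)"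
    have ne: "norm (y - x) > 0" using elim by simp
    have "norm (L y z - L x z) = norm (\<Sum>b\<in>Basis. (z \<bullet> b) *\<^sub>R (L y b - L x b))"
     using linear_basis_expansion[OF lin, of y z] linear_basis_expansion[OF lin, of x z] elim(2) \<open>x \<in> S\<close>
     by (simp add: scaleR_diff_right sum_subtractf)
    also have "\<dots> \<le> (\<Sum>b\<in>Basis. norm z * norm (L y b - L x b))"
     by (intro sum_norm_le) (simp add: Basis_le_norm mult_right_mono)
    also have "\<dots> = norm z * e y" by (simp add: e_def sum_distrib_left)
    also have "\<dots> \<le> (norm (y - x) * C) * e y" unfolding z_def
     by (intro mult_right_mono C) (simp add: e_def sum_nonneg)
    finally have 1: "norm (L y z - L x z) \<le> norm (y - x) * C * e y" .
    have "c * norm (v y - v x - z) \<le> norm (L y (v y - v x - z))" using elim(1) by blast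
    also have "L y (v y - v x - z) = (r y - r x - (Dw x (y - x) - DL x (v x) (y - x))) - (L y z - L x z)"
     using elim(2) x Suc.prems(3) LD[OF x, of "y - x"] lin by (simp add: r_def linear_diff z_def)
    also have "norm \<dots> \<le> norm (r y - r x - (Dw x (y - x) - DL x (v x) (y - x))) + norm (y - x) * C * e y"
     using 1 norm_triangle_ineq4 by (smt (verit))
    finally show ?case using c(1) ne by (simp add: z_def field_simps)
   qed
   have "((\<lambda>y. (norm (r y - r x - (\<lambda>h. Dw x h - DL x (v x) h) (y - x)) / norm (y - x) + C * e y) / c) \<longlongrightarrow> (0 + C * 0) / c) (at x)"
    using c(1) by (intro tendsto_intros r e) auto
   then have lim: "((\<lambda>y. (norm (r y - r x - (\<lambda>h. Dw x h - DL x (v x) h) (y - x)) / norm (y - x) + C * e y) / c) \<longlongrightarrow> 0) (at x)"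
    by simp
   show "((\<lambda>y. norm (v y - v x - D x (y - x)) / norm (y - x)) \<longlongrightarrow> 0) (at x)"
    by (rule Lim_null_comparison[OF ev lim])
  qed
  show ?case
  proof (rule Ck_on_SucI[OF assms(1) der])
   fix h
   have "Ck_on k S (\<lambda>x. Dw x h - DL x (v x) h)"
   proof (rule Ck_on_diff[OF assms(1)])
    show "Ck_on k S (\<lambda>x. Dw x h)" using Suc.prems(2) by (simp add: Dw_def)
    have "Ck_on k S (\<lambda>x. \<Sum>b\<in>Basis. (v x \<bullet> b) *\<^sub>R DL x b h)"
     using Suc.prems(1) by (intro Ck_on_sum Ck_on_scaleR Ck_on_inner assms(1) vk Ck_on_const) (auto simp: DL_def)
    moreover have "DL x (v x) h = (\<Sum>b\<in>Basis. (v x \<bullet> b) *\<^sub>R DL x b h)" if x: "x \<in> S" for x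
    proof -
     have "((\<lambda>x'. L x' (v x)) has_derivative (\<lambda>h. \<Sum>b\<in>Basis. (v x \<bullet> b) *\<^sub>R DL x b h)) (at x)"
     proof (rule has_derivative_transform_within_open[OF _ assms(1) x])
      show "((\<lambda>x'. \<Sum>b\<in>Basis. (v x \<bullet> b) *\<^sub>R L x' b) has_derivative (\<lambda>h. \<Sum>b\<in>Basis. (v x \<bullet> b) *\<^sub>R DL x b h)) (at x)"
       by (intro has_derivative_sum has_derivative_scaleR_right DL x)
     qed (use linear_basis_expansion[OF lin] in metis)
     from has_derivative_unique[OF DL[OF x] this] show ?thesis by metis
    qed
    ultimately show "Ck_on k S (\<lambda>x. DL x (v x) h)" using Ck_on_cong[OF assms(1)] by (metis (no_types, lifting))
   qed
   then show "Ck_on k S (\<lambda>x. D x h)"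
    using Suc.IH[of "\<lambda>x. Dw x h - DL x (v x) h" "\<lambda>x. D x h"] Suc.prems(1) Ck_on_Suc_D LD by blast
  qed
 }
qed

text \<open>The inverse function theorem supplies a differentiable inverse \<open>g\<close>. Its
  derivative solves a linear equation with coefficients \<open>fderiv f (g y)\<close>, so an inverse
  of class C^k is automatically of class C^(k+1).\<close>

lemma smooth_local_inverse:
 fixes f :: "'a::euclidean_space \<Rightarrow> 'a"
 assumes "open S" "smooth_on S f" "x0 \<in> S"
  and inj: "\<And>h. fderiv f x0 h = 0 \<Longrightarrow> h = 0"
 obtains U V g where "open U" "U \<subseteq> S" "x0 \<in> U" "open V" "homeomorphism U V f g" "smooth_on V g"
proof -
 define f' where "f' x = Blinfun (fderiv f x)" for x
 have Ck: "Ck_on k S f" for k using assms(2) by (simp add: smooth_on_def)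
 have der: "(f has_derivative fderiv f x) (at x)" if "x \<in> S" for x
  using Ck_on_has_derivative[OF Ck that] .
 have f': "blinfun_apply (f' x) = fderiv f x" if "x \<in> S" for x
  using has_derivative_bounded_linear[OF der[OF that]] by (simp add: f'_def bounded_linear_Blinfun_apply)
 have cont: "continuous_on S f'"
 proof (rule continuous_on_blinfun_componentwise)
  fix i :: 'a
  have "continuous_on S (\<lambda>x. fderiv f x i)" using Ck[of "Suc 0"] by simp
  then show "continuous_on S (\<lambda>x. blinfun_apply (f' x) i)"
   using f' by (simp cong: continuous_on_cong)
 qed
 have lin0: "linear (fderiv f x0)" using has_derivative_linear[OF der[OF assms(3)]] .
 have inj0: "Fun.inj (fderiv f x0)" using inj linear_injective_0[OF lin0] by blast
 obtain B where B: "linear B" "B \<circ> fderiv f x0 = id"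
  using linear_injective_left_inverse[OF lin0 inj0] by blast
 have "Blinfun B o\<^sub>L f' x0 = id_blinfun"
 proof (rule blinfun_eqI)
  fix i
  show "blinfun_apply (Blinfun B o\<^sub>L f' x0) i = blinfun_apply id_blinfun i"
   using B f'[OF assms(3)] by (simp add: bounded_linear_Blinfun_apply linear_conv_bounded_linear o_def fun_eq_iff)
 qed
 from inverse_function_theorem[OF \<open>open S\<close> _ cont assms(3) this] der f'
 obtain U V g g' where UV: "open U" "U \<subseteq> S" "x0 \<in> U" "open V" "homeomorphism U V f g"
  and g: "\<And>y. y \<in> V \<Longrightarrow> (g has_derivative (g' y)) (at y)"
  "\<And>y. y \<in> V \<Longrightarrow> g' y = inv (blinfun_apply (f' (g y)))"
  "\<And>y. y \<in> V \<Longrightarrow> bij (blinfun_apply (f' (g y)))"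
  by metis
 have gV: "g y \<in> S" if "y \<in> V" for y using UV that by (auto simp: homeomorphism_def)
 have "Ck_on k V g" for k
 proof (induction k)
  case 0
  then show ?case using UV by (auto simp: homeomorphism_def)
 next
  case (Suc k)
  show ?case
  proof (rule Ck_on_SucI[OF UV(4) g(1)])
   fix h
   show "Ck_on k V (\<lambda>y. g' y h)"
   proof (rule Ck_on_solve_linear[OF UV(4), where L = "\<lambda>y. fderiv f (g y)" and w = "\<lambda>y. h"])
    fix y assume y: "y \<in> V"
    show "linear (fderiv f (g y))" using der[OF gV[OF y]] has_derivative_linear by blast
    show "Fun.inj (fderiv f (g y))" using g(3)[OF y] f'[OF gV[OF y]] by (simp add: bij_is_inj)
    show "fderiv f (g y) (g' y h) = h"
     using g(2,3)[OF y] f'[OF gV[OF y]] by (simp add: bij_is_surj surj_f_inv_f)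
   next
    fix h show "Ck_on k V (\<lambda>y. fderiv f (g y) h)"
     using Ck_on_frechet_derivative_apply[OF UV(4) \<open>open S\<close> Suc Ck gV, of "\<lambda>_. h"] by simp
   qed simp
  qed
 qed
 then show thesis using that UV by (auto simp: smooth_on_def)
qed

section \<open>Smooth functions, and estimates that are uniform near a compact set\<close>

lemma smooth_on_subset: "smooth_on S f \<Longrightarrow> T \<subseteq> S \<Longrightarrow> smooth_on T f"
 by (auto simp: smooth_on_def intro: Ck_on_subset)

lemma smooth_on_cong: "open S \<Longrightarrow> (\<And>x. x \<in> S \<Longrightarrow> f x = g x) \<Longrightarrow> smooth_on S f = smooth_on S g"
 unfolding smooth_on_def using Ck_on_cong by blast

lemma smooth_on_locally:
 "(\<And>x. x \<in> S \<Longrightarrow> \<exists>T. open T \<and> x \<in> T \<and> smooth_on T f) \<Longrightarrow> smooth_on S f"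
 unfolding smooth_on_def by (intro allI Ck_on_locally) blast

lemma smooth_on_continuous: "smooth_on S f \<Longrightarrow> continuous_on S f"
 unfolding smooth_on_def by (drule spec[of _ 0]) simp

lemma smooth_on_has_derivative:
 "smooth_on S f \<Longrightarrow> x \<in> S \<Longrightarrow> (f has_derivative fderiv f x) (at x)"
 unfolding smooth_on_def by (drule spec[of _ "Suc 0"]) (rule Ck_on_has_derivative)

lemma smooth_on_const [simp]: "smooth_on S (\<lambda>x. c)"
 and smooth_on_id [simp]: "smooth_on S (\<lambda>x. x)"
 by (simp_all add: smooth_on_def)

lemma smooth_on_linear: "bounded_linear L \<Longrightarrow> open S \<Longrightarrow> smooth_on S f \<Longrightarrow> smooth_on S (\<lambda>x. L (f x))"
 by (simp add: smooth_on_def Ck_on_linear)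

lemma smooth_on_add: "open S \<Longrightarrow> smooth_on S f \<Longrightarrow> smooth_on S g \<Longrightarrow> smooth_on S (\<lambda>x. f x + g x)"
 and smooth_on_diff: "open S \<Longrightarrow> smooth_on S f \<Longrightarrow> smooth_on S g \<Longrightarrow> smooth_on S (\<lambda>x. f x - g x)"
 by (simp_all add: smooth_on_def Ck_on_add Ck_on_diff)

lemma smooth_on_scaleR: "open S \<Longrightarrow> smooth_on S f \<Longrightarrow> smooth_on S g \<Longrightarrow> smooth_on S (\<lambda>x. f x *\<^sub>R g x)"
 by (simp add: smooth_on_def Ck_on_scaleR)

lemma smooth_on_Pair: "open S \<Longrightarrow> smooth_on S f \<Longrightarrow> smooth_on S g \<Longrightarrow> smooth_on S (\<lambda>x. (f x, g x))"
 by (simp add: smooth_on_def Ck_on_Pair)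

lemma smooth_on_fst: "open S \<Longrightarrow> smooth_on S f \<Longrightarrow> smooth_on S (\<lambda>x. fst (f x))"
 and smooth_on_snd: "open S \<Longrightarrow> smooth_on S f \<Longrightarrow> smooth_on S (\<lambda>x. snd (f x))"
 by (simp_all add: smooth_on_def Ck_on_fst Ck_on_snd)

lemma smooth_on_compose:
 fixes f :: "'a::euclidean_space \<Rightarrow> 'b::euclidean_space"
 shows "open S \<Longrightarrow> open T \<Longrightarrow> smooth_on S f \<Longrightarrow> smooth_on T g \<Longrightarrow> (\<And>x. x \<in> S \<Longrightarrow> f x \<in> T) \<Longrightarrow>
  smooth_on S (\<lambda>x. g (f x))"
 unfolding smooth_on_def using Ck_on_compose by blast

text \<open>Uniform continuity in which only one of the two points has to lie in the compact set. A
  Lebesgue number of a cover by balls of continuity provides it.\<close>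

lemma continuous_near_compact:
 fixes f :: "'a::metric_space \<Rightarrow> 'b::metric_space"
 assumes "compact Q" "open S" "Q \<subseteq> S" "continuous_on S f" "e > 0"
 obtains d where "d > 0" "\<And>q q'. q \<in> Q \<Longrightarrow> dist q' q < d \<Longrightarrow> q' \<in> S \<and> dist (f q') (f q) < e"
proof (cases "Q = {}")
 case True
 then show ?thesis using that[of 1] by auto
next
 case False
 have "\<exists>d>0. ball q d \<subseteq> S \<and> (\<forall>q'\<in>ball q d. dist (f q') (f q) < e / 2)" if q: "q \<in> Q" for q
 proof -
  have "isCont f q" using q assms by (auto simp: continuous_on_eq_continuous_at)
  then obtain d1 where d1: "d1 > 0" "\<And>q'. dist q' q < d1 \<Longrightarrow> dist (f q') (f q) < e / 2"
   unfolding continuous_at_eps_delta using assms(5) by (metis half_gt_zero)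
  obtain d2 where d2: "d2 > 0" "ball q d2 \<subseteq> S" using openE[OF assms(2)] q assms(3) by blast
  show ?thesis
   by (intro exI[of _ "min d1 d2"]) (use d1 d2 in \<open>auto simp: dist_commute\<close>)
 qed
 then have "\<forall>q\<in>Q. \<exists>d>0. ball q d \<subseteq> S \<and> (\<forall>q'\<in>ball q d. dist (f q') (f q) < e / 2)" by blast
 from bchoice[OF this] obtain r where r: "\<And>q. q \<in> Q \<Longrightarrow> r q > 0" "\<And>q. q \<in> Q \<Longrightarrow> ball q (r q) \<subseteq> S"
  "\<And>q q'. q \<in> Q \<Longrightarrow> q' \<in> ball q (r q) \<Longrightarrow> dist (f q') (f q) < e / 2"
  by blast
 obtain d where d: "d > 0" "\<And>x. x \<in> Q \<Longrightarrow> \<exists>G \<in> (\<lambda>q. ball q (r q)) ` Q. ball x d \<subseteq> G"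
 proof (rule Heine_Borel_lemma[OF assms(1), of "(\<lambda>q. ball q (r q)) ` Q"])
  show "Q \<subseteq> \<Union> ((\<lambda>q. ball q (r q)) ` Q)" using r(1) centre_in_ball by blast
 qed auto
 show ?thesis
 proof (rule that[OF d(1)])
  fix q q' assume q: "q \<in> Q" "dist q' q < d"
  obtain p where p: "p \<in> Q" "ball q d \<subseteq> ball p (r p)" using d(2)[OF q(1)] by blast
  have "q \<in> ball q d" "q' \<in> ball q d" using q(2) d(1) by (auto simp: dist_commute)
  then have "q \<in> ball p (r p)" "q' \<in> ball p (r p)" using p(2) by blast+
  then have "q' \<in> S" "dist (f q') (f p) < e / 2" "dist (f q) (f p) < e / 2"
   using r p(1) by (auto simp: subset_iff)
  then show "q' \<in> S \<and> dist (f q') (f q) < e" using dist_triangle_half_r[of "f p" "f q'" e "f q"]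
   by (simp add: dist_commute)
 qed
qed

text \<open>One radius serves all points of the compact set, since the derivatives in the finitely
  many basis directions are uniformly continuous near it. Difference quotients that carry further
  parameters rely on this.\<close>

lemma C1_uniformly_differentiable:
 fixes g :: "'a::euclidean_space \<Rightarrow> 'b::real_normed_vector"
 assumes "compact Q" "open S" "Q \<subseteq> S" "Ck_on 1 S g" "e > 0"
 obtains d where "d > 0" "\<And>x h. x \<in> Q \<Longrightarrow> norm h < d \<Longrightarrow>
  x + h \<in> S \<and> norm (g (x + h) - g x - fderiv g x h) \<le> e * norm h"
proof -
 define n where "n = real (card (Basis::'a set)) + 1"
 have n: "n > 0" by (simp add: n_def)
 have der: "(g has_derivative fderiv g x) (at x)" if "x \<in> S" for x
  using Ck_on_has_derivative[of 0 S g x] assms(4) that by simp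
 have "\<exists>d>0. \<forall>q q'. q \<in> Q \<longrightarrow> dist q' q < d \<longrightarrow> q' \<in> S \<and>
  dist (fderiv g q' b) (fderiv g q b) < e / n" for b
 proof -
  have "continuous_on S (\<lambda>x. fderiv g x b)" using assms(4) by simp
  from continuous_near_compact[OF assms(1-3) this, of "e / n"] show ?thesis
   using assms(5) n by (metis divide_pos_pos)
 qed
 then obtain r where r: "\<And>b. r b > 0" "\<And>b q q'. q \<in> Q \<Longrightarrow> dist q' q < r b \<Longrightarrow> q' \<in> S \<and>
  dist (fderiv g q' b) (fderiv g q b) < e / n" by metis
 define d where "d = Min (r ` Basis)"
 have d: "d > 0" "\<And>b. b \<in> Basis \<Longrightarrow> d \<le> r b" using r(1) by (auto simp: d_def)
 show ?thesis
 proof (rule that[OF d(1)])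
  fix x h :: 'a assume x: "x \<in> Q" and h: "norm h < d"
  have inS: "x + h' \<in> S" if "norm h' < d" for h'
   using r(2)[OF x, of "x + h'"] d(2) that by (metis SOME_Basis add_diff_cancel_left' dist_norm order_less_le_trans)
  have th: "norm (t *\<^sub>R h) < d" if "t \<in> {0..1}" for t
   using that h mult_left_le_one_le[of "norm h" t] by auto
  then have seg: "x + t *\<^sub>R h \<in> S" if "t \<in> {0..1}" for t
   using that by (intro inS) blast
  have bound: "norm (fderiv g (x + t *\<^sub>R h) h - fderiv g x h) \<le> e * norm h"
   if "t \<in> {0..1}" for t
  proof -
   have lin: "linear (fderiv g (x + t *\<^sub>R h))" "linear (fderiv g x)"
    using der seg[OF that] seg[of 0] has_derivative_linear by auto
   have "norm (fderiv g (x + t *\<^sub>R h) h - fderiv g x h) =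
    norm (\<Sum>b\<in>Basis. (h \<bullet> b) *\<^sub>R (fderiv g (x + t *\<^sub>R h) b - fderiv g x b))"
    using linear_basis_expansion[OF lin(1), of h] linear_basis_expansion[OF lin(2), of h]
    by (simp add: scaleR_diff_right sum_subtractf)
   also have "\<dots> \<le> (\<Sum>b\<in>(Basis::'a set). norm h * (e / n))"
   proof (intro sum_norm_le)
    fix b :: 'a assume b: "b \<in> Basis"
    have "dist (x + t *\<^sub>R h) x < r b" using d(2)[OF b] th[OF that] by (simp add: dist_norm)
    then have "norm (fderiv g (x + t *\<^sub>R h) b - fderiv g x b) \<le> e / n"
     using r(2)[OF x] by (auto simp: dist_norm less_imp_le)
    then show "norm ((h \<bullet> b) *\<^sub>R (fderiv g (x + t *\<^sub>R h) b - fderiv g x b)) \<le> norm h * (e / n)"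
     unfolding norm_scaleR using Basis_le_norm[OF b, of h] by (intro mult_mono) auto
   qed
   also have "\<dots> = (e * norm h) * (real (card (Basis::'a set)) / n)" by simp
   also have "\<dots> \<le> (e * norm h) * 1" using n assms(5) by (intro mult_left_mono) (auto simp: n_def)
   finally show ?thesis by simp
  qed
  have "norm (g (x + 1 *\<^sub>R h) - g (x + 0 *\<^sub>R h) - (1 - 0) *\<^sub>R fderiv g x h) \<le> e * norm h * \<bar>1 - 0\<bar>"
  proof (rule vector_mvt_bound[where f = "\<lambda>t. g (x + t *\<^sub>R h)" and f' = "\<lambda>t. fderiv g (x + t *\<^sub>R h) h"])
   fix t :: real assume "t \<in> closed_segment 0 1"
   then have t: "t \<in> {0..1}" by (simp add: closed_segment_eq_real_ivl)
   have "((\<lambda>t. g (x + t *\<^sub>R h)) has_derivative (\<lambda>s. fderiv g (x + t *\<^sub>R h) (s *\<^sub>R h))) (at t)"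
   proof (rule has_derivative_compose[where f = "\<lambda>t. x + t *\<^sub>R h" and g = g])
    show "((\<lambda>t. x + t *\<^sub>R h) has_derivative (\<lambda>s. s *\<^sub>R h)) (at t)"
     by (auto intro!: derivative_eq_intros)
   qed (rule der[OF seg[OF t]])
   then show "((\<lambda>t. g (x + t *\<^sub>R h)) has_vector_derivative fderiv g (x + t *\<^sub>R h) h) (at t within closed_segment 0 1)"
    unfolding has_vector_derivative_def linear_scale[OF has_derivative_linear[OF der[OF seg[OF t]]]]
    by (rule has_derivative_at_withinI)
   show "norm (fderiv g (x + t *\<^sub>R h) h - fderiv g x h) \<le> e * norm h"
    using bound[OF t] .
  qed
  then show "x + h \<in> S \<and> norm (g (x + h) - g x - fderiv g x h) \<le> e * norm h"
   using inS[OF h] by simp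
 qed
qed

lemma C1_bounded_derivative:
 fixes g :: "'a::euclidean_space \<Rightarrow> 'b::real_normed_vector"
 assumes "compact Q" "Q \<subseteq> S" "Ck_on 1 S g"
 obtains B where "B \<ge> 0" "\<And>x h. x \<in> Q \<Longrightarrow> norm (fderiv g x h) \<le> B * norm h"
proof -
 have "\<exists>C\<ge>0. \<forall>x\<in>Q. norm (fderiv g x b) \<le> C" for b
 proof -
  have "continuous_on Q (\<lambda>x. fderiv g x b)"
   using assms(2,3) by (intro continuous_on_subset[of S _ Q]) auto
  then have "bounded ((\<lambda>x. fderiv g x b) ` Q)"
   using compact_continuous_image[OF _ assms(1)] compact_imp_bounded by blast
  then obtain C where "\<forall>x\<in>Q. norm (fderiv g x b) \<le> C" by (auto simp: bounded_iff)
  then show ?thesis by (intro exI[of _ "max C 0"]) force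
 qed
 then obtain C where C: "\<And>b. C b \<ge> 0" "\<And>b x. x \<in> Q \<Longrightarrow> norm (fderiv g x b) \<le> C b" by metis
 show ?thesis
 proof
  show "(\<Sum>b\<in>Basis. C b) \<ge> 0" using C(1) by (simp add: sum_nonneg)
  fix x h assume x: "x \<in> Q"
  have lin: "linear (fderiv g x)"
   using Ck_on_has_derivative[of 0 S g x] assms(2,3) x has_derivative_linear by auto
  have "norm (fderiv g x h) = norm (\<Sum>b\<in>Basis. (h \<bullet> b) *\<^sub>R fderiv g x b)"
   using linear_basis_expansion[OF lin, of h] by simp
  also have "\<dots> \<le> (\<Sum>b\<in>Basis. norm h * C b)"
  proof (rule sum_norm_le)
   fix b :: 'a assume b: "b \<in> Basis"
   show "norm ((h \<bullet> b) *\<^sub>R fderiv g x b) \<le> norm h * C b"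
    unfolding norm_scaleR using Basis_le_norm[OF b, of h] C(2)[OF x, of b] by (intro mult_mono) auto
  qed
  also have "\<dots> = (\<Sum>b\<in>Basis. C b) * norm h" by (simp add: sum_distrib_left mult.commute)
  finally show "norm (fderiv g x h) \<le> (\<Sum>b\<in>Basis. C b) * norm h" .
 qed
qed

section \<open>Smooth dependence on parameters\<close>

text \<open>Solutions of \<open>\<partial>\<^sub>t y(p,t) = g(p, t, y(p, t - s p), y(p,t))\<close> subject to a linear side condition \<open>L\<close>
 that makes the linearized problem a contraction. The delay is a linear function \<open>s\<close> of the
 parameter. Two instances are used: ordinary differential equations (\<open>s = 0\<close>, \<open>L w \<longleftrightarrow> w 0 = 0\<close>)
 and twisted periodic solutions of the delay equation (\<open>s \<tau> = \<tau>\<close>). The equation is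
 imposed on \<open>I\<close>, the side condition concerns the larger \<open>Ih\<close>.\<close>

locale curve_family =
 fixes P :: "'p::euclidean_space set" and I Ih :: "real set" and s :: "'p \<Rightarrow> real"
  and L Tw :: "(real \<Rightarrow> 'e::euclidean_space) \<Rightarrow> bool"
 assumes P: "open P" and I: "open I" and Ih: "open Ih" and I_Ih: "I \<subseteq> Ih" and s: "bounded_linear s"
  and shift: "\<And>p t. p \<in> P \<Longrightarrow> t \<in> I \<Longrightarrow> t - s p \<in> Ih"
  and L_diff: "\<And>v w. L v \<Longrightarrow> L w \<Longrightarrow> L (\<lambda>t. v t - w t)"
  and L_scale: "\<And>c w. L w \<Longrightarrow> L (\<lambda>t. c *\<^sub>R w t)"
  and L_lim: "\<And>w z. (\<And>n::nat. L (w n)) \<Longrightarrow> (\<And>t. t \<in> Ih \<Longrightarrow> (\<lambda>n. w n t) \<longlonglongrightarrow> z t) \<Longrightarrow> L z"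
  and Tw_deriv: "\<And>w w'. L w \<Longrightarrow> (\<And>t. t \<in> Ih \<Longrightarrow> (w has_vector_derivative w' t) (at t)) \<Longrightarrow> Tw w'"
  and transfer: "\<And>k q. (\<And>p. p \<in> P \<Longrightarrow> Tw (q p)) \<Longrightarrow> Ck_on k (P \<times> I) (case_prod q) \<Longrightarrow>
   Ck_on k (P \<times> Ih) (case_prod q)"
begin

definition state :: "('p \<Rightarrow> real \<Rightarrow> 'e) \<Rightarrow> 'p \<Rightarrow> real \<Rightarrow> 'p \<times> real \<times> 'e \<times> 'e" where
 "state y p t = (p, t, y p (t - s p), y p t)"

text \<open>\<open>\<Lambda>\<close> is the linearization in the last two arguments. The side condition bounds a curve by its
 derivative on a compact set, on which \<open>\<Lambda>\<close> acts as a contraction with constant \<open>\<kappa>\<close>.\<close>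

definition control :: "('p \<Rightarrow> real \<Rightarrow> 'e \<Rightarrow> 'e \<Rightarrow> 'e) \<Rightarrow> real \<Rightarrow> bool" where
 "control \<Lambda> \<kappa> \<longleftrightarrow> (\<forall>t1\<in>Ih. \<exists>K r C. compact K \<and> K \<subseteq> I \<and> K \<noteq> {} \<and> r > 0 \<and> C \<ge> 0 \<and> ball t1 r \<subseteq> Ih \<and>
  (\<forall>p\<in>P. \<forall>w w' M. L w \<longrightarrow> (\<forall>t\<in>Ih. (w has_vector_derivative w' t) (at t)) \<longrightarrow> (\<forall>t\<in>K. norm (w' t) \<le> M) \<longrightarrow>
   (\<forall>t\<in>K. norm (\<Lambda> p t (w (t - s p)) (w t)) \<le> \<kappa> * M \<and>
    norm (w (t - s p)) \<le> C * M \<and> norm (w t) \<le> C * M) \<and>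
   (\<forall>t\<in>ball t1 r. norm (w t) \<le> C * M \<and> norm (w' t) \<le> C * M)))"

text \<open>The derivative \<open>u\<close> is a separate function: the curve is differentiable on
  all of \<open>Ih\<close>, the equation determines \<open>u\<close> on \<open>I\<close> only, and
  the difference quotients of \<open>y\<close> and of \<open>u\<close> have to converge
  together.\<close>

definition solves where
 "solves W g y u \<longleftrightarrow> open W \<and> (\<forall>p\<in>P. \<forall>t\<in>I. state y p t \<in> W) \<and> (\<forall>p\<in>P. L (y p)) \<and>
  (\<forall>p\<in>P. \<forall>t\<in>Ih. (y p has_vector_derivative u p t) (at t)) \<and>
  (\<forall>p\<in>P. \<forall>t\<in>I. u p t = g (state y p t)) \<and>
  continuous_on (P \<times> Ih) (case_prod y)"

lemma state_continuous:
 assumes "continuous_on (P \<times> Ih) (case_prod y)"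
 shows "continuous_on (P \<times> I) (case_prod (state y))"
proof -
 interpret s: bounded_linear s by (rule s)
 have "continuous_on (P \<times> I) (\<lambda>x. (case_prod y) (fst x, snd x - s (fst x)))"
  by (rule continuous_on_compose2[OF assms]) (auto intro!: continuous_intros s.continuous_on shift)
 moreover have "continuous_on (P \<times> I) (\<lambda>x. (case_prod y) x)"
  using I_Ih by (intro continuous_on_subset[OF assms]) auto
 ultimately show ?thesis
  unfolding state_def case_prod_beta by (auto intro!: continuous_intros)
qed

text \<open>On \<open>I\<close> the equation expresses \<open>u\<close> through the continuous
  \<open>y\<close>. On the rest of \<open>Ih\<close> the condition that derivatives inherit takes
  over, through \<open>transfer\<close>.\<close>

lemma u_continuous:
 assumes "solves W g y u" "continuous_on W g"
 shows "continuous_on (P \<times> Ih) (case_prod u)"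
proof -
 have "continuous_on (P \<times> I) (\<lambda>x. g ((case_prod (state y)) x))"
  using assms(1) by (intro continuous_on_compose2[OF assms(2) state_continuous]) (auto simp: solves_def)
 moreover have "continuous_on (P \<times> I) (case_prod u) = continuous_on (P \<times> I) (\<lambda>x. g ((case_prod (state y)) x))"
  using assms(1) by (intro continuous_on_cong) (auto simp: solves_def)
 ultimately show ?thesis
  using transfer[of u 0] Tw_deriv[of "y p" "u p" for p] assms(1) by (auto simp: solves_def)
qed

section \<open>Difference quotients in the parameter and their limits\<close>

definition dq :: "('p \<Rightarrow> real \<Rightarrow> 'e) \<Rightarrow> 'p \<Rightarrow> real \<Rightarrow> 'p \<Rightarrow> real \<Rightarrow> 'e" where
 "dq y h q p t = (y (p + q *\<^sub>R h) t - y p t) /\<^sub>R q"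

lemma dq_has_vector_derivative:
 assumes "((\<lambda>q. dq y h q p t) \<longlongrightarrow> z) (at 0)"
 shows "((\<lambda>q. y (p + q *\<^sub>R h) t) has_vector_derivative z) (at 0)"
 unfolding has_vector_derivative_def has_derivative_at
proof
 show "bounded_linear (\<lambda>h. h *\<^sub>R z)" by (rule bounded_linear_scaleR_left)
 have lim: "((\<lambda>q. norm (dq y h q p t - z)) \<longlongrightarrow> 0) (at 0)"
  using assms by (simp add: tendsto_norm_zero LIM_zero)
 have "norm (dq y h q p t - z) = norm (y (p + (0 + q) *\<^sub>R h) t - y (p + 0 *\<^sub>R h) t - q *\<^sub>R z) / norm q"
  if "q \<noteq> 0" for q
 proof -
  have "y (p + (0 + q) *\<^sub>R h) t - y (p + 0 *\<^sub>R h) t - q *\<^sub>R z = q *\<^sub>R (dq y h q p t - z)"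
   using that by (simp add: dq_def algebra_simps)
  then show ?thesis using that by simp
 qed
 then show "((\<lambda>q. norm (y (p + (0 + q) *\<^sub>R h) t - y (p + 0 *\<^sub>R h) t - q *\<^sub>R z) / norm q) \<longlongrightarrow> 0) (at 0)"
  by (intro Lim_transform_eventually[OF lim]) (auto simp: eventually_at intro!: exI[of _ 1])
qed

text \<open>Total by way of \<open>Lim\<close>; it is the directional derivative in \<open>h\<close>
  only once convergence is known, which is \<open>dlim_tendsto\<close>.\<close>

definition dlim :: "('p \<Rightarrow> real \<Rightarrow> 'e) \<Rightarrow> 'p \<Rightarrow> 'p \<Rightarrow> real \<Rightarrow> 'e" where
 "dlim y h p t = Lim (at 0) (\<lambda>q. dq y h q p t)"

text \<open>Completeness is used along the sequence \<open>1 / (n + 1)\<close>; naming the limit by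
  \<open>Lim\<close> keeps the statement independent of that sequence.\<close>

lemma tendsto_at_0_Cauchy:
 fixes f :: "real \<Rightarrow> 'b::banach"
 assumes "\<And>e. e > 0 \<Longrightarrow> \<exists>d>0. \<forall>x y. x \<noteq> 0 \<longrightarrow> \<bar>x\<bar> < d \<longrightarrow> y \<noteq> 0 \<longrightarrow> \<bar>y\<bar> < d \<longrightarrow> norm (f x - f y) \<le> e"
 shows "(f \<longlongrightarrow> Lim (at 0) f) (at 0)"
proof -
 define X where "X n = f (inverse (real (Suc n)))" for n
 have small: "\<exists>N. \<forall>n\<ge>N. \<bar>inverse (real (Suc n))\<bar> < d" if d: "d > 0" for d
 proof -
  obtain N where N: "inverse (real (Suc N)) < d" using reals_Archimedean[OF d] by blast
  have "inverse (real (Suc n)) \<le> inverse (real (Suc N))" if "n \<ge> N" for n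
   using that by (intro le_imp_inverse_le) auto
  then have "\<bar>inverse (real (Suc n))\<bar> < d" if "n \<ge> N" for n
   using le_less_trans[OF _ N] that by simp
  then show ?thesis by blast
 qed
 have "Cauchy X"
 proof (rule CauchyI)
  fix e :: real assume e: "e > 0"
  obtain d where d: "d > 0" "\<forall>x y. x \<noteq> 0 \<longrightarrow> \<bar>x\<bar> < d \<longrightarrow> y \<noteq> 0 \<longrightarrow> \<bar>y\<bar> < d \<longrightarrow> norm (f x - f y) \<le> e / 2"
   using assms[of "e / 2"] e by auto
  obtain N where N: "\<forall>n\<ge>N. \<bar>inverse (real (Suc n))\<bar> < d" using small[OF d(1)] by blast
  have "norm (X m - X n) \<le> e / 2" if "m \<ge> N" "n \<ge> N" for m n
   unfolding X_def using that N d(2) by (metis inverse_nonzero_iff_nonzero of_nat_eq_0_iff nat.distinct(1))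
  then show "\<exists>M. \<forall>m\<ge>M. \<forall>n\<ge>M. norm (X m - X n) < e" using e by (intro exI[of _ N]) force
 qed
 then obtain l where l: "X \<longlonglongrightarrow> l" using Cauchy_convergent_iff convergent_def by blast
 have "(f \<longlongrightarrow> l) (at 0)"
 proof (rule LIM_I)
  fix e :: real assume e: "e > 0"
  obtain d where d: "d > 0" "\<forall>x y. x \<noteq> 0 \<longrightarrow> \<bar>x\<bar> < d \<longrightarrow> y \<noteq> 0 \<longrightarrow> \<bar>y\<bar> < d \<longrightarrow> norm (f x - f y) \<le> e / 2"
   using assms[of "e / 2"] e by auto
  obtain N where N: "\<forall>n\<ge>N. \<bar>inverse (real (Suc n))\<bar> < d" using small[OF d(1)] by blast
  have "norm (f x - l) \<le> e / 2" if x: "x \<noteq> 0" "\<bar>x\<bar> < d" for x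
  proof (rule Lim_norm_ubound[of sequentially])
   show "((\<lambda>n. f x - X n) \<longlongrightarrow> f x - l) sequentially" by (intro tendsto_intros l)
   show "\<forall>\<^sub>F n in sequentially. norm (f x - X n) \<le> e / 2"
    unfolding eventually_sequentially X_def using d(2) x N
    by (intro exI[of _ N]) (metis inverse_nonzero_iff_nonzero of_nat_eq_0_iff nat.distinct(1))
  qed simp
  then show "\<exists>s>0. \<forall>x. x \<noteq> 0 \<and> norm (x - 0) < s \<longrightarrow> norm (f x - l) < e"
   using d(1) e by (intro exI[of _ d]) force
 qed
 then show ?thesis using tendsto_Lim[of "at (0::real)" f l] by simp
qed

context
 fixes W and g :: "'p \<times> real \<times> 'e \<times> 'e \<Rightarrow> 'e" and y u :: "'p \<Rightarrow> real \<Rightarrow> 'e" and \<kappa> \<Lambda>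
 assumes sol: "solves W g y u" and g: "Ck_on 1 W g" and \<kappa>: "0 \<le> \<kappa>" "\<kappa> < 1" and ctr: "control \<Lambda> \<kappa>"
  and \<Lambda>: "\<And>p t a b. p \<in> P \<Longrightarrow> t \<in> I \<Longrightarrow> fderiv g (state y p t) (0, 0, a, b) = \<Lambda> p t a b"
begin

text \<open>The parameter enters the delayed argument twice, through the curve and through the time
  \<open>t - s p\<close>. The second effect contributes \<open>- s h *\<^sub>R u p (t - s p)\<close>
  and is found from the known derivative \<open>u\<close> in time, so no differentiability in the
  parameter is presupposed. The quotients are not yet known to be bounded, hence the error is
  measured relative to their size.\<close>

lemma difference_quotient:
 assumes K: "compact K" "K \<subseteq> I" and B: "compact B" "B \<subseteq> P" and e: "e > 0"
 obtains d where "d > 0"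
  "\<And>q p t. q \<noteq> 0 \<Longrightarrow> \<bar>q\<bar> < d \<Longrightarrow> p \<in> B \<Longrightarrow> t \<in> K \<Longrightarrow>
   norm ((u (p + q *\<^sub>R h) t - u p t) /\<^sub>R q - fderiv g (state y p t)
    (h, 0, (y (p + q *\<^sub>R h) (t - s p) - y p (t - s p)) /\<^sub>R q - s h *\<^sub>R u p (t - s p), (y (p + q *\<^sub>R h) t - y p t) /\<^sub>R q))
   \<le> e * (1 + norm ((y (p + q *\<^sub>R h) (t - s p) - y p (t - s p)) /\<^sub>R q) + norm ((y (p + q *\<^sub>R h) t - y p t) /\<^sub>R q))"
proof -
 interpret s: bounded_linear s by (rule s)
 have W: "open W" and inS: "\<And>p t. p \<in> P \<Longrightarrow> t \<in> I \<Longrightarrow> state y p t \<in> W"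
  and der: "\<And>p t. p \<in> P \<Longrightarrow> t \<in> Ih \<Longrightarrow> (y p has_vector_derivative u p t) (at t)"
  and eq: "\<And>p t. p \<in> P \<Longrightarrow> t \<in> I \<Longrightarrow> u p t = g (state y p t)"
  and conty: "continuous_on (P \<times> Ih) (case_prod y)" using sol by (auto simp: solves_def)
 have contu: "continuous_on (P \<times> Ih) (case_prod u)"
  using u_continuous[OF sol] Ck_on_continuous[OF g] .
 define Q where "Q = B \<times> K"
 define \<Gamma> where "\<Gamma> = (case_prod (state y)) ` Q"
 have Q: "compact Q" "Q \<subseteq> P \<times> I" using K B by (auto simp: Q_def compact_Times)
 have \<Gamma>: "compact \<Gamma>" "\<Gamma> \<subseteq> W"
  using compact_continuous_image[OF continuous_on_subset[OF state_continuous[OF conty] Q(2)] Q(1)] inS Q(2)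
  by (auto simp: \<Gamma>_def)
 obtain C where C: "C \<ge> 0" "\<And>x v. x \<in> \<Gamma> \<Longrightarrow> norm (fderiv g x v) \<le> C * norm v"
  using C1_bounded_derivative[OF \<Gamma> g] by blast
 \<comment> \<open>The present and the delayed times together: \<open>y\<close> and \<open>u\<close>
   are compared near both.\<close>
 define S where "S = Q \<union> (\<lambda>(p,t). (p, t - s p)) ` Q"
 have S: "compact S" "S \<subseteq> P \<times> Ih"
 proof -
  have "compact ((\<lambda>x. (fst x, snd x - s (fst x))) ` Q)"
   by (intro compact_continuous_image Q continuous_intros s.continuous_on)
  then show "compact S" using Q(1) by (auto simp: S_def case_prod_beta)
  show "S \<subseteq> P \<times> Ih" using Q(2) I_Ih shift by (force simp: S_def)
 qed
 obtain Bu where Bu: "Bu \<ge> 0" "\<And>p t. (p,t) \<in> S \<Longrightarrow> norm (u p t) \<le> Bu"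
 proof -
  have "bounded ((case_prod u) ` S)"
   using compact_imp_bounded[OF compact_continuous_image[OF continuous_on_subset[OF contu S(2)] S(1)]] .
  then obtain b where "\<forall>x\<in>S. norm ((case_prod u) x) \<le> b" by (auto simp: bounded_iff)
  then show thesis using that[of "max b 0"] by fastforce
 qed
 \<comment> \<open>\<open>e1\<close> is the share of the error for the linearization of
   \<open>g\<close>, divided by the factor by which the increment of the state can exceed one plus
   the quotients. \<open>e3\<close> is the share for the time shift of the delayed argument, which
   gets multiplied by \<open>C * \<bar>s h\<bar>\<close>.\<close>
 define e1 where "e1 = e / 2 / (1 + norm h + \<bar>s h\<bar> * Bu + \<bar>s h\<bar>)"
 define e3 where "e3 = min 1 (e / 2 / (C * \<bar>s h\<bar> + 1))"
 have pos1: "1 + norm h + \<bar>s h\<bar> * Bu + \<bar>s h\<bar> > 0" using Bu(1) by (smt (verit) norm_ge_zero mult_nonneg_nonneg)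
 have pos3: "C * \<bar>s h\<bar> + 1 > 0" using C(1) by (smt (verit) mult_nonneg_nonneg)
 have e1: "e1 > 0" and e3: "e3 > 0" "e3 \<le> 1" using e pos1 pos3 by (auto simp: e1_def e3_def)
 obtain d1 where d1: "d1 > 0" "\<And>x v. x \<in> \<Gamma> \<Longrightarrow> norm v < d1 \<Longrightarrow>
  x + v \<in> W \<and> norm (g (x + v) - g x - fderiv g x v) \<le> e1 * norm v"
  using C1_uniformly_differentiable[OF \<Gamma>(1) W \<Gamma>(2) g e1] by metis
 obtain d2 where d2: "d2 > 0" "\<And>q q'. q \<in> S \<Longrightarrow> dist q' q < d2 \<Longrightarrow> q' \<in> P \<times> Ih \<and>
  dist ((case_prod y) q') ((case_prod y) q) < d1 / 3"
  using continuous_near_compact[OF S(1) open_Times[OF P Ih] S(2) conty, of "d1 / 3"] d1(1) by (metis zero_less_divide_iff zero_less_numeral)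
 obtain d3 where d3: "d3 > 0" "\<And>q q'. q \<in> S \<Longrightarrow> dist q' q < d3 \<Longrightarrow> q' \<in> P \<times> Ih \<and>
  dist ((case_prod u) q') ((case_prod u) q) < e3"
  using continuous_near_compact[OF S(1) open_Times[OF P Ih] S(2) contu e3(1)] by metis
 define n where "n = norm h + \<bar>s h\<bar> + 1"
 have n: "n > 0" by (simp add: n_def add_nonneg_pos)
 define d where "d = Min {d1 / 3 / n, d2 / n, d3 / n}"
 have d: "d > 0" using d1 d2 d3 n by (auto simp: d_def)
 show thesis
 proof (rule that[OF d])
  fix q :: real and p t assume q: "q \<noteq> 0" "\<bar>q\<bar> < d" and p: "p \<in> B" and t: "t \<in> K"
  have small: "\<bar>q\<bar> * n < d1 / 3" "\<bar>q\<bar> * n < d2" "\<bar>q\<bar> * n < d3"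
   using q(2) n by (auto simp: d_def field_simps)
  have dn: "\<bar>q\<bar> * norm h \<le> \<bar>q\<bar> * n" by (intro mult_left_mono) (auto simp: n_def)
  have near: "dist (p + q *\<^sub>R h, t' + r) (p, t') \<le> \<bar>q\<bar> * n" if "\<bar>r\<bar> \<le> \<bar>q\<bar> * \<bar>s h\<bar>" for t' r
  proof -
   have "dist (p + q *\<^sub>R h, t' + r) (p, t') \<le> norm (q *\<^sub>R h) + \<bar>r\<bar>"
    unfolding dist_norm using norm_Pair_le[of "q *\<^sub>R h" r] by simp
   also have "\<dots> \<le> \<bar>q\<bar> * n" using that by (simp add: n_def algebra_simps)
   finally show ?thesis .
  qed
  have inS: "(p, t) \<in> S" "(p, t - s p) \<in> S" using p t by (force simp: S_def Q_def)+
  have pP: "p \<in> P" "t \<in> I" using p t K B by auto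
  have p': "p + q *\<^sub>R h \<in> P" using d2(2)[OF inS(1), of "(p + q *\<^sub>R h, t + 0)"] near[of 0 t] small by auto
  define D where "D t = (y (p + q *\<^sub>R h) t - y p t) /\<^sub>R q" for t
  have D: "q *\<^sub>R D t = y (p + q *\<^sub>R h) t - y p t" for t using q by (simp add: D_def)
  define Y where "Y = y (p + q *\<^sub>R h) (t - s (p + q *\<^sub>R h)) - y p (t - s p)"
  \<comment> \<open>\<open>\<Delta>\<close> is the true increment of the state and
    \<open>q *\<^sub>R \<Delta>'\<close> its expected value; they differ in the delayed component
    only.\<close>
  define \<Delta> where "\<Delta> = (q *\<^sub>R h, 0::real, Y, q *\<^sub>R D t)"
  define \<Delta>' where "\<Delta>' = (h, 0::real, D (t - s p) - s h *\<^sub>R u p (t - s p), D t)"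
  have \<Delta>: "state y (p + q *\<^sub>R h) t = state y p t + \<Delta>" by (simp add: state_def \<Delta>_def Y_def D)
  have \<gamma>: "state y p t \<in> \<Gamma>" using p t by (force simp: \<Gamma>_def Q_def)
  have seg: "r - (t - s p) = r - (t - s p) \<and> \<bar>r - (t - s p)\<bar> \<le> \<bar>q\<bar> * \<bar>s h\<bar>"
   if "r \<in> closed_segment (t - s p) (t - s (p + q *\<^sub>R h))" for r
   using segment_bound1[OF that] by (simp add: s.add s.scaleR abs_mult algebra_simps dist_norm)
  \<comment> \<open>The time shift is estimated along the curve at the new parameter, but with the
    slope \<open>u p (t - s p)\<close> of the old one; continuity of \<open>u\<close> pays for the
    exchange.\<close>
  have "norm (y (p + q *\<^sub>R h) (t - s (p + q *\<^sub>R h)) - y (p + q *\<^sub>R h) (t - s p)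
    - ((t - s (p + q *\<^sub>R h)) - (t - s p)) *\<^sub>R u p (t - s p)) \<le> e3 * \<bar>(t - s (p + q *\<^sub>R h)) - (t - s p)\<bar>"
  proof (rule vector_mvt_bound)
   fix r assume r: "r \<in> closed_segment (t - s p) (t - s (p + q *\<^sub>R h))"
   have "dist (p + q *\<^sub>R h, r) (p, t - s p) < d3"
    using near[of "r - (t - s p)" "t - s p"] seg[OF r] small by auto
   from d3(2)[OF inS(2) this] have "r \<in> Ih" "norm (u (p + q *\<^sub>R h) r - u p (t - s p)) \<le> e3"
    by (auto simp: dist_norm)
   then show "norm (u (p + q *\<^sub>R h) r - u p (t - s p)) \<le> e3"
    "(y (p + q *\<^sub>R h) has_vector_derivative u (p + q *\<^sub>R h) r) (at r within closed_segment (t - s p) (t - s (p + q *\<^sub>R h)))"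
    using der[OF p'] has_vector_derivative_at_within by blast+
  qed
  then have Y: "norm (Y - q *\<^sub>R (D (t - s p) - s h *\<^sub>R u p (t - s p))) \<le> e3 * (\<bar>q\<bar> * \<bar>s h\<bar>)"
   by (simp add: Y_def D s.add s.scaleR abs_mult algebra_simps)
  have nY: "norm Y < d1 / 3"
  proof -
   have "dist (p + q *\<^sub>R h, t - s (p + q *\<^sub>R h)) (p, t - s p) < d2"
    using near[of "- (q * s h)" "t - s p"] small by (simp add: s.add s.scaleR abs_mult algebra_simps)
   from d2(2)[OF inS(2) this] show ?thesis by (simp add: Y_def dist_norm)
  qed
  have nD: "norm (q *\<^sub>R D t) < d1 / 3"
   using d2(2)[OF inS(1), of "(p + q *\<^sub>R h, t + 0)"] near[of 0 t] small by (auto simp: D dist_norm)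
  have n4: "norm (a, b, c, d) \<le> norm a + norm b + norm c + norm d" for a::'p and b::real and c d::'e
   using norm_Pair_le[of a "(b,c,d)"] norm_Pair_le[of b "(c,d)"] norm_Pair_le[of c d] by linarith
  have "norm \<Delta> < d1" using n4[of "q *\<^sub>R h" 0 Y "q *\<^sub>R D t"] nY nD small(1) dn by (simp add: \<Delta>_def)
  from d1(2)[OF \<gamma> this] have main: "norm (g (state y p t + \<Delta>) - g (state y p t) - fderiv g (state y p t) \<Delta>) \<le> e1 * norm \<Delta>"
   by blast
  have diff: "norm (\<Delta> - q *\<^sub>R \<Delta>') \<le> e3 * (\<bar>q\<bar> * \<bar>s h\<bar>)"
   using Y by (simp add: \<Delta>_def \<Delta>'_def norm_Pair)
  have \<Delta>'n: "norm \<Delta>' \<le> norm h + (norm (D (t - s p)) + \<bar>s h\<bar> * Bu) + norm (D t)"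
  proof -
   have "norm (D (t - s p) - s h *\<^sub>R u p (t - s p)) \<le> norm (D (t - s p)) + \<bar>s h\<bar> * norm (u p (t - s p))"
    using norm_triangle_ineq4[of "D (t - s p)" "s h *\<^sub>R u p (t - s p)"] by simp
   also have "\<bar>s h\<bar> * norm (u p (t - s p)) \<le> \<bar>s h\<bar> * Bu" using Bu(2)[OF inS(2)] by (intro mult_left_mono) auto
   finally show ?thesis using n4[of h 0 "D (t - s p) - s h *\<^sub>R u p (t - s p)" "D t"] by (simp add: \<Delta>'_def)
  qed
  have lin: "linear (fderiv g (state y p t))"
   using has_derivative_linear[OF C1_has_derivative[OF g]] \<gamma> \<Gamma>(2) by blast
  define E where "E = (u (p + q *\<^sub>R h) t - u p t) /\<^sub>R q"
  define G where "G = fderiv g (state y p t)"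
  have "q *\<^sub>R E = g (state y p t + \<Delta>) - g (state y p t)"
   using eq[OF pP] eq[OF p' pP(2)] q(1) by (simp add: E_def \<Delta>)
  then have "norm (q *\<^sub>R (E - G \<Delta>')) = norm ((g (state y p t + \<Delta>) - g (state y p t) - G \<Delta>) + G (\<Delta> - q *\<^sub>R \<Delta>'))"
   using lin by (simp add: G_def linear_diff linear_scale scaleR_diff_right)
  also have "\<dots> \<le> e1 * norm \<Delta> + C * norm (\<Delta> - q *\<^sub>R \<Delta>')"
   using main C(2)[OF \<gamma>] unfolding G_def by (meson add_mono norm_triangle_le)
  also have "\<dots> \<le> e1 * (\<bar>q\<bar> * norm \<Delta>' + e3 * (\<bar>q\<bar> * \<bar>s h\<bar>)) + C * (e3 * (\<bar>q\<bar> * \<bar>s h\<bar>))"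
  proof (intro add_mono mult_left_mono)
   show "norm \<Delta> \<le> \<bar>q\<bar> * norm \<Delta>' + e3 * (\<bar>q\<bar> * \<bar>s h\<bar>)"
    using diff norm_triangle_sub[of \<Delta> "q *\<^sub>R \<Delta>'"] by simp
  qed (use diff e1 C(1) in auto)
  also have "\<dots> = \<bar>q\<bar> * (e1 * (norm \<Delta>' + e3 * \<bar>s h\<bar>) + C * (e3 * \<bar>s h\<bar>))" by (simp add: algebra_simps)
  finally have "\<bar>q\<bar> * norm (E - G \<Delta>') \<le> \<bar>q\<bar> * (e1 * (norm \<Delta>' + e3 * \<bar>s h\<bar>) + C * (e3 * \<bar>s h\<bar>))" by simp
  then have "norm (E - G \<Delta>') \<le> e1 * (norm \<Delta>' + e3 * \<bar>s h\<bar>) + C * (e3 * \<bar>s h\<bar>)"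
   using q(1) by simp
  also have "\<dots> \<le> e1 * ((1 + norm h + \<bar>s h\<bar> * Bu + \<bar>s h\<bar>) * (1 + norm (D (t - s p)) + norm (D t))) + e / 2"
  proof (intro add_mono mult_left_mono)
   have "norm \<Delta>' + e3 * \<bar>s h\<bar> \<le> (norm h + \<bar>s h\<bar> * Bu + \<bar>s h\<bar>) + (norm (D (t - s p)) + norm (D t))"
    using \<Delta>'n mult_right_mono[OF e3(2), of "\<bar>s h\<bar>"] by simp
   also have "\<dots> \<le> (1 + norm h + \<bar>s h\<bar> * Bu + \<bar>s h\<bar>) * (1 + (norm (D (t - s p)) + norm (D t)))"
   proof -
    have "a + b \<le> (1 + a) * (1 + b)" if "a \<ge> 0" "b \<ge> 0" for a b :: real using that by (simp add: algebra_simps)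
    from this[of "norm h + \<bar>s h\<bar> * Bu + \<bar>s h\<bar>" "norm (D (t - s p)) + norm (D t)"] show ?thesis
     using Bu(1) by (simp add: add.assoc)
   qed
   finally show "norm \<Delta>' + e3 * \<bar>s h\<bar> \<le> (1 + norm h + \<bar>s h\<bar> * Bu + \<bar>s h\<bar>) * (1 + norm (D (t - s p)) + norm (D t))"
    by (simp add: add.assoc)
   have "C * (e3 * \<bar>s h\<bar>) = (C * \<bar>s h\<bar>) * e3" by simp
   also have "\<dots> \<le> (C * \<bar>s h\<bar> + 1) * (e / 2 / (C * \<bar>s h\<bar> + 1))"
    using C(1) e3 e by (intro mult_mono) (auto simp: e3_def)
   also have "\<dots> = e / 2"
   proof -
    have "x * (a / x) = a" if "x > 0" for a x :: real using that by simp
    from this[OF pos3] show ?thesis .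
   qed
   finally show "C * (e3 * \<bar>s h\<bar>) \<le> e / 2" .
  qed (use e1 in auto)
  also have "\<dots> = e / 2 * (1 + norm (D (t - s p)) + norm (D t)) + e / 2"
  proof -
   have "a / x * (x * b) = a * b" if "x > 0" for a b x :: real using that by simp
   from this[OF pos1] show ?thesis unfolding e1_def by (rule arg_cong[where f = "\<lambda>a. a + e / 2"])
  qed
  also have "\<dots> \<le> e * (1 + norm (D (t - s p)) + norm (D t))"
  proof -
   have "e / 2 * 1 \<le> e / 2 * (1 + norm (D (t - s p)) + norm (D t))" using e by (intro mult_left_mono) auto
   then show ?thesis by (simp add: field_simps)
  qed
  finally show "norm ((u (p + q *\<^sub>R h) t - u p t) /\<^sub>R q - fderiv g (state y p t)
    (h, 0, (y (p + q *\<^sub>R h) (t - s p) - y p (t - s p)) /\<^sub>R q - s h *\<^sub>R u p (t - s p), (y (p + q *\<^sub>R h) t - y p t) /\<^sub>R q))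
   \<le> e * (1 + norm ((y (p + q *\<^sub>R h) (t - s p) - y p (t - s p)) /\<^sub>R q) + norm ((y (p + q *\<^sub>R h) t - y p t) /\<^sub>R q))"
   by (simp add: E_def G_def D_def \<Delta>'_def)
 qed
qed

lemma dq_L:
 assumes "p \<in> P" "p + q *\<^sub>R h \<in> P"
 shows "L (dq y h q p)"
  and "t \<in> Ih \<Longrightarrow> (dq y h q p has_vector_derivative dq u h q p t) (at t)"
proof -
 show "L (dq y h q p)"
  using L_scale[OF L_diff[of "y (p + q *\<^sub>R h)" "y p"]] assms sol by (simp add: solves_def dq_def[abs_def])
 show "t \<in> Ih \<Longrightarrow> (dq y h q p has_vector_derivative dq u h q p t) (at t)"
  using assms sol unfolding dq_def[abs_def] solves_def
  by (intro has_vector_derivative_scaleR[where g' = "0", simplified] has_vector_derivative_diff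
    bounded_linear.has_vector_derivative[OF bounded_linear_scaleR_right]) auto
qed

text \<open>Quotients for different \<open>q\<close> satisfy the same linear equation up to small
  errors, and its inhomogeneous part cancels in their difference. On the compact set
  \<open>K\<close> the linearization shrinks this difference by \<kappa> < 1, so it is bounded by
  the errors alone. The same absorption, with the inhomogeneous part kept, first shows that the
  quotients are bounded.\<close>

lemma dq_cauchy:
 assumes p0: "p0 \<in> P" and t1: "t1 \<in> Ih"
 obtains \<rho> r where "\<rho> > 0" "r > 0" "cball p0 \<rho> \<subseteq> P" "ball t1 r \<subseteq> Ih"
  "\<And>e. e > 0 \<Longrightarrow> \<exists>d>0. \<forall>q q' p t. q \<noteq> 0 \<longrightarrow> \<bar>q\<bar> < d \<longrightarrow> q' \<noteq> 0 \<longrightarrow> \<bar>q'\<bar> < d \<longrightarrow> p \<in> cball p0 \<rho> \<longrightarrow> t \<in> ball t1 r \<longrightarrow>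
   p + q *\<^sub>R h \<in> P \<and> norm (dq y h q p t - dq y h q' p t) \<le> e \<and> norm (dq u h q p t - dq u h q' p t) \<le> e"
proof -
 interpret s: bounded_linear s by (rule s)
 have contu: "continuous_on (P \<times> Ih) (case_prod u)"
  using u_continuous[OF sol] Ck_on_continuous[OF g] .
 have inS: "\<And>p t. p \<in> P \<Longrightarrow> t \<in> I \<Longrightarrow> state y p t \<in> W" and W: "open W"
  and conty: "continuous_on (P \<times> Ih) (case_prod y)" using sol by (auto simp: solves_def)
 from ctr obtain K r C where K: "compact K" "K \<subseteq> I" "K \<noteq> {}" and r: "r > 0" "ball t1 r \<subseteq> Ih" and C: "C \<ge> 0"
  and ctl0: "\<forall>p\<in>P. \<forall>w w' M. L w \<longrightarrow> (\<forall>t\<in>Ih. (w has_vector_derivative w' t) (at t)) \<longrightarrow> (\<forall>t\<in>K. norm (w' t) \<le> M) \<longrightarrow>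
   (\<forall>t\<in>K. norm (\<Lambda> p t (w (t - s p)) (w t)) \<le> \<kappa> * M \<and>
    norm (w (t - s p)) \<le> C * M \<and> norm (w t) \<le> C * M) \<and>
   (\<forall>t\<in>ball t1 r. norm (w t) \<le> C * M \<and> norm (w' t) \<le> C * M)"
  unfolding control_def by (drule_tac bspec[OF _ t1]) (elim exE conjE, rule that)
 have ctl: "norm (fderiv g (state y p t) (0, 0, w (t - s p), w t)) \<le> \<kappa> * M \<and>
    norm (w (t - s p)) \<le> C * M \<and> norm (w t) \<le> C * M"
  if "p \<in> P" "L w" "\<And>t. t \<in> Ih \<Longrightarrow> (w has_vector_derivative w' t) (at t)" "\<And>t. t \<in> K \<Longrightarrow> norm (w' t) \<le> M" "t \<in> K" for p w w' M t
  using ctl0[rule_format, OF that(1,2), of w' M] that(3-5) \<Lambda>[OF that(1)] K(2) by (simp add: subset_iff)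
 have ctl2: "norm (w t) \<le> C * M \<and> norm (w' t) \<le> C * M"
  if "p \<in> P" "L w" "\<And>t. t \<in> Ih \<Longrightarrow> (w has_vector_derivative w' t) (at t)" "\<And>t. t \<in> K \<Longrightarrow> norm (w' t) \<le> M" "t \<in> ball t1 r" for p w w' M t
  using ctl0[rule_format, OF that(1,2), of w' M] that(3-5) by simp
 \<comment> \<open>Twice the radius, so that \<open>p + q *\<^sub>R h\<close> stays in
   \<open>P\<close> for \<open>p\<close> in the ball of radius \<rho> and small
   \<open>q\<close>.\<close>
 obtain \<rho> where \<rho>: "\<rho> > 0" "cball p0 (2 * \<rho>) \<subseteq> P"
 proof -
  obtain e where "e > 0" "cball p0 e \<subseteq> P" using P p0 open_contains_cball by blast
  then show thesis using that[of "e / 2"] by simp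
 qed
 define B where "B = cball p0 \<rho>"
 have B: "compact B" "B \<subseteq> P" using \<rho> by (auto simp: B_def subset_iff)
 define d0 where "d0 = \<rho> / (norm h + 1)"
 have d0: "d0 > 0" using \<rho> by (simp add: d0_def add_nonneg_pos)
 have pP: "p + q *\<^sub>R h \<in> P" if "p \<in> B" "\<bar>q\<bar> < d0" for p q
 proof -
  have "norm (q *\<^sub>R h) \<le> d0 * (norm h + 1)" using that(2) by (simp add: mult_mono)
  also have "\<dots> = \<rho>" using norm_ge_zero[of h] by (simp add: d0_def add_nonneg_eq_0_iff)
  finally have "dist p0 (p + q *\<^sub>R h) \<le> 2 * \<rho>"
   using that(1) norm_triangle_ineq4[of "p0 - p" "q *\<^sub>R h"] by (simp add: B_def dist_norm algebra_simps)
  then show ?thesis using \<rho> by auto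
 qed
 have contdq: "continuous_on K (\<lambda>t. norm (dq u h q p t))" if "p \<in> B" "\<bar>q\<bar> < d0" for p q
 proof -
  have "continuous_on K (u q)" if "q \<in> P" for q
  proof -
   have "continuous_on K (\<lambda>t. (q, t))" by (intro continuous_intros)
   from continuous_on_compose2[OF contu this] show ?thesis using that K(2) I_Ih by auto
  qed
  then show ?thesis using pP[OF that] that B unfolding dq_def[abs_def] by (auto intro!: continuous_intros)
 qed
 define G where "G p t = fderiv g (state y p t)" for p t
 have linG: "linear (G p t)" if "p \<in> P" "t \<in> I" for p t
  unfolding G_def using has_derivative_linear[OF C1_has_derivative[OF g inS[OF that]]] .
 \<comment> \<open>The inhomogeneous part of the linearized equation: it comes from the explicit
   parameter and from the shift of the delayed time, and contains no quotient.\<close>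
 define b where "b p t = G p t (h, 0, - s h *\<^sub>R u p (t - s p), 0)" for p t
 have splitG: "G p t (h, 0, a - s h *\<^sub>R u p (t - s p), c) = G p t (0, 0, a, c) + b p t" if "p \<in> P" "t \<in> I" for p t a c
  unfolding b_def linear_add[OF linG[OF that], symmetric] by simp
 obtain C0 where C0: "\<And>p t. p \<in> B \<Longrightarrow> t \<in> K \<Longrightarrow> norm (b p t) \<le> C0" "C0 \<ge> 0"
 proof -
  have "continuous_on (P \<times> I) (\<lambda>x. (case_prod u) (fst x, snd x - s (fst x)))"
   by (rule continuous_on_compose2[OF contu]) (auto intro!: continuous_intros s.continuous_on shift)
  then have "continuous_on (P \<times> I) (\<lambda>x. (h, 0::real, - s h *\<^sub>R u (fst x) (snd x - s (fst x)), 0::'e))"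
   by (auto intro!: continuous_intros)
  then have "Ck_on 0 (P \<times> I) (\<lambda>x. fderiv g ((case_prod (state y)) x) (h, 0, - s h *\<^sub>R u (fst x) (snd x - s (fst x)), 0))"
   using state_continuous[OF conty] inS g
   by (intro Ck_on_frechet_derivative_apply[OF open_Times[OF P I] W]) auto
  then have "continuous_on (B \<times> K) (case_prod b)"
   using B K by (auto simp: b_def G_def case_prod_beta intro: continuous_on_subset)
  from compact_imp_bounded[OF compact_continuous_image[OF this compact_Times[OF B(1) K(1)]]]
  obtain b0 where "\<forall>x\<in>B \<times> K. norm ((case_prod b) x) \<le> b0" by (auto simp: bounded_iff)
  then show thesis using that[of "max b0 0"] by fastforce
 qed
 \<comment> \<open>Half of the gap \<open>1 - \<kappa>\<close> absorbs the error that grows with the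
   quotients: \<open>2 * e1 * C\<close> is at most \<open>(1 - \<kappa>) / 2\<close>.\<close>
 define e1 where "e1 = (1 - \<kappa>) / (4 * (C + 1))"
 have e1: "e1 > 0" using \<kappa> C by (simp add: e1_def)
 \<comment> \<open>The solution of \<open>(1 - \<kappa>) / 2 * M0 = C0 + e1\<close>, which is the
   bound left after absorption.\<close>
 define M0 where "M0 = 2 * (C0 + e1) / (1 - \<kappa>)"
 have M0: "M0 \<ge> 0" using C0 e1 \<kappa> by (simp add: M0_def)
 obtain d1 where d1: "d1 > 0" and dq1: "\<And>q p t. q \<noteq> 0 \<Longrightarrow> \<bar>q\<bar> < d1 \<Longrightarrow> p \<in> B \<Longrightarrow> t \<in> K \<Longrightarrow>
   norm (dq u h q p t - G p t (h, 0, dq y h q p (t - s p) - s h *\<^sub>R u p (t - s p), dq y h q p t))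
   \<le> e1 * (1 + norm (dq y h q p (t - s p)) + norm (dq y h q p t))"
  using difference_quotient[OF K(1,2) B e1, of h] unfolding dq_def G_def by metis
 \<comment> \<open>The estimate is made at the point of \<open>K\<close> where the quotient is
   largest, so that \<open>M\<close> is both the quantity to be bounded and the bound that enters
   \<open>control\<close>.\<close>
 have bound: "norm (dq u h q p t) \<le> M0" if q: "q \<noteq> 0" "\<bar>q\<bar> < d1" "\<bar>q\<bar> < d0" "p \<in> B" and t: "t \<in> K" for q p t
 proof -
  obtain t' where t': "t' \<in> K" "\<And>t. t \<in> K \<Longrightarrow> norm (dq u h q p t) \<le> norm (dq u h q p t')"
   using continuous_attains_sup[OF K(1,3) contdq[OF q(4,3)]] by blast
  define M where "M = norm (dq u h q p t')"
  have p: "p \<in> P" "t' \<in> I" using q B t' K by auto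
  note c = ctl[OF p(1) dq_L[OF p(1) pP[OF q(4,3)]] t'(2) t'(1), folded M_def G_def]
  have "M \<le> norm (dq u h q p t' - G p t' (h, 0, dq y h q p (t' - s p) - s h *\<^sub>R u p (t' - s p), dq y h q p t'))
    + norm (G p t' (0, 0, dq y h q p (t' - s p), dq y h q p t')) + norm (b p t')"
   unfolding M_def splitG[OF p] by norm
  also have "\<dots> \<le> e1 * (1 + C * M + C * M) + \<kappa> * M + C0"
   using order_trans[OF dq1[OF q(1,2,4) t'(1)] mult_left_mono[of _ "1 + C * M + C * M" e1]] c C0(1)[OF q(4) t'(1)] e1
   by (smt (verit))
  finally have "M \<le> e1 * (1 + C * M + C * M) + \<kappa> * M + C0" .
  moreover have "e1 * (C * M + C * M) \<le> (1 - \<kappa>) / 2 * M"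
  proof -
   have "a / (4 * x) * (C * M + C * M) = a / 2 * (C / x) * M" if "x > 0" for a x :: real
    using that by (simp add: field_simps)
   from this[of "C + 1" "1 - \<kappa>"] have "e1 * (C * M + C * M) = (1 - \<kappa>) / 2 * (C / (C + 1)) * M"
    unfolding e1_def using C by simp
   also have "\<dots> \<le> (1 - \<kappa>) / 2 * 1 * M" using \<kappa> C by (intro mult_right_mono mult_left_mono) (auto simp: M_def)
   finally show ?thesis by simp
  qed
  ultimately have "(1 - \<kappa>) / 2 * M \<le> C0 + e1" by (simp add: field_simps)
  then have "M \<le> M0" using \<kappa> by (simp add: M0_def field_simps)
  then show ?thesis using t'(2)[OF t] by (simp add: M_def)
 qed
 have main: "\<exists>d>0. \<forall>q q' p t. q \<noteq> 0 \<longrightarrow> \<bar>q\<bar> < d \<longrightarrow> q' \<noteq> 0 \<longrightarrow> \<bar>q'\<bar> < d \<longrightarrow> p \<in> cball p0 \<rho> \<longrightarrow> t \<in> ball t1 r \<longrightarrow>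
   p + q *\<^sub>R h \<in> P \<and> norm (dq y h q p t - dq y h q' p t) \<le> e \<and> norm (dq u h q p t - dq u h q' p t) \<le> e"
  if e: "e > 0" for e
 proof -
  \<comment> \<open>After absorption the difference of the \<open>u\<close> quotients is at most
    \<open>e / (C + 1)\<close> on \<open>K\<close>; the factor \<open>C\<close> is the price for
    passing from \<open>K\<close> to \<open>ball t1 r\<close>.\<close>
  define e2 where "e2 = e * (1 - \<kappa>) / (2 * (1 + C * M0 + C * M0) * (C + 1))"
  have pos: "1 + C * M0 + C * M0 > 0" using mult_nonneg_nonneg[OF C M0] by linarith
  have e2: "e2 > 0" using e \<kappa> C pos by (simp add: e2_def)
  obtain d2 where d2: "d2 > 0" and dq2: "\<And>q p t. q \<noteq> 0 \<Longrightarrow> \<bar>q\<bar> < d2 \<Longrightarrow> p \<in> B \<Longrightarrow> t \<in> K \<Longrightarrow>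
   norm (dq u h q p t - G p t (h, 0, dq y h q p (t - s p) - s h *\<^sub>R u p (t - s p), dq y h q p t))
   \<le> e2 * (1 + norm (dq y h q p (t - s p)) + norm (dq y h q p t))"
   using difference_quotient[OF K(1,2) B e2, of h] unfolding dq_def G_def by metis
  define d where "d = Min {d0, d1, d2}"
  have "d > 0" using d0 d1 d2 by (simp add: d_def)
  moreover have "p + q *\<^sub>R h \<in> P \<and> norm (dq y h q p t - dq y h q' p t) \<le> e \<and> norm (dq u h q p t - dq u h q' p t) \<le> e"
   if q: "q \<noteq> 0" "\<bar>q\<bar> < d" "q' \<noteq> 0" "\<bar>q'\<bar> < d" and p: "p \<in> B" and t: "t \<in> ball t1 r" for q q' p t
  proof -
   have qd: "\<bar>q\<bar> < d0" "\<bar>q\<bar> < d1" "\<bar>q\<bar> < d2" "\<bar>q'\<bar> < d0" "\<bar>q'\<bar> < d1" "\<bar>q'\<bar> < d2"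
    using q by (auto simp: d_def)
   have pP': "p \<in> P" "p + q *\<^sub>R h \<in> P" "p + q' *\<^sub>R h \<in> P" using p B pP qd by auto
   define w where "w t = dq y h q p t - dq y h q' p t" for t
   define w' where "w' t = dq u h q p t - dq u h q' p t" for t
   have w: "L w" "\<And>t. t \<in> Ih \<Longrightarrow> (w has_vector_derivative w' t) (at t)"
    unfolding w_def[abs_def] w'_def using dq_L[OF pP'(1,2)] dq_L[OF pP'(1,3)]
    by (auto intro!: L_diff has_vector_derivative_diff)
   have est: "norm (w' t - G p t (0, 0, w (t - s p), w t)) \<le> 2 * e2 * (1 + C * M0 + C * M0)" if t: "t \<in> K" for t
   proof -
    have *: "norm (dq u h q p t - G p t (h, 0, dq y h q p (t - s p) - s h *\<^sub>R u p (t - s p), dq y h q p t)) \<le> e2 * (1 + C * M0 + C * M0)"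
     if "q \<noteq> 0" "\<bar>q\<bar> < d0" "\<bar>q\<bar> < d1" "\<bar>q\<bar> < d2" for q
    proof -
     have "norm (dq y h q p (t - s p)) \<le> C * M0" "norm (dq y h q p t) \<le> C * M0"
      using ctl[OF pP'(1) dq_L[OF pP'(1) pP[OF p that(2)]] bound[OF that(1,3,2) p] t] by auto
     then have "e2 * (1 + norm (dq y h q p (t - s p)) + norm (dq y h q p t)) \<le> e2 * (1 + C * M0 + C * M0)"
      using e2 by (intro mult_left_mono) auto
     then show ?thesis using dq2[OF that(1,4) p t] by linarith
    qed
    have tI: "t \<in> I" using t K by auto
    have "w' t - G p t (0, 0, w (t - s p), w t) =
     (dq u h q p t - G p t (h, 0, dq y h q p (t - s p) - s h *\<^sub>R u p (t - s p), dq y h q p t)) -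
     (dq u h q' p t - G p t (h, 0, dq y h q' p (t - s p) - s h *\<^sub>R u p (t - s p), dq y h q' p t))"
     using linear_diff[OF linG[OF pP'(1) tI], of "(0, 0, dq y h q p (t - s p), dq y h q p t)" "(0, 0, dq y h q' p (t - s p), dq y h q' p t)"]
     by (simp add: splitG[OF pP'(1) tI] w_def w'_def)
    also have "norm \<dots> \<le> e2 * (1 + C * M0 + C * M0) + e2 * (1 + C * M0 + C * M0)"
     by (rule order_trans[OF norm_triangle_ineq4 add_mono[OF *[OF q(1) qd(1-3)] *[OF q(3) qd(4-6)]]])
    finally show ?thesis by simp
   qed
   have "continuous_on K (\<lambda>t. norm (w' t))"
    using pP' K I_Ih unfolding w'_def dq_def
    by (intro continuous_intros continuous_on_compose2[OF contu, of K "\<lambda>t. (_, t)", simplified]) auto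
   then obtain t' where t': "t' \<in> K" "\<And>t. t \<in> K \<Longrightarrow> norm (w' t) \<le> norm (w' t')"
    using continuous_attains_sup[OF K(1,3)] by blast
   define M where "M = norm (w' t')"
   have "norm (G p t' (0, 0, w (t' - s p), w t')) \<le> \<kappa> * M"
    using ctl[OF pP'(1) w t'(2) t'(1)] by (simp add: M_def G_def)
   then have "M \<le> \<kappa> * M + 2 * e2 * (1 + C * M0 + C * M0)"
    using est[OF t'(1)] norm_triangle_ineq2[of "w' t'" "G p t' (0, 0, w (t' - s p), w t')"] by (simp add: M_def)
   moreover have "2 * (a * k / (2 * x * c)) * x = k * (a / c)" if "x > 0" for a x k c :: real
    using that by (simp add: field_simps)
   from this[OF pos, of e "1 - \<kappa>" "C + 1"] have "2 * e2 * (1 + C * M0 + C * M0) = (1 - \<kappa>) * (e / (C + 1))"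
    unfolding e2_def .
   ultimately have "(1 - \<kappa>) * M \<le> (1 - \<kappa>) * (e / (C + 1))" by (simp add: algebra_simps)
   then have "M \<le> e / (C + 1)" by (rule mult_left_le_imp_le) (use \<kappa> in simp)
   then have "C * M \<le> C * (e / (C + 1))" using C by (intro mult_left_mono) auto
   also have "\<dots> \<le> e" using C e by (simp add: field_simps)
   finally have "C * M \<le> e" .
   then show ?thesis
    using ctl2[OF pP'(1) w t'(2) t] pP'(2) by (auto simp: M_def w_def w'_def)
  qed
  ultimately show ?thesis unfolding B_def by blast
 qed
 have "cball p0 \<rho> \<subseteq> P" using B by (simp add: B_def)
 from that[OF \<rho>(1) r(1) this r(2) main] show thesis .
qed

text \<open>The Cauchy property is uniform near each point of \<open>P \<times> Ih\<close>. This
  makes the limit jointly continuous and lets the derivative in \<open>t\<close> be exchanged with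
  the limit; the side condition survives by \<open>L_lim\<close>.\<close>

lemma
 shows dlim_L: "p \<in> P \<Longrightarrow> L (dlim y h p)"
  and dlim_continuous: "continuous_on (P \<times> Ih) (case_prod (dlim y h))"
  and dlim_tendsto: "p \<in> P \<Longrightarrow> t \<in> Ih \<Longrightarrow> ((\<lambda>q. dq y h q p t) \<longlongrightarrow> dlim y h p t) (at 0)"
  and dlim_tendsto': "p \<in> P \<Longrightarrow> t \<in> Ih \<Longrightarrow> ((\<lambda>q. dq u h q p t) \<longlongrightarrow> dlim u h p t) (at 0)"
  and dlim_deriv: "p \<in> P \<Longrightarrow> t \<in> Ih \<Longrightarrow> (dlim y h p has_vector_derivative dlim u h p t) (at t)"
proof -
 have conty: "continuous_on (P \<times> Ih) (case_prod y)" using sol by (auto simp: solves_def)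
 define U where "U p0 t1 \<rho> r \<longleftrightarrow> (\<forall>e>0. \<exists>d>0. \<forall>q p t. q \<noteq> 0 \<longrightarrow> \<bar>q\<bar> < d \<longrightarrow> p \<in> cball p0 \<rho> \<longrightarrow> t \<in> ball t1 r \<longrightarrow>
   p + q *\<^sub>R h \<in> P \<and> norm (dq y h q p t - dlim y h p t) \<le> e \<and> norm (dq u h q p t - dlim u h p t) \<le> e)" for p0 t1 \<rho> r
 have UD: "\<exists>d>0. \<forall>q p t. q \<noteq> 0 \<longrightarrow> \<bar>q\<bar> < d \<longrightarrow> p \<in> cball p0 \<rho> \<longrightarrow> t \<in> ball t1 r \<longrightarrow>
   p + q *\<^sub>R h \<in> P \<and> norm (dq y h q p t - dlim y h p t) \<le> e \<and> norm (dq u h q p t - dlim u h p t) \<le> e"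
  if "U p0 t1 \<rho> r" "e > 0" for p0 t1 \<rho> r e
  using that unfolding U_def by (drule_tac spec[of _ e]) simp
 have loc: "\<exists>\<rho> r. \<rho> > 0 \<and> r > 0 \<and> cball p0 \<rho> \<subseteq> P \<and> ball t1 r \<subseteq> Ih \<and> U p0 t1 \<rho> r \<and>
  (\<forall>p\<in>cball p0 \<rho>. \<forall>t\<in>ball t1 r. ((\<lambda>q. dq y h q p t) \<longlongrightarrow> dlim y h p t) (at 0) \<and> ((\<lambda>q. dq u h q p t) \<longlongrightarrow> dlim u h p t) (at 0))"
  if p0: "p0 \<in> P" and t1: "t1 \<in> Ih" for p0 t1
 proof -
  obtain \<rho> r where r: "\<rho> > 0" "r > 0" "cball p0 \<rho> \<subseteq> P" "ball t1 r \<subseteq> Ih"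
   and C: "\<And>e. e > 0 \<Longrightarrow> \<exists>d>0. \<forall>q q' p t. q \<noteq> 0 \<longrightarrow> \<bar>q\<bar> < d \<longrightarrow> q' \<noteq> 0 \<longrightarrow> \<bar>q'\<bar> < d \<longrightarrow> p \<in> cball p0 \<rho> \<longrightarrow> t \<in> ball t1 r \<longrightarrow>
   p + q *\<^sub>R h \<in> P \<and> norm (dq y h q p t - dq y h q' p t) \<le> e \<and> norm (dq u h q p t - dq u h q' p t) \<le> e"
   by (rule dq_cauchy[OF p0 t1, where h = h]) (assumption | rule that)+
  have T: "((\<lambda>q. dq y h q p t) \<longlongrightarrow> dlim y h p t) (at 0)" "((\<lambda>q. dq u h q p t) \<longlongrightarrow> dlim u h p t) (at 0)"
   if "p \<in> cball p0 \<rho>" "t \<in> ball t1 r" for p t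
   unfolding dlim_def by (rule tendsto_at_0_Cauchy, use C that in meson)+
  have "\<exists>d>0. \<forall>q p t. q \<noteq> 0 \<longrightarrow> \<bar>q\<bar> < d \<longrightarrow> p \<in> cball p0 \<rho> \<longrightarrow> t \<in> ball t1 r \<longrightarrow>
   p + q *\<^sub>R h \<in> P \<and> norm (dq y h q p t - dlim y h p t) \<le> e \<and> norm (dq u h q p t - dlim u h p t) \<le> e" if e: "e > 0" for e
  proof -
   obtain d where d: "d > 0" and D: "\<forall>q q' p t. q \<noteq> 0 \<longrightarrow> \<bar>q\<bar> < d \<longrightarrow> q' \<noteq> 0 \<longrightarrow> \<bar>q'\<bar> < d \<longrightarrow> p \<in> cball p0 \<rho> \<longrightarrow> t \<in> ball t1 r \<longrightarrow>
   p + q *\<^sub>R h \<in> P \<and> norm (dq y h q p t - dq y h q' p t) \<le> e \<and> norm (dq u h q p t - dq u h q' p t) \<le> e"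
    using C[OF e] by blast
   have ev: "\<forall>\<^sub>F q' in at 0. q' \<noteq> 0 \<and> \<bar>q'\<bar> < d" using d by (auto simp: eventually_at intro!: exI[of _ d])
   have "norm (dq y h q p t - dlim y h p t) \<le> e \<and> norm (dq u h q p t - dlim u h p t) \<le> e"
    if "q \<noteq> 0" "\<bar>q\<bar> < d" "p \<in> cball p0 \<rho>" "t \<in> ball t1 r" for q p t
   proof
    show "norm (dq y h q p t - dlim y h p t) \<le> e"
     by (rule Lim_norm_ubound[of "at 0" "\<lambda>q'. dq y h q p t - dq y h q' p t"])
      (use that T D in \<open>auto intro!: tendsto_intros eventually_mono[OF ev]\<close>)
    show "norm (dq u h q p t - dlim u h p t) \<le> e"
     by (rule Lim_norm_ubound[of "at 0" "\<lambda>q'. dq u h q p t - dq u h q' p t"])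
      (use that T D in \<open>auto intro!: tendsto_intros eventually_mono[OF ev]\<close>)
   qed
   then show ?thesis using d D by (intro exI[of _ d]) blast
  qed
  then have "U p0 t1 \<rho> r" unfolding U_def by simp
  then show ?thesis using r T by blast
 qed
 show T: "p \<in> P \<Longrightarrow> t \<in> Ih \<Longrightarrow> ((\<lambda>q. dq y h q p t) \<longlongrightarrow> dlim y h p t) (at 0)" for p t
  using loc[of p t] by (meson centre_in_ball centre_in_cball less_imp_le)
 show T': "p \<in> P \<Longrightarrow> t \<in> Ih \<Longrightarrow> ((\<lambda>q. dq u h q p t) \<longlongrightarrow> dlim u h p t) (at 0)" for p t
  using loc[of p t] by (meson centre_in_ball centre_in_cball less_imp_le)
 show "p \<in> P \<Longrightarrow> L (dlim y h p)" for p
 proof -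
  assume p: "p \<in> P"
  have "\<forall>\<^sub>F q in at 0. p + q *\<^sub>R h \<in> P"
  proof -
   have "((\<lambda>q. p + q *\<^sub>R h) \<longlongrightarrow> p + 0 *\<^sub>R h) (at 0)" by (intro tendsto_intros)
   then show ?thesis using topological_tendstoD[OF _ P] p by simp
  qed
  then obtain d where d: "d > 0" "\<And>q. q \<noteq> 0 \<Longrightarrow> \<bar>q\<bar> < d \<Longrightarrow> p + q *\<^sub>R h \<in> P" by (auto simp: eventually_at)
  \<comment> \<open>\<open>L_lim\<close> is about sequences, so the limit is taken along one that
    avoids \<open>0\<close> and stays below \<open>d\<close>.\<close>
  define q where "q n = d / 2 * inverse (real (Suc n))" for n
  have q: "q n \<noteq> 0" "\<bar>q n\<bar> < d" for n using d(1) by (auto simp: q_def field_simps add_pos_nonneg abs_mult)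
  have "q \<longlonglongrightarrow> 0" unfolding q_def using tendsto_mult_right_zero[OF LIMSEQ_inverse_real_of_nat] .
  then have "filterlim q (at 0) sequentially" using q(1) by (simp add: filterlim_at)
  show "L (dlim y h p)"
  proof (rule L_lim)
   show "L (dq y h (q n) p)" for n using dq_L(1)[OF p] d(2)[OF q] by blast
   show "(\<lambda>n. dq y h (q n) p t) \<longlonglongrightarrow> dlim y h p t" if "t \<in> Ih" for t
    using filterlim_compose[OF T[OF p that] \<open>filterlim q (at 0) sequentially\<close>] .
  qed
 qed
 show "continuous_on (P \<times> Ih) (case_prod (dlim y h))"
 proof (rule continuous_at_imp_continuous_on, clarify)
  fix p0 t1 assume "p0 \<in> P" "t1 \<in> Ih"
  from loc[OF this] obtain \<rho> r where r: "\<rho> > 0" "r > 0" "cball p0 \<rho> \<subseteq> P" "ball t1 r \<subseteq> Ih"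
   and "U p0 t1 \<rho> r" by blast
  note U = UD[OF \<open>U p0 t1 \<rho> r\<close>]
  define V where "V = ball p0 \<rho> \<times> ball t1 r"
  have ul: "uniform_limit V (\<lambda>q (p,t). dq y h q p t) (case_prod (dlim y h)) (at 0)"
  proof (rule uniform_limitI)
   fix e :: real assume e: "e > 0"
   obtain d where d: "d > 0" "\<forall>q p t. q \<noteq> 0 \<longrightarrow> \<bar>q\<bar> < d \<longrightarrow> p \<in> cball p0 \<rho> \<longrightarrow> t \<in> ball t1 r \<longrightarrow>
   p + q *\<^sub>R h \<in> P \<and> norm (dq y h q p t - dlim y h p t) \<le> e / 2" using U[of "e / 2"] e by (auto simp del: mem_ball mem_cball)
   have "dist (dq y h q p t) (dlim y h p t) < e" if "q \<noteq> 0" "\<bar>q\<bar> < d" "(p, t) \<in> V" for q p t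
    using d(2)[rule_format, OF that(1,2), of p t] that(3) e by (auto simp: V_def dist_norm)
   then show "\<forall>\<^sub>F q in at 0. \<forall>x\<in>V. dist (case x of (p, t) \<Rightarrow> dq y h q p t) (case x of (p, t) \<Rightarrow> dlim y h p t) < e"
    using d(1) unfolding eventually_at by (intro exI[of _ d]) auto
  qed
  have cv: "\<forall>\<^sub>F q in at 0. continuous_on V (case_prod (dq y h q))"
  proof -
   obtain d where d: "d > 0" "\<forall>q p t. q \<noteq> 0 \<longrightarrow> \<bar>q\<bar> < d \<longrightarrow> p \<in> cball p0 \<rho> \<longrightarrow> t \<in> ball t1 r \<longrightarrow> p + q *\<^sub>R h \<in> P"
    using U[of 1] by auto
   have "continuous_on V (case_prod (dq y h q))" if "q \<noteq> 0" "\<bar>q\<bar> < d" for q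
   proof -
    have "continuous_on V (\<lambda>x. (case_prod y) (fst x + q *\<^sub>R h, snd x))"
     using d(2)[rule_format, OF that, of _ t1] r
     by (intro continuous_on_compose2[OF conty] continuous_intros) (auto simp: V_def subset_iff)
    moreover have "continuous_on V (\<lambda>x. (case_prod y) x)"
     using r by (intro continuous_on_subset[OF conty]) (auto simp: V_def subset_iff)
    ultimately show ?thesis unfolding dq_def case_prod_beta by (auto intro!: continuous_intros)
   qed
   then show ?thesis using d(1) unfolding eventually_at by (intro exI[of _ d]) auto
  qed
  have "continuous_on V (case_prod (dlim y h))"
   by (rule uniform_limit_theorem[OF cv ul]) simp
  then show "isCont (case_prod (dlim y h)) (p0, t1)"
   using r by (subst (asm) continuous_on_eq_continuous_at) (auto simp: V_def open_Times)
 qed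
 show "p \<in> P \<Longrightarrow> t \<in> Ih \<Longrightarrow> (dlim y h p has_vector_derivative dlim u h p t) (at t)" for p t
 proof -
  assume p: "p \<in> P" and t: "t \<in> Ih"
  from loc[OF this] obtain \<rho> r where r: "\<rho> > 0" "r > 0" "cball p \<rho> \<subseteq> P" "ball t r \<subseteq> Ih"
   and "U p t \<rho> r" by blast
  note U = UD[OF \<open>U p t \<rho> r\<close>]
  have pt: "p \<in> cball p \<rho>" "t \<in> ball t r" using r by auto
  obtain d where d: "d > 0" "\<And>q. q \<noteq> 0 \<Longrightarrow> \<bar>q\<bar> < d \<Longrightarrow> p + q *\<^sub>R h \<in> P"
   using U[OF zero_less_one] pt by blast
  define q where "q n = d / 2 * inverse (real (Suc n))" for n
  have q: "q n \<noteq> 0" "\<bar>q n\<bar> < d" for n using d(1) by (auto simp: q_def field_simps add_pos_nonneg abs_mult)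
  have q0: "q \<longlonglongrightarrow> 0" unfolding q_def using tendsto_mult_right_zero[OF LIMSEQ_inverse_real_of_nat] .
  then have qF: "filterlim q (at 0) sequentially" using q(1) by (simp add: filterlim_at)
  have "\<exists>G. \<forall>x\<in>ball t r. (\<lambda>n. dq y h (q n) p x) \<longlonglongrightarrow> G x \<and> (G has_derivative (\<lambda>k. k *\<^sub>R dlim u h p x)) (at x within ball t r)"
  proof (rule has_derivative_sequence[where f' = "\<lambda>n x k. k *\<^sub>R dq u h (q n) p x"])
   fix n x assume x: "x \<in> ball t r"
   show "(dq y h (q n) p has_derivative (\<lambda>k. k *\<^sub>R dq u h (q n) p x)) (at x within ball t r)"
    using dq_L(2)[OF p d(2)[OF q]] x r has_derivative_at_withinI unfolding has_vector_derivative_def by blast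
  next
   fix e :: real assume "e > 0"
   then obtain d' where d': "d' > 0" "\<And>q x. q \<noteq> 0 \<Longrightarrow> \<bar>q\<bar> < d' \<Longrightarrow> x \<in> ball t r \<Longrightarrow> norm (dq u h q p x - dlim u h p x) \<le> e"
    using U[of e] pt(1) by blast
   have "\<forall>\<^sub>F n in sequentially. \<bar>q n\<bar> < d'"
    using tendstoD[OF q0 d'(1)] by (simp add: dist_norm)
   then show "\<forall>\<^sub>F n in sequentially. \<forall>x\<in>ball t r. \<forall>k. norm (k *\<^sub>R dq u h (q n) p x - k *\<^sub>R dlim u h p x) \<le> e * norm k"
    by eventually_elim (use d'(2) q(1) in \<open>auto simp: scaleR_diff_right[symmetric] mult.commute[of e] intro!: mult_left_mono\<close>)
  qed (use r filterlim_compose[OF T[OF p t] qF] in auto)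
  then obtain G where G: "\<And>x. x \<in> ball t r \<Longrightarrow> (\<lambda>n. dq y h (q n) p x) \<longlonglongrightarrow> G x"
   "\<And>x. x \<in> ball t r \<Longrightarrow> (G has_derivative (\<lambda>k. k *\<^sub>R dlim u h p x)) (at x within ball t r)" by blast
  have tt: "t \<in> ball t r" using r by simp
  have GL: "G x = dlim y h p x" if "x \<in> ball t r" for x
   using LIMSEQ_unique[OF G(1)[OF that] filterlim_compose[OF T[OF p] qF]] that r by blast
  have "(G has_derivative (\<lambda>k. k *\<^sub>R dlim u h p t)) (at t)"
   using G(2)[of t] unfolding at_within_open[OF tt open_ball] by (simp only: tt)
  then have "(dlim y h p has_derivative (\<lambda>k. k *\<^sub>R dlim u h p t)) (at t)"
   by (rule has_derivative_transform_within_open[of _ _ _ _ "ball t r"]) (use GL r in auto)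
  then show ?thesis by (simp add: has_vector_derivative_def)
 qed
qed

text \<open>The limit of \<open>difference_quotient\<close> at a single point: the quotients
  converge, so the defect is at most \<open>e * N\<close> for every positive \<open>e\<close>, with
  \<open>N\<close> fixed.\<close>

lemma dlim_equation:
 assumes p: "p \<in> P" and t: "t \<in> I"
 shows "dlim u h p t = fderiv g (state y p t) (h, 0, dlim y h p (t - s p) - s h *\<^sub>R u p (t - s p), dlim y h p t)"
proof -
 define G where "G = fderiv g (state y p t)"
 have "state y p t \<in> W" using sol p t by (simp add: solves_def)
 then interpret G: bounded_linear G
  unfolding G_def using has_derivative_bounded_linear[OF C1_has_derivative[OF g]] by blast
 have tI: "t \<in> Ih" "t - s p \<in> Ih" using t I_Ih shift p by auto
 note T = dlim_tendsto[OF p] dlim_tendsto'[OF p]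
 define F where "F q = norm (dq u h q p t - G (h, 0, dq y h q p (t - s p) - s h *\<^sub>R u p (t - s p), dq y h q p t))" for q
 define l where "l = norm (dlim u h p t - G (h, 0, dlim y h p (t - s p) - s h *\<^sub>R u p (t - s p), dlim y h p t))"
 define N where "N = 1 + norm (dlim y h p (t - s p)) + norm (dlim y h p t)"
 have F: "(F \<longlongrightarrow> l) (at 0)"
  unfolding F_def l_def by (intro tendsto_intros G.tendsto T tI)
 have "l \<le> e * N" if e: "e > 0" for e
 proof (rule tendsto_le[OF _ _ F])
  show "((\<lambda>q. e * (1 + norm (dq y h q p (t - s p)) + norm (dq y h q p t))) \<longlongrightarrow> e * N) (at 0)"
   unfolding N_def by (intro tendsto_intros T tI)
  obtain d where d: "d > 0" "\<And>q. q \<noteq> 0 \<Longrightarrow> \<bar>q\<bar> < d \<Longrightarrow> F q \<le> e * (1 + norm (dq y h q p (t - s p)) + norm (dq y h q p t))"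
   by (rule difference_quotient[ of "{t}" "{p}" e h])
    (use t p e in \<open>auto simp: F_def G_def dq_def\<close>)
  then show "\<forall>\<^sub>F q in at 0. F q \<le> e * (1 + norm (dq y h q p (t - s p)) + norm (dq y h q p t))"
   unfolding eventually_at by (intro exI[of _ d]) auto
 qed simp
 then have *: "l / N \<le> e" if "e > 0" for e
  using that by (simp add: N_def divide_le_eq add_pos_nonneg)
 have "N > 0" by (simp add: N_def add_pos_nonneg)
 then have "l \<le> 0" using field_le_epsilon[of "l / N" 0] * by (simp add: divide_le_eq)
 then show ?thesis by (simp add: l_def G_def)
qed

end

text \<open>A parameter derivative of the solution solves a problem of the same kind whose
  right-hand side has lost one order of smoothness but has the same linearization \<Lambda>. Since
  \<open>control\<close> concerns \<Lambda> alone, the induction on \<open>k\<close> neither changes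
  \<kappa> nor shrinks \<open>P\<close> or \<open>I\<close>.\<close>

theorem smooth_dependence:
 assumes "solves W g y u" "Ck_on k W g" and \<kappa>: "0 \<le> \<kappa>" "\<kappa> < 1" and ctr: "control \<Lambda> \<kappa>"
  and "\<And>p t a b. k > 0 \<Longrightarrow> p \<in> P \<Longrightarrow> t \<in> I \<Longrightarrow> fderiv g (state y p t) (0, 0, a, b) = \<Lambda> p t a b"
 shows "Ck_on k (P \<times> Ih) (case_prod y)"
 using assms(1,2,6)
proof (induction k arbitrary: W g y u)
 case 0
 then show ?case by (simp add: solves_def)
next
 case (Suc k)
 interpret s: bounded_linear s by (rule s)
 note oPI = open_Times[OF P I] and oPIh = open_Times[OF P Ih]
 have sol: "solves W g y u" and g: "Ck_on 1 W g" and gk: "Ck_on k W g" and W: "open W"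
  using Suc.prems Ck_on_le[OF Suc.prems(2), of 1] Ck_on_Suc_D[OF Suc.prems(2)] by (auto simp: solves_def)
 have \<Lambda>: "\<And>p t a b. p \<in> P \<Longrightarrow> t \<in> I \<Longrightarrow> fderiv g (state y p t) (0, 0, a, b) = \<Lambda> p t a b"
  using Suc.prems(3) by simp
 have yk: "Ck_on k (P \<times> Ih) (\<lambda>x. y (fst x) (snd x))"
  using Suc.IH[OF sol gk \<Lambda>] by (simp add: case_prod_beta)
 have inPIh: "(fst x, snd x - s (fst x)) \<in> P \<times> Ih" if "x \<in> P \<times> I" for x using that shift by auto
 have shiftk: "Ck_on k (P \<times> I) (\<lambda>x. (fst x, snd x - s (fst x)))"
  by (intro Ck_on_Pair Ck_on_diff oPI Ck_on_fst Ck_on_snd Ck_on_id Ck_on_linear[OF s])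
 have yk': "Ck_on k (P \<times> I) (\<lambda>x. y (fst x) (snd x - s (fst x)))"
  using Ck_on_compose[OF oPI oPIh shiftk yk inPIh] by simp
 have statek: "Ck_on k (P \<times> I) (\<lambda>x. state y (fst x) (snd x))"
  unfolding state_def using Ck_on_subset[OF yk, of "P \<times> I"] I_Ih
  by (intro Ck_on_Pair oPI yk' Ck_on_fst Ck_on_snd Ck_on_id) auto
 have inO: "state y (fst x) (snd x) \<in> W" if "x \<in> P \<times> I" for x
  using that sol by (auto simp: solves_def)
 have "Ck_on k (P \<times> I) (case_prod u)"
  using Ck_on_compose[OF oPI W statek gk inO] sol
  by (subst Ck_on_cong[OF oPI, of _ "\<lambda>x. g (state y (fst x) (snd x))"]) (auto simp: solves_def)
 from transfer[OF _ this] have uk: "Ck_on k (P \<times> Ih) (\<lambda>x. u (fst x) (snd x))"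
  using Tw_deriv[of "y p" "u p" for p] sol unfolding solves_def case_prod_beta by blast
 have uk': "Ck_on k (P \<times> I) (\<lambda>x. u (fst x) (snd x - s (fst x)))"
  using Ck_on_compose[OF oPI oPIh shiftk uk inPIh] by simp
 note dl = dlim_L[OF sol g \<kappa> ctr \<Lambda>] dlim_continuous[OF sol g \<kappa> ctr \<Lambda>] dlim_deriv[OF sol g \<kappa> ctr \<Lambda>]
 have zk: "Ck_on k (P \<times> Ih) (case_prod (dlim y h))" for h
 proof -
  \<comment> \<open>The coefficients of the differentiated equation are taken along the known
    solution and depend on parameter and time only; \<open>g'\<close> is affine in the last two
    arguments, so its derivative there is again \<Lambda>.\<close>
  define W' :: "('p \<times> real \<times> 'e \<times> 'e) set" where "W' = P \<times> I \<times> UNIV \<times> UNIV"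
  define g' where "g' x = fderiv g (state y (fst x) (fst (snd x)))
   (h, 0, fst (snd (snd x)) - s h *\<^sub>R u (fst x) (fst (snd x) - s (fst x)), snd (snd (snd x)))" for x
  have o': "open W'" unfolding W'_def by (intro open_Times P I open_UNIV)
  have pr: "Ck_on k W' (\<lambda>x. (fst x, fst (snd x)))"
   by (intro Ck_on_Pair o' Ck_on_fst Ck_on_snd Ck_on_id)
  have prI: "(fst x, fst (snd x)) \<in> P \<times> I" if "x \<in> W'" for x using that by (auto simp: W'_def)
  have st': "Ck_on k W' (\<lambda>x. state y (fst x) (fst (snd x)))"
   using Ck_on_compose[OF o' oPI pr statek prI] by simp
  have u': "Ck_on k W' (\<lambda>x. u (fst x) (fst (snd x) - s (fst x)))"
   using Ck_on_compose[OF o' oPI pr uk' prI] by simp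
  have "Ck_on k W' g'"
   unfolding g'_def
  proof (rule Ck_on_frechet_derivative_apply[OF o' W st' Suc.prems(2)])
   show "state y (fst x) (fst (snd x)) \<in> W" if "x \<in> W'" for x using inO[OF prI[OF that]] by simp
   show "Ck_on k W' (\<lambda>x. (h, 0, fst (snd (snd x)) - s h *\<^sub>R u (fst x) (fst (snd x) - s (fst x)), snd (snd (snd x))))"
    by (intro Ck_on_Pair Ck_on_diff Ck_on_scaleR o' Ck_on_fst Ck_on_snd Ck_on_id Ck_on_const u')
  qed
  moreover have "solves W' g' (dlim y h) (dlim u h)"
   unfolding solves_def
  proof (intro conjI ballI)
   fix p t assume "p \<in> P" "t \<in> I"
   then show "dlim u h p t = g' (state (dlim y h) p t)"
    using dlim_equation[OF sol g \<kappa> ctr \<Lambda>, of p t h] by (simp add: g'_def state_def)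
  qed (use dl o' in \<open>auto simp: W'_def state_def\<close>)
  moreover have "fderiv g' (state (dlim y h) p t) (0, 0, a, b) = \<Lambda> p t a b"
   if k: "k > 0" and pt: "p \<in> P" "t \<in> I" for p t a b
  proof -
   define x where "x = state (dlim y h) p t"
   have xO: "x \<in> W'" using pt by (simp add: x_def state_def W'_def)
   have st: "state y p t \<in> W" using inO[of "(p,t)"] pt by simp
   have lin: "linear (fderiv g (state y p t))"
    using has_derivative_linear[OF C1_has_derivative[OF g st]] .
   have "(g' has_derivative fderiv g' x) (at x)"
    using C1_has_derivative[OF Ck_on_le[OF \<open>Ck_on k W' g'\<close>] xO] k by simp
   then have "(g' has_derivative fderiv g' x) (at (x + 0 *\<^sub>R (0, 0, a, b)))" by (simp only: scaleR_zero_left add_0_right)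
   then have 1: "((\<lambda>r. g' (x + r *\<^sub>R (0, 0, a, b))) has_derivative (\<lambda>r. fderiv g' x (r *\<^sub>R (0, 0, a, b)))) (at 0)"
    by (rule has_derivative_compose[rotated]) (auto intro!: derivative_eq_intros)
   have "g' (x + r *\<^sub>R (0, 0, a, b)) = g' x + r *\<^sub>R \<Lambda> p t a b" for r
   proof -
    have "g' (x + r *\<^sub>R (0, 0, a, b)) = fderiv g (state y p t)
     ((h, 0, dlim y h p (t - s p) - s h *\<^sub>R u p (t - s p), dlim y h p t) + r *\<^sub>R (0, 0, a, b))"
     by (simp add: g'_def x_def state_def algebra_simps)
    also have "\<dots> = g' x + r *\<^sub>R \<Lambda> p t a b"
     unfolding linear_add[OF lin] linear_scale[OF lin] \<Lambda>[OF pt] by (simp add: g'_def x_def state_def)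
    finally show ?thesis .
   qed
   then have "((\<lambda>r. g' (x + r *\<^sub>R (0, 0, a, b))) has_derivative (\<lambda>r. r *\<^sub>R \<Lambda> p t a b)) (at 0)"
    by (auto intro!: derivative_eq_intros)
   from fun_cong[OF has_derivative_unique[OF 1 this], of 1] show ?thesis unfolding x_def scaleR_one .
  qed
  ultimately show ?thesis using Suc.IH by blast
 qed
 \<comment> \<open>\<open>fst b = 0\<close> singles out the time direction in the basis of the
   product space.\<close>
 define G where "G b = (\<lambda>x. if fst b = 0 then u (fst x) (snd x) else dlim y (fst b) (fst x) (snd x))" for b :: "'p \<times> real"
 show ?case
 proof (rule Ck_on_Suc_partials[OF oPIh, where g = G])
  fix b :: "'p \<times> real" assume b: "b \<in> Basis"
  then have b': "b = (0, 1) \<or> (fst b \<noteq> 0 \<and> snd b = 0)" by (auto simp: Basis_prod_def)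
  show "Ck_on k (P \<times> Ih) (G b)" 
   using uk zk[of "fst b", unfolded case_prod_beta] by (cases "fst b = 0") (simp_all add: G_def case_prod_beta)
  fix x assume x: "x \<in> P \<times> Ih"
  obtain p t where xp: "x = (p, t)" "p \<in> P" "t \<in> Ih" using x by auto
  show "((\<lambda>r. case x + r *\<^sub>R b of (p, t) \<Rightarrow> y p t) has_vector_derivative G b x) (at 0)"
  proof (cases "b = (0, 1)")
   case True
   have "(y p has_vector_derivative u p t) (at (t + 0))" using sol xp by (simp add: solves_def)
   then have "(y p \<circ> (\<lambda>r. t + r) has_vector_derivative 1 *\<^sub>R u p t) (at 0)"
    by (intro vector_diff_chain_at) (auto intro!: derivative_eq_intros)
   then show ?thesis using True xp by (simp add: G_def o_def)
  next
   case False
   then have b0: "fst b \<noteq> 0" "snd b = 0" using b' by auto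
   have "((\<lambda>r. dq y (fst b) r p t) \<longlongrightarrow> dlim y (fst b) p t) (at 0)"
    using dlim_tendsto[OF sol g \<kappa> ctr \<Lambda>] xp by blast
   then have "((\<lambda>r. y (p + r *\<^sub>R fst b) t) has_vector_derivative dlim y (fst b) p t) (at 0)"
    by (rule dq_has_vector_derivative)
   then show ?thesis using b0 xp by (simp add: G_def case_prod_beta)
  qed
 qed
qed

end

section \<open>Ordinary differential equations\<close>

text \<open>Banach's theorem for the supremum distance over \<open>S\<close>, with functions
  compared on \<open>S\<close> alone. The fixed point is the telescoping series of the iterates
  started at \<open>a\<close>; \<open>d0\<close> bounds its first term.\<close>

lemma sup_contraction_fixpoint:
 fixes T :: "('x \<Rightarrow> 'b::banach) \<Rightarrow> 'x \<Rightarrow> 'b"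
 assumes a: "a \<in> F" and TF: "\<And>f. f \<in> F \<Longrightarrow> T f \<in> F"
  and c: "0 \<le> c" "c < 1"
  and contr: "\<And>f g d x. f \<in> F \<Longrightarrow> g \<in> F \<Longrightarrow> (\<And>x. x \<in> S \<Longrightarrow> norm (f x - g x) \<le> d) \<Longrightarrow> x \<in> S \<Longrightarrow>
   norm (T f x - T g x) \<le> c * d"
  and bd: "\<And>x. x \<in> S \<Longrightarrow> norm (T a x - a x) \<le> d0"
  and lim: "\<And>f l. (\<And>n::nat. f n \<in> F) \<Longrightarrow> uniform_limit S f l sequentially \<Longrightarrow> l \<in> F"
 shows "\<exists>f\<in>F. \<forall>x\<in>S. T f x = f x"
proof -
 define f where "f n = (T ^^ n) a" for n
 have fF: "f n \<in> F" for n by (induction n) (auto simp: f_def a TF)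
 have f0: "f 0 = a" by (simp add: f_def)
 have step: "\<forall>x\<in>S. norm (f (Suc n) x - f n x) \<le> c ^ n * d0" for n
 proof (induction n)
  case 0
  then show ?case using bd by (simp add: f_def)
 next
  case (Suc n)
  then show ?case using contr[OF fF fF, of "Suc n" n "c ^ n * d0"] by (simp add: f_def mult.assoc)
 qed
 define l where "l x = a x + (\<Sum>i. f (Suc i) x - f i x)" for x
 have "uniform_limit S (\<lambda>n x. \<Sum>i<n. f (Suc i) x - f i x) (\<lambda>x. \<Sum>i. f (Suc i) x - f i x) sequentially"
 proof (rule Weierstrass_m_test)
  show "norm (f (Suc n) x - f n x) \<le> c ^ n * d0" if "x \<in> S" for n x using step that by blast
  show "summable (\<lambda>n. c ^ n * d0)" using c by (intro summable_mult2 summable_geometric) auto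
 qed
 then have "uniform_limit S (\<lambda>n x. a x + (\<Sum>i<n. f (Suc i) x - f i x)) l sequentially"
  unfolding l_def by (intro uniform_limit_intros)
 moreover have "a x + (\<Sum>i<n. f (Suc i) x - f i x) = f n x" for n x
  using sum_lessThan_telescope[of "\<lambda>i. f i x" n] by (simp add: f0)
 ultimately have ul: "uniform_limit S f l sequentially" by simp
 have lF: "l \<in> F" using lim[OF fF ul] .
 have "T l x = l x" if x: "x \<in> S" for x
 proof -
  have "norm (T l x - l x) \<le> 0 + e" if e: "e > 0" for e
  proof -
   have "\<forall>\<^sub>F n in sequentially. \<forall>x\<in>S. dist (f n x) (l x) < e / 2"
    using uniform_limitD[OF ul, of "e / 2"] e by simp
   then obtain N where N: "\<And>n x. n \<ge> N \<Longrightarrow> x \<in> S \<Longrightarrow> dist (f n x) (l x) < e / 2"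
    by (auto simp: eventually_sequentially)
   have "norm (T l x - T (f N) x) \<le> c * (e / 2)"
    using N[of N] by (intro contr lF fF x) (auto simp: dist_norm norm_minus_commute less_imp_le)
   also have "\<dots> \<le> 1 * (e / 2)" using c e by (intro mult_right_mono) auto
   finally have "norm (T l x - f (Suc N) x) \<le> e / 2" by (simp add: f_def)
   moreover have "norm (f (Suc N) x - l x) \<le> e / 2" using N[of "Suc N", OF _ x] by (simp add: dist_norm)
   ultimately show ?thesis using norm_triangle_ineq[of "T l x - f (Suc N) x" "f (Suc N) x - l x"] by simp
  qed
  then have "norm (T l x - l x) \<le> 0" by (rule field_le_epsilon)
  then show ?thesis by simp
 qed
 then show ?thesis using lF by blast
qed

text \<open>The last bound repeats the Lipschitz constant on the level of the derivative: the fixed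
  point argument uses the one, \<open>control\<close> the other.\<close>

lemma C1_lipschitz:
 fixes W :: "real \<times> 'e::euclidean_space \<Rightarrow> 'b::real_normed_vector"
 assumes U: "open U" and W: "Ck_on 1 U W" and "(t0, v0) \<in> U"
 obtains R l B where "R > 0" "l \<ge> 0" "B \<ge> 0" "cball t0 R \<times> cball v0 R \<subseteq> U"
  "\<And>t a. t \<in> cball t0 R \<Longrightarrow> a \<in> cball v0 R \<Longrightarrow> norm (W (t, a)) \<le> B"
  "\<And>t a b. t \<in> cball t0 R \<Longrightarrow> a \<in> cball v0 R \<Longrightarrow> b \<in> cball v0 R \<Longrightarrow> norm (W (t, a) - W (t, b)) \<le> l * norm (a - b)"
  "\<And>t a b. t \<in> cball t0 R \<Longrightarrow> a \<in> cball v0 R \<Longrightarrow> norm (fderiv W (t, a) (0, b)) \<le> l * norm b"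
proof -
 obtain A' B' where AB: "open A'" "open B'" "t0 \<in> A'" "v0 \<in> B'" "A' \<times> B' \<subseteq> U"
  using open_prod_elim[OF U assms(3)] by (metis mem_Sigma_iff)
 obtain e1 where e1: "e1 > 0" "cball t0 e1 \<subseteq> A'" using AB open_contains_cball by blast
 obtain e2 where e2: "e2 > 0" "cball v0 e2 \<subseteq> B'" using AB open_contains_cball by blast
 define R where "R = min e1 e2"
 have R: "R > 0" using e1 e2 by (simp add: R_def)
 define Q where "Q = cball t0 R \<times> cball v0 R"
 have Q: "compact Q" "Q \<subseteq> U"
  using AB(5) e1 e2 by (auto simp: Q_def R_def compact_Times subset_iff)
 have "bounded (W ` Q)"
  using compact_imp_bounded[OF compact_continuous_image[OF continuous_on_subset[OF Ck_on_continuous[OF W] Q(2)] Q(1)]] .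
 then obtain B0 where B0: "\<And>x. x \<in> Q \<Longrightarrow> norm (W x) \<le> B0" by (auto simp: bounded_iff)
 obtain l where l: "l \<ge> 0" "\<And>x h. x \<in> Q \<Longrightarrow> norm (fderiv W x h) \<le> l * norm h"
  using C1_bounded_derivative[OF Q W] by blast
 have lip: "norm (W (t, a) - W (t, b)) \<le> l * norm (a - b)" if t: "t \<in> cball t0 R" and ab: "a \<in> cball v0 R" "b \<in> cball v0 R" for t a b
 proof (rule differentiable_bound[where f = "\<lambda>a. W (t, a)" and f' = "\<lambda>a h. fderiv W (t, a) (0, h)", OF convex_cball])
  fix a assume a: "a \<in> cball v0 R"
  have tQ: "(t, a) \<in> Q" using t a by (simp add: Q_def)
  have "(W has_derivative fderiv W (t, a)) (at (t, a))"
   using C1_has_derivative[OF W] tQ Q by blast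
  then show "((\<lambda>a. W (t, a)) has_derivative (\<lambda>h. fderiv W (t, a) (0, h))) (at a within cball v0 R)"
   by (rule has_derivative_compose[where f = "\<lambda>a. (t, a)" and g = W, rotated]) (auto intro!: derivative_eq_intros)
  show "onorm (\<lambda>h. fderiv W (t, a) (0, h)) \<le> l"
   by (rule onorm_le) (use l(2)[OF tQ, of "(0, _)"] in simp)
 qed (use ab in auto)
 show thesis
 proof (rule that[OF R l(1), of "max B0 0"])
  show "norm (W (t, a)) \<le> max B0 0" if "t \<in> cball t0 R" "a \<in> cball v0 R" for t a
   using B0[of "(t, a)"] that by (simp add: Q_def)
  show "norm (fderiv W (t, a) (0, b)) \<le> l * norm b" if "t \<in> cball t0 R" "a \<in> cball v0 R" for t a b
   using l(2)[of "(t, a)" "(0, b)"] that by (simp add: Q_def)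
 qed (use Q lip in \<open>auto simp: Q_def\<close>)
qed

text \<open>Over a segment shorter than \<open>e\<close> the largest distance of the two solutions
  is at most half of itself. Derivatives are taken within the convex set \<open>S\<close>, so
  \<open>t0\<close> may be one of its end points.\<close>

lemma ode_unique_local:
 fixes W :: "real \<times> 'e::euclidean_space \<Rightarrow> 'e"
 assumes U: "open U" and W: "Ck_on 1 U W" and S: "convex S" "t0 \<in> S" and d: "d > 0"
  and x: "\<And>t. t \<in> S \<Longrightarrow> dist t t0 < d \<Longrightarrow> (x has_vector_derivative W (t, x t)) (at t within S)"
  and z: "\<And>t. t \<in> S \<Longrightarrow> dist t t0 < d \<Longrightarrow> (z has_vector_derivative W (t, z t)) (at t within S)"
  and eq: "x t0 = z t0" and "(t0, x t0) \<in> U"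
 shows "\<exists>e>0. \<forall>t\<in>S. dist t t0 < e \<longrightarrow> x t = z t"
proof -
 obtain R l where R: "R > 0" and l: "l \<ge> 0" and lip: "\<And>t a b. t \<in> cball t0 R \<Longrightarrow> a \<in> cball (x t0) R \<Longrightarrow> b \<in> cball (x t0) R \<Longrightarrow> norm (W (t, a) - W (t, b)) \<le> l * norm (a - b)"
  by (rule C1_lipschitz[OF U W \<open>(t0, x t0) \<in> U\<close>], rule that)
 have "continuous (at t0 within S) x" "continuous (at t0 within S) z"
  using x[OF S(2)] z[OF S(2)] d has_vector_derivative_continuous by force+
 then have "\<exists>e>0. \<forall>t\<in>S. dist t t0 < e \<longrightarrow> dist (x t) (x t0) < R" "\<exists>e>0. \<forall>t\<in>S. dist t t0 < e \<longrightarrow> dist (z t) (x t0) < R"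
  unfolding continuous_within_eps_delta eq using R by auto
 then obtain e1 e2 where e12: "e1 > 0" "\<And>t. t \<in> S \<Longrightarrow> dist t t0 < e1 \<Longrightarrow> dist (x t) (x t0) < R"
  "e2 > 0" "\<And>t. t \<in> S \<Longrightarrow> dist t t0 < e2 \<Longrightarrow> dist (z t) (x t0) < R"
  by blast
 \<comment> \<open>The last entry gives \<open>l * e \<le> 1 / 2\<close>; the others keep the times
   and both curves where the Lipschitz bound holds.\<close>
 define e where "e = Min {e1, e2, d, R, 1 / (2 * (l + 1))}"
 have e: "e > 0" "e \<le> e1" "e \<le> e2" "e \<le> d" "e \<le> R" "e \<le> 1 / (2 * (l + 1))"
  using e12 d R l by (auto simp: e_def)
 have le: "l * e \<le> 1 / 2"
 proof -
  have "l * e \<le> (l + 1) * (1 / (2 * (l + 1)))" using e l by (intro mult_mono) auto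
  also have "(l + 1) * (1 / (2 * (l + 1))) = 1 / 2" using l by (simp add: divide_simps)
  finally show ?thesis .
 qed
 have "x t1 = z t1" if t1: "t1 \<in> S" "dist t1 t0 < e" for t1
 proof -
  define J where "J = closed_segment t0 t1"
  have J: "J \<subseteq> S" "\<And>t. t \<in> J \<Longrightarrow> dist t t0 < e" "compact J" "J \<noteq> {}"
  proof -
   show "J \<subseteq> S" using S t1 by (simp add: J_def closed_segment_subset)
   show "dist t t0 < e" if "t \<in> J" for t
    using segment_bound1[of t t0 t1] that t1(2) by (simp add: J_def dist_norm)
  qed (auto simp: J_def)
  have der: "((\<lambda>t. x t - z t) has_vector_derivative W (t, x t) - W (t, z t)) (at t within J)" if "t \<in> J" for t
  proof -
   have "dist t t0 < d" "t \<in> S" using J that e by force+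
   from has_vector_derivative_diff[OF x[OF this(2,1)] z[OF this(2,1)]] show ?thesis
    using has_vector_derivative_within_subset J(1) by blast
  qed
  then have "continuous_on J (\<lambda>t. norm (x t - z t))"
   by (intro continuous_on_norm continuous_on_vector_derivative) auto
  then obtain t' where t': "t' \<in> J" "\<And>t. t \<in> J \<Longrightarrow> norm (x t - z t) \<le> norm (x t' - z t')"
   using continuous_attains_sup[OF J(3,4)] by blast
  have sub: "closed_segment t0 t' \<subseteq> J" using t'(1) by (simp add: J_def subset_closed_segment)
  have "norm ((x t' - z t') - (x t0 - z t0) - (t' - t0) *\<^sub>R 0) \<le> (l * norm (x t' - z t')) * \<bar>t' - t0\<bar>"
  proof (rule vector_mvt_bound)
   fix t assume "t \<in> closed_segment t0 t'"
   then have tJ: "t \<in> J" using sub by blast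
   then show "((\<lambda>t. x t - z t) has_vector_derivative W (t, x t) - W (t, z t)) (at t within closed_segment t0 t')"
    using der has_vector_derivative_within_subset sub by blast
   have tS: "t \<in> S" "dist t t0 < e1" "dist t t0 < e2" "dist t t0 \<le> R" using J tJ e by force+
   have "norm (W (t, x t) - W (t, z t)) \<le> l * norm (x t - z t)"
    using e12(2)[OF tS(1,2)] e12(4)[OF tS(1,3)] tS(4) by (intro lip) (auto simp: dist_commute)
   also have "\<dots> \<le> l * norm (x t' - z t')" using t'(2)[OF tJ] l by (intro mult_left_mono) auto
   finally show "norm (W (t, x t) - W (t, z t) - 0) \<le> l * norm (x t' - z t')" by simp
  qed
  also have "\<dots> \<le> (l * norm (x t' - z t')) * e"
   using J(2)[OF t'(1)] l by (intro mult_left_mono) (auto simp: dist_norm)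
  also have "\<dots> = (l * e) * norm (x t' - z t')" by simp
  also have "\<dots> \<le> 1 / 2 * norm (x t' - z t')" by (intro mult_right_mono le) auto
  finally have "norm (x t' - z t') \<le> 0" using eq by simp
  then show ?thesis using t'(2)[of t1] by (simp add: J_def)
 qed
 then show ?thesis using e(1) by blast
qed

text \<open>The scaled integral is the primitive of \<open>h\<close> that vanishes at
  \<open>0\<close>, for either sign of \<open>r\<close>. Its domain of integration is fixed, so
  continuity in further parameters is that of an integral with parameters.\<close>

lemma primitive_scaled:
 fixes h :: "real \<Rightarrow> 'e::euclidean_space"
 assumes "open I" "convex I" "0 \<in> I" and h: "continuous_on I h" and r: "r \<in> I"
 shows "((\<lambda>r. r *\<^sub>R integral {0..1} (\<lambda>q. h (q * r))) has_vector_derivative h r) (at r)"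
proof -
 obtain e where e: "e > 0" "cball r e \<subseteq> I" using assms(1) r open_contains_cball by blast
 define a b where "a = min 0 (r - e)" and "b = max 0 (r + e)"
 have ab: "a \<le> 0" "0 \<le> b" "a < b" "a < r" "r < b" using e by (auto simp: a_def b_def)
 have "a \<in> I" "b \<in> I" using e assms(3) by (auto simp: a_def b_def min_def max_def dist_norm subset_iff)
 then have abI: "{a..b} \<subseteq> I"
  using closed_segment_subset[OF _ _ assms(2), of a b] ab by (simp add: closed_segment_eq_real_ivl)
 obtain G where G: "\<And>x. x \<in> {a..b} \<Longrightarrow> (G has_vector_derivative h x) (at x within {a..b})"
  using antiderivative_continuous[OF continuous_on_subset[OF h abI]] by blast
 have "r' *\<^sub>R integral {0..1} (\<lambda>q. h (q * r')) = G r' - G 0" if r': "r' \<in> {a..b}" for r'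
 proof -
  have in': "q * r' \<in> {a..b}" if "q \<in> {0..1}" for q
  proof -
   have "q * r' \<in> closed_segment 0 r'" using that by (auto simp: in_segment intro!: exI[of _ q])
   moreover have "closed_segment 0 r' \<subseteq> {a..b}" using r' ab by (intro closed_segment_subset) auto
   ultimately show ?thesis by blast
  qed
  have "((\<lambda>q. r' *\<^sub>R h (q * r')) has_integral G (1 * r') - G (0 * r')) {0..1}"
  proof (rule fundamental_theorem_of_calculus)
   fix q :: real assume q: "q \<in> {0..1}"
   have "(G \<circ> (\<lambda>q. q * r') has_vector_derivative r' *\<^sub>R h (q * r')) (at q within {0..1})"
   proof (rule vector_diff_chain_within)
    show "((\<lambda>q. q * r') has_vector_derivative r') (at q within {0..1})" by (auto intro!: derivative_eq_intros)
    show "(G has_vector_derivative h (q * r')) (at (q * r') within (\<lambda>q. q * r') ` {0..1})"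
     using has_vector_derivative_within_subset[OF G[OF in'[OF q]] image_subsetI[OF in']] .
   qed
   then show "((\<lambda>q. G (q * r')) has_vector_derivative r' *\<^sub>R h (q * r')) (at q within {0..1})" by (simp add: o_def)
  qed simp
  from integral_unique[OF this] show ?thesis by simp
 qed
 note G_eq = this
 have "(G has_vector_derivative h r) (at r)"
  using G[of r] ab unfolding at_within_Icc_at[OF ab(4,5)] by simp
 then have "((\<lambda>r. G r - G 0) has_vector_derivative h r) (at r)"
  by (auto intro!: derivative_eq_intros)
 then show ?thesis
  by (rule has_vector_derivative_transform_within_open[of _ _ _ "{a<..<b}"]) (use ab G_eq in auto)
qed


text \<open>Starting time and starting value become parameters of a displacement that starts at
  zero: \<open>\<phi> s v t = v + y (s, v) (t - s)\<close>. One fixed point for all parameters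
  together gives continuity in them, and \<open>smooth_dependence\<close> with zero delay gives
  smoothness.\<close>

lemma local_flow:
 fixes W :: "real \<times> 'e::euclidean_space \<Rightarrow> 'e"
 assumes U: "open U" and W: "smooth_on U W" and "(t0, v0) \<in> U"
 obtains m \<phi> where "m > 0" "smooth_on (ball t0 m \<times> ball v0 m \<times> ball t0 m) (\<lambda>(s, v, t). \<phi> s v t)"
  "\<And>s v. s \<in> ball t0 m \<Longrightarrow> v \<in> ball v0 m \<Longrightarrow> \<phi> s v s = v"
  "\<And>s v t. s \<in> ball t0 m \<Longrightarrow> v \<in> ball v0 m \<Longrightarrow> t \<in> ball t0 m \<Longrightarrow>
   (t, \<phi> s v t) \<in> U \<and> (\<phi> s v has_vector_derivative W (t, \<phi> s v t)) (at t)"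
proof -
 have W1: "Ck_on 1 U W" using W by (simp add: smooth_on_def)
 obtain R l B where R: "R > 0" and lB: "l \<ge> 0" "B \<ge> 0" and sub: "cball t0 R \<times> cball v0 R \<subseteq> U"
  and bound: "\<And>t a. t \<in> cball t0 R \<Longrightarrow> a \<in> cball v0 R \<Longrightarrow> norm (W (t, a)) \<le> B"
  and lip: "\<And>t a b. t \<in> cball t0 R \<Longrightarrow> a \<in> cball v0 R \<Longrightarrow> b \<in> cball v0 R \<Longrightarrow> norm (W (t, a) - W (t, b)) \<le> l * norm (a - b)"
  and lip': "\<And>t a b. t \<in> cball t0 R \<Longrightarrow> a \<in> cball v0 R \<Longrightarrow> norm (fderiv W (t, a) (0, b)) \<le> l * norm b"
  by (rule C1_lipschitz[OF U W1 assms(3)], rule that)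
 \<comment> \<open>Elapsed times are below \<open>2 * m\<close>. The entries keep time and position
   in the region of the bounds, the displacement below \<open>R / 2\<close> by
   \<open>2 * m * B \<le> R / 2\<close>, and the contraction factor \<open>2 * m * l\<close> below
   \<open>1 / 2\<close>.\<close>
 define m where "m = min (R / 4) (min (R / (4 * (B + 1))) (1 / (4 * (l + 1))))"
 have m0: "m > 0" unfolding m_def using R lB by simp
 have m1: "m \<le> R / 4" unfolding m_def by (rule min.cobounded1)
 have m2: "m \<le> R / (4 * (B + 1))" unfolding m_def by (rule order_trans[OF min.cobounded2 min.cobounded1])
 have m3: "m \<le> 1 / (4 * (l + 1))" unfolding m_def by (rule order_trans[OF min.cobounded2 min.cobounded2])
 note m = m0 m1 m2 m3
 have mB: "2 * m * B \<le> R / 2"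
 proof -
  have "2 * m * B \<le> 2 * (R / (4 * (B + 1))) * (B + 1)" using m lB by (intro mult_mono) auto
  also have "\<dots> = R / 2" using lB by (simp add: divide_simps)
  finally show ?thesis .
 qed
 have ml: "2 * m * l \<le> 1 / 2"
 proof -
  have "2 * m * l \<le> 2 * (1 / (4 * (l + 1))) * (l + 1)" using m lB by (intro mult_mono) auto
  also have "\<dots> = 1 / 2" using lB by (simp add: divide_simps)
  finally show ?thesis .
 qed
 define P where "P = ball t0 m \<times> ball v0 m"
 define I where "I = {- (2 * m) <..< 2 * m}"
 define S where "S = P \<times> I"
 have I: "open I" "convex I" "0 \<in> I" using m by (auto simp: I_def)
 have inS: "fst (fst x) + snd x \<in> cball t0 R" if "x \<in> S" for x
  using that m by (auto simp: S_def P_def I_def dist_real_def)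
 have inB: "snd (fst x) + a \<in> cball v0 R" if "x \<in> S" "norm a \<le> R / 2" for x a
 proof -
  have "dist v0 (snd (fst x)) \<le> m" using that by (auto simp: S_def P_def)
  then have "dist v0 (snd (fst x) + a) \<le> m + R / 2"
   using that(2) norm_triangle_ineq4[of "v0 - snd (fst x)" a] by (simp add: dist_norm algebra_simps)
  then show ?thesis using m(2) R by simp
 qed
 have scale: "(fst x, q * snd x) \<in> S" if "x \<in> S" "q \<in> {0..1}" for x q
 proof -
  have "\<bar>q * snd x\<bar> \<le> \<bar>snd x\<bar>" using that(2) by (auto simp: abs_mult mult_left_le_one_le)
  then show ?thesis using that(1) by (auto simp: S_def I_def abs_less_iff)
 qed
 define F where "F = {y :: (real \<times> 'e) \<times> real \<Rightarrow> 'e. continuous_on S y \<and> (\<forall>x\<in>S. norm (y x) \<le> R / 2)}"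
 define h where "h y x = W (fst (fst x) + snd x, snd (fst x) + y x)" for y :: "(real \<times> 'e) \<times> real \<Rightarrow> 'e" and x
 \<comment> \<open>The integral equation with the elapsed time \<open>snd x\<close> scaled to the
   unit interval, as in \<open>primitive_scaled\<close>.\<close>
 define T where "T y x = snd x *\<^sub>R integral {0..1} (\<lambda>q. h y (fst x, q * snd x))" for y x
 have hcont: "continuous_on S (h y)" if "y \<in> F" for y
  unfolding h_def using that inS inB sub
  by (intro continuous_on_compose2[OF Ck_on_continuous[OF W1]] continuous_intros) (auto simp: F_def)
 have hb: "norm (h y x) \<le> B" if "y \<in> F" "x \<in> S" for y x
  unfolding h_def using that inS inB by (intro bound) (auto simp: F_def)
 have hq: "continuous_on {0..1} (\<lambda>q. h y (fst x, q * snd x))" if "y \<in> F" "x \<in> S" for y x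
  using scale[OF that(2)] by (intro continuous_on_compose2[OF hcont[OF that(1)]] continuous_intros) auto
 have snd2: "\<bar>snd x\<bar> \<le> 2 * m" if "x \<in> S" for x using that by (auto simp: S_def I_def)
 have "\<exists>y\<in>F. \<forall>x\<in>S. T y x = y x"
 proof (rule sup_contraction_fixpoint[where a = "\<lambda>x. 0" and c = "1/2" and ?d0.0 = "R"])
  show zero: "(\<lambda>x. 0) \<in> F" using R by (simp add: F_def)
  show TF: "T y \<in> F" if y: "y \<in> F" for y
  proof -
   have "continuous_on (S \<times> cbox 0 1) (\<lambda>(x, q). h y (fst x, q * snd x))"
    unfolding case_prod_beta using scale
    by (intro continuous_on_compose2[OF hcont[OF y]] continuous_intros) auto
   from integral_continuous_on_param[OF this] have "continuous_on S (T y)"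
    unfolding T_def by (intro continuous_intros) (simp add: cbox_interval)
   moreover have "norm (T y x) \<le> R / 2" if x: "x \<in> S" for x
   proof -
    have "norm (integral {0..1} (\<lambda>q. h y (fst x, q * snd x))) \<le> B * (1 - 0)"
     using hb[OF y scale[OF x]] by (intro integral_bound hq[OF y x]) auto
    then have "norm (T y x) \<le> (2 * m) * B"
     unfolding T_def norm_scaleR using snd2[OF x] lB m by (intro mult_mono) auto
    then show ?thesis using mB by simp
   qed
   ultimately show ?thesis by (simp add: F_def)
  qed
  show "norm (T y x - T z x) \<le> 1 / 2 * d" if y: "y \<in> F" and z: "z \<in> F" and d: "\<And>x. x \<in> S \<Longrightarrow> norm (y x - z x) \<le> d" and x: "x \<in> S" for y z d x
  proof -
   have d0: "d \<ge> 0" using d[OF x] norm_ge_zero order_trans by blast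
   have "norm (h y x' - h z x') \<le> l * d" if x': "x' \<in> S" for x'
   proof -
    have "norm (h y x' - h z x') \<le> l * norm (snd (fst x') + y x' - (snd (fst x') + z x'))"
     unfolding h_def using y z x' inS inB by (intro lip) (auto simp: F_def)
    also have "\<dots> \<le> l * d" using d[OF x'] lB by (intro mult_left_mono) auto
    finally show ?thesis .
   qed
   then have "norm (integral {0..1} (\<lambda>q. h y (fst x, q * snd x) - h z (fst x, q * snd x))) \<le> l * d * (1 - 0)"
    using scale[OF x] by (intro integral_bound continuous_intros hq y z x) auto
   then have "norm (snd x *\<^sub>R integral {0..1} (\<lambda>q. h y (fst x, q * snd x) - h z (fst x, q * snd x))) \<le> (2 * m) * (l * d)"
    unfolding norm_scaleR using snd2[OF x] lB m d0 by (intro mult_mono) auto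
   moreover have "T y x - T z x = snd x *\<^sub>R integral {0..1} (\<lambda>q. h y (fst x, q * snd x) - h z (fst x, q * snd x))"
    unfolding T_def using integrable_continuous_interval[OF hq[OF y x]] integrable_continuous_interval[OF hq[OF z x]]
    by (simp add: integral_diff scaleR_diff_right)
   moreover have "(2 * m) * (l * d) \<le> 1 / 2 * d" using mult_right_mono[OF ml d0] by (simp add: mult.assoc)
   ultimately show ?thesis by simp
  qed
  show "norm (T (\<lambda>x. 0) x - 0) \<le> R" if "x \<in> S" for x
  proof -
   have "norm (T (\<lambda>x. 0) x) \<le> R / 2" using TF[OF zero] that by (simp add: F_def)
   then show ?thesis using R by simp
  qed
  show "y \<in> F" if f: "\<And>n::nat. f n \<in> F" and ul: "uniform_limit S f y sequentially" for f y
  proof -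
   have "continuous_on S y" using f by (intro uniform_limit_theorem[OF _ ul]) (auto simp: F_def)
   moreover have "norm (y x) \<le> R / 2" if "x \<in> S" for x
    using f that by (intro Lim_norm_ubound[OF _ tendsto_uniform_limitI[OF ul that]]) (auto simp: F_def)
   ultimately show ?thesis by (simp add: F_def)
  qed
 qed auto
 then obtain y0 where yF: "y0 \<in> F" and fixp: "\<And>x. x \<in> S \<Longrightarrow> T y0 x = y0 x" by blast
 define y where "y p r = y0 (p, r)" for p r
 have ynorm: "norm (y p r) \<le> R / 2" if "p \<in> P" "r \<in> I" for p r
  using yF that by (auto simp: F_def y_def S_def)
 have inU: "(fst p + r, snd p + y p r) \<in> U" if "p \<in> P" "r \<in> I" for p r
  using inS[of "(p, r)"] inB[of "(p, r)" "y p r"] ynorm[OF that] that sub by (auto simp: S_def)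
 have yder: "(y p has_vector_derivative W (fst p + r, snd p + y p r)) (at r)" if p: "p \<in> P" and r: "r \<in> I" for p r
 proof -
  have "continuous_on I (\<lambda>r. h y0 (p, r))"
   using p by (intro continuous_on_compose2[OF hcont[OF yF]] continuous_intros) (auto simp: S_def)
  from primitive_scaled[OF I this r]
  have "((\<lambda>r. T y0 (p, r)) has_vector_derivative h y0 (p, r)) (at r)" by (simp add: T_def)
  then have "(y p has_vector_derivative h y0 (p, r)) (at r)"
   by (rule has_vector_derivative_transform_within_open[OF _ I(1) r]) (use p fixp in \<open>auto simp: y_def S_def\<close>)
  then show ?thesis by (simp add: h_def y_def)
 qed
 have y0: "y p 0 = 0" if "p \<in> P" for p
  using fixp[of "(p, 0)"] that I(3) by (simp add: T_def S_def y_def)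
 \<comment> \<open>No delay; the side condition is the initial value zero; derivatives inherit no
   condition, and the two time domains coincide.\<close>
 interpret curve_family P I I "\<lambda>p. 0" "\<lambda>w. w 0 = (0::'e)" "\<lambda>w. True"
 proof
  show "open P" by (auto simp: P_def open_Times)
  show "\<exists>K. \<forall>x::real \<times> 'e. norm (0::real) \<le> norm x * K" by (rule exI[of _ 0]) simp
  show "z 0 = 0" if "\<And>n::nat. w n 0 = 0" "\<And>t. t \<in> I \<Longrightarrow> (\<lambda>n. w n t) \<longlonglongrightarrow> z t" for w :: "nat \<Rightarrow> real \<Rightarrow> 'e" and z
   using that(2)[OF I(3)] that(1) by (simp add: LIMSEQ_const_iff)
 qed (use I in auto)
 define pr where "pr x = (fst (fst x) + fst (snd x), snd (fst x) + snd (snd (snd x)))"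
  for x :: "(real \<times> 'e) \<times> real \<times> 'e \<times> 'e"
 have pr: "bounded_linear pr"
  unfolding pr_def[abs_def] by (intro bounded_linear_Pair bounded_linear_add bounded_linear_fst_comp
   bounded_linear_snd_comp bounded_linear_fst bounded_linear_snd)
 define U' where "U' = pr -` U"
 have U': "open U'" unfolding U'_def
  using open_vimage[OF U] linear_continuous_on[OF pr, of UNIV] by blast
 have gk: "Ck_on k U' (\<lambda>x. W (pr x))" for k
  using W by (intro Ck_on_compose[OF U' U Ck_on_bounded_linear[OF pr]]) (auto simp: U'_def smooth_on_def)
 have prs: "pr (state y p r) = (fst p + r, snd p + y p r)" for p r by (simp add: pr_def state_def)
 have sol: "solves U' (\<lambda>x. W (pr x)) y (\<lambda>p r. W (fst p + r, snd p + y p r))"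
  unfolding solves_def
 proof (intro conjI ballI)
  show "continuous_on (P \<times> I) (\<lambda>(p, r). (y p r))"
   using yF by (simp add: F_def S_def y_def)
 qed (use U' prs inU yder y0 in \<open>auto simp: U'_def\<close>)
 define \<Lambda> where "\<Lambda> p r a b = fderiv W (fst p + r, snd p + y p r) (0, b)" for p r and a b :: 'e
 have ctr: "control \<Lambda> (1 / 2)"
  unfolding control_def
 proof (intro ballI)
  fix t1 assume t1: "t1 \<in> I"
  \<comment> \<open>Halfway between \<open>\<bar>t1\<bar>\<close> and \<open>2 * m\<close>: the
    compact interval contains \<open>0\<close>, where the side condition lives, and a neighbourhood
    of \<open>t1\<close>.\<close>
  define \<rho> where "\<rho> = (\<bar>t1\<bar> + 2 * m) / 2"
  have \<rho>: "\<rho> > 0" "\<bar>t1\<bar> < \<rho>" "\<rho> < 2 * m" using t1 m by (auto simp: \<rho>_def I_def)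
  have KI: "{-\<rho>..\<rho>} \<subseteq> I" using \<rho> by (auto simp: I_def)
  have est: "norm (w t) \<le> \<rho> * M \<and> 0 \<le> M" if "w 0 = 0" "\<forall>t\<in>I. (w has_vector_derivative w' t) (at t)" "\<forall>t\<in>{-\<rho>..\<rho>}. norm (w' t) \<le> M" "t \<in> {-\<rho>..\<rho>}"
   for w w' :: "real \<Rightarrow> 'e" and M t
  proof -
   have seg: "closed_segment 0 t \<subseteq> {-\<rho>..\<rho>}" using that(4) \<rho> by (intro closed_segment_subset) auto
   have M: "0 \<le> M" using that(3) \<rho> norm_ge_zero order_trans by (metis atLeastAtMost_iff less_imp_le neg_le_0_iff_le)
   have "norm (w t - w 0 - (t - 0) *\<^sub>R 0) \<le> M * \<bar>t - 0\<bar>"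
   proof (rule vector_mvt_bound[where f' = w'])
    fix x assume "x \<in> closed_segment 0 t"
    then have x: "x \<in> {-\<rho>..\<rho>}" "x \<in> I" using seg KI by blast+
    show "(w has_vector_derivative w' x) (at x within closed_segment 0 t)"
     using that(2) x(2) has_vector_derivative_at_within by blast
    show "norm (w' x - 0) \<le> M" using that(3) x(1) by simp
   qed
   also have "\<dots> \<le> M * \<rho>" using that(4) M by (intro mult_left_mono) auto
   finally show ?thesis using that(1) M by (simp add: mult.commute)
  qed
  show "\<exists>K r C. compact K \<and> K \<subseteq> I \<and> K \<noteq> {} \<and> 0 < r \<and> 0 \<le> C \<and> ball t1 r \<subseteq> I \<and>
   (\<forall>p\<in>P. \<forall>w w' M. w 0 = 0 \<longrightarrow> (\<forall>t\<in>I. (w has_vector_derivative w' t) (at t)) \<longrightarrow> (\<forall>t\<in>K. norm (w' t) \<le> M) \<longrightarrow>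
    (\<forall>t\<in>K. norm (\<Lambda> p t (w (t - 0)) (w t)) \<le> 1 / 2 * M \<and> norm (w (t - 0)) \<le> C * M \<and> norm (w t) \<le> C * M) \<and>
    (\<forall>t\<in>ball t1 r. norm (w t) \<le> C * M \<and> norm (w' t) \<le> C * M))"
  proof (rule exI[of _ "{-\<rho>..\<rho>}"], rule exI[of _ "\<rho> - \<bar>t1\<bar>"], rule exI[of _ "\<rho> + 1"], intro conjI ballI allI impI)
   have "ball t1 (\<rho> - \<bar>t1\<bar>) \<subseteq> {-\<rho>..\<rho>}" by (auto simp: dist_real_def)
   then show "ball t1 (\<rho> - \<bar>t1\<bar>) \<subseteq> I" using KI by blast
   fix p M and w w' :: "real \<Rightarrow> 'e"
   assume p: "p \<in> P" and w: "w 0 = 0" "\<forall>t\<in>I. (w has_vector_derivative w' t) (at t)" "\<forall>t\<in>{-\<rho>..\<rho>}. norm (w' t) \<le> M"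
   have b: "norm (w t) \<le> \<rho> * M" "0 \<le> M" if "t \<in> {-\<rho>..\<rho>}" for t using est[OF w that] by auto
   {
    fix t assume t: "t \<in> {-\<rho>..\<rho>}"
    show "norm (w t) \<le> (\<rho> + 1) * M" "norm (w (t - 0)) \<le> (\<rho> + 1) * M" using b[OF t] by (auto simp: algebra_simps)
    have pt: "(p, t) \<in> S" using p t KI by (auto simp: S_def)
    have "norm (\<Lambda> p t (w (t - 0)) (w t)) \<le> l * norm (w t)"
     unfolding \<Lambda>_def using inS[OF pt] inB[OF pt ynorm[of p t]] p t KI by (intro lip') auto
    also have "\<dots> \<le> l * (\<rho> * M)" using b[OF t] lB by (intro mult_left_mono) auto
    also have "\<dots> \<le> l * (2 * m * M)" using \<rho> b[OF t] lB by (intro mult_left_mono mult_right_mono) auto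
    also have "\<dots> = (2 * m * l) * M" by simp
    also have "\<dots> \<le> 1 / 2 * M" by (rule mult_right_mono[OF ml b(2)[OF t]])
    finally show "norm (\<Lambda> p t (w (t - 0)) (w t)) \<le> 1 / 2 * M" .
   }
   {
    fix t assume "t \<in> ball t1 (\<rho> - \<bar>t1\<bar>)"
    then have t: "t \<in> {-\<rho>..\<rho>}" by (auto simp: dist_real_def)
    show "norm (w t) \<le> (\<rho> + 1) * M" using b[OF t] by (auto simp: algebra_simps)
    have "norm (w' t) \<le> 1 * M" using w(3) t by simp
    also have "\<dots> \<le> (\<rho> + 1) * M" using b[OF t] \<rho> by (intro mult_right_mono) auto
    finally show "norm (w' t) \<le> (\<rho> + 1) * M" .
   }
  qed (use KI \<rho> in auto)
 qed
 have \<Lambda>: "fderiv (\<lambda>x. W (pr x)) (state y p r) (0, 0, a, b) = \<Lambda> p r a b"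
  if "p \<in> P" "r \<in> I" for p r a b
 proof -
  have "(W has_derivative fderiv W (pr (state y p r))) (at (pr (state y p r)))"
   using inU[OF that] C1_has_derivative[OF W1] unfolding prs by blast
  then have "((\<lambda>x. W (pr x)) has_derivative (\<lambda>v. fderiv W (pr (state y p r)) (pr v))) (at (state y p r))"
   by (rule has_derivative_compose[OF bounded_linear_imp_has_derivative[OF pr]])
  from fun_cong[OF frechet_derivative_at[OF this], of "(0, 0, a, b)"] show ?thesis
   unfolding prs by (simp add: \<Lambda>_def pr_def zero_prod_def)
 qed
 have smooth: "smooth_on (P \<times> I) (case_prod y)"
  unfolding smooth_on_def
 proof
  fix k show "Ck_on k (P \<times> I) (case_prod y)"
   using \<Lambda> by (intro smooth_dependence[OF sol gk _ _ ctr]) auto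
 qed
 define D where "D = ball t0 m \<times> ball v0 m \<times> ball t0 m"
 have D: "open D" by (auto simp: D_def open_Times)
 define \<phi> where "\<phi> s v t = v + y (s, v) (t - s)" for s v t
 have tI: "t - s \<in> I" if "s \<in> ball t0 m" "t \<in> ball t0 m" for s t
  using that by (auto simp: I_def dist_real_def)
 show thesis
 proof (rule that[OF m(1)])
  have "smooth_on D (\<lambda>x. (case_prod y) ((fst x, fst (snd x)), snd (snd x) - fst x))"
   using tI by (intro smooth_on_compose[OF D _ _ smooth] smooth_on_Pair smooth_on_diff smooth_on_fst smooth_on_snd smooth_on_id D open_Times I)
    (auto simp: D_def P_def open_Times)
  then have "smooth_on D (\<lambda>x. fst (snd x) + (case_prod y) ((fst x, fst (snd x)), snd (snd x) - fst x))"
   by (intro smooth_on_add smooth_on_fst smooth_on_snd smooth_on_id D)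
  then show "smooth_on (ball t0 m \<times> ball v0 m \<times> ball t0 m) (\<lambda>(s, v, t). \<phi> s v t)"
   by (simp add: D_def \<phi>_def case_prod_unfold)
  show "\<phi> s v s = v" if "s \<in> ball t0 m" "v \<in> ball v0 m" for s v
   using y0[of "(s, v)"] that by (simp add: \<phi>_def P_def)
  show "(t, \<phi> s v t) \<in> U \<and> (\<phi> s v has_vector_derivative W (t, \<phi> s v t)) (at t)"
   if "s \<in> ball t0 m" "v \<in> ball v0 m" "t \<in> ball t0 m" for s v t
  proof -
   have p: "(s, v) \<in> P" using that by (simp add: P_def)
   have "(y (s, v) \<circ> (\<lambda>t. t - s) has_vector_derivative 1 *\<^sub>R W (s + (t - s), v + y (s, v) (t - s))) (at t)"
    using yder[OF p tI[OF that(1,3)]] by (intro vector_diff_chain_at) (auto intro!: derivative_eq_intros)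
   then have "(\<phi> s v has_vector_derivative W (t, \<phi> s v t)) (at t)"
    unfolding \<phi>_def[abs_def] by (auto intro!: derivative_eq_intros simp: o_def)
   then show ?thesis using inU[OF p tI[OF that(1,3)]] by (simp add: \<phi>_def)
  qed
 qed
qed

section \<open>Maps into manifolds and flows\<close>

locale atlas =
 fixes A :: "('m::{t2_space, second_countable_topology}, 'e::euclidean_space) chart set"
 assumes atlas: "smooth_atlas A"
begin

lemma chart_facts:
 assumes "c \<in> A"
 shows open_dom: "open (fst c)" and open_img: "open (snd c ` fst c)"
  and chart_continuous: "continuous_on (fst c) (snd c)"
  and inv_continuous: "continuous_on (snd c ` fst c) (chart_inv c)"
  and inv_chart: "p \<in> fst c \<Longrightarrow> chart_inv c (snd c p) = p"
  and chart_inv_chart: "y \<in> snd c ` fst c \<Longrightarrow> snd c (chart_inv c y) = y"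
  and inv_in_dom: "y \<in> snd c ` fst c \<Longrightarrow> chart_inv c y \<in> fst c"
 using atlas assms by (auto simp: smooth_atlas_def is_chart_def homeomorphism_def f_inv_into_f)

lemma chart_at: "\<exists>c\<in>A. p \<in> fst c"
 using atlas by (auto simp: smooth_atlas_def)

lemma open_overlap:
 assumes "c \<in> A" "d \<in> A"
 shows "open (snd c ` (fst c \<inter> fst d))"
proof -
 have "snd c ` (fst c \<inter> fst d) = snd c ` fst c \<inter> chart_inv c -` fst d"
  using chart_facts[OF assms(1)] by force
 then show ?thesis
  using continuous_open_preimage[OF inv_continuous[OF assms(1)] open_img[OF assms(1)] open_dom[OF assms(2)]] by simp
qed

lemma transition_smooth: "c \<in> A \<Longrightarrow> d \<in> A \<Longrightarrow> smooth_on (snd c ` (fst c \<inter> fst d)) (\<lambda>y. snd d (chart_inv c y))"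
 using atlas by (auto simp: smooth_atlas_def o_def)

text \<open>Continuity is a conjunct of its own because coordinate maps are unspecified off their
  domains. It makes the sets open on which the coordinates are required to be smooth.\<close>

definition smooth_into :: "'b::euclidean_space set \<Rightarrow> ('b \<Rightarrow> 'm) \<Rightarrow> bool" where
 "smooth_into U q \<longleftrightarrow> open U \<and> continuous_on U q \<and> (\<forall>c\<in>A. smooth_on (U \<inter> q -` fst c) (\<lambda>u. snd c (q u)))"

lemma smooth_into_open_vimage: "smooth_into U q \<Longrightarrow> open T \<Longrightarrow> open (U \<inter> q -` T)"
 unfolding smooth_into_def using continuous_open_preimage by blast

lemma smooth_into_chart: "smooth_into U q \<Longrightarrow> c \<in> A \<Longrightarrow> smooth_on (U \<inter> q -` fst c) (\<lambda>u. snd c (q u))"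
 by (simp add: smooth_into_def)

text \<open>One chart near each point is enough, since transition maps are smooth; continuity is
  recovered through the continuous inverse of that chart.\<close>

lemma smooth_intoI:
 assumes U: "open U" and loc: "\<And>u. u \<in> U \<Longrightarrow> \<exists>N c. open N \<and> u \<in> N \<and> N \<subseteq> U \<and> c \<in> A \<and> q ` N \<subseteq> fst c \<and> smooth_on N (\<lambda>u. snd c (q u))"
 shows "smooth_into U q"
 unfolding smooth_into_def
proof (intro conjI ballI)
 have cont: "continuous_on N q" if N: "open N" "c \<in> A" "q ` N \<subseteq> fst c" "smooth_on N (\<lambda>u. snd c (q u))" for N c
 proof -
  have "continuous_on N (\<lambda>u. chart_inv c (snd c (q u)))"
   by (rule continuous_on_compose2[OF inv_continuous[OF N(2)] smooth_on_continuous[OF N(4)]]) (use N(3) in auto)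
  moreover have "chart_inv c (snd c (q u)) = q u" if "u \<in> N" for u using inv_chart[OF N(2)] N(3) that by auto
  ultimately show ?thesis by (simp cong: continuous_on_cong)
 qed
 show "continuous_on U q"
 proof (rule continuous_at_imp_continuous_on, rule ballI)
  fix u assume "u \<in> U"
  then obtain N c where N: "open N" "u \<in> N" "c \<in> A" "q ` N \<subseteq> fst c" "smooth_on N (\<lambda>u. snd c (q u))" using loc by blast
  from cont[OF N(1,3,4,5)] show "isCont q u" using N(1,2) by (simp add: continuous_on_eq_continuous_at)
 qed
 fix d assume d: "d \<in> A"
 show "smooth_on (U \<inter> q -` fst d) (\<lambda>u. snd d (q u))"
 proof (rule smooth_on_locally)
  fix u assume u: "u \<in> U \<inter> q -` fst d"
  then obtain N c where N: "open N" "u \<in> N" "c \<in> A" "q ` N \<subseteq> fst c" "smooth_on N (\<lambda>u. snd c (q u))" using loc by blast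
  define T where "T = N \<inter> q -` fst d"
  have T: "open T" unfolding T_def using continuous_open_preimage[OF cont[OF N(1,3,4,5)] N(1) open_dom[OF d]] .
  have "smooth_on T (\<lambda>u. snd d (chart_inv c (snd c (q u))))"
   by (rule smooth_on_compose[OF T open_overlap[OF N(3) d] smooth_on_subset[OF N(5)] transition_smooth[OF N(3) d]])
    (use N in \<open>auto simp: T_def\<close>)
  moreover have "snd d (chart_inv c (snd c (q u))) = snd d (q u)" if "u \<in> T" for u
   using inv_chart[OF N(3), of "q u"] N(4) that by (auto simp: T_def)
  ultimately have "smooth_on T (\<lambda>u. snd d (q u))"
   using smooth_on_cong[OF T, of "\<lambda>u. snd d (chart_inv c (snd c (q u)))" "\<lambda>u. snd d (q u)"] by simp
  then show "\<exists>T. open T \<and> u \<in> T \<and> smooth_on T (\<lambda>u. snd d (q u))" using T u N by (auto simp: T_def)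
 qed
qed (rule U)

lemma smooth_into_local_chart:
 assumes "smooth_into U q" "u \<in> U"
 obtains N c where "open N" "u \<in> N" "N \<subseteq> U" "c \<in> A" "q ` N \<subseteq> fst c" "smooth_on N (\<lambda>u. snd c (q u))"
proof -
 obtain c where c: "c \<in> A" "q u \<in> fst c" using chart_at by blast
 show thesis
 proof (rule that[of "U \<inter> q -` fst c" c])
  show "open (U \<inter> q -` fst c)" by (rule smooth_into_open_vimage[OF assms(1) open_dom[OF c(1)]])
  show "smooth_on (U \<inter> q -` fst c) (\<lambda>u. snd c (q u))" by (rule smooth_into_chart[OF assms(1) c(1)])
 qed (use c assms(2) in auto)
qed

lemma smooth_into_locally:
 assumes "open U" "\<And>u. u \<in> U \<Longrightarrow> \<exists>N q'. u \<in> N \<and> smooth_into N q' \<and> (\<forall>x\<in>N. q x = q' x)"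
 shows "smooth_into U q"
proof (rule smooth_intoI[OF assms(1)])
 fix u assume u: "u \<in> U"
 from assms(2)[OF this] obtain N q' where N: "u \<in> N" "smooth_into N q'" "\<And>x. x \<in> N \<Longrightarrow> q x = q' x"
  by (elim exE conjE) (erule (1) that, simp)
 obtain T c where T: "open T" "u \<in> T" "T \<subseteq> N" "c \<in> A" "q' ` T \<subseteq> fst c" "smooth_on T (\<lambda>u. snd c (q' u))"
  by (rule smooth_into_local_chart[OF N(2,1)], rule that)
 have o: "open (T \<inter> U)" using T(1) assms(1) by blast
 have qq: "q x = q' x" if "x \<in> T \<inter> U" for x using N(3) T(3) that by blast
 have "smooth_on (T \<inter> U) (\<lambda>u. snd c (q u))"
  using smooth_on_cong[OF o, of "\<lambda>u. snd c (q u)" "\<lambda>u. snd c (q' u)"] qq smooth_on_subset[OF T(6)] by simp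
 moreover have "q ` (T \<inter> U) \<subseteq> fst c" using T(5) qq by force
 ultimately show "\<exists>N c. open N \<and> u \<in> N \<and> N \<subseteq> U \<and> c \<in> A \<and> q ` N \<subseteq> fst c \<and> smooth_on N (\<lambda>u. snd c (q u))"
  using o T(2,4) u by blast
qed

lemma smooth_into_subset:
 assumes "smooth_into U q" "open V" "V \<subseteq> U"
 shows "smooth_into V q"
 unfolding smooth_into_def
proof (intro conjI ballI)
 fix c assume "c \<in> A"
 from smooth_into_chart[OF assms(1) this] show "smooth_on (V \<inter> q -` fst c) (\<lambda>u. snd c (q u))"
  by (rule smooth_on_subset) (use assms(3) in auto)
qed (use assms continuous_on_subset in \<open>auto simp: smooth_into_def\<close>)

lemma smooth_into_compose:
 fixes h :: "'b::euclidean_space \<Rightarrow> 'c::euclidean_space"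
 assumes "smooth_into U q" "open V" "smooth_on V h" "\<And>v. v \<in> V \<Longrightarrow> h v \<in> U"
 shows "smooth_into V (\<lambda>v. q (h v))"
proof (rule smooth_intoI[OF assms(2)])
 fix v assume v: "v \<in> V"
 obtain T c where T: "open T" "h v \<in> T" "T \<subseteq> U" "c \<in> A" "q ` T \<subseteq> fst c" "smooth_on T (\<lambda>u. snd c (q u))"
  by (rule smooth_into_local_chart[OF assms(1) assms(4)[OF v]], rule that)
 have o: "open (V \<inter> h -` T)"
  using continuous_open_preimage[OF smooth_on_continuous[OF assms(3)] assms(2) T(1)] .
 have "smooth_on (V \<inter> h -` T) (\<lambda>v. snd c (q (h v)))"
  by (rule smooth_on_compose[OF o T(1) smooth_on_subset[OF assms(3)] T(6)]) auto
 then show "\<exists>N c. open N \<and> v \<in> N \<and> N \<subseteq> V \<and> c \<in> A \<and> (\<lambda>v. q (h v)) ` N \<subseteq> fst c \<and> smooth_on N (\<lambda>v. snd c (q (h v)))"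
  using o v T by (intro exI[of _ "V \<inter> h -` T"] exI[of _ c]) auto
qed

lemma smooth_into_chart_inv:
 assumes "open U" "smooth_on U h" "c \<in> A" "\<And>u. u \<in> U \<Longrightarrow> h u \<in> snd c ` fst c"
 shows "smooth_into U (\<lambda>u. chart_inv c (h u))"
proof (rule smooth_intoI[OF assms(1)])
 fix u assume "u \<in> U"
 moreover have "smooth_on U (\<lambda>u. snd c (chart_inv c (h u)))"
  using smooth_on_cong[OF assms(1), of "\<lambda>u. snd c (chart_inv c (h u))" h] chart_inv_chart[OF assms(3)] assms(2,4) by simp
 ultimately show "\<exists>N d. open N \<and> u \<in> N \<and> N \<subseteq> U \<and> d \<in> A \<and> (\<lambda>u. chart_inv c (h u)) ` N \<subseteq> fst d \<and> smooth_on N (\<lambda>u. snd d (chart_inv c (h u)))"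
  using assms inv_in_dom[OF assms(3)] by (intro exI[of _ U] exI[of _ c]) auto
qed

lemma tangent_transition:
 assumes "v \<in> tangent_space A p" "c \<in> A" "d \<in> A" "p \<in> fst c" "p \<in> fst d"
 shows "((\<lambda>y. snd d (chart_inv c y)) has_derivative fderiv (\<lambda>y. snd d (chart_inv c y)) (snd c p)) (at (snd c p))"
  and "v d = fderiv (\<lambda>y. snd d (chart_inv c y)) (snd c p) (v c)"
proof -
 show "((\<lambda>y. snd d (chart_inv c y)) has_derivative fderiv (\<lambda>y. snd d (chart_inv c y)) (snd c p)) (at (snd c p))"
  by (rule smooth_on_has_derivative[OF transition_smooth[OF assms(2,3)]]) (use assms(4,5) in blast)
 have "\<forall>c\<in>A. \<forall>d\<in>A. p \<in> fst c \<and> p \<in> fst d \<longrightarrow>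
    v d = fderiv (\<lambda>y. snd d (chart_inv c y)) (snd c p) (v c)"
  using assms(1)[unfolded tangent_space_def o_def mem_Collect_eq, THEN conjunct2] .
 from this[rule_format, OF assms(2,3)] assms(4,5)
 show "v d = fderiv (\<lambda>y. snd d (chart_inv c y)) (snd c p) (v c)" by simp
qed

text \<open>The derivative in one chart settles all others: by the chain rule coordinate derivatives
  change by the transition maps, and so do the components of \<open>v\<close>.\<close>

lemma has_velocityI:
 assumes c: "c \<in> A" "x t \<in> fst c" and cont: "continuous (at t within S) x" and v: "v \<in> tangent_space A (x t)"
  and der: "((\<lambda>t. snd c (x t)) has_vector_derivative v c) (at t within S)" and "t \<in> S"
 shows "has_velocity A x v t S"
 unfolding has_velocity_def
proof (intro conjI ballI impI cont v)
 fix d assume d: "d \<in> A" "x t \<in> fst d"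
 note tr = tangent_transition[OF v c(1) d(1) c(2) d(2)]
 have "((\<lambda>t. snd d (chart_inv c (snd c (x t)))) has_derivative
  (\<lambda>h. fderiv (\<lambda>y. snd d (chart_inv c y)) (snd c (x t)) (h *\<^sub>R v c))) (at t within S)"
  by (rule has_derivative_compose[OF der[unfolded has_vector_derivative_def] tr(1)])
 then have "((\<lambda>t. snd d (chart_inv c (snd c (x t)))) has_vector_derivative v d) (at t within S)"
  using linear_scale[OF has_derivative_linear[OF tr(1)]] tr(2) by (simp add: has_vector_derivative_def)
 moreover have "\<forall>\<^sub>F t in at t within S. x t \<in> fst c"
  using topological_tendstoD[OF cont[unfolded continuous_within] open_dom[OF c(1)] c(2)] .
 then have "\<forall>\<^sub>F t in at t within S. snd d (chart_inv c (snd c (x t))) = (snd d \<circ> x) t"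
  by eventually_elim (simp add: inv_chart[OF c(1)])
 ultimately show "((snd d \<circ> x) has_vector_derivative v d) (at t within S)"
  unfolding has_vector_derivative_def
  by (elim has_derivative_transform_eventually) (simp_all add: inv_chart[OF c] c \<open>t \<in> S\<close>)
qed

lemma has_velocity_within_subset:
 "has_velocity A x v t S \<Longrightarrow> T \<subseteq> S \<Longrightarrow> has_velocity A x v t T"
 unfolding has_velocity_def
 by (auto intro: continuous_within_subset has_vector_derivative_within_subset)

lemma has_velocity_cong:
 assumes "has_velocity A x v t S" "open N" "t \<in> N" "\<And>r. r \<in> N \<Longrightarrow> x r = z r" "t \<in> S"
 shows "has_velocity A z v t S"
proof -
 obtain c where c: "c \<in> A" "x t \<in> fst c" using chart_at by blast
 have ev: "\<forall>\<^sub>F r in at t within S. x r = z r"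
  using eventually_at_in_open'[OF assms(2,3)] assms(4) by (auto simp: eventually_at_filter elim: eventually_mono)
 show ?thesis
 proof (rule has_velocityI[OF c(1)])
  show "z t \<in> fst c" "v \<in> tangent_space A (z t)" using c assms by (auto simp: has_velocity_def)
  have "(x \<longlongrightarrow> x t) (at t within S)" using assms(1) by (simp add: has_velocity_def continuous_within)
  then show "continuous (at t within S) z"
   unfolding continuous_within using Lim_transform_eventually[OF _ ev, of "x t"] assms(4)[OF assms(3)] by simp
  have "((\<lambda>r. snd c (x r)) has_vector_derivative v c) (at t within S)"
   using assms(1) c by (simp add: has_velocity_def o_def)
  then show "((\<lambda>r. snd c (z r)) has_vector_derivative v c) (at t within S)"
   unfolding has_vector_derivative_def
   by (rule has_derivative_transform_eventually) (use ev assms(3-5) in \<open>auto elim: eventually_mono\<close>)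
 qed (rule assms(5))
qed

definition smooth_field :: "(real \<Rightarrow> 'm \<Rightarrow> ('m, 'e) tangent_vector) \<Rightarrow> bool" where
 "smooth_field Y \<longleftrightarrow> (\<forall>t p. Y t p \<in> tangent_space A p) \<and>
  (\<forall>c\<in>A. smooth_on (UNIV \<times> snd c ` fst c) (\<lambda>(t, y). Y t (chart_inv c y) c))"

text \<open>Near a time of agreement the curves agree by uniqueness in a chart; near a time of
  disagreement they disagree by the Hausdorff property. So agreement is locally constant on the
  connected set \<open>S\<close>.\<close>

lemma integral_curve_unique:
 assumes Y: "smooth_field Y" and S: "convex S"
  and x: "integral_curve_on A Y S x" and z: "integral_curve_on A Y S z"
  and t0: "t0 \<in> S" "x t0 = z t0" and t: "t \<in> S"
 shows "x t = z t"
proof -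
 have vel: "has_velocity A x (Y t (x t)) t S" "has_velocity A z (Y t (z t)) t S" if "t \<in> S" for t
  using x z that by (auto simp: integral_curve_on_def)
 have cont: "(x \<longlongrightarrow> x t) (at t within S)" "(z \<longlongrightarrow> z t) (at t within S)" if "t \<in> S" for t
  using vel[OF that] by (auto simp: has_velocity_def continuous_within)
 have "\<forall>a\<in>S. \<forall>\<^sub>F b in at a within S. (x a = z a) = (x b = z b)"
 proof
  fix a assume a: "a \<in> S"
  show "\<forall>\<^sub>F b in at a within S. (x a = z a) = (x b = z b)"
  proof (cases "x a = z a")
   case False
   obtain U V where UV: "open U" "open V" "x a \<in> U" "z a \<in> V" "U \<inter> V = {}"
    using hausdorff[OF False] by (elim exE conjE) (rule that)
   have "\<forall>\<^sub>F b in at a within S. x b \<in> U" "\<forall>\<^sub>F b in at a within S. z b \<in> V"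
    by (rule topological_tendstoD[OF cont(1)[OF a] UV(1,3)], rule topological_tendstoD[OF cont(2)[OF a] UV(2,4)])
   then show ?thesis by eventually_elim (use UV False in auto)
  next
   case True
   obtain c where c: "c \<in> A" "x a \<in> fst c" using chart_at by blast
   have "\<forall>\<^sub>F b in at a within S. x b \<in> fst c \<and> z b \<in> fst c"
    using topological_tendstoD[OF cont(1)[OF a] open_dom[OF c(1)]] topological_tendstoD[OF cont(2)[OF a] open_dom[OF c(1)]] c True
    by (simp add: eventually_conj)
   then obtain d where d: "d > 0" "\<And>b. b \<in> S \<Longrightarrow> b \<noteq> a \<Longrightarrow> dist b a < d \<Longrightarrow> x b \<in> fst c \<and> z b \<in> fst c"
    by (auto simp: eventually_at)
   have d': "x b \<in> fst c \<and> z b \<in> fst c" if "b \<in> S" "dist b a < d" for b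
    using d(2)[OF that(1) _ that(2)] c True by metis
   define W where "W = (\<lambda>(t, y). Y t (chart_inv c y) c)"
   have "smooth_on (UNIV \<times> snd c ` fst c) W" using Y c(1) unfolding smooth_field_def W_def by blast
   then have W1: "Ck_on 1 (UNIV \<times> snd c ` fst c) W" unfolding smooth_on_def by (rule spec)
   have der: "((\<lambda>t. snd c (w t)) has_vector_derivative W (b, snd c (w b))) (at b within S)"
    if "has_velocity A w (Y b (w b)) b S" "w b \<in> fst c" for w b
    using that c inv_chart[OF c(1)] by (auto simp: has_velocity_def W_def o_def)
   have "\<exists>e>0. \<forall>t\<in>S. dist t a < e \<longrightarrow> snd c (x t) = snd c (z t)"
    by (rule ode_unique_local[OF _ W1 S a d(1)])
     (use d' vel der c True open_img[OF c(1)] in \<open>auto intro!: open_Times\<close>)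
   then obtain e where e: "e > 0" "\<And>t. t \<in> S \<Longrightarrow> dist t a < e \<Longrightarrow> snd c (x t) = snd c (z t)" by blast
   have "x b = z b" if "b \<in> S" "dist b a < min d e" for b
    using e(2)[OF that(1)] d'[OF that(1)] that(2) inv_chart[OF c(1)] by (metis min_less_iff_conj)
   then show ?thesis using True d(1) e(1) unfolding eventually_at by (intro exI[of _ "min d e"]) auto
  qed
 qed
 from connected_local_const[OF convex_connected[OF S] t0(1) t this] t0(2) show ?thesis by simp
qed

lemma flow_eq:
 assumes Y: "smooth_field Y" and x: "integral_curve_on A Y (closed_segment 0 t) x" "x 0 = p"
 shows "flow A Y t p = x t"
 unfolding flow_def
proof (rule the_equality)
 show "\<exists>z. integral_curve_on A Y (closed_segment 0 t) z \<and> z 0 = p \<and> z t = x t" using x by blast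
 fix q assume "\<exists>z. integral_curve_on A Y (closed_segment 0 t) z \<and> z 0 = p \<and> z t = q"
 then show "q = x t"
  using integral_curve_unique[OF Y convex_closed_segment x(1), of _ 0 t] x(2) by force
qed

end

section \<open>Flow boxes along a given integral curve\<close>

context atlas
begin

text \<open>The parameter \<open>u\<close> merely labels integral curves. Which curve it labels is
  fixed separately, by prescribing the values at one time, so a box can be continued from any of its
  times.\<close>

definition flow_box :: "(real \<Rightarrow> 'm \<Rightarrow> ('m, 'e) tangent_vector) \<Rightarrow> real set \<Rightarrow> 'e set \<Rightarrow> (real \<Rightarrow> 'e \<Rightarrow> 'm) \<Rightarrow> bool" where
 "flow_box Y T V H \<longleftrightarrow> smooth_into (T \<times> V) (case_prod H) \<and>
  (\<forall>u\<in>V. \<forall>t\<in>T. has_velocity A (\<lambda>t. H t u) (Y t (H t u)) t UNIV)"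

lemma integral_curve_subset:
 "integral_curve_on A Y T x \<Longrightarrow> S \<subseteq> T \<Longrightarrow> integral_curve_on A Y S x"
 unfolding integral_curve_on_def by (blast intro: has_velocity_within_subset)

lemma flow_box_curve:
 assumes "flow_box Y T V H" "u \<in> V" "S \<subseteq> T"
 shows "integral_curve_on A Y S (\<lambda>t. H t u)"
 using assms has_velocity_within_subset unfolding flow_box_def integral_curve_on_def by blast

lemma flow_box_subset:
 assumes "flow_box Y T V H" "open T'" "T' \<subseteq> T" "open V'" "V' \<subseteq> V"
 shows "flow_box Y T' V' H"
 unfolding flow_box_def
proof
 show "smooth_into (T' \<times> V') (case_prod H)"
  by (rule smooth_into_subset[OF conjunct1[OF assms(1)[unfolded flow_box_def]] open_Times[OF assms(2,4)]])
   (use assms(3,5) in blast)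
 show "\<forall>u\<in>V'. \<forall>t\<in>T'. has_velocity A (\<lambda>t. H t u) (Y t (H t u)) t UNIV"
  using conjunct2[OF assms(1)[unfolded flow_box_def]] assms(3,5) by blast
qed

text \<open>On the common time interval the two boxes agree, being integral curves with the same
  value at \<open>b\<close>. Hence the switch at \<open>b\<close> does not disturb
  smoothness.\<close>

lemma flow_box_glue:
 assumes Y: "smooth_field Y" and 1: "flow_box Y {a1<..<b1} V H1" and 2: "flow_box Y {a2<..<b2} V H2"
  and V: "open V" and eq: "\<And>u. u \<in> V \<Longrightarrow> H1 b u = H2 b u" and le: "a1 \<le> a2" "a2 < b" "b < b1" "b1 \<le> b2"
 shows "flow_box Y {a1<..<b2} V (\<lambda>t u. if t < b then H1 t u else H2 t u)"
proof -
 define H where "H t u = (if t < b then H1 t u else H2 t u)" for t u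
 have agree: "H1 t u = H2 t u" if "t \<in> {a2<..<b1}" "u \<in> V" for t u
 proof (rule integral_curve_unique[OF Y _ _ _ _ _ that(1)])
  show "integral_curve_on A Y {a2<..<b1} (\<lambda>t. H1 t u)" "integral_curve_on A Y {a2<..<b1} (\<lambda>t. H2 t u)"
   using le by (auto intro!: flow_box_curve[OF 1 that(2)] flow_box_curve[OF 2 that(2)])
  show "H1 b u = H2 b u" using eq that(2) .
 qed (use le in auto)
 have H1: "H t u = H1 t u" if "t < b1" "u \<in> V" for t u using agree[of t u] that le by (auto simp: H_def)
 have H2: "H t u = H2 t u" if "t > a2" "u \<in> V" for t u using agree[of t u] that le by (auto simp: H_def)
 have "smooth_into ({a1<..<b2} \<times> V) (case_prod H)"
 proof (rule smooth_into_locally)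
  fix x assume x: "x \<in> {a1<..<b2} \<times> V"
  obtain t u where xt: "x = (t, u)" "t \<in> {a1<..<b2}" "u \<in> V" using x by auto
  have s1: "smooth_into ({a1<..<b1} \<times> V) (case_prod H1)" "smooth_into ({a2<..<b2} \<times> V) (case_prod H2)"
   using 1 2 by (auto simp: flow_box_def)
  show "\<exists>N q'. x \<in> N \<and> smooth_into N q' \<and> (\<forall>x\<in>N. (case_prod H) x = q' x)"
  proof (cases "t < b1")
   case True
   show ?thesis
    by (rule exI[of _ "{a1<..<b1} \<times> V"], rule exI[of _ "\<lambda>(t, u). H1 t u"])
     (use s1 True xt H1 in auto)
  next
   case False
   show ?thesis
    by (rule exI[of _ "{a2<..<b2} \<times> V"], rule exI[of _ "\<lambda>(t, u). H2 t u"])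
     (use s1 False xt H2 le in auto)
  qed
 qed (use V in \<open>auto intro: open_Times\<close>)
 moreover have "has_velocity A (\<lambda>t. H t u) (Y t (H t u)) t UNIV" if u: "u \<in> V" and t: "t \<in> {a1<..<b2}" for t u
 proof (cases "t < b1")
  case True
  have "has_velocity A (\<lambda>t. H1 t u) (Y t (H1 t u)) t UNIV" using 1 u t True by (simp add: flow_box_def)
  from has_velocity_cong[OF this, of "{a1<..<b1}" "\<lambda>t. H t u"] show ?thesis using True t u H1 by simp
 next
  case False
  have "has_velocity A (\<lambda>t. H2 t u) (Y t (H2 t u)) t UNIV" using 2 u t False le by (simp add: flow_box_def)
  from has_velocity_cong[OF this, of "{a2<..<b2}" "\<lambda>t. H t u"] show ?thesis using False t u H2 le by simp
 qed
 ultimately show ?thesis unfolding flow_box_def H_def by blast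
qed

text \<open>The starting time is any point of the interval and the starting values form an arbitrary
  smooth family \<open>q\<close>, not just a chart. So the values of one box at the end of its
  interval can be the family from which the next box starts.\<close>

definition flowable :: "(real \<Rightarrow> 'm \<Rightarrow> ('m, 'e) tangent_vector) \<Rightarrow> (real \<Rightarrow> 'm) \<Rightarrow> real \<Rightarrow> real \<Rightarrow> bool" where
 "flowable Y x0 a b \<longleftrightarrow> (\<forall>t0\<in>{a..b}. \<forall>U q u0. smooth_into U q \<longrightarrow> u0 \<in> U \<longrightarrow> q u0 = x0 t0 \<longrightarrow>
  (\<exists>V w H. open V \<and> u0 \<in> V \<and> V \<subseteq> U \<and> 0 < w \<and> flow_box Y {a - w<..<b + w} V H \<and> (\<forall>u\<in>V. H t0 u = q u)))"

lemma flowableD: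
 assumes "flowable Y x0 a b" "t0 \<in> {a..b}" "smooth_into U q" "u0 \<in> U" "q u0 = x0 t0"
 obtains V w H where "open V" "u0 \<in> V" "V \<subseteq> U" "0 < w" "flow_box Y {a - w<..<b + w} V H" "\<And>u. u \<in> V \<Longrightarrow> H t0 u = q u"
 using assms(1)[unfolded flowable_def, rule_format, OF assms(2-5)]
 by (elim exE conjE) (rule that, assumption+, drule bspec, assumption+)

lemma flow_box_at:
 assumes "flow_box Y T V H" "t \<in> T" "open V"
 shows "smooth_into V (H t)"
proof -
 have 1: "smooth_into (T \<times> V) (case_prod H)" using assms by (simp add: flow_box_def)
 have "smooth_into V (\<lambda>u. (case_prod H) (t, u))"
  using assms by (intro smooth_into_compose[OF 1 assms(3)] smooth_on_Pair) auto
 then show ?thesis by simp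
qed

lemma flowable_trans:
 assumes Y: "smooth_field Y" and x0: "integral_curve_on A Y UNIV x0"
  and ab: "flowable Y x0 a b" and bc: "flowable Y x0 b c" and le: "a \<le> b" "b \<le> c"
 shows "flowable Y x0 a c"
 unfolding flowable_def
proof (intro ballI allI impI)
 fix t0 U q and u0 :: 'e assume t0: "t0 \<in> {a..c}" and q: "smooth_into U q" "u0 \<in> U" "q u0 = x0 t0"
 have x0': "integral_curve_on A Y S x0" for S by (rule integral_curve_subset[OF x0 subset_UNIV])
 have glue: "\<exists>V w H. open V \<and> u0 \<in> V \<and> V \<subseteq> U \<and> 0 < w \<and> flow_box Y {a - w<..<c + w} V H \<and> (\<forall>u\<in>V. H t0 u = q u)"
  if V: "open V" "u0 \<in> V" "V \<subseteq> U" and e: "0 < w1" "0 < w2"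
   and F: "flow_box Y {a - w1<..<b + w1} V H1" "flow_box Y {b - w2<..<c + w2} V H2"
   and eq: "\<And>u. u \<in> V \<Longrightarrow> H1 b u = H2 b u" "\<And>u. u \<in> V \<Longrightarrow> (if t0 < b then H1 t0 u else H2 t0 u) = q u"
  for V w1 w2 H1 H2
 proof -
  define w where "w = min w1 w2"
  have w: "w > 0" "w \<le> w1" "w \<le> w2" using e by (auto simp: w_def)
  have 1: "flow_box Y {a - w<..<b + w} V H1" using w by (intro flow_box_subset[OF F(1)] V) auto
  have 2: "flow_box Y {b - w<..<c + w} V H2" using w by (intro flow_box_subset[OF F(2)] V) auto
  have "flow_box Y {a - w<..<c + w} V (\<lambda>t u. if t < b then H1 t u else H2 t u)"
   using w le by (intro flow_box_glue[OF Y 1 2 V(1) eq(1)]) auto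
  then show ?thesis using V w(1) eq(2) by blast
 qed
 show "\<exists>V w H. open V \<and> u0 \<in> V \<and> V \<subseteq> U \<and> 0 < w \<and> flow_box Y {a - w<..<c + w} V H \<and> (\<forall>u\<in>V. H t0 u = q u)"
 proof (cases "t0 < b")
  case True
  have t0b: "t0 \<in> {a..b}" "b \<in> {b..c}" using True t0 le by auto
  obtain V1 w1 H1 where 1: "open V1" "u0 \<in> V1" "V1 \<subseteq> U" "0 < w1" "flow_box Y {a - w1<..<b + w1} V1 H1" "\<And>u. u \<in> V1 \<Longrightarrow> H1 t0 u = q u"
   by (rule flowableD[OF ab t0b(1) q(1,2,3)], rule that)
  have bI: "b \<in> {a - w1<..<b + w1}" using 1(4) le by auto
  \<comment> \<open>At \<open>u0\<close> the box follows the orbit, so its values at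
    \<open>b\<close> are an admissible starting family on the second interval.\<close>
  have Hb: "H1 b u0 = x0 b"
   by (rule integral_curve_unique[OF Y _ flow_box_curve[OF 1(5,2) order_refl] x0', of t0])
    (use bI True t0 1(4,6,2) q(3) in auto)
  obtain V2 w2 H2 where 2: "open V2" "u0 \<in> V2" "V2 \<subseteq> V1" "0 < w2" "flow_box Y {b - w2<..<c + w2} V2 H2" "\<And>u. u \<in> V2 \<Longrightarrow> H2 b u = H1 b u"
   by (rule flowableD[OF bc t0b(2) flow_box_at[OF 1(5) bI 1(1)] 1(2) Hb], rule that)
  have "flow_box Y {a - w1<..<b + w1} V2 H1" by (rule flow_box_subset[OF 1(5) _ _ 2(1,3)]) auto
  from glue[OF 2(1,2) _ 1(4) 2(4) this 2(5)] show ?thesis using 1(3,6) 2(3,6) True by force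
 next
  case False
  have t0b: "t0 \<in> {b..c}" "b \<in> {a..b}" using False t0 le by auto
  obtain V2 w2 H2 where 2: "open V2" "u0 \<in> V2" "V2 \<subseteq> U" "0 < w2" "flow_box Y {b - w2<..<c + w2} V2 H2" "\<And>u. u \<in> V2 \<Longrightarrow> H2 t0 u = q u"
   by (rule flowableD[OF bc t0b(1) q(1,2,3)], rule that)
  have bI: "b \<in> {b - w2<..<c + w2}" using 2(4) le by auto
  have Hb: "H2 b u0 = x0 b"
   by (rule integral_curve_unique[OF Y _ flow_box_curve[OF 2(5,2) order_refl] x0', of t0])
    (use bI False t0 2(4,6,2) q(3) in auto)
  obtain V1 w1 H1 where 1: "open V1" "u0 \<in> V1" "V1 \<subseteq> V2" "0 < w1" "flow_box Y {a - w1<..<b + w1} V1 H1" "\<And>u. u \<in> V1 \<Longrightarrow> H1 b u = H2 b u"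
   by (rule flowableD[OF ab t0b(2) flow_box_at[OF 2(5) bI 2(1)] 2(2) Hb], rule that)
  have "flow_box Y {b - w2<..<c + w2} V1 H2" by (rule flow_box_subset[OF 2(5) _ _ 1(1,3)]) auto
  from glue[OF 1(1,2) _ 1(4) 2(4) 1(5) this] show ?thesis using 2(3,6) 1(3,6) False by force
 qed
qed

text \<open>A short interval keeps the orbit in one chart and within reach of
  \<open>local_flow\<close>, which then transports the coordinates of \<open>q u\<close>.\<close>

lemma flowable_local:
 assumes Y: "smooth_field Y" and x0: "integral_curve_on A Y UNIV x0"
 shows "\<exists>d>0. \<forall>a b. a \<le> x \<and> x \<le> b \<and> b - a < d \<longrightarrow> flowable Y x0 a b"
proof -
 obtain c where c: "c \<in> A" "x0 x \<in> fst c" using chart_at by blast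
 define W where "W = (\<lambda>(t, y). Y t (chart_inv c y) c)"
 define v0 where "v0 = snd c (x0 x)"
 have W: "smooth_on (UNIV \<times> snd c ` fst c) W" using Y c(1) unfolding smooth_field_def W_def by blast
 have o: "open (UNIV \<times> snd c ` fst c :: (real \<times> 'e) set)" by (intro open_Times open_UNIV open_img c)
 have xv: "(x, v0) \<in> UNIV \<times> snd c ` fst c" using c by (auto simp: v0_def)
 obtain w \<phi> where w: "w > 0" and \<phi>: "smooth_on (ball x w \<times> ball v0 w \<times> ball x w) (\<lambda>(s, v, t). \<phi> s v t)"
  and \<phi>0: "\<And>s v. s \<in> ball x w \<Longrightarrow> v \<in> ball v0 w \<Longrightarrow> \<phi> s v s = v"
  and \<phi>': "\<And>s v t. s \<in> ball x w \<Longrightarrow> v \<in> ball v0 w \<Longrightarrow> t \<in> ball x w \<Longrightarrow>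
   (t, \<phi> s v t) \<in> UNIV \<times> snd c ` fst c \<and> (\<phi> s v has_vector_derivative W (t, \<phi> s v t)) (at t)"
  by (rule local_flow[OF o W xv], rule that)
 have vel: "has_velocity A x0 (Y x (x0 x)) x UNIV" using x0 by (simp add: integral_curve_on_def)
 then have cx: "isCont x0 x" by (simp add: has_velocity_def)
 have cc: "isCont (snd c) (x0 x)"
  using chart_continuous[OF c(1)] open_dom[OF c(1)] c(2) by (simp add: continuous_on_eq_continuous_at)
 have "isCont (\<lambda>t. snd c (x0 t)) x" using isCont_o2[OF cx cc] .
 then have "\<forall>\<^sub>F t in nhds x. snd c (x0 t) \<in> ball v0 w"
  using w by (auto simp: v0_def isCont_def tendsto_def eventually_at_filter elim!: allE[of _ "ball v0 w"] eventually_mono)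
 moreover have "\<forall>\<^sub>F t in nhds x. x0 t \<in> fst c"
  using cx c open_dom[OF c(1)] by (auto simp: isCont_def tendsto_def eventually_at_filter elim!: allE[of _ "fst c"] eventually_mono)
 ultimately have "\<forall>\<^sub>F t in nhds x. x0 t \<in> fst c \<and> snd c (x0 t) \<in> ball v0 w" by (rule eventually_conj[rotated])
 then obtain \<delta> where \<delta>: "\<delta> > 0" "\<And>t. dist t x < \<delta> \<Longrightarrow> x0 t \<in> fst c \<and> snd c (x0 t) \<in> ball v0 w"
  by (auto simp: eventually_nhds_metric)
 define d where "d = min \<delta> (w / 2)"
 have d: "d > 0" "d \<le> \<delta>" "d \<le> w / 2" using \<delta> w by (auto simp: d_def)
 have "flowable Y x0 a b" if ab: "a \<le> x" "x \<le> b" "b - a < d" for a b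
  unfolding flowable_def
 proof (intro ballI allI impI)
  fix t0 U q and u0 :: 'e assume t0: "t0 \<in> {a..b}" and q: "smooth_into U q" "u0 \<in> U" "q u0 = x0 t0"
  have t0x: "dist t0 x < \<delta>" "t0 \<in> ball x w" using ab t0 d w by (auto simp: dist_real_def)
  define V0 where "V0 = U \<inter> q -` fst c"
  have V0: "open V0" "smooth_on V0 (\<lambda>u. snd c (q u))"
   unfolding V0_def by (rule smooth_into_open_vimage[OF q(1) open_dom[OF c(1)]], rule smooth_into_chart[OF q(1) c(1)])
  define V where "V = V0 \<inter> (\<lambda>u. snd c (q u)) -` ball v0 w"
  have V: "open V" unfolding V_def by (rule continuous_open_preimage[OF smooth_on_continuous[OF V0(2)] V0(1) open_ball])
  have VU: "V \<subseteq> U" "u0 \<in> V" using \<delta>(2)[OF t0x(1)] q by (auto simp: V_def V0_def)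
  have Vq: "q u \<in> fst c" "snd c (q u) \<in> ball v0 w" if "u \<in> V" for u using that by (auto simp: V_def V0_def)
  define T where "T = {a - w / 2<..<b + w / 2}"
  have T: "T \<subseteq> ball x w" using ab d by (auto simp: T_def dist_real_def)
  define h where "h = (\<lambda>x. \<phi> t0 (snd c (q (snd x))) (fst x))"
  define H where "H t u = chart_inv c (\<phi> t0 (snd c (q u)) t)" for t u
  have oTV: "open (T \<times> V)" using V by (auto simp: T_def open_Times)
  have "smooth_on (T \<times> V) (\<lambda>x. (\<lambda>(s, v, t). \<phi> s v t) (t0, snd c (q (snd x)), fst x))"
  proof (rule smooth_on_compose[OF oTV _ _ \<phi>])
   show "smooth_on (T \<times> V) (\<lambda>x. (t0, snd c (q (snd x)), fst x))"
   proof (intro smooth_on_Pair oTV smooth_on_const smooth_on_fst smooth_on_id)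
    show "smooth_on (T \<times> V) (\<lambda>x. snd c (q (snd x)))"
     by (rule smooth_on_compose[OF oTV V0(1) _ V0(2)]) (use oTV in \<open>auto intro!: smooth_on_snd simp: V_def\<close>)
   qed
  qed (use T t0x Vq in \<open>auto simp: open_Times\<close>)
  then have h: "smooth_on (T \<times> V) h" by (simp add: h_def)
  have "smooth_into (T \<times> V) (\<lambda>x. chart_inv c (h x))"
   by (rule smooth_into_chart_inv[OF oTV h c(1)]) (use \<phi>' T t0x Vq in \<open>force simp: h_def\<close>)
  then have 1: "smooth_into (T \<times> V) (case_prod H)" by (simp add: h_def H_def case_prod_beta')
  have 2: "has_velocity A (\<lambda>t. H t u) (Y t (H t u)) t UNIV" if u: "u \<in> V" and t: "t \<in> T" for t u
  proof -
   have i: "\<phi> t0 (snd c (q u)) r \<in> snd c ` fst c" if "r \<in> T" for r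
    using \<phi>'[OF t0x(2) Vq(2)[OF u], of r] that T by auto
   have ev: "\<And>r. r \<in> T \<Longrightarrow> \<phi> t0 (snd c (q u)) r = snd c (H r u)"
    using chart_inv_chart[OF c(1) i] by (simp add: H_def)
   have "(\<phi> t0 (snd c (q u)) has_vector_derivative W (t, \<phi> t0 (snd c (q u)) t)) (at t)"
    using \<phi>'[OF t0x(2) Vq(2)[OF u], of t] t T by auto
   then have der: "((\<lambda>r. snd c (H r u)) has_vector_derivative Y t (H t u) c) (at t)"
    by (intro has_vector_derivative_transform_within_open[OF _ _ t ev]) (auto simp: W_def H_def T_def)
   have "continuous_on T (\<lambda>r. H r u)"
    by (rule continuous_on_compose2[OF conjunct1[OF conjunct2[OF 1[unfolded smooth_into_def]]], of T "\<lambda>r. (r, u)", simplified])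
     (use u in \<open>auto intro!: continuous_intros\<close>)
   then have "isCont (\<lambda>r. H r u) t" using t by (simp add: continuous_on_eq_continuous_at T_def)
   then show ?thesis
    using Y inv_in_dom[OF c(1) i[OF t]] der
    by (intro has_velocityI[where c = c]) (auto simp: smooth_field_def H_def c)
  qed
  have "H t0 u = q u" if "u \<in> V" for u
   using \<phi>0[OF t0x(2) Vq(2)[OF that]] inv_chart[OF c(1) Vq(1)[OF that]] by (simp add: H_def)
  then show "\<exists>V w H. open V \<and> u0 \<in> V \<and> V \<subseteq> U \<and> 0 < w \<and> flow_box Y {a - w<..<b + w} V H \<and> (\<forall>u\<in>V. H t0 u = q u)"
   using V VU w 1 2 unfolding flow_box_def T_def
   by (intro exI[of _ V], rule_tac exI[of _ "w / 2"], rule_tac exI[of _ H]) simp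
 qed
 then show ?thesis using d(1) by blast
qed

text \<open>Compactness of the interval enters as induction over intervals. The orbit
  \<open>x0\<close> exists at all times, and this is what keeps nearby curves from ending
  early.\<close>

lemma flowable:
 assumes Y: "smooth_field Y" and x0: "integral_curve_on A Y UNIV x0" and "a \<le> b"
 shows "flowable Y x0 a b"
 using assms(3)
proof (induction rule: Bolzano)
 case (trans a b c)
 then show ?case using flowable_trans[OF Y x0] by blast
next
 case (local x)
 then show ?case using flowable_local[OF Y x0] by blast
qed

text \<open>In coordinates, the flow from \<open>t1\<close> back to \<open>t0\<close> is a smooth
  left inverse of the flow from \<open>t0\<close> to \<open>t1\<close>, so the derivative of the
  latter has trivial kernel.\<close>

lemma flow_box_derivative_injective:
 assumes Y: "smooth_field Y" and x0: "integral_curve_on A Y UNIV x0" and box: "flow_box Y {a<..<b} V \<Phi>" and V: "open V" "u0 \<in> V"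
  and T: "t0 \<in> {a<..<b}" "t1 \<in> {a<..<b}" and c0: "c0 \<in> A" "V \<subseteq> snd c0 ` fst c0" and \<Phi>0: "\<And>u. u \<in> V \<Longrightarrow> \<Phi> t0 u = chart_inv c0 u"
  and u0: "u0 = snd c0 (x0 t0)" "x0 t0 \<in> fst c0" and c: "c \<in> A" "x0 t1 \<in> fst c"
  and h: "fderiv (\<lambda>u. snd c (\<Phi> t1 u)) u0 h = 0"
 shows "h = 0"
proof -
 have x0': "integral_curve_on A Y S x0" for S by (rule integral_curve_subset[OF x0 subset_UNIV])
 define T where "T = {min t0 t1..max t0 t1}"
 have TI: "T \<subseteq> {a<..<b}" "t0 \<in> T" "t1 \<in> T" "convex T" using assms by (auto simp: T_def)
 have \<Phi>t1: "\<Phi> t1 u0 = x0 t1"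
  by (rule integral_curve_unique[OF Y TI(4) flow_box_curve[OF box V(2) TI(1)] x0' TI(2) _ TI(3)])
   (use \<Phi>0[OF V(2)] u0 inv_chart[OF c0(1)] in auto)
 have "smooth_into (snd c ` fst c) (chart_inv c)"
  using smooth_into_chart_inv[OF open_img[OF c(1)] smooth_on_id c(1)] by simp
 note inv_smooth = this
 have tm: "t1 \<in> {min t0 t1..max t0 t1}" "min t0 t1 \<le> max t0 t1" by auto
 have imc: "snd c (x0 t1) \<in> snd c ` fst c" "chart_inv c (snd c (x0 t1)) = x0 t1" using c inv_chart[OF c] by auto
 obtain V' w H where V': "open V'" "snd c (x0 t1) \<in> V'" "V' \<subseteq> snd c ` fst c" and w: "0 < w"
  and H: "flow_box Y {min t0 t1 - w<..<max t0 t1 + w} V' H" "\<And>y. y \<in> V' \<Longrightarrow> H t1 y = chart_inv c y"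
  by (rule flowableD[OF flowable[OF Y x0 tm(2)] tm(1) inv_smooth imc], rule that)
 have Tw: "T \<subseteq> {min t0 t1 - w<..<max t0 t1 + w}" using w by (auto simp: T_def)
 have sm: "smooth_into V (\<Phi> t1)" by (rule flow_box_at[OF box T(2) V(1)])
 define N where "N = V \<inter> \<Phi> t1 -` (fst c)"
 have N: "open N" "smooth_on N (\<lambda>u. snd c (\<Phi> t1 u))" "u0 \<in> N"
  unfolding N_def using smooth_into_open_vimage[OF sm open_dom[OF c(1)]] smooth_into_chart[OF sm c(1)] V \<Phi>t1 c by auto
 define N' where "N' = N \<inter> (\<lambda>u. snd c (\<Phi> t1 u)) -` V'"
 have N': "open N'" "u0 \<in> N'"
  unfolding N'_def using continuous_open_preimage[OF smooth_on_continuous[OF N(2)] N(1) V'(1)] N(3) \<Phi>t1 V' by auto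
 have bk: "H t0 (snd c (\<Phi> t1 u)) = chart_inv c0 u" if "u \<in> N'" for u
 proof -
  have uV: "u \<in> V" "snd c (\<Phi> t1 u) \<in> V'" "\<Phi> t1 u \<in> fst c" using that by (auto simp: N'_def N_def)
  have "H t0 (snd c (\<Phi> t1 u)) = \<Phi> t0 u"
   by (rule integral_curve_unique[OF Y TI(4) flow_box_curve[OF H(1) uV(2) Tw] flow_box_curve[OF box uV(1) TI(1)] TI(3) _ TI(2)])
    (use H(2)[OF uV(2)] inv_chart[OF c(1) uV(3)] in simp)
  then show ?thesis using \<Phi>0[OF uV(1)] by simp
 qed
 have t0w: "t0 \<in> {min t0 t1 - w<..<max t0 t1 + w}" using w by auto
 have sm0: "smooth_into V' (H t0)" by (rule flow_box_at[OF H(1) t0w V'(1)])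
 define M where "M = V' \<inter> H t0 -` (fst c0)"
 have y0: "snd c (\<Phi> t1 u0) \<in> M"
  using bk[OF N'(2)] N'(2) u0 inv_chart[OF c0(1) u0(2)] by (simp add: M_def N'_def)
 define F where "F = fderiv (\<lambda>y. snd c0 (H t0 y)) (snd c (\<Phi> t1 u0))"
 have dF: "((\<lambda>y. snd c0 (H t0 y)) has_derivative F) (at (snd c (\<Phi> t1 u0)))"
  unfolding F_def by (rule smooth_on_has_derivative[OF smooth_into_chart[OF sm0 c0(1)]]) (use y0 in \<open>simp add: M_def\<close>)
 have dG: "((\<lambda>u. snd c (\<Phi> t1 u)) has_derivative fderiv (\<lambda>u. snd c (\<Phi> t1 u)) u0) (at u0)"
  by (rule smooth_on_has_derivative[OF N(2,3)])
 have "((\<lambda>u. snd c0 (H t0 (snd c (\<Phi> t1 u)))) has_derivative (\<lambda>h. F (fderiv (\<lambda>u. snd c (\<Phi> t1 u)) u0 h))) (at u0)"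
  by (rule has_derivative_compose[OF dG dF])
 then have "((\<lambda>u. u) has_derivative (\<lambda>h. F (fderiv (\<lambda>u. snd c (\<Phi> t1 u)) u0 h))) (at u0)"
 proof (rule has_derivative_transform_within_open[OF _ N'])
  fix u assume u: "u \<in> N'"
  then have "u \<in> snd c0 ` fst c0" using c0(2) by (auto simp: N'_def N_def)
  then show "snd c0 (H t0 (snd c (\<Phi> t1 u))) = u" using bk[OF u] chart_inv_chart[OF c0(1)] by simp
 qed
 from fun_cong[OF has_derivative_unique[OF this has_derivative_ident], of h] h
 show ?thesis using linear_0[OF has_derivative_linear[OF dF]] by simp
qed

end

section \<open>Twisted periodic solutions of delay equations\<close>

locale twist =
 fixes Q Qi :: "'e::euclidean_space \<Rightarrow> 'e"
 assumes Q: "linear Q" and Qi: "linear Qi" and QQi: "\<And>x. Q (Qi x) = x" and QiQ: "\<And>x. Qi (Q x) = x"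
  and no_fixed: "\<And>x. Q x = x \<Longrightarrow> x = 0"
begin

definition twisted :: "(real \<Rightarrow> 'e) \<Rightarrow> bool" where
 "twisted w \<longleftrightarrow> (\<forall>t. w t = Q (w (t + 1)))"

lemma twistedD: "twisted w \<Longrightarrow> w t = Q (w (t + 1))"
 unfolding twisted_def by blast

lemma twistedD': "twisted w \<Longrightarrow> w t = Qi (w (t - 1))"
 using twistedD[of w "t - 1"] by (simp add: QiQ)

lemma bl: "bounded_linear Q" "bounded_linear Qi"
 using Q Qi linear_conv_bounded_linear by auto

lemma twisted_derivative:
 assumes "twisted w" "\<And>t. (w has_vector_derivative w' t) (at t)"
 shows "twisted w'"
 unfolding twisted_def
proof
 fix t
 have "(w \<circ> (\<lambda>t. t + 1) has_vector_derivative 1 *\<^sub>R w' (t + 1)) (at t)"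
  by (rule vector_diff_chain_at[OF _ assms(2)]) (auto intro!: derivative_eq_intros)
 from bounded_linear.has_vector_derivative[OF bl(1) this]
 have "(w has_vector_derivative Q (w' (t + 1))) (at t)"
  by (simp add: o_def twistedD[OF assms(1), symmetric])
 from vector_derivative_unique_at[OF assms(2) this] show "w' t = Q (w' (t + 1))" .
qed

text \<open>These are the times \<open>t\<close> for which \<open>t\<close> and \<open>t + 1\<close>
  both lie in \<open>{5/6<..<13/6}\<close>; so this is all that the twist demands of the values of
  \<open>v\<close> on that interval.\<close>

definition seam :: "(real \<Rightarrow> 'e) \<Rightarrow> bool" where
 "seam v \<longleftrightarrow> (\<forall>t\<in>{5/6<..<7/6}. v t = Q (v (t + 1)))"

text \<open>The values on \<open>[1, 2)\<close> are propagated by powers of \<open>Q\<close> and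
  \<open>Qi\<close>. Agreement with \<open>v\<close> on a larger interval is a matter of the
  relation at the overlaps.\<close>

definition extend :: "(real \<Rightarrow> 'e) \<Rightarrow> real \<Rightarrow> 'e" where
 "extend v t = (let n = \<lfloor>t\<rfloor> - 1 in
  if n \<ge> 0 then (Qi ^^ nat n) (v (t - of_int n)) else (Q ^^ nat (- n)) (v (t - of_int n)))"

lemma twisted_extend: "twisted (extend v)"
 unfolding twisted_def
proof
 fix t :: real
 define n where "n = \<lfloor>t\<rfloor> - 1"
 have n: "\<lfloor>t + 1\<rfloor> - 1 = n + 1" by (simp add: n_def)
 show "extend v t = Q (extend v (t + 1))"
 proof (cases "n \<ge> 0")
  case True
  then have "nat (n + 1) = Suc (nat n)" by simp
  then show ?thesis using True unfolding extend_def Let_def n n_def[symmetric] by (simp add: QQi)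
 next
  case False
  show ?thesis
  proof (cases "n = -1")
   case True
   then show ?thesis unfolding extend_def Let_def n n_def[symmetric] by simp
  next
   case neq: False
   then have "nat (- n) = Suc (nat (- (n + 1)))" using False by simp
   then show ?thesis using False neq unfolding extend_def Let_def n n_def[symmetric] by simp
  qed
 qed
qed

lemma extend_eq:
 assumes "seam v" "t \<in> {5/6<..<13/6}"
 shows "extend v t = v t"
proof -
 consider "t < 1" | "1 \<le> t" "t < 2" | "2 \<le> t" by linarith
 then show ?thesis
 proof cases
  case 1
  then have "\<lfloor>t\<rfloor> - 1 = -1" using assms(2) by (simp add: floor_eq_iff)
  then show ?thesis using assms 1 unfolding extend_def seam_def by (simp add: Let_def add.commute)
 next
  case 2
  then have "\<lfloor>t\<rfloor> - 1 = 0" by (simp add: floor_eq_iff)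
  then show ?thesis unfolding extend_def by (simp add: Let_def)
 next
  case 3
  then have "\<lfloor>t\<rfloor> - 1 = 1" using assms(2) by (simp add: floor_eq_iff)
  moreover have "v (t - 1) = Q (v t)" using assms 3 unfolding seam_def by (auto dest!: bspec[of _ _ "t - 1"])
  ultimately show ?thesis unfolding extend_def by (simp add: Let_def QiQ)
 qed
qed

text \<open>The interval is longer than one period, so its translates overlap, and smoothness
  spreads from each to the next through the linear maps \<open>Q\<close> and
  \<open>Qi\<close>.\<close>

lemma twisted_transfer:
 fixes q :: "'p::euclidean_space \<Rightarrow> real \<Rightarrow> 'e"
 assumes P: "open P" and tw: "\<And>p. p \<in> P \<Longrightarrow> twisted (q p)" and q: "Ck_on k (P \<times> {5/6<..<13/6}) (case_prod q)"
 shows "Ck_on k (P \<times> UNIV) (case_prod q)"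
proof -
 define J where "J n = {5/6 - real n<..<13/6 + real n}" for n
 have J: "open (P \<times> J n)" for n using P by (simp add: J_def open_Times)
 have "Ck_on k (P \<times> J n) (case_prod q)" for n
 proof (induction n)
  case 0
  then show ?case using q by (simp add: J_def)
 next
  case (Suc n)
  have part: "Ck_on k (P \<times> {a<..<b}) (case_prod q)"
   if R: "bounded_linear R" and R': "\<And>p t. p \<in> P \<Longrightarrow> q p t = R (q p (t + s))" and s: "\<And>t. t \<in> {a<..<b} \<Longrightarrow> t + s \<in> J n" for R s a b
  proof -
   have o: "open (P \<times> {a<..<b})" using P by (simp add: open_Times)
   have "Ck_on k (P \<times> {a<..<b}) (\<lambda>x. (case_prod q) (fst x, snd x + s))"
    by (rule Ck_on_compose[OF o J[of n] _ Suc]) (auto intro!: Ck_on_Pair Ck_on_fst Ck_on_snd Ck_on_add o s)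
   then have "Ck_on k (P \<times> {a<..<b}) (\<lambda>x. R (q (fst x) (snd x + s)))"
    using Ck_on_linear[OF R o] by simp
   moreover have "(case_prod q) x = R (q (fst x) (snd x + s))" if "x \<in> P \<times> {a<..<b}" for x
    using that R'[of "fst x" "snd x"] by (auto simp: case_prod_beta)
   ultimately show ?thesis
    using Ck_on_cong[OF o, of "\<lambda>(p,t). q p t" "\<lambda>x. R (q (fst x) (snd x + s))"] by simp
  qed
  show ?case
  proof (rule Ck_on_locally)
   fix x assume x: "x \<in> P \<times> J (Suc n)"
   obtain p t where xp: "x = (p, t)" "p \<in> P" "t \<in> J (Suc n)" using x by auto
   consider "t \<in> J n" | "t \<le> 5/6 - real n" | "t \<ge> 13/6 + real n"
    unfolding J_def greaterThanLessThan_iff by linarith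
   then show "\<exists>T. open T \<and> x \<in> T \<and> Ck_on k T (case_prod q)"
   proof cases
    case 1
    then show ?thesis using Suc J[of n] xp by (intro exI[of _ "P \<times> J n"]) simp
   next
    case 2
    have "Ck_on k (P \<times> {5/6 - real (Suc n)<..<13/6 - 1 + real n}) (case_prod q)"
     by (rule part[OF bl(1), where s = 1]) (erule twistedD[OF tw], auto simp: J_def)
    moreover have "x \<in> P \<times> {5/6 - real (Suc n)<..<13/6 - 1 + real n}" using xp 2 by (auto simp: J_def)
    ultimately show ?thesis using P by (intro exI[of _ "P \<times> {5/6 - real (Suc n)<..<13/6 - 1 + real n}"]) (simp add: open_Times)
   next
    case 3
    have "Ck_on k (P \<times> {5/6 + 1 - real n<..<13/6 + real (Suc n)}) (case_prod q)"
    proof (rule part[OF bl(2), where s = "-1"])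
     show "q p t = Qi (q p (t + -1))" if "p \<in> P" for p t using twistedD'[OF tw[OF that], of t] by simp
    qed (auto simp: J_def)
    moreover have "x \<in> P \<times> {5/6 + 1 - real n<..<13/6 + real (Suc n)}" using xp 3 by (auto simp: J_def)
    ultimately show ?thesis using P by (intro exI[of _ "P \<times> {5/6 + 1 - real n<..<13/6 + real (Suc n)}"]) (simp add: open_Times)
   qed
  qed
 qed
 note JJ = this
 show ?thesis
 proof (rule Ck_on_locally)
  fix x :: "'p \<times> real" assume x: "x \<in> P \<times> UNIV"
  obtain n where "real n > \<bar>snd x\<bar> + 1" using reals_Archimedean2 by blast
  then have "snd x \<in> J n" by (auto simp: J_def)
  then have "x \<in> P \<times> J n" using x by auto
  then show "\<exists>T. open T \<and> x \<in> T \<and> Ck_on k T (case_prod q)"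
   using J[of n] JJ[of n] by (intro exI[of _ "P \<times> J n"]) simp
 qed
qed

text \<open>\<open>CQ \<ge> 1\<close> lets its powers bound the growth over any number of periods.
  \<open>CI\<close> below bounds the inverse of \<open>id - Q\<close>; it is the quantitative form
  of non-degeneracy.\<close>

definition CQ :: real where "CQ = (SOME C. C \<ge> 1 \<and> (\<forall>x. norm (Q x) \<le> C * norm x) \<and> (\<forall>x. norm (Qi x) \<le> C * norm x))"
definition CI :: real where "CI = (SOME C. C \<ge> 0 \<and> (\<forall>x. norm x \<le> C * norm (x - Q x)))"

lemma CQ: "CQ \<ge> 1" "norm (Q x) \<le> CQ * norm x" "norm (Qi x) \<le> CQ * norm x"
proof -
 obtain C1 where C1: "\<And>x. norm (Q x) \<le> norm x * C1" using bounded_linear.bounded[OF bl(1)] by blast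
 obtain C2 where C2: "\<And>x. norm (Qi x) \<le> norm x * C2" using bounded_linear.bounded[OF bl(2)] by blast
 define C where "C = max 1 (max C1 C2)"
 have "norm (Q x) \<le> C * norm x" "norm (Qi x) \<le> C * norm x" for x
  using order_trans[OF C1[of x] mult_left_mono[of C1 C "norm x"]] order_trans[OF C2[of x] mult_left_mono[of C2 C "norm x"]]
  by (auto simp: C_def mult.commute)
 then have "\<exists>C. C \<ge> 1 \<and> (\<forall>x. norm (Q x) \<le> C * norm x) \<and> (\<forall>x. norm (Qi x) \<le> C * norm x)"
  by (intro exI[of _ C]) (auto simp: C_def)
 from someI_ex[OF this] show "CQ \<ge> 1" "norm (Q x) \<le> CQ * norm x" "norm (Qi x) \<le> CQ * norm x"
  unfolding CQ_def by auto
qed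

lemma lin_IQ: "linear (\<lambda>x. x - Q x)" by (intro linear_compose_sub linear_id[unfolded id_def] Q)

lemma inj_IQ: "inj (\<lambda>x. x - Q x)"
 using linear_injective_0[OF lin_IQ] no_fixed by auto

lemma CI: "CI \<ge> 0" "norm x \<le> CI * norm (x - Q x)"
proof -
 obtain B where B: "B > 0" "\<And>x. B * norm x \<le> norm (x - Q x)"
  using linear_inj_bounded_below_pos[OF lin_IQ inj_IQ] by blast
 then have "\<exists>C. C \<ge> 0 \<and> (\<forall>x. norm x \<le> C * norm (x - Q x))"
  by (intro exI[of _ "1 / B"]) (auto simp: field_simps)
 from someI_ex[OF this] show "CI \<ge> 0" "norm x \<le> CI * norm (x - Q x)" unfolding CI_def by auto
qed

lemma twisted_norm:
 assumes "twisted w" and M: "\<And>t. t \<in> {1..2} \<Longrightarrow> norm (w t) \<le> M" and t: "t \<in> {1 - real n..2 + real n}"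
 shows "norm (w t) \<le> CQ ^ n * M"
 using t
proof (induction n arbitrary: t)
 case 0
 then show ?case using M by simp
next
 case (Suc n)
 have M0: "M \<ge> 0" by (rule order_trans[OF norm_ge_zero M[of 1]]) simp
 have "\<exists>t'. t' \<in> {1 - real n..2 + real n} \<and> norm (w t) \<le> CQ * norm (w t')"
 proof -
  consider "t \<in> {1 - real n..2 + real n}" | "t + 1 \<in> {1 - real n..2 + real n}" | "t - 1 \<in> {1 - real n..2 + real n}"
   using Suc.prems by force
  then show ?thesis
  proof cases
   case 1
   then show ?thesis using mult_right_mono[OF CQ(1), of "norm (w t)"] by auto
  next
   case 2
   have "norm (w t) \<le> CQ * norm (w (t + 1))" using CQ(2)[of "w (t + 1)"] unfolding twistedD[OF assms(1), of t] .
   then show ?thesis using 2 by blast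
  next
   case 3
   have "norm (w t) \<le> CQ * norm (w (t - 1))" using CQ(3)[of "w (t - 1)"] unfolding twistedD'[OF assms(1), of t] .
   then show ?thesis using 3 by blast
  qed
 qed
 then obtain t' where t': "t' \<in> {1 - real n..2 + real n}" "norm (w t) \<le> CQ * norm (w t')" by blast
 have "CQ * norm (w t') \<le> CQ * (CQ ^ n * M)" using Suc.IH[OF t'(1)] CQ(1) by (intro mult_left_mono) auto
 then show ?case using t'(2) by simp
qed

text \<open>A Poincare inequality: since \<open>w 1 = Q (w 2)\<close>, the vector
  \<open>w 2 - Q (w 2)\<close> is the increment of \<open>w\<close> over one period. The derivative
  bounds it, and \<open>id - Q\<close> is invertible.\<close>

lemma twisted_bounds:
 assumes tw: "twisted w" and der: "\<And>t. (w has_vector_derivative w' t) (at t)" and M: "\<And>t. t \<in> {1..2} \<Longrightarrow> norm (w' t) \<le> M"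
 shows "M \<ge> 0"
  and "t \<in> {1..2} \<Longrightarrow> norm (w t) \<le> (CI + 1) * M"
  and "t \<in> {1 - real n..2 + real n} \<Longrightarrow> norm (w t) \<le> CQ ^ n * ((CI + 1) * M)"
  and "t \<in> {1 - real n..2 + real n} \<Longrightarrow> norm (w' t) \<le> CQ ^ n * M"
  and "t \<in> {1..2} \<Longrightarrow> \<bar>\<tau>\<bar> \<le> 1 \<Longrightarrow> norm (w (t - \<tau>) - w t) \<le> \<bar>\<tau>\<bar> * (CQ * M)"
proof -
 show M0: "M \<ge> 0" by (rule order_trans[OF norm_ge_zero M[of 1]]) simp
 have tw': "twisted w'" using twisted_derivative[OF tw der] .
 have mvt: "norm (w b - w a) \<le> B * \<bar>b - a\<bar>" if "\<And>t. t \<in> closed_segment a b \<Longrightarrow> norm (w' t) \<le> B" for a b B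
  using vector_mvt_bound[of a b w w' 0 B] has_vector_derivative_at_within[OF der] that by simp
 have w2: "norm (w 2) \<le> CI * M"
 proof -
  have "w 1 = Q (w 2)" using twistedD[OF tw, of 1] by simp
  then have "norm (w 2) \<le> CI * norm (w 2 - w 1)" using CI(2)[of "w 2"] by simp
  also have "\<dots> \<le> CI * (M * \<bar>2 - 1\<bar>)"
   using M CI(1) by (intro mult_left_mono mvt) (auto simp: closed_segment_eq_real_ivl)
  finally show ?thesis by simp
 qed
 show A: "norm (w t) \<le> (CI + 1) * M" if t: "t \<in> {1..2}" for t
 proof -
  have "norm (w 2 - w t) \<le> M * \<bar>2 - t\<bar>" using M t by (intro mvt) (auto simp: closed_segment_eq_real_ivl)
  also have "\<dots> \<le> M * 1" using t M0 by (intro mult_left_mono) auto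
  finally show ?thesis using w2 norm_triangle_sub[of "w t" "w 2"] by (simp add: norm_minus_commute algebra_simps)
 qed
 show "t \<in> {1 - real n..2 + real n} \<Longrightarrow> norm (w t) \<le> CQ ^ n * ((CI + 1) * M)" for t n
  using twisted_norm[OF tw A] .
 show W': "t \<in> {1 - real n..2 + real n} \<Longrightarrow> norm (w' t) \<le> CQ ^ n * M" for t n
  using twisted_norm[OF tw' M] .
 show "norm (w (t - \<tau>) - w t) \<le> \<bar>\<tau>\<bar> * (CQ * M)" if "t \<in> {1..2}" "\<bar>\<tau>\<bar> \<le> 1" for t \<tau>
 proof -
  have "norm (w (t - \<tau>) - w t) \<le> (CQ * M) * \<bar>t - \<tau> - t\<bar>"
  proof (rule mvt)
   fix r assume "r \<in> closed_segment t (t - \<tau>)"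
   then have "r \<in> {1 - real 1..2 + real 1}" using that by (auto simp: closed_segment_eq_real_ivl split: if_splits)
   from W'[OF this] show "norm (w' r) \<le> CQ * M" by simp
  qed
  then show ?thesis by (simp add: mult.commute)
 qed
qed

section \<open>Twisted primitives\<close>

definition resolvent :: "'e \<Rightarrow> 'e" where "resolvent = inv (\<lambda>x. x - Q x)"

lemma resolvent: "resolvent J - Q (resolvent J) = J"
 using linear_injective_imp_surjective[OF lin_IQ inj_IQ] surj_f_inv_f[of "\<lambda>x. x - Q x" J] by (simp add: resolvent_def)

lemma resolvent_linear: "linear resolvent"
 unfolding resolvent_def using inj_linear_imp_inv_linear[OF lin_IQ inj_IQ] .

text \<open>With \<open>J\<close> the integral of \<open>U\<close> over \<open>[1, 2]\<close>, the
  constant is chosen so that the value at \<open>1\<close> is \<open>Q (resolvent J)\<close> and the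
  value at \<open>2\<close> is \<open>resolvent J\<close>. This is the twist relation at
  \<open>t = 1\<close>.\<close>

definition primitive :: "(real \<Rightarrow> 'e) \<Rightarrow> real \<Rightarrow> 'e" where
 "primitive U t = Q (resolvent (integral {0..1} (\<lambda>q. U (1 + q)))) + (t - 1) *\<^sub>R integral {0..1} (\<lambda>q. U (1 + q * (t - 1)))"

lemma primitive_deriv:
 assumes "continuous_on UNIV U"
 shows "(primitive U has_vector_derivative U t) (at t)"
proof -
 have "((\<lambda>r. r *\<^sub>R integral {0..1} (\<lambda>q. U (1 + q * r))) has_vector_derivative U (1 + (t - 1))) (at (t - 1))"
  by (rule primitive_scaled[of UNIV "\<lambda>r. U (1 + r)"]) (auto intro!: continuous_on_compose2[OF assms] continuous_intros)
 then have "((\<lambda>r. r *\<^sub>R integral {0..1} (\<lambda>q. U (1 + q * r))) \<circ> (\<lambda>t. t - 1) has_vector_derivative 1 *\<^sub>R U t) (at t)"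
  by (intro vector_diff_chain_at) (auto intro!: derivative_eq_intros)
 then have "((\<lambda>t. (t - 1) *\<^sub>R integral {0..1} (\<lambda>q. U (1 + q * (t - 1)))) has_vector_derivative U t) (at t)"
  by (simp add: o_def)
 from has_vector_derivative_add[OF has_vector_derivative_const this] show ?thesis
  unfolding primitive_def[abs_def] by simp
qed

lemma primitive_twisted:
 assumes "continuous_on UNIV U" "twisted U"
 shows "twisted (primitive U)"
 unfolding twisted_def
proof
 fix t
 define D where "D t = primitive U t - Q (primitive U (t + 1))" for t
 have "(D has_vector_derivative 0) (at t within UNIV)" for t
 proof -
  have "(primitive U \<circ> (\<lambda>t. t + 1) has_vector_derivative 1 *\<^sub>R U (t + 1)) (at t)"
   using primitive_deriv[OF assms(1)] by (intro vector_diff_chain_at) (auto intro!: derivative_eq_intros)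
  from has_vector_derivative_diff[OF primitive_deriv[OF assms(1)] bounded_linear.has_vector_derivative[OF bl(1) this]]
  show ?thesis unfolding D_def[abs_def] o_def using twistedD[OF assms(2), of t] by simp
 qed
 then obtain k where k: "\<And>t. D t = k" using has_vector_derivative_zero_constant[of UNIV D] by auto
 have "D 1 = 0"
 proof -
  define J where "J = integral {0..1} (\<lambda>q. U (1 + q))"
  have "D 1 = Q (resolvent J) - Q (Q (resolvent J) + J)" by (simp add: D_def primitive_def J_def)
  also have "Q (resolvent J) + J = resolvent J" using resolvent[of J] by (simp add: algebra_simps)
  finally show ?thesis by simp
 qed
 then show "primitive U t = Q (primitive U (t + 1))" using k[of t] k[of 1] by (simp add: D_def)
qed

lemma primitive_continuous:
 fixes U :: "'p::euclidean_space \<Rightarrow> real \<Rightarrow> 'e"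
 assumes "continuous_on (P \<times> UNIV) (case_prod U)"
 shows "continuous_on (P \<times> UNIV) (\<lambda>(p,t). primitive (U p) t)"
proof -
 have "continuous_on ((P \<times> UNIV) \<times> cbox 0 1) (\<lambda>z::('p \<times> real) \<times> real. (case_prod U) (fst (fst z), 1 + snd z))"
  by (rule continuous_on_compose2[OF assms]) (auto intro!: continuous_intros)
 then have "continuous_on ((P \<times> UNIV) \<times> cbox 0 1) (\<lambda>(x::'p \<times> real, q::real). U (fst x) (1 + q))"
  by (simp add: case_prod_beta)
 from integral_continuous_on_param[OF this]
 have 1: "continuous_on (P \<times> UNIV) (\<lambda>x::'p \<times> real. integral {0..1} (\<lambda>q. U (fst x) (1 + q)))" by (simp add: cbox_interval)
 have "continuous_on ((P \<times> UNIV) \<times> cbox 0 1) (\<lambda>z::('p \<times> real) \<times> real. (case_prod U) (fst (fst z), 1 + snd z * (snd (fst z) - 1)))"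
  by (rule continuous_on_compose2[OF assms]) (auto intro!: continuous_intros)
 then have "continuous_on ((P \<times> UNIV) \<times> cbox 0 1) (\<lambda>(x::'p \<times> real, q::real). U (fst x) (1 + q * (snd x - 1)))"
  by (simp add: case_prod_beta)
 from integral_continuous_on_param[OF this]
 have 2: "continuous_on (P \<times> UNIV) (\<lambda>x. integral {0..1} (\<lambda>q. U (fst x) (1 + q * (snd x - 1))))" by (simp add: cbox_interval)
 have bl3: "bounded_linear resolvent" using resolvent_linear linear_conv_bounded_linear by blast
 show ?thesis
  unfolding primitive_def case_prod_beta
  by (intro continuous_intros 2 bounded_linear.continuous_on[OF bl(1)] bounded_linear.continuous_on[OF bl3] 1)
qed


lemma twisted_diff: "twisted v \<Longrightarrow> twisted w \<Longrightarrow> twisted (\<lambda>t. v t - w t)"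
 using twistedD[of v] twistedD[of w] unfolding twisted_def by (metis linear_diff[OF Q])

lemma twisted_scale: "twisted w \<Longrightarrow> twisted (\<lambda>t. c *\<^sub>R w t)"
 using twistedD[of w] unfolding twisted_def by (metis linear_scale[OF Q])

lemma twisted_lim:
 assumes "\<And>n::nat. twisted (w n)" "\<And>t. (\<lambda>n. w n t) \<longlonglongrightarrow> z t"
 shows "twisted z"
 unfolding twisted_def
proof
 fix t
 have "(\<lambda>n. Q (w n (t + 1))) \<longlonglongrightarrow> Q (z (t + 1))" by (rule bounded_linear.tendsto[OF bl(1) assms(2)])
 then have "(\<lambda>n. w n t) \<longlonglongrightarrow> Q (z (t + 1))" by (simp only: twistedD[OF assms(1), symmetric])
 then show "z t = Q (z (t + 1))" using LIMSEQ_unique assms(2) by blast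
qed

text \<open>Solutions obey their equation on one period with margins only. The twist makes them
  differentiable at all times, as the bounds for twisted curves require.\<close>

lemma twisted_differentiable:
 assumes tw: "twisted z" and der: "\<And>t. t \<in> {5/6<..<13/6} \<Longrightarrow> (z has_vector_derivative z' t) (at t)"
 obtains W where "\<And>t. (z has_vector_derivative W t) (at t)" "\<And>t. t \<in> {5/6<..<13/6} \<Longrightarrow> W t = z' t"
proof -
 have shift: "(z has_vector_derivative R v) (at t)" if R: "bounded_linear R" "\<And>t. z t = R (z (t + s))" and "(z has_vector_derivative v) (at (t + s))" for R s v t
 proof -
  have "(z \<circ> (\<lambda>t. t + s) has_vector_derivative 1 *\<^sub>R v) (at t)"
   by (rule vector_diff_chain_at[of "\<lambda>t. t + s" 1 t z v]) (use that(3) in \<open>auto intro!: derivative_eq_intros\<close>)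
  from bounded_linear.has_vector_derivative[OF R(1) this] show ?thesis by (simp add: o_def R(2)[symmetric])
 qed
 have "\<forall>t\<in>{5/6 - real n<..<13/6 + real n}. \<exists>v. (z has_vector_derivative v) (at t)" for n
 proof (induction n)
  case 0
  show ?case
  proof
   fix t assume "t \<in> {5/6 - real 0<..<13/6 + real 0}"
   then show "\<exists>v. (z has_vector_derivative v) (at t)" using der[of t] by (intro exI[of _ "z' t"]) simp
  qed
 next
  case (Suc n)
  show ?case
  proof
   fix t assume t: "t \<in> {5/6 - real (Suc n)<..<13/6 + real (Suc n)}"
   then consider "t \<in> {5/6 - real n<..<13/6 + real n}" | "t + 1 \<in> {5/6 - real n<..<13/6 + real n}" | "t + -1 \<in> {5/6 - real n<..<13/6 + real n}"
    unfolding greaterThanLessThan_iff of_nat_Suc by linarith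
   then show "\<exists>v. (z has_vector_derivative v) (at t)"
   proof cases
    case 2
    then obtain v where "(z has_vector_derivative v) (at (t + 1))" using Suc by blast
    from shift[OF bl(1) twistedD[OF tw] this] show ?thesis by blast
   next
    case 3
    then obtain v where v: "(z has_vector_derivative v) (at (t + -1))" using Suc by blast
    have "z t = Qi (z (t + -1))" for t using twistedD'[OF tw, of t] by simp
    from shift[OF bl(2) this v] show ?thesis by blast
   qed (use Suc in blast)
  qed
 qed
 note ex = this
 have "\<exists>v. (z has_vector_derivative v) (at t)" for t
 proof -
  obtain n where "real n > \<bar>t\<bar> + 1" using reals_Archimedean2 by blast
  then have "t \<in> {5/6 - real n<..<13/6 + real n}" by auto
  then show ?thesis using ex by blast
 qed
 then obtain W where W: "\<And>t. (z has_vector_derivative W t) (at t)" by metis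
 show thesis
  by (rule that[OF W]) (use vector_derivative_unique_at[OF W der] in blast)
qed

text \<open>A fixed point problem for the derivative: from \<open>u\<close> on one period with
  margins the twisted primitive \<open>Y u\<close> is formed, and \<open>G\<close> is evaluated
  along it. The unknown is a function of \<tau> and \<open>t\<close> together, so the solution is
  continuous in \<tau> from the start. Uniqueness is proved for every small twisted solution and not
  only within the class of the fixed point theorem.\<close>

lemma delay_problem:
 fixes G :: "real \<times> real \<times> 'e \<times> 'e \<Rightarrow> 'e"
 assumes \<delta>: "0 < \<delta>" "\<delta> \<le> 1/6" and r: "0 < r"
  and G: "smooth_on ({-\<delta><..<\<delta>} \<times> {5/6<..<13/6} \<times> ball 0 r \<times> ball 0 r) G"
  and seamG: "\<And>\<tau> t a b. \<bar>\<tau>\<bar> < \<delta> \<Longrightarrow> t \<in> {5/6<..<7/6} \<Longrightarrow> a \<in> ball 0 r \<Longrightarrow> b \<in> ball 0 r \<Longrightarrow>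
   Q a \<in> ball 0 r \<Longrightarrow> Q b \<in> ball 0 r \<Longrightarrow> G (\<tau>, t, Q a, Q b) = Q (G (\<tau>, t + 1, a, b))"
  and G0: "\<And>t. t \<in> {5/6<..<13/6} \<Longrightarrow> G (0, t, 0, 0) = 0"
  and dG0: "\<And>t h. t \<in> {5/6<..<13/6} \<Longrightarrow> fderiv G (0, t, 0, 0) (0, 0, h, h) = 0"
 obtains \<tau>1 \<rho> y where "0 < \<tau>1" "\<tau>1 \<le> \<delta>" "0 < \<rho>" "\<rho> < r"
  "smooth_on ({-\<tau>1<..<\<tau>1} \<times> UNIV) (case_prod y)"
  "\<And>\<tau>. \<bar>\<tau>\<bar> < \<tau>1 \<Longrightarrow> twisted (y \<tau>)" "\<And>t. y 0 t = 0"
  "\<And>\<tau> t. \<bar>\<tau>\<bar> < \<tau>1 \<Longrightarrow> t \<in> {0..3} \<Longrightarrow> norm (y \<tau> t) \<le> \<rho>"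
  "\<And>\<tau> t. \<bar>\<tau>\<bar> < \<tau>1 \<Longrightarrow> t \<in> {5/6<..<13/6} \<Longrightarrow> (y \<tau> has_vector_derivative G (\<tau>, t, y \<tau> (t - \<tau>), y \<tau> t)) (at t)"
  "\<And>\<tau> z t. \<bar>\<tau>\<bar> < \<tau>1 \<Longrightarrow> twisted z \<Longrightarrow> (\<And>t. t \<in> {2/3..7/3} \<Longrightarrow> norm (z t) \<le> \<rho>) \<Longrightarrow>
   (\<And>t. t \<in> {5/6<..<13/6} \<Longrightarrow> (z has_vector_derivative G (\<tau>, t, z (t - \<tau>), z t)) (at t)) \<Longrightarrow> z t = y \<tau> t"
proof -
 define I where "I = {5/6<..<13/6::real}"
 define X where "X = {-\<delta><..<\<delta>} \<times> I \<times> ball (0::'e) r \<times> ball (0::'e) r"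
 have X: "open X" by (auto simp: X_def I_def open_Times)
 have Gk: "Ck_on k X G" for k using G by (simp add: smooth_on_def X_def I_def)
 note G1 = Gk[of 1]
 define DG where "DG x = fderiv G x" for x
 have DG: "(G has_derivative DG x) (at x)" if "x \<in> X" for x
  unfolding DG_def by (rule C1_has_derivative[OF G1 that])
 \<comment> \<open>\<open>E\<close> measures the linearization on the diagonal and vanishes on
   \<open>K0\<close>, where \<tau> and the curve are zero. \<open>N\<close> measures it in the
   delayed argument, where it is merely bounded but acts on
   \<open>w (t - \<tau>) - w t\<close>.\<close>
 define E where "E x = (\<Sum>b\<in>Basis. norm (DG x (0, 0, b, b)))" for x
 define N where "N x = (\<Sum>b\<in>Basis. norm (DG x (0, 0, b, 0)))" for x
 have DGc: "continuous_on X (\<lambda>x. DG x v)" for v using G1 unfolding DG_def by (simp del: split_paired_All)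
 have EN: "norm (DG x (0, 0, a, b)) \<le> E x * norm b + N x * norm (a - b)" if "x \<in> X" for x a b
 proof -
  have lin: "linear (DG x)" using has_derivative_linear[OF DG[OF that]] .
  have 1: "norm (f h) \<le> (\<Sum>b\<in>Basis. norm (f b)) * norm h" if "linear f" for f :: "'e \<Rightarrow> 'e" and h
  proof -
   have "norm (f h) = norm (\<Sum>b\<in>Basis. (h \<bullet> b) *\<^sub>R f b)" using linear_basis_expansion[OF that, of h] by simp
   also have "\<dots> \<le> (\<Sum>b\<in>Basis. norm (f b) * norm h)"
    unfolding mult.commute[of "norm (f _)"] by (intro sum_norm_le) (simp add: Basis_le_norm mult_right_mono)
   finally show ?thesis by (simp add: sum_distrib_right)
  qed
  have "DG x (0, 0, a, b) = DG x ((0, 0, b, b) + (0, 0, a - b, 0))" by simp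
  also have "\<dots> = DG x (0, 0, b, b) + DG x (0, 0, a - b, 0)" by (rule linear_add[OF lin])
  finally have "norm (DG x (0, 0, a, b)) \<le> norm (DG x (0, 0, b, b)) + norm (DG x (0, 0, a - b, 0))"
   by (simp add: norm_triangle_ineq)
  moreover have "linear (\<lambda>h. DG x (0, 0, h, h))" "linear (\<lambda>h. DG x (0, 0, h, 0))"
   by (auto intro!: linearI simp: linear_add[OF lin, symmetric] linear_scale[OF lin, symmetric])
  ultimately show ?thesis using 1[of "\<lambda>h. DG x (0, 0, h, h)" b] 1[of "\<lambda>h. DG x (0, 0, h, 0)" "a - b"] by (simp add: E_def N_def)
 qed
 define K0 where "K0 = (\<lambda>t. (0::real, t, 0::'e, 0::'e)) ` {1..2::real}"
 have K0: "compact K0" "K0 \<subseteq> X"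
  using \<delta> r by (auto simp: K0_def X_def I_def intro!: compact_continuous_image continuous_intros)
 have "continuous_on K0 N" unfolding N_def by (intro continuous_intros continuous_on_subset[OF DGc K0(2)])
 from compact_imp_bounded[OF compact_continuous_image[OF this K0(1)]]
 obtain B where B: "\<And>x. x \<in> K0 \<Longrightarrow> \<bar>N x\<bar> \<le> B" by (auto simp: bounded_iff)
 have B0: "B \<ge> 0" using B[of "(0, 1, 0, 0)"] by (auto simp: K0_def)
 have pos: "CQ > 0" "CI + 1 > 0" "B + 1 > 0" using CQ(1) CI(1) B0 by auto
 \<comment> \<open>Estimates are made on \<open>[1, 2]\<close> and lose a factor \<open>CQ\<close>
   on the larger interval \<open>I\<close>; with this \<kappa> the contraction constant there is
   \<open>1 / 2\<close>. Half of \<kappa> goes to the diagonal part through \<open>e\<close>, half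
   to the delay through \<eta>.\<close>
 define \<kappa> where "\<kappa> = 1 / (2 * CQ)"
 define e where "e = 1 / (4 * CQ * (CI + 1))"
 have \<kappa>: "0 < \<kappa>" "\<kappa> \<le> 1 / 2" using CQ(1) by (auto simp: \<kappa>_def field_simps)
 have e1: "e > 0" unfolding e_def using pos by (intro divide_pos_pos mult_pos_pos) auto
 have "1 / (4 * c * x) * x = 1 / (2 * c) / 2" if "c > 0" "x > 0" for c x :: real
  using that by (simp add: field_simps)
 from this[OF pos(1,2)] have e2: "e * (CI + 1) = \<kappa> / 2" unfolding e_def \<kappa>_def .
 note e = e1 e2
 have cE: "continuous_on X E" and cN: "continuous_on X N"
  unfolding E_def N_def by (intro continuous_intros DGc)+
 obtain d1 where d1: "d1 > 0" "\<And>q q'. q \<in> K0 \<Longrightarrow> dist q' q < d1 \<Longrightarrow> q' \<in> X \<and> dist (E q') (E q) < e"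
  by (rule continuous_near_compact[OF K0(1) X K0(2) cE e(1)], rule that)
 obtain d2 where d2: "d2 > 0" "\<And>q q'. q \<in> K0 \<Longrightarrow> dist q' q < d2 \<Longrightarrow> q' \<in> X \<and> dist (N q') (N q) < 1"
  by (rule continuous_near_compact[OF K0(1) X K0(2) cN zero_less_one], rule that)
 \<comment> \<open>A state with delay and both curve values of size at most \<rho> is within
   \<open>3 * \<rho>\<close> of \<open>K0\<close>, hence within \<open>d1\<close> and
   \<open>d2\<close>.\<close>
 define \<rho> where "\<rho> = min (d1 / 4) (min (d2 / 4) (r / 2))"
 have \<rho>: "\<rho> > 0" "\<rho> \<le> d1 / 4" "\<rho> \<le> d2 / 4" "\<rho> \<le> r / 2" using d1(1) d2(1) r by (simp_all add: \<rho>_def min_le_iff_disj)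
 \<comment> \<open>A twisted curve whose derivative is at most \<open>\<rho>'\<close> on
   \<open>[1, 2]\<close> is at most \<rho> on \<open>[0, 3]\<close>.\<close>
 define \<rho>' where "\<rho>' = \<rho> / (CQ * (CI + 1))"
 have \<rho>': "\<rho>' > 0" "CQ * ((CI + 1) * \<rho>') = \<rho>" using \<rho> pos by (auto simp: \<rho>'_def)
 have "\<rho>' / 2 > 0" using \<rho>' by simp
 obtain d3 where d3: "d3 > 0" "\<And>q q'. q \<in> K0 \<Longrightarrow> dist q' q < d3 \<Longrightarrow> q' \<in> X \<and> dist (G q') (G q) < \<rho>' / 2"
  by (rule continuous_near_compact[OF K0(1) X K0(2) Ck_on_continuous[OF G1] \<open>\<rho>' / 2 > 0\<close>], rule that)
 define \<eta> where "\<eta> = \<kappa> / (2 * CQ * (B + 1))"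
 have \<eta>: "\<eta> > 0" unfolding \<eta>_def using pos \<kappa> by (intro divide_pos_pos mult_pos_pos) auto
 define \<tau>1 where "\<tau>1 = min (min \<delta> \<rho>) (min \<eta> d3)"
 have \<tau>1: "\<tau>1 > 0" "\<tau>1 \<le> \<delta>" "\<tau>1 \<le> \<rho>" "\<tau>1 \<le> \<eta>" "\<tau>1 \<le> d3"
  using \<delta>(1) \<rho>(1) \<eta> d3(1) by (simp_all add: \<tau>1_def min_le_iff_disj)
 have \<tau>1B: "(B + 1) * (\<tau>1 * CQ) \<le> \<kappa> / 2"
 proof -
  have "(B + 1) * (\<tau>1 * CQ) \<le> (B + 1) * (\<eta> * CQ)" using \<tau>1 pos by (intro mult_left_mono mult_right_mono) auto
  moreover have "b * (k / (2 * c * b) * c) = k / 2" if "b > 0" "c > 0" for b c k :: real using that by simp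
  from this[OF pos(3,1)] have "(B + 1) * (\<eta> * CQ) = \<kappa> / 2" unfolding \<eta>_def .
  ultimately show ?thesis by simp
 qed
 have near: "x \<in> X \<and> E x \<le> e \<and> N x \<le> B + 1" if x: "x = (\<tau>, t, a, b)" "\<bar>\<tau>\<bar> < \<tau>1" "t \<in> {1..2}" "norm a \<le> \<rho>" "norm b \<le> \<rho>" for x \<tau> t a b
 proof -
  define q where "q = (0::real, t, 0::'e, 0::'e)"
  have q: "q \<in> K0" using x by (auto simp: q_def K0_def)
  have "dist x q = norm (\<tau>, 0::real, a, b)" by (simp add: x q_def dist_norm)
  also have "\<dots> \<le> \<bar>\<tau>\<bar> + (0 + (norm a + norm b))"
   using norm_Pair_le[of \<tau> "(0::real, a, b)"] norm_Pair_le[of "0::real" "(a, b)"] norm_Pair_le[of a b] by simp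
  finally have "dist x q \<le> 3 * \<rho>" using x \<tau>1 by simp
  then have "dist x q < d1" "dist x q < d2" using \<rho> by auto
  moreover have "E q = 0" using dG0[of t] x(3) by (simp add: E_def DG_def q_def)
  ultimately show ?thesis using d1(2)[OF q, of x] d2(2)[OF q, of x] B[OF q] by (auto simp: dist_real_def)
 qed
 \<comment> \<open>The diagonal part is small because \<open>E\<close> is, the delayed part because
   the delay is short and \<open>w\<close> is controlled by its derivative.\<close>
 have lipG: "norm (DG x (0, 0, w (t - \<tau>), w t)) \<le> \<kappa> * M"
  if x: "x \<in> X" "E x \<le> e" "N x \<le> B + 1" "\<bar>\<tau>\<bar> < \<tau>1" "t \<in> {1..2}" and w: "twisted w" "\<And>t. (w has_vector_derivative w' t) (at t)" "\<And>t. t \<in> {1..2} \<Longrightarrow> norm (w' t) \<le> M"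
  for x \<tau> t w w' M
 proof -
  note b = twisted_bounds[OF w]
  have "norm (DG x (0, 0, w (t - \<tau>), w t)) \<le> E x * norm (w t) + N x * norm (w (t - \<tau>) - w t)" by (rule EN[OF x(1)])
  also have "\<dots> \<le> e * ((CI + 1) * M) + (B + 1) * (\<tau>1 * (CQ * M))"
  proof (intro add_mono mult_mono)
   have "norm (w (t - \<tau>) - w t) \<le> \<bar>\<tau>\<bar> * (CQ * M)" using x \<tau>1 \<delta> by (intro b(5)) auto
   also have "\<dots> \<le> \<tau>1 * (CQ * M)" using x b(1) pos by (intro mult_right_mono) auto
   finally show "norm (w (t - \<tau>) - w t) \<le> \<tau>1 * (CQ * M)" .
  qed (use x b(2) e pos in auto)
  also have "\<dots> = (e * (CI + 1)) * M + ((B + 1) * (\<tau>1 * CQ)) * M" by (simp add: algebra_simps)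
  also have "\<dots> \<le> \<kappa> / 2 * M + \<kappa> / 2 * M" using e(2) \<tau>1B b(1) by (intro add_mono mult_right_mono) auto
  finally show ?thesis by (simp add: mult.commute)
 qed
 have contr: "norm (G (\<tau>, t, z1 (t - \<tau>), z1 t) - G (\<tau>, t, z2 (t - \<tau>), z2 t)) \<le> \<kappa> * M"
  if \<tau>: "\<bar>\<tau>\<bar> < \<tau>1" and t: "t \<in> {1..2}" and z: "\<And>t. t \<in> {2/3..7/3} \<Longrightarrow> norm (z1 t) \<le> \<rho>" "\<And>t. t \<in> {2/3..7/3} \<Longrightarrow> norm (z2 t) \<le> \<rho>"
   and w: "twisted (\<lambda>t. z1 t - z2 t)" "\<And>t. ((\<lambda>t. z1 t - z2 t) has_vector_derivative w' t) (at t)" "\<And>t. t \<in> {1..2} \<Longrightarrow> norm (w' t) \<le> M"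
  for \<tau> t z1 z2 w' M
 proof -
  define a where "a = (\<tau>, t, z2 (t - \<tau>), z2 t)"
  define h where "h = (0::real, 0::real, z1 (t - \<tau>) - z2 (t - \<tau>), z1 t - z2 t)"
  have tt: "t - \<tau> \<in> {2/3..7/3}" "t \<in> {2/3..7/3}" using t \<tau> \<tau>1 \<delta> by auto
  have conv: "norm ((1 - s) *\<^sub>R v2 + s *\<^sub>R v1) \<le> \<rho>" if "s \<in> {0..1}" "norm v1 \<le> \<rho>" "norm v2 \<le> \<rho>" for s and v1 v2 :: 'e
   using convexD[OF convex_cball[of "0::'e" \<rho>], of v2 v1 "1 - s" s] that by auto
  have seg: "a + s *\<^sub>R h = (\<tau>, t, (1 - s) *\<^sub>R z2 (t - \<tau>) + s *\<^sub>R z1 (t - \<tau>), (1 - s) *\<^sub>R z2 t + s *\<^sub>R z1 t)" for s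
   by (simp add: a_def h_def algebra_simps)
  have "norm (G (a + 1 *\<^sub>R h) - G (a + 0 *\<^sub>R h) - (1 - 0) *\<^sub>R 0) \<le> \<kappa> * M * \<bar>1 - 0\<bar>"
  proof (rule vector_mvt_bound[where f = "\<lambda>s. G (a + s *\<^sub>R h)" and f' = "\<lambda>s. DG (a + s *\<^sub>R h) h"])
   fix s :: real assume "s \<in> closed_segment 0 1"
   then have s: "s \<in> {0..1}" by (simp add: closed_segment_eq_real_ivl)
   have n: "a + s *\<^sub>R h \<in> X" "E (a + s *\<^sub>R h) \<le> e" "N (a + s *\<^sub>R h) \<le> B + 1"
    using near[OF seg[of s] \<tau> t conv[OF s z(1,2)[OF tt(1)]] conv[OF s z(1,2)[OF tt(2)]]] by auto
   have "((\<lambda>s. G (a + s *\<^sub>R h)) has_derivative (\<lambda>k. DG (a + s *\<^sub>R h) (k *\<^sub>R h))) (at s)"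
   proof (rule has_derivative_compose[where f = "\<lambda>s. a + s *\<^sub>R h" and g = G])
    show "((\<lambda>s. a + s *\<^sub>R h) has_derivative (\<lambda>k. k *\<^sub>R h)) (at s)" by (auto intro!: derivative_eq_intros)
   qed (rule DG[OF n(1)])
   then show "((\<lambda>s. G (a + s *\<^sub>R h)) has_vector_derivative DG (a + s *\<^sub>R h) h) (at s within closed_segment 0 1)"
    unfolding has_vector_derivative_def linear_scale[OF has_derivative_linear[OF DG[OF n(1)]]]
    by (rule has_derivative_at_withinI)
   have "norm (DG (a + s *\<^sub>R h) (0, 0, (\<lambda>t. z1 t - z2 t) (t - \<tau>), (\<lambda>t. z1 t - z2 t) t)) \<le> \<kappa> * M"
    by (rule lipG[OF n \<tau> t w])
   then show "norm (DG (a + s *\<^sub>R h) h - 0) \<le> \<kappa> * M" by (simp add: h_def)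
  qed
  then show ?thesis by (simp add: a_def h_def)
 qed
 \<comment> \<open>The largest derivative of the difference over \<open>[1, 2]\<close> is at most
   half of itself, hence zero; a twisted curve with zero derivative on a period vanishes by
   \<open>twisted_bounds\<close>.\<close>
 have unique: "z1 t = z2 t"
  if \<tau>: "\<bar>\<tau>\<bar> < \<tau>1" and z: "\<And>t. t \<in> {2/3..7/3} \<Longrightarrow> norm (z1 t) \<le> \<rho>" "\<And>t. t \<in> {2/3..7/3} \<Longrightarrow> norm (z2 t) \<le> \<rho>"
   and tw: "twisted z1" "twisted z2"
   and der: "\<And>t. t \<in> {5/6<..<13/6} \<Longrightarrow> (z1 has_vector_derivative G (\<tau>, t, z1 (t - \<tau>), z1 t)) (at t)"
    "\<And>t. t \<in> {5/6<..<13/6} \<Longrightarrow> (z2 has_vector_derivative G (\<tau>, t, z2 (t - \<tau>), z2 t)) (at t)"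
  for \<tau> z1 z2 t
 proof -
  note tw' = twisted_diff[OF tw]
  obtain w' where w': "\<And>t. ((\<lambda>t. z1 t - z2 t) has_vector_derivative w' t) (at t)"
   "\<And>t. t \<in> {5/6<..<13/6} \<Longrightarrow> w' t = G (\<tau>, t, z1 (t - \<tau>), z1 t) - G (\<tau>, t, z2 (t - \<tau>), z2 t)"
   by (rule twisted_differentiable[OF tw' has_vector_derivative_diff[OF der]], assumption, assumption, rule that)
  have contI: "continuous_on I z" if "\<And>t. t \<in> {5/6<..<13/6} \<Longrightarrow> (z has_vector_derivative G (\<tau>, t, z (t - \<tau>), z t)) (at t)" for z
   unfolding I_def by (rule continuous_on_vector_derivative, rule has_vector_derivative_at_within, rule that)
  have contG: "continuous_on {1..2} (\<lambda>t. G (\<tau>, t, z (t - \<tau>), z t))" if "continuous_on I z" "\<And>t. t \<in> {2/3..7/3} \<Longrightarrow> norm (z t) \<le> \<rho>" for z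
  proof (rule continuous_on_compose2[OF Ck_on_continuous[OF G1]])
   have sub: "t \<in> I" "t - \<tau> \<in> I" if "t \<in> {1..2}" for t using that \<tau> \<tau>1 \<delta> by (auto simp: I_def)
   have "continuous_on {1..2} (\<lambda>t. z (t - \<tau>))"
    by (rule continuous_on_compose2[OF that(1), of "{1..2}" "\<lambda>t. t - \<tau>"]) (intro continuous_intros, rule image_subsetI, rule sub(2))
   moreover have "continuous_on {1..2} z" by (rule continuous_on_subset[OF that(1)]) (use sub in auto)
   ultimately show "continuous_on {1..2} (\<lambda>t. (\<tau>, t, z (t - \<tau>), z t))" by (intro continuous_on_Pair continuous_on_const continuous_on_id)
   show "(\<lambda>t. (\<tau>, t, z (t - \<tau>), z t)) ` {1..2} \<subseteq> X"
   proof (rule image_subsetI)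
    fix t :: real assume t: "t \<in> {1..2}"
    have "t - \<tau> \<in> {2/3..7/3}" "t \<in> {2/3..7/3}" using t \<tau> \<tau>1 \<delta> by auto
    then show "(\<tau>, t, z (t - \<tau>), z t) \<in> X" using near[OF refl \<tau> t] that(2) by blast
   qed
  qed
  have "continuous_on {1..2} (\<lambda>t. G (\<tau>, t, z1 (t - \<tau>), z1 t) - G (\<tau>, t, z2 (t - \<tau>), z2 t))"
   by (intro continuous_intros contG contI) (use der z in auto)
  from continuous_on_norm[OF this] have "continuous_on {1..2} (\<lambda>t. norm (G (\<tau>, t, z1 (t - \<tau>), z1 t) - G (\<tau>, t, z2 (t - \<tau>), z2 t)))" .
  then have cont: "continuous_on {1..2} (\<lambda>t. norm (w' t))" by (rule continuous_on_eq) (use w'(2) in simp)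
  obtain t' where t': "t' \<in> {1..2}" "\<And>t. t \<in> {1..2} \<Longrightarrow> norm (w' t) \<le> norm (w' t')"
   using continuous_attains_sup[OF compact_Icc _ cont] by auto
  have "norm (w' t') \<le> \<kappa> * norm (w' t')"
   using contr[OF \<tau> t'(1) z tw' w'(1) t'(2)] w'(2)[of t'] t'(1) by simp
  also have "\<dots> \<le> 1 / 2 * norm (w' t')" using \<kappa> by (intro mult_right_mono) auto
  finally have "norm (w' t') = 0" by simp
  then have M: "norm (w' t) \<le> 0" if "t \<in> {1..2}" for t using t'(2)[OF that] by simp
  obtain n where n: "real n > \<bar>t\<bar> + 1" using reals_Archimedean2 by blast
  have "norm (z1 t - z2 t) \<le> CQ ^ n * ((CI + 1) * 0)"
   by (rule twisted_bounds(3)[OF tw' w'(1) M]) (use n in \<open>auto simp: abs_less_iff\<close>)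
  then show ?thesis by simp
 qed
 define P where "P = {-\<tau>1<..<\<tau>1}"
 define S where "S = P \<times> I"
 have P: "open P" and PD: "\<And>\<tau>. \<tau> \<in> P \<longleftrightarrow> \<bar>\<tau>\<bar> < \<tau>1" by (auto simp: P_def abs_less_iff)
 \<comment> \<open>The bound is imposed on the fundamental interval \<open>[1, 2]\<close> alone; the
   relation at the seam controls the margins of \<open>I\<close> up to a factor
   \<open>CQ\<close>.\<close>
 define F where "F = {u :: real \<times> real \<Rightarrow> 'e. continuous_on S u \<and> (\<forall>\<tau>\<in>P. seam (\<lambda>t. u (\<tau>, t))) \<and> (\<forall>\<tau>\<in>P. \<forall>t\<in>{1..2}. norm (u (\<tau>, t)) \<le> \<rho>')}"
 define U where "U u \<tau> = extend (\<lambda>t. u (\<tau>, t))" for u :: "real \<times> real \<Rightarrow> 'e" and \<tau>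
 define Y where "Y u \<tau> = primitive (U u \<tau>)" for u \<tau>
 define T where "T u x = G (fst x, snd x, Y u (fst x) (snd x - fst x), Y u (fst x) (snd x))" for u x
 have U_tw: "twisted (U u \<tau>)" for u \<tau> unfolding U_def by (rule twisted_extend)
 have U_eq: "U u \<tau> t = u (\<tau>, t)" if "u \<in> F" "\<tau> \<in> P" "t \<in> I" for u \<tau> t
  unfolding U_def using that by (intro extend_eq) (auto simp: F_def I_def)
 have U_cont: "continuous_on (P \<times> UNIV) (case_prod (U u))" if u: "u \<in> F" for u
 proof -
  have "continuous_on S (case_prod (U u)) = continuous_on S u"
   using U_eq[OF u] by (intro continuous_on_cong) (auto simp: S_def)
  then have "Ck_on 0 (P \<times> {5/6<..<13/6}) (case_prod (U u))" using u by (simp add: F_def S_def I_def)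
  from twisted_transfer[OF P U_tw this] show ?thesis by simp
 qed
 have U_cont1: "continuous_on UNIV (U u \<tau>)" if "u \<in> F" "\<tau> \<in> P" for u \<tau>
 proof -
  have "continuous_on UNIV (\<lambda>t. (case_prod (U u)) (\<tau>, t))"
   using that by (intro continuous_on_compose2[OF U_cont[OF that(1)]] continuous_intros) auto
  then show ?thesis by simp
 qed
 have Y_tw: "twisted (Y u \<tau>)" and Y_der: "(Y u \<tau> has_vector_derivative U u \<tau> t) (at t)" if "u \<in> F" "\<tau> \<in> P" for u \<tau> t
  unfolding Y_def using primitive_twisted[OF U_cont1[OF that] U_tw] primitive_deriv[OF U_cont1[OF that]] by auto
 have Y_cont: "continuous_on (P \<times> UNIV) (case_prod (Y u))" if "u \<in> F" for u
  unfolding Y_def by (rule primitive_continuous[OF U_cont[OF that]])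
 have U_norm: "norm (U u \<tau> t) \<le> \<rho>'" if "u \<in> F" "\<tau> \<in> P" "t \<in> {1..2}" for u \<tau> t
  using U_eq[OF that(1,2), of t] that by (simp add: F_def I_def)
 have Y_norm: "norm (Y u \<tau> t) \<le> \<rho>" if "u \<in> F" "\<tau> \<in> P" "t \<in> {0..3}" for u \<tau> t
 proof -
  have "norm (Y u \<tau> t) \<le> CQ ^ 1 * ((CI + 1) * \<rho>')"
   by (rule twisted_bounds(3)[OF Y_tw[OF that(1,2)] Y_der[OF that(1,2)] U_norm[OF that(1,2)]]) (use that(3) in auto)
  then show ?thesis using \<rho>'(2) by simp
 qed
 have mem: "(\<tau>, t, Y u \<tau> (t - \<tau>), Y u \<tau> t) \<in> X" "t - \<tau> \<in> {0..3}" "t \<in> {0..3}" if "u \<in> F" "\<tau> \<in> P" "t \<in> I" for u \<tau> t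
 proof -
  show t: "t - \<tau> \<in> {0..3}" "t \<in> {0..3}" using that \<tau>1 \<delta> by (auto simp: I_def PD)
  show "(\<tau>, t, Y u \<tau> (t - \<tau>), Y u \<tau> t) \<in> X"
   using Y_norm[OF that(1,2) t(1)] Y_norm[OF that(1,2) t(2)] that \<tau>1 \<rho> r by (auto simp: X_def PD)
 qed
 have T_seam: "T u (\<tau>, t) = Q (T u (\<tau>, t + 1))" if "u \<in> F" "\<tau> \<in> P" "t \<in> {5/6<..<7/6}" for u \<tau> t
 proof -
  have t: "t \<in> I" "t + 1 \<in> I" using that by (auto simp: I_def)
  have eq: "Y u \<tau> (t - \<tau>) = Q (Y u \<tau> (t + 1 - \<tau>))" "Y u \<tau> t = Q (Y u \<tau> (t + 1))"
   using twistedD[OF Y_tw[OF that(1,2)], of "t - \<tau>"] twistedD[OF Y_tw[OF that(1,2)], of t] by (auto simp: algebra_simps)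
  have "T u (\<tau>, t) = G (\<tau>, t, Q (Y u \<tau> (t + 1 - \<tau>)), Q (Y u \<tau> (t + 1)))" by (simp only: T_def eq fst_conv snd_conv)
  also have "\<dots> = Q (G (\<tau>, t + 1, Y u \<tau> (t + 1 - \<tau>), Y u \<tau> (t + 1)))"
   using mem(1)[OF that(1,2) t(1)] mem(1)[OF that(1,2) t(2)] that \<tau>1 by (intro seamG) (auto simp: X_def PD eq)
  finally show ?thesis by (simp add: T_def)
 qed
 have far: "norm (v t) \<le> CQ * d" if v: "seam v" and d: "\<And>t. t \<in> {1..2} \<Longrightarrow> norm (v t) \<le> d" and t: "t \<in> I" for v d t
 proof -
  have "extend v t' = v t'" if "t' \<in> I" for t' using extend_eq[OF v] that by (simp add: I_def)
  moreover have "norm (extend v t) \<le> CQ ^ 1 * d"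
   by (rule twisted_norm[OF twisted_extend]) (use d t calculation in \<open>auto simp: I_def\<close>)
  ultimately show ?thesis using t by simp
 qed
 have T_diff: "norm (T u (\<tau>, t) - T v (\<tau>, t)) \<le> \<kappa> * d"
  if "u \<in> F" "v \<in> F" "\<And>x. x \<in> S \<Longrightarrow> norm (u x - v x) \<le> d" "\<tau> \<in> P" "t \<in> {1..2}" for u v d \<tau> t
 proof -
  have "norm (G (\<tau>, t, Y u \<tau> (t - \<tau>), Y u \<tau> t) - G (\<tau>, t, Y v \<tau> (t - \<tau>), Y v \<tau> t)) \<le> \<kappa> * d"
  proof (rule contr[where w' = "\<lambda>t. U u \<tau> t - U v \<tau> t"])
   show "norm (U u \<tau> t - U v \<tau> t) \<le> d" if "t \<in> {1..2}" for t
    using U_eq[of u \<tau> t] U_eq[of v \<tau> t] that \<open>u \<in> F\<close> \<open>v \<in> F\<close> \<open>\<tau> \<in> P\<close> \<open>\<And>x. x \<in> S \<Longrightarrow> norm (u x - v x) \<le> d\<close>[of "(\<tau>, t)"]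
    by (auto simp: I_def S_def)
  qed (use that Y_tw Y_der Y_norm in \<open>auto simp: PD intro!: twisted_diff has_vector_derivative_diff\<close>)
  then show ?thesis by (simp add: T_def)
 qed
 have "\<exists>u\<in>F. \<forall>x\<in>S. T u x = u x"
 proof (rule sup_contraction_fixpoint[where a = "\<lambda>x. 0" and c = "1/2" and ?d0.0 = "CQ * \<rho>'"])
  show zero: "(\<lambda>x. 0) \<in> F" using \<rho>' by (simp add: F_def seam_def linear_0[OF Q])
  show TF: "T u \<in> F" if u: "u \<in> F" for u
  proof -
   have "continuous_on S (\<lambda>x. (fst x, snd x, (case_prod (Y u)) (fst x, snd x - fst x), (case_prod (Y u)) (fst x, snd x)))"
    by (intro continuous_intros continuous_on_compose2[OF Y_cont[OF u]]) (auto simp: S_def)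
   then have "continuous_on S (\<lambda>x. (fst x, snd x, Y u (fst x) (snd x - fst x), Y u (fst x) (snd x)))" by (simp only: prod.case)
   then have "continuous_on S (T u)"
    unfolding T_def[abs_def] using mem(1)[OF u] by (intro continuous_on_compose2[OF Ck_on_continuous[OF G1]]) (auto simp: S_def)
   moreover have "norm (T u (\<tau>, t)) \<le> \<rho>'" if \<tau>: "\<tau> \<in> P" and t: "t \<in> {1..2}" for \<tau> t
   proof -
    have "norm (G (\<tau>, t, Y u \<tau> (t - \<tau>), Y u \<tau> t) - G (\<tau>, t, (\<lambda>t. 0) (t - \<tau>), (\<lambda>t. 0) t)) \<le> \<kappa> * \<rho>'"
    proof (rule contr[where w' = "U u \<tau>"])
     show "((\<lambda>t. Y u \<tau> t - 0) has_vector_derivative U u \<tau> t) (at t)" for t using Y_der[OF u \<tau>] by simp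
    qed (use u \<tau> t Y_tw Y_norm U_norm \<rho> in \<open>auto simp: PD\<close>)
    moreover have "dist (G (\<tau>, t, 0, 0)) (G (0, t, 0, 0)) < \<rho>' / 2"
    proof -
     have "dist (\<tau>, t, 0::'e, 0::'e) (0, t, 0, 0) = \<bar>\<tau>\<bar>" by (simp add: dist_Pair_Pair dist_real_def)
     then show ?thesis using d3(2)[of "(0, t, 0, 0)" "(\<tau>, t, 0, 0)"] \<tau> \<tau>1 t by (auto simp: K0_def PD)
    qed
    moreover have "\<kappa> * \<rho>' \<le> 1 / 2 * \<rho>'" using \<kappa> \<rho>' by (intro mult_right_mono) auto
    moreover have "G (0, t, 0, 0) = 0" using G0[of t] t by simp
    ultimately have "norm (G (\<tau>, t, Y u \<tau> (t - \<tau>), Y u \<tau> t)) \<le> \<rho>'"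
     using norm_triangle_sub[of "G (\<tau>, t, Y u \<tau> (t - \<tau>), Y u \<tau> t)" "G (\<tau>, t, 0, 0)"] by (simp add: dist_norm)
    then show ?thesis by (simp add: T_def)
   qed
   ultimately show ?thesis using T_seam[OF u] by (simp add: F_def seam_def)
  qed
  show "norm (T u x - T v x) \<le> 1 / 2 * d" if u: "u \<in> F" "v \<in> F" "\<And>x. x \<in> S \<Longrightarrow> norm (u x - v x) \<le> d" and x: "x \<in> S" for u v d x
  proof -
   obtain \<tau> t where xt: "x = (\<tau>, t)" "\<tau> \<in> P" "t \<in> I" using x by (auto simp: S_def)
   have "norm ((\<lambda>t. T u (\<tau>, t) - T v (\<tau>, t)) t) \<le> CQ * (\<kappa> * d)"
   proof (rule far[OF _ _ xt(3)])
    show "seam (\<lambda>t. T u (\<tau>, t) - T v (\<tau>, t))"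
     using T_seam[OF u(1) xt(2)] T_seam[OF u(2) xt(2)] by (simp add: seam_def linear_diff[OF Q])
    show "norm (T u (\<tau>, t) - T v (\<tau>, t)) \<le> \<kappa> * d" if "t \<in> {1..2}" for t
     by (rule T_diff[OF u xt(2) that])
   qed
   also have "\<dots> = 1 / 2 * d" using pos by (simp add: \<kappa>_def)
   finally show ?thesis by (simp add: xt)
  qed
  show "norm (T (\<lambda>x. 0) x - 0) \<le> CQ * \<rho>'" if x: "x \<in> S" for x
  proof -
   obtain \<tau> t where xt: "x = (\<tau>, t)" "\<tau> \<in> P" "t \<in> I" using x by (auto simp: S_def)
   have "norm ((\<lambda>t. T (\<lambda>x. 0) (\<tau>, t)) t) \<le> CQ * \<rho>'"
    by (rule far[OF _ _ xt(3)]) (use TF[OF zero] xt(2) in \<open>auto simp: F_def\<close>)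
   then show ?thesis by (simp add: xt)
  qed
  show "l \<in> F" if f: "\<And>n::nat. f n \<in> F" and ul: "uniform_limit S f l sequentially" for f l
  proof -
   have "continuous_on S l" using f by (intro uniform_limit_theorem[OF _ ul]) (auto simp: F_def)
   moreover have lim: "(\<lambda>n. f n (\<tau>, t)) \<longlonglongrightarrow> l (\<tau>, t)" if "\<tau> \<in> P" "t \<in> I" for \<tau> t
    using tendsto_uniform_limitI[OF ul, of "(\<tau>, t)"] that by (simp add: S_def)
   moreover have "norm (l (\<tau>, t)) \<le> \<rho>'" if "\<tau> \<in> P" "t \<in> {1..2}" for \<tau> t
    using f that by (intro Lim_norm_ubound[OF _ lim]) (auto simp: F_def I_def)
   moreover have "l (\<tau>, t) = Q (l (\<tau>, t + 1))" if "\<tau> \<in> P" "t \<in> {5/6<..<7/6}" for \<tau> t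
   proof -
    have "(\<lambda>n. Q (f n (\<tau>, t + 1))) \<longlonglongrightarrow> Q (l (\<tau>, t + 1))"
     using that by (intro bounded_linear.tendsto[OF bl(1)] lim) (auto simp: I_def)
    moreover have "Q (f n (\<tau>, t + 1)) = f n (\<tau>, t)" for n using f[of n] that by (auto simp: F_def seam_def)
    ultimately have "(\<lambda>n. f n (\<tau>, t)) \<longlonglongrightarrow> Q (l (\<tau>, t + 1))" by simp
    then show ?thesis using LIMSEQ_unique lim[of \<tau> t] that by (auto simp: I_def)
   qed
   ultimately show ?thesis by (simp add: F_def seam_def)
  qed
 qed auto
 then obtain u where u: "u \<in> F" "\<And>x. x \<in> S \<Longrightarrow> T u x = u x" by blast
 define y where "y = Y u"
 have y_tw: "twisted (y \<tau>)" and y_der: "(y \<tau> has_vector_derivative U u \<tau> t) (at t)" if "\<tau> \<in> P" for \<tau> t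
  using Y_tw Y_der u(1) that by (auto simp: y_def)
 have y_norm: "norm (y \<tau> t) \<le> \<rho>" if "\<tau> \<in> P" "t \<in> {0..3}" for \<tau> t using Y_norm[OF u(1) that] by (simp add: y_def)
 have U_G: "U u \<tau> t = G (\<tau>, t, y \<tau> (t - \<tau>), y \<tau> t)" if "\<tau> \<in> P" "t \<in> I" for \<tau> t
  using U_eq[OF u(1) that] u(2)[of "(\<tau>, t)"] that by (simp add: S_def T_def y_def)
 have y_eq: "(y \<tau> has_vector_derivative G (\<tau>, t, y \<tau> (t - \<tau>), y \<tau> t)) (at t)" if "\<tau> \<in> P" "t \<in> {5/6<..<13/6}" for \<tau> t
  using y_der[OF that(1), of t] U_G[OF that(1), of t] that(2) by (simp add: I_def)
 \<comment> \<open>The equation is imposed on \<open>I\<close>, the twist carries everything to the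
   whole line, and the delay is the parameter itself.\<close>
 interpret curve_family P I UNIV "\<lambda>\<tau>. \<tau>" twisted twisted
 proof
  show "twisted z" if "\<And>n::nat. twisted (w n)" "\<And>t. t \<in> UNIV \<Longrightarrow> (\<lambda>n. w n t) \<longlonglongrightarrow> z t" for w z
   using twisted_lim[of w z] that by simp
  show "twisted w'" if "twisted w" "\<And>t. t \<in> UNIV \<Longrightarrow> (w has_vector_derivative w' t) (at t)" for w w'
   using twisted_derivative[of w w'] that by simp
  show "Ck_on k (P \<times> UNIV) (case_prod q)" if "\<And>p. p \<in> P \<Longrightarrow> twisted (q p)" "Ck_on k (P \<times> I) (case_prod q)" for k q
   using twisted_transfer[OF P that(1)] that(2) by (simp add: I_def)
  show "\<exists>K. \<forall>x. norm (x::real) \<le> norm x * K" by (rule exI[of _ 1]) simp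
 qed (auto simp: P I_def intro: twisted_diff twisted_scale)
 have st: "state y \<tau> t = (\<tau>, t, y \<tau> (t - \<tau>), y \<tau> t)" for \<tau> t by (simp add: state_def)
 have sol: "solves X G y (U u)"
  unfolding solves_def st using X mem(1)[OF u(1)] y_tw y_der U_G Y_cont[OF u(1)] by (auto simp: y_def)
 define \<Lambda> where "\<Lambda> \<tau> t a b = DG (state y \<tau> t) (0, 0, a, b)" for \<tau> t a b
 have ctr: "control \<Lambda> \<kappa>"
  unfolding control_def
 proof (intro ballI)
  fix t1 :: real
  \<comment> \<open>Enough periods around \<open>[1, 2]\<close> to cover the unit ball about
    \<open>t1\<close>. The constant \<open>C\<close> grows with their number, \<kappa> does
    not.\<close>
  obtain n0 where n0: "real n0 > \<bar>t1\<bar> + 1" using reals_Archimedean2 by blast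
  define n where "n = Suc n0"
  define C where "C = CQ ^ n * (CI + 1)"
  show "\<exists>K r C. compact K \<and> K \<subseteq> I \<and> K \<noteq> {} \<and> 0 < r \<and> 0 \<le> C \<and> ball t1 r \<subseteq> UNIV \<and>
   (\<forall>p\<in>P. \<forall>w w' M. twisted w \<longrightarrow> (\<forall>t\<in>UNIV. (w has_vector_derivative w' t) (at t)) \<longrightarrow> (\<forall>t\<in>K. norm (w' t) \<le> M) \<longrightarrow>
    (\<forall>t\<in>K. norm (\<Lambda> p t (w (t - p)) (w t)) \<le> \<kappa> * M \<and> norm (w (t - p)) \<le> C * M \<and> norm (w t) \<le> C * M) \<and>
    (\<forall>t\<in>ball t1 r. norm (w t) \<le> C * M \<and> norm (w' t) \<le> C * M))"
  proof (rule exI[of _ "{1..2}"], rule exI[of _ 1], rule exI[of _ C], intro conjI ballI allI impI)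
   show "0 \<le> C" using CQ(1) pos by (simp add: C_def)
   fix \<tau> w w' M
   assume \<tau>: "\<tau> \<in> P" and w0: "twisted w" "\<forall>t\<in>UNIV. (w has_vector_derivative w' t) (at t)" "\<forall>t\<in>{1..2}. norm (w' t) \<le> M"
   have w: "twisted w" "\<And>t. (w has_vector_derivative w' t) (at t)" "\<And>t. t \<in> {1..2} \<Longrightarrow> norm (w' t) \<le> M" using w0 by auto
   note b = twisted_bounds[OF w]
   have big: "norm (w t) \<le> C * M" "norm (w' t) \<le> C * M" if "t \<in> {1 - real n..2 + real n}" for t
   proof -
    show "norm (w t) \<le> C * M" using b(3)[OF _ that] by (simp add: C_def mult.assoc)
    have "CQ ^ n * M \<le> CQ ^ n * ((CI + 1) * M)" using b(1) CI(1) CQ(1) by (intro mult_left_mono) (auto simp: algebra_simps)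
    then show "norm (w' t) \<le> C * M" using b(4)[OF _ that] by (simp add: C_def mult.assoc)
   qed
   {
    fix t :: real assume t: "t \<in> {1..2}"
    have tt: "t - \<tau> \<in> {1 - real n..2 + real n}" "t \<in> {1 - real n..2 + real n}" "t - \<tau> \<in> {0..3}" "t \<in> {0..3}" "\<bar>\<tau>\<bar> < \<tau>1"
     using t \<tau> \<tau>1 \<delta> by (auto simp: PD n_def)
    show "norm (w (t - \<tau>)) \<le> C * M" "norm (w t) \<le> C * M" using big tt by auto
    have n: "state y \<tau> t \<in> X" "E (state y \<tau> t) \<le> e" "N (state y \<tau> t) \<le> B + 1"
     using near[OF st tt(5) t y_norm[OF \<tau> tt(3)] y_norm[OF \<tau> tt(4)]] by auto
    show "norm (\<Lambda> \<tau> t (w (t - \<tau>)) (w t)) \<le> \<kappa> * M"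
     unfolding \<Lambda>_def by (rule lipG[OF n tt(5) t w])
   }
   {
    fix t assume "t \<in> ball t1 1"
    then have t: "t \<in> {1 - real n..2 + real n}" using n0 by (auto simp: n_def dist_real_def)
    show "norm (w t) \<le> C * M" "norm (w' t) \<le> C * M" using big[OF t] by auto
   }
  qed (auto simp: I_def)
 qed
 have smooth: "smooth_on (P \<times> UNIV) (case_prod y)"
  unfolding smooth_on_def
 proof
  fix k show "Ck_on k (P \<times> UNIV) (case_prod y)"
   by (rule smooth_dependence[OF sol Gk _ _ ctr]) (use \<kappa> in \<open>auto simp: \<Lambda>_def DG_def\<close>)
 qed
 have P0: "0 \<in> P" using \<tau>1 by (simp add: P_def)
 have y0: "y 0 t = 0" for t
 proof (rule unique[of 0 "y 0" "\<lambda>t. 0"])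
  show "((\<lambda>t. 0) has_vector_derivative G (0, t, 0, 0)) (at t)" if "t \<in> {5/6<..<13/6}" for t
   using G0[OF that] by simp
  show "twisted (\<lambda>t. 0)" by (simp add: twisted_def linear_0[OF Q])
 qed (use \<tau>1 \<rho> y_norm[OF P0] y_tw[OF P0] y_eq[OF P0] in auto)
 show thesis
 proof (rule that[OF \<tau>1(1,2) \<rho>(1)])
  show "\<rho> < r" using \<rho> r by simp
  show "smooth_on ({-\<tau>1<..<\<tau>1} \<times> UNIV) (case_prod y)" using smooth by (simp add: P_def)
  show "z t = y \<tau> t"
   if "\<bar>\<tau>\<bar> < \<tau>1" "twisted z" "\<And>t. t \<in> {2/3..7/3} \<Longrightarrow> norm (z t) \<le> \<rho>"
    "\<And>t. t \<in> {5/6<..<13/6} \<Longrightarrow> (z has_vector_derivative G (\<tau>, t, z (t - \<tau>), z t)) (at t)" for \<tau> z t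
   by (rule unique[OF that(1) that(3) _ that(2) y_tw that(4) y_eq]) (use that(1) y_norm[of \<tau>] in \<open>auto simp: PD\<close>)
 qed (use y_tw y0 y_norm y_eq in \<open>auto simp: PD\<close>)
qed

end

section \<open>The equation in a tube around the orbit\<close>

context twist
begin

text \<open>A pointwise form of \<open>extend_eq\<close>, for curves whose twist relation is known
  on a wider overlap than that of \<open>seam\<close>.\<close>

lemma extend_eq_at:
 assumes "0 \<le> t" "t < 3" "t < 1 \<Longrightarrow> v t = Q (v (t + 1))" "2 \<le> t \<Longrightarrow> v (t - 1) = Q (v t)"
 shows "extend v t = v t"
proof -
 consider "t < 1" | "1 \<le> t" "t < 2" | "2 \<le> t" by linarith
 then show ?thesis
 proof cases
  case 1
  then have "\<lfloor>t\<rfloor> - 1 = -1" using assms(1) by (simp add: floor_eq_iff)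
  then show ?thesis using assms 1 unfolding extend_def by (simp add: Let_def add.commute)
 next
  case 2
  then have "\<lfloor>t\<rfloor> - 1 = 0" by (simp add: floor_eq_iff)
  then show ?thesis unfolding extend_def by (simp add: Let_def)
 next
  case 3
  then have "\<lfloor>t\<rfloor> - 1 = 1" using assms(2) by (simp add: floor_eq_iff)
  then show ?thesis using assms(4) 3 unfolding extend_def by (simp add: Let_def QiQ)
 qed
qed

end

text \<open>The product rule at a zero of \<open>k\<close>: the term with the derivative of
  \<open>L\<close> is multiplied by \<open>k x = 0\<close> and drops out.\<close>

lemma has_derivative_apply_zero:
 fixes L :: "'a::real_normed_vector \<Rightarrow> 'b::euclidean_space \<Rightarrow> 'c::real_normed_vector" and k :: "'a \<Rightarrow> 'b"
 assumes "open S" "x \<in> S" and lin: "\<And>y. y \<in> S \<Longrightarrow> linear (L y)" and L: "\<And>b. (\<lambda>y. L y b) differentiable (at x)"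
  and k: "(k has_derivative k') (at x)" "k x = 0"
 shows "((\<lambda>y. L y (k y)) has_derivative (\<lambda>h. L x (k' h))) (at x)"
proof -
 obtain L' where L': "\<And>b. ((\<lambda>y. L y b) has_derivative L' b) (at x)" using L unfolding differentiable_def by metis
 have "((\<lambda>y. \<Sum>b\<in>Basis. (k y \<bullet> b) *\<^sub>R L y b) has_derivative (\<lambda>h. \<Sum>b\<in>Basis. (k x \<bullet> b) *\<^sub>R L' b h + (k' h \<bullet> b) *\<^sub>R L x b)) (at x)"
  by (intro has_derivative_sum has_derivative_scaleR has_derivative_inner_left k L')
 moreover have "(\<lambda>h. \<Sum>b\<in>Basis. (k x \<bullet> b) *\<^sub>R L' b h + (k' h \<bullet> b) *\<^sub>R L x b) = (\<lambda>h. L x (k' h))"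
  by (simp add: k(2) linear_basis_expansion[OF lin[OF assms(2)], symmetric])
 ultimately have "((\<lambda>y. \<Sum>b\<in>Basis. (k y \<bullet> b) *\<^sub>R L y b) has_derivative (\<lambda>h. L x (k' h))) (at x)" by simp
 then show ?thesis
  by (rule has_derivative_transform_within_open[OF _ assms(1,2)]) (simp add: linear_basis_expansion[OF lin, symmetric])
qed

lemma (in atlas) smooth_periodic_function_compose:
 assumes "smooth_periodic_function A f" "smooth_into U q" "smooth_on U s"
 shows "smooth_on U (\<lambda>u. f (s u) (q u))"
proof (rule smooth_on_locally)
 fix u assume u: "u \<in> U"
 obtain N c where N: "open N" "u \<in> N" "N \<subseteq> U" "c \<in> A" "q ` N \<subseteq> fst c" "smooth_on N (\<lambda>u. snd c (q u))"
  by (rule smooth_into_local_chart[OF assms(2) u], rule that)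
 have o: "open (UNIV \<times> snd c ` fst c :: (real \<times> 'e) set)" by (intro open_Times open_UNIV open_img N)
 have fc: "smooth_on (UNIV \<times> snd c ` fst c) (\<lambda>(t, y). f t (chart_inv c y))"
  using assms(1) N(4) by (simp add: smooth_periodic_function_def)
 have "smooth_on N (\<lambda>u. (\<lambda>(t, y). f t (chart_inv c y)) (s u, snd c (q u)))"
  using N by (intro smooth_on_compose[OF N(1) o _ fc] smooth_on_Pair smooth_on_subset[OF assms(3)]) auto
 moreover have "smooth_on N (\<lambda>u. f (s u) (chart_inv c (snd c (q u)))) = smooth_on N (\<lambda>u. f (s u) (q u))"
  using N inv_chart[OF N(4)] by (intro smooth_on_cong) auto
 ultimately show "\<exists>T. open T \<and> u \<in> T \<and> smooth_on T (\<lambda>u. f (s u) (q u))" using N by (intro exI[of _ N]) simp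
qed

lemma (in atlas) smooth_periodic_vector_field_compose:
 assumes "smooth_periodic_vector_field A X" "smooth_into U q" "smooth_on U s" "c \<in> A"
 shows "smooth_on (U \<inter> q -` fst c) (\<lambda>u. X (s u) (q u) c)"
proof -
 have o: "open (UNIV \<times> snd c ` fst c :: (real \<times> 'e) set)" by (intro open_Times open_UNIV open_img assms)
 have oN: "open (U \<inter> q -` fst c)" by (rule smooth_into_open_vimage[OF assms(2) open_dom[OF assms(4)]])
 have Xc: "smooth_on (UNIV \<times> snd c ` fst c) (\<lambda>(t, y). X t (chart_inv c y) c)"
  using assms(1,4) by (simp add: smooth_periodic_vector_field_def)
 have "smooth_on (U \<inter> q -` fst c) (\<lambda>u. (\<lambda>(t, y). X t (chart_inv c y) c) (s u, snd c (q u)))"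
  by (intro smooth_on_compose[OF oN o _ Xc] smooth_on_Pair oN smooth_on_subset[OF assms(3)] smooth_into_chart[OF assms(2,4)]) auto
 moreover have "smooth_on (U \<inter> q -` fst c) (\<lambda>u. X (s u) (chart_inv c (snd c (q u))) c) = smooth_on (U \<inter> q -` fst c) (\<lambda>u. X (s u) (q u) c)"
  using inv_chart[OF assms(4)] by (intro smooth_on_cong[OF oN]) auto
 ultimately show ?thesis by simp
qed

lemma (in atlas) has_velocity_shift:
 assumes "has_velocity A x v (t + s) UNIV"
 shows "has_velocity A (\<lambda>t. x (t + s)) v t UNIV"
proof -
 obtain c where c: "c \<in> A" "x (t + s) \<in> fst c" using chart_at by blast
 show ?thesis
 proof (rule has_velocityI[OF c(1)])
  show "continuous (at t within UNIV) (\<lambda>t. x (t + s))"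
   using assms isCont_o2[of t "\<lambda>t. t + s" x] by (simp add: has_velocity_def)
  have "(snd c \<circ> x has_vector_derivative v c) (at (t + s))" using assms c by (simp add: has_velocity_def)
  then have "((snd c \<circ> x) \<circ> (\<lambda>t. t + s) has_vector_derivative 1 *\<^sub>R v c) (at t)"
   by (intro vector_diff_chain_at[of "\<lambda>t. t + s" 1 t "snd c \<circ> x"]) (auto intro!: derivative_eq_intros)
  then show "((\<lambda>t. snd c (x (t + s))) has_vector_derivative v c) (at t within UNIV)" by (simp add: o_def)
 qed (use assms c in \<open>auto simp: has_velocity_def\<close>)
qed

text \<open>The fundamental interval is \<open>[1, 2]\<close>. The time interval of \<open>\<Psi>\<close> leaves room for delays up to \<open>1/6\<close>, and the
 cut-off acts between \<open>17/12\<close> and \<open>19/12\<close>. Because of \<open>drift\<close> the curves \<open>t \<mapsto> \<Psi> t v\<close> solve the equation without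
 delay to first order in \<open>v\<close>.\<close>

locale tube = atlas A + twist Q Qi
 for A :: "('m::{t2_space, second_countable_topology}, 'e::euclidean_space) chart set" and Q Qi :: "'e \<Rightarrow> 'e" +
 fixes \<Psi> :: "real \<Rightarrow> 'e \<Rightarrow> 'm" and r0 :: real and x0 :: "real \<Rightarrow> 'm"
  and f :: "real \<Rightarrow> 'm \<Rightarrow> real" and X :: "real \<Rightarrow> 'm \<Rightarrow> ('m, 'e) tangent_vector"
 assumes r0: "0 < r0" and \<Psi>: "smooth_into ({7/12<..<29/12} \<times> ball 0 r0) (case_prod \<Psi>)"
  and center: "\<And>t. t \<in> {7/12<..<29/12} \<Longrightarrow> \<Psi> t 0 = x0 t"
  and seam\<Psi>: "\<And>t v. t \<in> {7/12<..<17/12} \<Longrightarrow> v \<in> ball 0 r0 \<Longrightarrow> Q v \<in> ball 0 r0 \<Longrightarrow> \<Psi> (t + 1) v = \<Psi> t (Q v)"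
  and inj0: "\<And>c t h. c \<in> A \<Longrightarrow> t \<in> {7/12<..<29/12} \<Longrightarrow> x0 t \<in> fst c \<Longrightarrow>
   fderiv (\<lambda>(t, v). snd c (\<Psi> t v)) (t, 0) (0, h) = 0 \<Longrightarrow> h = 0"
  and drift: "\<And>c t. c \<in> A \<Longrightarrow> t \<in> {7/12<..<29/12} \<Longrightarrow> x0 t \<in> fst c \<Longrightarrow>
   ((\<lambda>v. f t (\<Psi> t v) *\<^sub>R X t (\<Psi> t v) c - fderiv (\<lambda>(t, v). snd c (\<Psi> t v)) (t, v) (1, 0))
    has_derivative (\<lambda>h. 0)) (at 0)"
  and f: "smooth_periodic_function A f" and X: "smooth_periodic_vector_field A X"
  and orbit: "periodic_orbit A (\<lambda>t p. tangent_scale (f t p) (X t p)) x0"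
begin

section \<open>The tube map in charts and its inverses in the fibres\<close>

definition "I = {7/12<..<29/12::real}"

definition "DF c = (\<lambda>x. fderiv (\<lambda>(t, v). snd c (\<Psi> t v)) x)"

definition "cdom c = {(t, v). t \<in> I \<and> v \<in> ball 0 r0 \<and> \<Psi> t v \<in> fst c}"

lemma mem_cdom: "(t, v) \<in> cdom c \<longleftrightarrow> t \<in> I \<and> v \<in> ball 0 r0 \<and> \<Psi> t v \<in> fst c"
 by (simp add: cdom_def)

lemma cdom_eq: "cdom c = ({7/12<..<29/12} \<times> ball 0 r0) \<inter> (case_prod \<Psi>) -` fst c"
 by (auto simp: cdom_def I_def)

lemma open_cdom: "c \<in> A \<Longrightarrow> open (cdom c)"
 unfolding cdom_eq by (rule smooth_into_open_vimage[OF \<Psi> open_dom])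

lemma F_smooth: "c \<in> A \<Longrightarrow> smooth_on (cdom c) (\<lambda>(t, v). snd c (\<Psi> t v))"
 using smooth_into_chart[OF \<Psi>, of c] unfolding cdom_eq by (simp add: case_prod_beta')

lemma F_derivative: "c \<in> A \<Longrightarrow> x \<in> cdom c \<Longrightarrow> ((\<lambda>(t, v). snd c (\<Psi> t v)) has_derivative DF c x) (at x)"
 unfolding DF_def by (rule smooth_on_has_derivative[OF F_smooth])

lemma DF_linear: "c \<in> A \<Longrightarrow> x \<in> cdom c \<Longrightarrow> linear (DF c x)"
 using F_derivative has_derivative_linear by blast

lemma DF_smooth: "c \<in> A \<Longrightarrow> smooth_on (cdom c) (\<lambda>x. DF c x v)"
 unfolding DF_def smooth_on_def
proof
 fix k assume c: "c \<in> A"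
 have "Ck_on (Suc k) (cdom c) (\<lambda>(t, v). snd c (\<Psi> t v))" using F_smooth[OF c] by (simp only: smooth_on_def)
 then show "Ck_on k (cdom c) (\<lambda>x. fderiv (\<lambda>(t, v). snd c (\<Psi> t v)) x v)" by (simp del: split_paired_All)
qed

lemma curve_derivative:
 assumes "c \<in> A" "(t, z t) \<in> cdom c" "(z has_vector_derivative g) (at t)"
 shows "((\<lambda>s. snd c (\<Psi> s (z s))) has_vector_derivative DF c (t, z t) (1, g)) (at t)"
proof -
 have z: "((\<lambda>s. (s, z s)) has_derivative (\<lambda>k. k *\<^sub>R (1, g))) (at t)"
  using has_derivative_Pair[OF has_derivative_ident assms(3)[unfolded has_vector_derivative_def]] by simp
 have "((\<lambda>s. (\<lambda>(t, v). snd c (\<Psi> t v)) (s, z s)) has_derivative (\<lambda>k. DF c (t, z t) (k *\<^sub>R (1, g)))) (at t)"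
  by (rule has_derivative_compose[OF z F_derivative[OF assms(1,2)]])
 then show ?thesis unfolding has_vector_derivative_def linear_scale[OF DF_linear[OF assms(1,2)]] by simp
qed

lemma curve_continuous:
 assumes "t \<in> I" "z t \<in> ball 0 r0" "isCont z t"
 shows "isCont (\<lambda>s. \<Psi> s (z s)) t"
proof -
 have "continuous_on ({7/12<..<29/12} \<times> ball 0 r0) (case_prod \<Psi>)" using \<Psi> by (simp add: smooth_into_def)
 then have "isCont (case_prod \<Psi>) (t, z t)"
  using assms by (subst (asm) continuous_on_eq_continuous_at) (auto simp: open_Times I_def)
 then show ?thesis using isCont_o2[of t "\<lambda>s. (s, z s)" "\<lambda>(t, v). \<Psi> t v"] assms(3) by (simp add: isCont_Pair)
qed

lemma curve_velocity:
 assumes "c \<in> A" "(t, z t) \<in> cdom c" "(z has_vector_derivative g) (at t)"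
  and "v \<in> tangent_space A (\<Psi> t (z t))" "DF c (t, z t) (1, g) = v c"
 shows "has_velocity A (\<lambda>s. \<Psi> s (z s)) v t UNIV"
 using assms curve_derivative[OF assms(1-3)] has_vector_derivative_continuous[OF assms(3)]
 by (intro has_velocityI[OF assms(1)] curve_continuous) (auto simp: mem_cdom)

lemma DF_change:
 assumes "c \<in> A" "d \<in> A" "(t, b) \<in> cdom c" "(t, b) \<in> cdom d"
 shows "DF d (t, b) k = fderiv (\<lambda>y. snd d (chart_inv c y)) (snd c (\<Psi> t b)) (DF c (t, b) k)"
proof -
 have o: "open (cdom c \<inter> cdom d)" using open_cdom assms by blast
 have y: "snd c (\<Psi> t b) \<in> snd c ` (fst c \<inter> fst d)" using assms by (auto simp: mem_cdom)
 have "((\<lambda>x. snd d (chart_inv c ((\<lambda>(t, v). snd c (\<Psi> t v)) x))) has_derivative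
  (\<lambda>k. fderiv (\<lambda>y. snd d (chart_inv c y)) (snd c (\<Psi> t b)) (DF c (t, b) k))) (at (t, b))"
  using smooth_on_has_derivative[OF transition_smooth[OF assms(1,2)] y]
  by (intro has_derivative_compose[OF F_derivative[OF assms(1,3)]]) simp
 then have "((\<lambda>(t, v). snd d (\<Psi> t v)) has_derivative
  (\<lambda>k. fderiv (\<lambda>y. snd d (chart_inv c y)) (snd c (\<Psi> t b)) (DF c (t, b) k))) (at (t, b))"
 proof (rule has_derivative_transform_within_open[OF _ o])
  fix x assume "x \<in> cdom c \<inter> cdom d"
  then show "snd d (chart_inv c ((\<lambda>(t, v). snd c (\<Psi> t v)) x)) = (\<lambda>(t, v). snd d (\<Psi> t v)) x"
   using inv_chart[OF assms(1)] by (auto simp: cdom_def)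
 qed (use assms in blast)
 from has_derivative_unique[OF F_derivative[OF assms(2,4)] this] show ?thesis by (rule fun_cong)
qed

lemma DF_tangent:
 assumes "c \<in> A" "d \<in> A" "(t, b) \<in> cdom c" "(t, b) \<in> cdom d" "v \<in> tangent_space A (\<Psi> t b)" "DF c (t, b) k = v c"
 shows "DF d (t, b) k = v d"
 using DF_change[OF assms(1-4)] tangent_transition(2)[OF assms(5,1,2)] assms by (simp add: mem_cdom)

text \<open>A local inverse of \<open>(t, v) \<mapsto> (t, snd c (\<Psi> t v))\<close>. Time passes
  through unchanged, so only the second component \<open>g\<close> of the inverse is
  recorded.\<close>

definition lift :: "('m, 'e) chart \<Rightarrow> (real \<times> 'e) set \<Rightarrow> (real \<times> 'e) set \<Rightarrow> (real \<times> 'e \<Rightarrow> 'e) \<Rightarrow> bool" where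
 "lift c U V g \<longleftrightarrow> c \<in> A \<and> open U \<and> U \<subseteq> cdom c \<and> open V \<and> smooth_on V g \<and>
  (\<forall>t v. (t, v) \<in> U \<longrightarrow> (t, snd c (\<Psi> t v)) \<in> V \<and> g (t, snd c (\<Psi> t v)) = v) \<and>
  (\<forall>t w. (t, w) \<in> V \<longrightarrow> (t, g (t, w)) \<in> U \<and> snd c (\<Psi> t (g (t, w))) = w)"

lemma liftD:
 assumes "lift c U V g"
 shows "c \<in> A" "open U" "U \<subseteq> cdom c" "open V" "smooth_on V g"
  and "(t, v) \<in> U \<Longrightarrow> (t, snd c (\<Psi> t v)) \<in> V" "(t, v) \<in> U \<Longrightarrow> g (t, snd c (\<Psi> t v)) = v"
  and "(t, w) \<in> V \<Longrightarrow> (t, g (t, w)) \<in> U" "(t, w) \<in> V \<Longrightarrow> snd c (\<Psi> t (g (t, w))) = w"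
 using assms unfolding lift_def by simp_all

text \<open>The derivative at \<open>(s, 0)\<close> of the map to be inverted is block triangular,
  with the identity in time and the injective map of \<open>inj0\<close> in the fibre.\<close>

lemma lift_exists:
 assumes s: "s \<in> I"
 shows "\<exists>c U V g. lift c U V g \<and> (s, 0) \<in> U"
proof -
 obtain c where c: "c \<in> A" "x0 s \<in> fst c" using chart_at by blast
 define F where "F = (\<lambda>(t, v). snd c (\<Psi> t v))"
 define E where "E x = (fst x, F x)" for x
 have s0: "(s, 0) \<in> cdom c" using s c r0 center[of s] by (simp add: mem_cdom I_def)
 have E: "smooth_on (cdom c) E"
  unfolding E_def F_def by (intro smooth_on_Pair smooth_on_fst open_cdom c smooth_on_id F_smooth)
 have "(E has_derivative (\<lambda>k. (fst k, DF c (s, 0) k))) (at (s, 0))"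
  unfolding E_def[abs_def] F_def by (rule has_derivative_Pair[OF bounded_linear_imp_has_derivative[OF bounded_linear_fst] F_derivative[OF c(1) s0]])
 then have dE: "fderiv E (s, 0) = (\<lambda>k. (fst k, DF c (s, 0) k))" by (rule frechet_derivative_at[symmetric])
 have inj: "k = 0" if "fderiv E (s, 0) k = 0" for k
 proof -
  have "fst k = 0" "DF c (s, 0) k = 0" using that by (simp_all add: dE zero_prod_def)
  moreover from this have "snd k = 0" using inj0[OF c(1) _ c(2), of "snd k"] s by (cases k) (simp add: DF_def I_def)
  ultimately show ?thesis by (simp add: prod_eq_iff)
 qed
 obtain U V h where U: "open U" "U \<subseteq> cdom c" "(s, 0) \<in> U" "open V" "homeomorphism U V E h" "smooth_on V h"
  by (rule smooth_local_inverse[OF open_cdom[OF c(1)] E s0 inj], assumption, rule that)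
 define g where "g x = snd (h x)" for x
 have hE: "h (E x) = x" if "x \<in> U" for x using U(5) that by (auto simp: homeomorphism_def)
 have Eh: "E (h x) = x" "h x \<in> U" if "x \<in> V" for x using U(5) that by (auto simp: homeomorphism_def)
 have EV: "E x \<in> V" if "x \<in> U" for x using U(5) that by (auto simp: homeomorphism_def)
 have h: "h (t, w) = (t, g (t, w))" if "(t, w) \<in> V" for t w
  using Eh(1)[OF that] by (cases "h (t, w)") (simp add: E_def g_def)
 have "lift c U V g"
  unfolding lift_def
 proof (intro conjI allI impI c U)
  show "smooth_on V g" unfolding g_def by (rule smooth_on_snd[OF U(4,6)])
  fix t and v :: 'e assume tv: "(t, v) \<in> U"
  show "(t, snd c (\<Psi> t v)) \<in> V" "g (t, snd c (\<Psi> t v)) = v" using EV[OF tv] hE[OF tv] by (auto simp: E_def F_def g_def)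
 next
  fix t and w :: 'e assume tw: "(t, w) \<in> V"
  show "(t, g (t, w)) \<in> U" "snd c (\<Psi> t (g (t, w))) = w" using Eh[OF tw] h[OF tw] by (auto simp: E_def F_def)
 qed
 then show ?thesis using U(3) by (intro exI[of _ c], rule_tac exI[of _ U], rule_tac exI[of _ V], rule_tac exI[of _ g]) simp
qed

lemma lift_inj:
 assumes "lift c U V g" "(t, v) \<in> U" "(t, v') \<in> U" "\<Psi> t v = \<Psi> t v'"
 shows "v = v'"
 using liftD(7)[OF assms(1,2)] liftD(7)[OF assms(1,3)] unfolding assms(4) by (rule trans[OF sym])

text \<open>\<open>g\<close> is a smooth left inverse in the fibres, so the fibre derivative is
  injective in the chart of the lift; \<open>DF_change\<close> carries this to every other
  chart.\<close>

lemma lift_inj_derivative: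
 assumes l: "lift c U V g" and x: "(t, v) \<in> U" and d: "d \<in> A" "\<Psi> t v \<in> fst d" and h: "DF d (t, v) (0, h) = 0"
 shows "h = 0"
proof -
 have lf: "c \<in> A" "open U" "U \<subseteq> cdom c" "smooth_on V g" "(t, snd c (\<Psi> t v)) \<in> V" by (fact liftD(1-3,5)[OF l] liftD(6)[OF l x])+
 note gF = liftD(7)[OF l]
 have xd: "(t, v) \<in> cdom c" "(t, v) \<in> cdom d" using x lf d by (auto simp: mem_cdom)
 have "DF c (t, v) (0, h) = 0"
  using DF_change[OF d(1) lf(1) xd(2,1), of "(0, h)"] h
   linear_0[OF has_derivative_linear[OF smooth_on_has_derivative[OF transition_smooth[OF d(1) lf(1)], of "snd d (\<Psi> t v)"]]] xd
  by (simp add: mem_cdom)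
 then have z: "DF c (t, v) (0, h) = 0" .
 define F where "F = (\<lambda>(t, v). snd c (\<Psi> t v))"
 define Dg where "Dg = fderiv g (t, snd c (\<Psi> t v))"
 have Dg: "(g has_derivative Dg) (at (t, snd c (\<Psi> t v)))" unfolding Dg_def by (rule smooth_on_has_derivative[OF lf(4,5)])
 have "((\<lambda>x. (fst x, F x)) has_derivative (\<lambda>k. (fst k, DF c (t, v) k))) (at (t, v))"
  unfolding F_def by (rule has_derivative_Pair[OF bounded_linear_imp_has_derivative[OF bounded_linear_fst] F_derivative[OF lf(1) xd(1)]])
 from has_derivative_compose[OF this, of g Dg]
 have "((\<lambda>x. g (fst x, F x)) has_derivative (\<lambda>k. Dg (fst k, DF c (t, v) k))) (at (t, v))"
  using Dg by (simp add: F_def)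
 then have "(snd has_derivative (\<lambda>k. Dg (fst k, DF c (t, v) k))) (at (t, v))"
  by (rule has_derivative_transform_within_open[OF _ lf(2) x]) (auto simp: F_def gF)
 moreover have "(snd has_derivative snd) (at (t, v))" by (rule bounded_linear_imp_has_derivative) (rule bounded_linear_snd)
 ultimately have "Dg (fst (0::real, h), DF c (t, v) (0, h)) = snd (0::real, h)" using has_derivative_unique by metis
 then show ?thesis using z linear_0[OF has_derivative_linear[OF Dg]] by (simp add: zero_prod_def)
qed

text \<open>A Lebesgue number for the cover of the compact centre line by domains of lifts gives one
  radius for all times.\<close>

lemma uniform_lift:
 "\<exists>r>0. r \<le> r0 \<and> (\<forall>t\<in>{2/3..7/3}. \<exists>c U V g. lift c U V g \<and> {t} \<times> ball 0 r \<subseteq> U)"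
proof -
 define K where "K = {2/3..7/3::real} \<times> {0::'e}"
 define C where "C = {U. \<exists>c V g. lift c U V g}"
 have cK: "compact K" unfolding K_def by (intro compact_Times) auto
 have KC: "K \<subseteq> \<Union>C"
 proof
  fix x assume "x \<in> K"
  then obtain s where s: "x = (s, 0)" "s \<in> I" by (auto simp: K_def I_def)
  obtain c U V g where l: "lift c U V g" "(s, 0) \<in> U" using lift_exists[OF s(2)] by (elim exE conjE) (rule that)
  have "U \<in> C" unfolding C_def using l(1) by blast
  then show "x \<in> \<Union>C" using s(1) l(2) by blast
 qed
 have oC: "open U" if "U \<in> C" for U using that liftD(2) unfolding C_def by blast
 obtain e where e: "e > 0" "\<And>x. x \<in> K \<Longrightarrow> \<exists>U\<in>C. ball x e \<subseteq> U" by (rule Heine_Borel_lemma[OF cK KC oC], assumption, rule that)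
 show ?thesis
 proof (intro exI[of _ "min e r0"] conjI ballI)
  fix t :: real assume "t \<in> {2/3..7/3}"
  then have "(t, 0) \<in> K" by (simp add: K_def)
  then obtain U where U: "U \<in> C" "ball (t, 0) e \<subseteq> U" using e(2) by blast
  have "{t} \<times> ball 0 (min e r0) \<subseteq> ball (t, 0::'e) e" by (auto simp: dist_Pair_Pair)
  then show "\<exists>c U V g. lift c U V g \<and> {t} \<times> ball 0 (min e r0) \<subseteq> U" using U unfolding C_def by blast
 qed (use e r0 in auto)
qed

definition "r1 = (SOME r. r > 0 \<and> r \<le> r0 \<and> (\<forall>t\<in>{2/3..7/3}. \<exists>c U V g. lift c U V g \<and> {t} \<times> ball 0 r \<subseteq> U))"

lemma r1: "0 < r1" "r1 \<le> r0" "t \<in> {2/3..7/3} \<Longrightarrow> \<exists>c U V g. lift c U V g \<and> {t} \<times> ball 0 r1 \<subseteq> U"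
proof -
 have "r1 > 0 \<and> r1 \<le> r0 \<and> (\<forall>t\<in>{2/3..7/3}. \<exists>c U V g. lift c U V g \<and> {t} \<times> ball 0 r1 \<subseteq> U)"
  unfolding r1_def by (rule someI_ex) (rule uniform_lift)
 then show "0 < r1" "r1 \<le> r0" "t \<in> {2/3..7/3} \<Longrightarrow> \<exists>c U V g. lift c U V g \<and> {t} \<times> ball 0 r1 \<subseteq> U" by blast+
qed

lemma inj_\<Psi>:
 assumes "t \<in> {2/3..7/3}" "v \<in> ball 0 r1" "v' \<in> ball 0 r1" "\<Psi> t v = \<Psi> t v'"
 shows "v = v'"
proof -
 obtain c U V g where "lift c U V g" "{t} \<times> ball 0 r1 \<subseteq> U" using r1(3)[OF assms(1)] by (elim exE conjE) (rule that)
 then show ?thesis using lift_inj[of c U V g t v v'] assms by blast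
qed

lemma inj_DF:
 assumes "t \<in> {2/3..7/3}" "v \<in> ball 0 r1" "d \<in> A" "\<Psi> t v \<in> fst d" "DF d (t, v) (0, h) = 0"
 shows "h = 0"
proof -
 obtain c U V g where "lift c U V g" "{t} \<times> ball 0 r1 \<subseteq> U" using r1(3)[OF assms(1)] by (elim exE conjE) (rule that)
 then show ?thesis using lift_inj_derivative[of c U V g t v d h] assms by blast
qed

end

lemma (in atlas) tangent_scale_closed:
 assumes "v \<in> tangent_space A p"
 shows "tangent_scale r v \<in> tangent_space A p"
 unfolding tangent_space_def mem_Collect_eq tangent_scale_def
proof (intro conjI allI impI ballI)
 show "\<not> (c \<in> A \<and> p \<in> fst c) \<Longrightarrow> r *\<^sub>R v c = 0" for c
  using conjunct1[OF assms[unfolded tangent_space_def mem_Collect_eq], rule_format, of c] by simp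
 fix c d assume cd: "c \<in> A" "d \<in> A" "p \<in> fst c \<and> p \<in> fst d"
 note tr = tangent_transition[OF assms cd(1,2) conjunct1[OF cd(3)] conjunct2[OF cd(3)]]
 show "r *\<^sub>R v d = fderiv (snd d \<circ> chart_inv c) (snd c p) (r *\<^sub>R v c)"
  unfolding o_def linear_scale[OF has_derivative_linear[OF tr(1)]] using tr(2) by simp
qed

section \<open>The delay equation in the coordinates of the tube\<close>

context tube
begin

definition "speed \<tau> t a b = tangent_scale (f t (\<Psi> (t - \<tau>) a)) (X t (\<Psi> t b))"

lemma speed_tangent: "speed \<tau> t a b \<in> tangent_space A (\<Psi> t b)"
 using X unfolding speed_def smooth_periodic_vector_field_def by (intro tangent_scale_closed) simp

text \<open>\<open>g\<close> is the derivative that a curve \<open>z\<close> with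
  \<open>z (t - \<tau>) = a\<close> and \<open>z t = b\<close> must have at \<open>t\<close> for
  \<open>s \<mapsto> \<Psi> s (z s)\<close> to have the velocity which the delay equation requires.
  All charts are quantified, so \<open>G\<close> depends on no choice of a chart.\<close>

definition "sol \<tau> t a b g \<longleftrightarrow> (\<forall>c\<in>A. \<Psi> t b \<in> fst c \<longrightarrow> DF c (t, b) (1, g) = speed \<tau> t a b c)"

definition "G = (\<lambda>(\<tau>, t, a, b). THE g. sol \<tau> t a b g)"

lemma times:
 assumes "\<bar>\<tau>\<bar> < 1/6" "t \<in> {5/6<..<13/6}"
 shows "t \<in> I" "t - \<tau> \<in> I" "t \<in> {2/3..7/3}" "t - \<tau> \<in> {2/3..7/3}"
 using assms by (auto simp: I_def)

lemma in_cdom: "t \<in> {2/3..7/3} \<Longrightarrow> b \<in> ball 0 r1 \<Longrightarrow> \<Psi> t b \<in> fst c \<Longrightarrow> (t, b) \<in> cdom c"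
 using r1(2) by (auto simp: mem_cdom I_def)

lemma solI:
 assumes "t \<in> {2/3..7/3}" "b \<in> ball 0 r1" "c \<in> A" "\<Psi> t b \<in> fst c" "DF c (t, b) (1, g) = speed \<tau> t a b c"
 shows "sol \<tau> t a b g"
 unfolding sol_def
proof (intro ballI impI)
 fix d assume d: "d \<in> A" "\<Psi> t b \<in> fst d"
 show "DF d (t, b) (1, g) = speed \<tau> t a b d"
  by (rule DF_tangent[OF assms(3) d(1) in_cdom[OF assms(1,2,4)] in_cdom[OF assms(1,2) d(2)] speed_tangent assms(5)])
qed

lemma DF_split: "c \<in> A \<Longrightarrow> (t, b) \<in> cdom c \<Longrightarrow> DF c (t, b) (1, g) = DF c (t, b) (1, 0) + DF c (t, b) (0, g)"
 using linear_add[OF DF_linear, of c "(t, b)" "(1, 0)" "(0, g)"] by simp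

lemma DF_fibre_linear: "c \<in> A \<Longrightarrow> x \<in> cdom c \<Longrightarrow> linear (\<lambda>h. DF c x (0, h))"
 using linear_compose[OF _ DF_linear, of "\<lambda>h. (0, h)" c x] by (simp add: o_def linear_iff)

lemma DF_fibre_inj:
 assumes "t \<in> {2/3..7/3}" "b \<in> ball 0 r1" "c \<in> A" "\<Psi> t b \<in> fst c"
 shows "inj (\<lambda>h. DF c (t, b) (0, h))"
 using inj_DF[OF assms] linear_injective_0[OF DF_fibre_linear[OF assms(3) in_cdom[OF assms(1,2,4)]]] by blast

lemma sol_unique:
 assumes "t \<in> {2/3..7/3}" "b \<in> ball 0 r1" "sol \<tau> t a b g" "sol \<tau> t a b g'"
 shows "g = g'"
proof -
 obtain c where c: "c \<in> A" "\<Psi> t b \<in> fst c" using chart_at by blast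
 have "DF c (t, b) (1, g) = DF c (t, b) (1, g')" using assms(3,4) c by (simp add: sol_def)
 then have "DF c (t, b) (0, g) = DF c (t, b) (0, g')" using DF_split[OF c(1) in_cdom[OF assms(1,2) c(2)], of g] DF_split[OF c(1) in_cdom[OF assms(1,2) c(2)], of g'] by simp
 then show ?thesis using DF_fibre_inj[OF assms(1,2) c] by (simp add: inj_def)
qed

text \<open>The fibre derivative is an injective linear map of the finite-dimensional model space
  into itself, hence onto.\<close>

lemma sol_exists:
 assumes "t \<in> {2/3..7/3}" "b \<in> ball 0 r1"
 shows "\<exists>g. sol \<tau> t a b g"
proof -
 obtain c where c: "c \<in> A" "\<Psi> t b \<in> fst c" using chart_at by blast
 note d = in_cdom[OF assms c(2)]
 have "surj (\<lambda>h. DF c (t, b) (0, h))"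
  by (rule linear_injective_imp_surjective[OF DF_fibre_linear[OF c(1) d] DF_fibre_inj[OF assms c] refl])
 then obtain g where "DF c (t, b) (0, g) = speed \<tau> t a b c - DF c (t, b) (1, 0)" by (metis surjD)
 then have "DF c (t, b) (1, g) = speed \<tau> t a b c" using DF_split[OF c(1) d, of g] by simp
 from solI[OF assms c this] show ?thesis by blast
qed

lemma G_sol:
 assumes "t \<in> {2/3..7/3}" "b \<in> ball 0 r1"
 shows "sol \<tau> t a b (G (\<tau>, t, a, b))"
proof -
 obtain g where g: "sol \<tau> t a b g" using sol_exists[OF assms] by (rule exE)
 have "\<exists>!g. sol \<tau> t a b g" by (rule ex1I[where P = "sol \<tau> t a b", OF g sol_unique[OF assms _ g]])
 then show ?thesis unfolding G_def prod.case by (rule theI')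
qed

lemma G_eqI: "t \<in> {2/3..7/3} \<Longrightarrow> b \<in> ball 0 r1 \<Longrightarrow> sol \<tau> t a b g \<Longrightarrow> G (\<tau>, t, a, b) = g"
 by (rule sol_unique[OF _ _ G_sol])

text \<open>In a chart \<open>G\<close> solves a linear equation whose operator, the fibre
  derivative of \<Psi>, is smooth and injective, so \<open>Ck_on_solve_linear\<close>
  applies.\<close>

lemma G_smooth: "smooth_on ({-1/6<..<1/6::real} \<times> {5/6<..<13/6::real} \<times> ball 0 r1 \<times> ball 0 r1) G"
proof (rule smooth_on_locally)
 define \<Omega> where "\<Omega> = {-1/6<..<1/6::real} \<times> {5/6<..<13/6::real} \<times> ball (0::'e) r1 \<times> ball (0::'e) r1"
 have o\<Omega>: "open \<Omega>" by (auto simp: \<Omega>_def open_Times)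
 fix x assume x: "x \<in> {-1/6<..<1/6::real} \<times> {5/6<..<13/6::real} \<times> ball (0::'e) r1 \<times> ball (0::'e) r1"
 define p where "p = (\<lambda>x::real \<times> real \<times> 'e \<times> 'e. (fst (snd x), snd (snd (snd x))))"
 define q where "q = (\<lambda>x::real \<times> real \<times> 'e \<times> 'e. (fst (snd x) - fst x, fst (snd (snd x))))"
 have p: "smooth_on \<Omega> p" and q: "smooth_on \<Omega> q"
  unfolding p_def q_def by (intro smooth_on_Pair smooth_on_fst smooth_on_snd smooth_on_diff smooth_on_id o\<Omega>)+
 have pm: "p x \<in> {7/12<..<29/12} \<times> ball 0 r0" and qm: "q x \<in> {7/12<..<29/12} \<times> ball 0 r0" if "x \<in> \<Omega>" for x
  using that r1(2) by (auto simp: p_def q_def \<Omega>_def)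
 have sp: "smooth_into \<Omega> (\<lambda>x. (case_prod \<Psi>) (p x))" by (rule smooth_into_compose[OF \<Psi> o\<Omega> p pm])
 have sq: "smooth_into \<Omega> (\<lambda>x. (case_prod \<Psi>) (q x))" by (rule smooth_into_compose[OF \<Psi> o\<Omega> q qm])
 obtain c where c: "c \<in> A" "(case_prod \<Psi>) (p x) \<in> fst c" using chart_at by blast
 define N where "N = \<Omega> \<inter> (\<lambda>x. (case_prod \<Psi>) (p x)) -` fst c"
 have oN: "open N" unfolding N_def by (rule smooth_into_open_vimage[OF sp open_dom[OF c(1)]])
 have N\<Omega>: "N \<subseteq> \<Omega>" by (auto simp: N_def)
 have st: "smooth_on \<Omega> (\<lambda>x. fst (snd x))" by (intro smooth_on_fst smooth_on_snd smooth_on_id o\<Omega>)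
 have pN: "p x \<in> cdom c" if "x \<in> N" for x using that pm[of x] by (auto simp: N_def cdom_def I_def)
 have tb: "fst (p x) \<in> {2/3..7/3}" "snd (p x) \<in> ball 0 r1" "\<Psi> (fst (p x)) (snd (p x)) \<in> fst c" if "x \<in> N" for x
  using that by (auto simp: N_def \<Omega>_def p_def)
 have DFs: "smooth_on N (\<lambda>x. DF c (p x) k)" for k
  by (rule smooth_on_compose[OF oN open_cdom[OF c(1)] smooth_on_subset[OF p N\<Omega>] DF_smooth[OF c(1)] pN])
 have "smooth_on N (\<lambda>x. f (fst (snd x)) ((case_prod \<Psi>) (q x)) *\<^sub>R X (fst (snd x)) ((case_prod \<Psi>) (p x)) c)"
  using smooth_periodic_vector_field_compose[OF X sp st c(1)] smooth_on_subset[OF smooth_periodic_function_compose[OF f sq st] N\<Omega>]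
  by (intro smooth_on_scaleR oN) (simp_all add: N_def)
 then have w: "smooth_on N (\<lambda>x. f (fst (snd x)) ((case_prod \<Psi>) (q x)) *\<^sub>R X (fst (snd x)) ((case_prod \<Psi>) (p x)) c - DF c (p x) (1, 0))"
  by (rule smooth_on_diff[OF oN _ DFs])
 have eq: "DF c (p x) (0, G x) = f (fst (snd x)) ((case_prod \<Psi>) (q x)) *\<^sub>R X (fst (snd x)) ((case_prod \<Psi>) (p x)) c - DF c (p x) (1, 0)"
  if "x \<in> N" for x
 proof -
  obtain \<tau> t a b where xx: "x = (\<tau>, t, a, b)" by (cases x)
  have "sol \<tau> t a b (G (\<tau>, t, a, b))" using tb[OF that] by (intro G_sol) (auto simp: xx p_def)
  then have "DF c (t, b) (1, G (\<tau>, t, a, b)) = speed \<tau> t a b c" using tb(3)[OF that] c(1) by (simp add: xx p_def sol_def)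
  moreover have "(t, b) \<in> cdom c" using pN[OF that] by (simp add: xx p_def)
  ultimately show ?thesis using DF_split[OF c(1), of t b "G (\<tau>, t, a, b)"] by (simp add: xx p_def q_def speed_def tangent_scale_def eq_diff_eq add.commute)
 qed
 have "smooth_on N G"
  unfolding smooth_on_def
 proof
  fix k
  show "Ck_on k N G"
  proof (rule Ck_on_solve_linear[OF oN, of "\<lambda>x h. DF c (p x) (0, h)"])
   show "linear (\<lambda>h. DF c (p x) (0, h))" if "x \<in> N" for x by (rule DF_fibre_linear[OF c(1) pN[OF that]])
   show "inj (\<lambda>h. DF c (p x) (0, h))" if "x \<in> N" for x
    using DF_fibre_inj[OF tb(1,2)[OF that] c(1) tb(3)[OF that]] by simp
   show "Ck_on k N (\<lambda>x. DF c (p x) (0, h))" for h using DFs[of "(0, h)"] by (simp add: smooth_on_def)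
   show "Ck_on k N (\<lambda>x. f (fst (snd x)) ((case_prod \<Psi>) (q x)) *\<^sub>R X (fst (snd x)) ((case_prod \<Psi>) (p x)) c - DF c (p x) (1, 0))"
    using w by (simp add: smooth_on_def)
  qed (rule eq)
 qed
 moreover have "x \<in> N" using x c by (simp add: N_def \<Omega>_def)
 ultimately show "\<exists>T. open T \<and> x \<in> T \<and> smooth_on T G" using oN by (intro exI[of _ N]) simp
qed

lemma f_periodic: "f (t + 1) = f t" and X_periodic: "X (t + 1) = X t"
 using f X by (simp_all add: smooth_periodic_function_def smooth_periodic_vector_field_def)

lemma Q_ball: "\<exists>C>0. \<forall>v. norm (Q v) \<le> C * norm v"
 using linear_bounded_pos[OF Q] by blast

text \<open>The test curve \<open>z\<close> is affine with value \<open>b\<close> at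
  \<open>t + 1\<close> and slope \<open>g\<close>. By \<open>seam\<Psi>\<close> its image near
  \<open>t + 1\<close> is the image of the curve \<open>s \<mapsto> Q (z (s + 1))\<close> near
  \<open>t\<close>, so the two velocities coincide, and uniqueness of \<open>G\<close> gives the
  relation.\<close>

lemma G_seam:
 assumes \<tau>: "\<bar>\<tau>\<bar> < 1/6" and t: "t \<in> {5/6<..<7/6}" and ab: "a \<in> ball 0 r1" "b \<in> ball 0 r1" "Q a \<in> ball 0 r1" "Q b \<in> ball 0 r1"
 shows "G (\<tau>, t, Q a, Q b) = Q (G (\<tau>, t + 1, a, b))"
proof (rule G_eqI)
 show t': "t \<in> {2/3..7/3}" using t by auto
 have t1: "t + 1 \<in> {2/3..7/3}" using t by auto
 define g where "g = G (\<tau>, t + 1, a, b)"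
 define z where "z s = b + (s - t - 1) *\<^sub>R g" for s
 have z: "(z has_vector_derivative g) (at s)" for s unfolding z_def by (auto intro!: derivative_eq_intros)
 have Qz: "((\<lambda>s. Q (z (s + 1))) has_vector_derivative Q g) (at s)" for s
 proof -
  have "(z \<circ> (\<lambda>s. s + 1) has_vector_derivative 1 *\<^sub>R g) (at s)"
   by (rule vector_diff_chain_at[OF _ z]) (auto intro!: derivative_eq_intros)
  from bounded_linear.has_vector_derivative[OF bl(1) this] show ?thesis by (simp add: o_def)
 qed
 have br: "b \<in> ball 0 r0" "Q b \<in> ball 0 r0" using ab r1(2) by auto
 have eqt: "\<Psi> (t + 1) b = \<Psi> t (Q b)" using t br by (intro seam\<Psi>) auto
 obtain c where c: "c \<in> A" "\<Psi> t (Q b) \<in> fst c" using chart_at by blast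
 have d1: "(t + 1, b) \<in> cdom c" using in_cdom[OF t1 ab(2)] c eqt by simp
 have d2: "(t, Q b) \<in> cdom c" using in_cdom[OF t' ab(4) c(2)] .
 have "sol \<tau> (t + 1) a b g" unfolding g_def by (rule G_sol[OF t1 ab(2)])
 then have "DF c (t + 1, b) (1, g) = speed \<tau> (t + 1) a b c" using c eqt by (simp add: sol_def)
 moreover have "speed \<tau> (t + 1) a b = speed \<tau> t (Q a) (Q b)"
 proof -
  have "\<Psi> (t - \<tau> + 1) a = \<Psi> (t - \<tau>) (Q a)" using t \<tau> ab r1(2) by (intro seam\<Psi>) auto
  then show ?thesis by (simp add: speed_def f_periodic X_periodic eqt diff_add_eq)
 qed
 moreover have "DF c (t + 1, b) (1, g) = DF c (t, Q b) (1, Q g)"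
 proof -
  have "((\<lambda>s. snd c (\<Psi> s (z s))) has_vector_derivative DF c (t + 1, z (t + 1)) (1, g)) (at (t + 1))"
   by (rule curve_derivative[OF c(1) _ z]) (use d1 in \<open>simp add: z_def\<close>)
  then have "((\<lambda>s. snd c (\<Psi> s (z s))) \<circ> (\<lambda>s. s + 1) has_vector_derivative 1 *\<^sub>R DF c (t + 1, b) (1, g)) (at t)"
   by (intro vector_diff_chain_at) (auto simp: z_def intro!: derivative_eq_intros)
  then have 1: "((\<lambda>s. snd c (\<Psi> (s + 1) (z (s + 1)))) has_vector_derivative DF c (t + 1, b) (1, g)) (at t)" by (simp add: o_def)
  have 2: "((\<lambda>s. snd c (\<Psi> s (Q (z (s + 1))))) has_vector_derivative DF c (t, Q (z (t + 1))) (1, Q g)) (at t)"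
   by (rule curve_derivative[where z = "\<lambda>s. Q (z (s + 1))", OF c(1) _ Qz]) (use d2 in \<open>simp add: z_def\<close>)
  define N where "N = {7/12<..<17/12} \<inter> (\<lambda>s. z (s + 1)) -` ball 0 r0 \<inter> (\<lambda>s. Q (z (s + 1))) -` ball 0 r0"
  have "continuous_on UNIV (\<lambda>s. z (s + 1))" unfolding z_def by (intro continuous_intros)
  then have "open N"
   unfolding N_def using bounded_linear.continuous_on[OF bl(1)] by (intro open_Int open_vimage) auto
  have "((\<lambda>s. snd c (\<Psi> s (Q (z (s + 1))))) has_vector_derivative DF c (t + 1, b) (1, g)) (at t)"
  proof (rule has_vector_derivative_transform_within_open[OF 1 \<open>open N\<close>])
   show "t \<in> N" using t br by (simp add: N_def z_def)
   fix s assume "s \<in> N"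
   then have "\<Psi> (s + 1) (z (s + 1)) = \<Psi> s (Q (z (s + 1)))" by (intro seam\<Psi>) (auto simp: N_def)
   then show "snd c (\<Psi> (s + 1) (z (s + 1))) = snd c (\<Psi> s (Q (z (s + 1))))" by simp
  qed
  from vector_derivative_unique_at[OF this 2] show ?thesis by (simp add: z_def)
 qed
 ultimately have "DF c (t, Q b) (1, Q g) = speed \<tau> t (Q a) (Q b) c" by simp
 from solI[OF t' ab(4) c this] show "sol \<tau> t (Q a) (Q b) (Q (G (\<tau>, t + 1, a, b)))" by (simp add: g_def)
qed (rule ab)

text \<open>The zero curve is mapped to the orbit, which solves the equation without delay.\<close>

lemma G_center:
 assumes t: "t \<in> {5/6<..<13/6}"
 shows "G (0, t, 0, 0) = 0"
proof (rule G_eqI)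
 show t': "t \<in> {2/3..7/3}" using t by auto
 show b: "0 \<in> ball 0 r1" using r1(1) by simp
 have tI: "t \<in> I" using t by (auto simp: I_def)
 obtain c where c: "c \<in> A" "\<Psi> t 0 \<in> fst c" using chart_at by blast
 have "((\<lambda>s. snd c (\<Psi> s 0)) has_vector_derivative DF c (t, 0) (1, 0)) (at t)"
  by (rule curve_derivative[where z = "\<lambda>s. 0", OF c(1)]) (use in_cdom[OF t' b c(2)] in auto)
 moreover have "((\<lambda>s. snd c (\<Psi> s 0)) has_vector_derivative speed 0 t 0 0 c) (at t)"
 proof -
  have "((\<lambda>s. snd c (x0 s)) has_vector_derivative tangent_scale (f t (x0 t)) (X t (x0 t)) c) (at t)"
   using orbit c center[of t] tI by (auto simp: periodic_orbit_def integral_curve_on_def has_velocity_def o_def I_def)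
  then have "((\<lambda>s. snd c (x0 s)) has_vector_derivative speed 0 t 0 0 c) (at t)" using center[of t] tI by (simp add: speed_def I_def)
  then show ?thesis
   by (rule has_vector_derivative_transform_within_open[of _ _ _ I]) (use tI center in \<open>auto simp: I_def\<close>)
 qed
 ultimately have "DF c (t, 0) (1, 0) = speed 0 t 0 0 c" by (rule vector_derivative_unique_at)
 from solI[OF t' b c this] show "sol 0 t 0 0 0" .
qed

text \<open>For \<tau> = 0 and equal arguments, \<open>DF\<close> applied to \<open>G\<close> is the
  difference in \<open>drift\<close>, whose derivative vanishes. As \<open>G\<close> is zero at the
  orbit, the product rule leaves \<open>DF\<close> applied to the derivative of \<open>G\<close>,
  and \<open>DF\<close> is injective on the fibre.\<close>

lemma G_derivative_center:
 assumes t: "t \<in> {5/6<..<13/6}"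
 shows "fderiv G (0, t, 0, 0) (0, 0, h, h) = 0"
proof -
 have t': "t \<in> {2/3..7/3}" "t \<in> {7/12<..<29/12}" using t by auto
 have b: "0 \<in> ball 0 r1" using r1(1) by simp
 obtain c where c: "c \<in> A" "\<Psi> t 0 \<in> fst c" using chart_at by blast
 have c': "x0 t \<in> fst c" using center[OF t'(2)] c by simp
 define D where "D = fderiv G (0, t, 0, 0)"
 have D: "(G has_derivative D) (at (0, t, 0, 0))"
  unfolding D_def by (rule smooth_on_has_derivative[OF G_smooth]) (use t b in auto)
 have "((\<lambda>v. (0, t, v, v)) has_derivative (\<lambda>h. (0, 0, h, h))) (at 0)" by (auto intro!: derivative_eq_intros)
 from has_derivative_compose[OF this D]
 have k: "((\<lambda>v. G (0, t, v, v)) has_derivative (\<lambda>h. D (0, 0, h, h))) (at 0)" .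
 define S where "S = ball (0::'e) r1 \<inter> (\<lambda>v. (t, v)) -` cdom c"
 have "continuous_on UNIV (\<lambda>v::'e. (t, v))" by (intro continuous_intros)
 then have S: "open S" unfolding S_def using open_cdom[OF c(1)] by (intro open_Int open_vimage) auto
 have S0: "0 \<in> S" using b in_cdom[OF t'(1) b c(2)] by (simp add: S_def)
 have "((\<lambda>v. DF c (t, v) (0, G (0, t, v, v))) has_derivative (\<lambda>h. DF c (t, 0) (0, D (0, 0, h, h)))) (at 0)"
 proof (rule has_derivative_apply_zero[OF S S0 _ _ k G_center[OF t]])
  show "linear (\<lambda>h. DF c (t, v) (0, h))" if "v \<in> S" for v using that by (intro DF_fibre_linear c) (simp add: S_def)
  show "(\<lambda>v. DF c (t, v) (0, b)) differentiable (at 0)" for b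
  proof -
   have p: "((\<lambda>v::'e. (t, v)) has_derivative (\<lambda>h. (0, h))) (at 0)" by (auto intro!: derivative_eq_intros)
   have "((\<lambda>x. DF c x (0, b)) has_derivative fderiv (\<lambda>x. DF c x (0, b)) (t, 0)) (at (t, 0))"
    by (rule smooth_on_has_derivative[OF DF_smooth[OF c(1)]]) (use S0 in \<open>simp add: S_def\<close>)
   from has_derivative_compose[OF p this] show ?thesis unfolding differentiable_def by blast
  qed
 qed
 moreover have "((\<lambda>v. DF c (t, v) (0, G (0, t, v, v))) has_derivative (\<lambda>h. 0)) (at 0)"
 proof (rule has_derivative_transform_within_open[OF drift[OF c(1) t'(2) c'] S S0])
  fix v assume v: "v \<in> S"
  then have vb: "v \<in> ball 0 r1" "\<Psi> t v \<in> fst c" "(t, v) \<in> cdom c" by (auto simp: S_def mem_cdom)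
  have "DF c (t, v) (1, G (0, t, v, v)) = speed 0 t v v c" using G_sol[OF t'(1) vb(1), of 0 v] c(1) vb(2) by (simp add: sol_def)
  then show "f t (\<Psi> t v) *\<^sub>R X t (\<Psi> t v) c - fderiv (\<lambda>(t, v). snd c (\<Psi> t v)) (t, v) (1, 0) = DF c (t, v) (0, G (0, t, v, v))"
   using DF_split[OF c(1) vb(3), of "G (0, t, v, v)"] by (simp add: speed_def tangent_scale_def DF_def)
 qed
 ultimately have "DF c (t, 0) (0, D (0, 0, h, h)) = 0" using fun_cong[OF has_derivative_unique] by blast
 from inj_DF[OF t'(1) b c this] show ?thesis by (simp add: D_def)
qed

end

lemma periodic_int:
 assumes "\<And>t::real. x (t + 1) = x t"
 shows "x (t + of_int n) = x t"
proof (induction n rule: int_induct[where k = 0])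
 case (step1 i)
 then show ?case using assms[of "t + of_int i"] by (simp add: add.assoc)
next
 case (step2 i)
 then show ?case using assms[of "t + of_int (i - 1)"] by (simp add: add.assoc)
qed simp

section \<open>Loops close to the orbit and their lifts to twisted curves\<close>

context tube
begin

lemma x0_periodic: "x0 (t + 1) = x0 t"
 using orbit by (simp add: periodic_orbit_def)

lemma x0_continuous: "isCont x0 t"
 using orbit by (auto simp: periodic_orbit_def integral_curve_on_def has_velocity_def)

text \<open>On \<open>[a, b]\<close> every curve that is \<open>e\<close>-close to the orbit in the
  chart \<open>c\<close> has a lift of norm below \<rho>. This converts uniform closeness in charts
  into smallness in the tube.\<close>

definition "near \<rho> c a b e \<longleftrightarrow> c \<in> A \<and> a < b \<and> x0 ` {a..b} \<subseteq> fst c \<and>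
 (\<exists>U V g. lift c U V g \<and> (\<forall>s\<in>{a..b}. \<forall>w. dist w (snd c (x0 s)) < e \<longrightarrow> (s, w) \<in> V \<and> norm (g (s, w)) < \<rho>))"

lemma near_exists:
 assumes s: "s \<in> {2/3..7/3}" and \<rho>: "\<rho> > 0"
 shows "\<exists>c a b e. near \<rho> c a b e \<and> a < s \<and> s < b \<and> e > 0"
proof -
 have sI: "s \<in> I" "s \<in> {7/12<..<29/12}" using s by (auto simp: I_def)
 obtain c U V g where l: "lift c U V g" "(s, 0) \<in> U" using lift_exists[OF sI(1)] by (elim exE conjE) (rule that)
 note lf = liftD[OF l(1)]
 define O' where "O' = V \<inter> g -` ball 0 \<rho>"
 have O': "open O'" unfolding O'_def by (rule continuous_open_preimage[OF smooth_on_continuous[OF lf(5)] lf(4) open_ball])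
 have "(s, 0) \<in> cdom c" using lf(3) l(2) by blast
 then have x0c: "x0 s \<in> fst c" using center[OF sI(2)] by (simp add: mem_cdom)
 have "(s, snd c (x0 s)) \<in> V" "g (s, snd c (x0 s)) = 0" using lf(6,7)[OF l(2)] center[OF sI(2)] by simp_all
 then have "(s, snd c (x0 s)) \<in> O'" using \<rho> by (simp add: O'_def)
 then obtain e' where e': "e' > 0" "ball (s, snd c (x0 s)) e' \<subseteq> O'" using O' by (auto simp: open_contains_ball)
 have "isCont (snd c) (x0 s)"
  using chart_continuous[OF lf(1)] open_dom[OF lf(1)] x0c by (simp add: continuous_on_eq_continuous_at)
 then have "isCont (\<lambda>t. snd c (x0 t)) s" using isCont_o2[OF x0_continuous] by blast
 then obtain \<eta>1 where \<eta>1: "\<eta>1 > 0" "\<And>t. dist t s < \<eta>1 \<Longrightarrow> dist (snd c (x0 t)) (snd c (x0 s)) < e' / 3"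
  unfolding continuous_at_eps_delta using e'(1) by (metis divide_pos_pos zero_less_numeral)
 have "\<forall>\<^sub>F t in nhds s. x0 t \<in> fst c"
  using x0_continuous[of s] x0c open_dom[OF lf(1)] by (auto simp: isCont_def tendsto_def eventually_at_filter elim!: allE[of _ "fst c"] eventually_mono)
 then obtain \<eta>2 where \<eta>2: "\<eta>2 > 0" "\<And>t. dist t s < \<eta>2 \<Longrightarrow> x0 t \<in> fst c" by (auto simp: eventually_nhds_metric)
 \<comment> \<open>The distances \<open>e' / 6\<close> in time, \<open>e' / 3\<close> from
   \<open>w\<close> to the orbit and \<open>e' / 3\<close> along the orbit add up to less than
   \<open>e'\<close>.\<close>
 define \<eta> where "\<eta> = min (\<eta>1 / 2) (min (\<eta>2 / 2) (e' / 6))"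
 have \<eta>: "\<eta> > 0" "\<eta> \<le> \<eta>1 / 2" "\<eta> \<le> \<eta>2 / 2" "\<eta> \<le> e' / 6" using \<eta>1(1) \<eta>2(1) e'(1) by (simp_all add: \<eta>_def min_le_iff_disj)
 have dd: "dist t s \<le> \<eta>" if "t \<in> {s - \<eta>..s + \<eta>}" for t using that by (auto simp: dist_real_def)
 have im: "x0 ` {s - \<eta>..s + \<eta>} \<subseteq> fst c"
  proof (rule image_subsetI)
   fix t assume "t \<in> {s - \<eta>..s + \<eta>}"
   from dd[OF this] show "x0 t \<in> fst c" using \<eta>2 \<eta> by (intro \<eta>2(2)) simp
  qed
 have V: "(t, w) \<in> V \<and> norm (g (t, w)) < \<rho>" if t: "t \<in> {s - \<eta>..s + \<eta>}" and w: "dist w (snd c (x0 t)) < e' / 3" for t w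
 proof -
  have "dist (t, w) (s, snd c (x0 s)) \<le> dist t s + dist w (snd c (x0 s))"
   unfolding dist_Pair_Pair by (rule sqrt_sum_squares_le_sum) auto
  also have "\<dots> \<le> dist t s + (dist w (snd c (x0 t)) + dist (snd c (x0 t)) (snd c (x0 s)))" by (intro add_left_mono dist_triangle)
  also have "\<dots> < e'" using dd[OF t] \<eta> w \<eta>1(1) \<eta>1(2)[of t] e'(1) by linarith
  finally have "(t, w) \<in> O'" using e'(2) by (auto simp: dist_commute)
  then show ?thesis by (simp add: O'_def)
 qed
 have "near \<rho> c (s - \<eta>) (s + \<eta>) (e' / 3)"
  unfolding near_def
 proof (intro conjI im lf(1))
  show "s - \<eta> < s + \<eta>" using \<eta> by simp
  show "\<exists>U V g. lift c U V g \<and> (\<forall>t\<in>{s - \<eta>..s + \<eta>}. \<forall>w. dist w (snd c (x0 t)) < e' / 3 \<longrightarrow> (t, w) \<in> V \<and> norm (g (t, w)) < \<rho>)"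
   by (rule exI[of _ U], rule exI[of _ V], rule exI[of _ g], intro conjI[OF l(1)] ballI allI impI, rule V)
 qed
 then show ?thesis
  by (intro exI[of _ c], rule_tac exI[of _ "s - \<eta>"], rule_tac exI[of _ "s + \<eta>"], rule_tac exI[of _ "e' / 3"]) (use \<eta>(1) e'(1) in simp)
qed

lemma near_mono: "near \<rho> c a b e \<Longrightarrow> e' \<le> e \<Longrightarrow> near \<rho> c a b e'"
 unfolding near_def by (meson less_le_trans)

lemma near_cover:
 assumes \<rho>: "\<rho> > 0"
 obtains C e where "finite C" "e > 0" "\<And>c a b. (c, a, b) \<in> C \<Longrightarrow> near \<rho> c a b e"
  "\<And>t. t \<in> {2/3..7/3} \<Longrightarrow> \<exists>(c, a, b)\<in>C. a < t \<and> t < b"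
proof -
 define P where "P = {(c, a, b, e). near \<rho> c a b e \<and> e > 0}"
 define W where "W = (\<lambda>(c::('m, 'e) chart, a::real, b, e::real). {a<..<b})"
 have cov: "{2/3..7/3} \<subseteq> (\<Union>p\<in>P. W p)"
 proof
  fix s :: real assume "s \<in> {2/3..7/3}"
  from near_exists[OF this \<rho>] obtain c a b e where "near \<rho> c a b e" "a < s" "s < b" "e > 0" by (elim exE conjE) (rule that)
  then show "s \<in> (\<Union>p\<in>P. W p)" by (intro UN_I[of "(c, a, b, e)"]) (simp_all add: P_def W_def)
 qed
 have oW: "open (W p)" if "p \<in> P" for p by (cases p) (simp add: W_def)
 obtain P' where P': "P' \<subseteq> P" "finite P'" "{2/3..7/3} \<subseteq> (\<Union>p\<in>P'. W p)"
  by (rule compactE_image[OF compact_Icc oW cov], assumption, rule that)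
 \<comment> \<open>The inserted \<open>1\<close> guarantees a minimum over a nonempty set.\<close>
 define e where "e = Min (insert 1 ((\<lambda>(c, a, b, e). e) ` P'))"
 define C where "C = (\<lambda>(c, a, b, e). (c, a, b)) ` P'"
 have fin: "finite (insert 1 ((\<lambda>(c, a, b, e). e) ` P'))" using P'(2) by simp
 have "e \<in> insert 1 ((\<lambda>(c, a, b, e). e) ` P')" unfolding e_def by (rule Min_in[OF fin]) simp
 then have "e > 0" using P'(1) by (auto simp: P_def)
 moreover have "near \<rho> c a b e" if "(c, a, b) \<in> C" for c a b
 proof -
  obtain e' where e': "(c, a, b, e') \<in> P'" using \<open>(c, a, b) \<in> C\<close> by (auto simp: C_def)
  have "e \<le> e'" unfolding e_def by (rule Min_le[OF fin]) (use e' in force)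
  moreover have "near \<rho> c a b e'" using e' P'(1) by (auto simp: P_def)
  ultimately show ?thesis by (rule near_mono[rotated])
 qed
 moreover have "\<exists>(c, a, b)\<in>C. a < t \<and> t < b" if "t \<in> {2/3..7/3}" for t
 proof -
  obtain c a b e' where p: "(c, a, b, e') \<in> P'" "t \<in> W (c, a, b, e')" using P'(3) \<open>t \<in> {2/3..7/3}\<close> by force
  have "(c, a, b) \<in> C" unfolding C_def using p(1) by force
  then show ?thesis using p(2) by (intro bexI[of _ "(c, a, b)"]) (simp_all add: W_def)
 qed
 moreover have "finite C" using P'(2) by (simp add: C_def)
 ultimately show thesis by (intro that)
qed

text \<open>At each time a small lift exists, and injectivity of \<open>\<Psi> t\<close> makes it
  unique. Hence the lift coincides with the smooth local formula \<open>g (s, snd c (y s))\<close>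
  and is differentiable; and since \<open>Q\<close> of the lift at \<open>t + 1\<close> also lifts
  \<open>y t\<close>, the lift is twisted.\<close>

lemma lifted_solution:
 assumes \<tau>: "\<bar>\<tau>\<bar> < 1/6" and y: "delay_solution A f X \<tau> y" and \<rho>: "\<rho> \<le> r1" "\<And>v. norm v < \<rho> \<Longrightarrow> norm (Q v) < r1"
  and C: "\<And>c a b. (c, a, b) \<in> C \<Longrightarrow> near \<rho> c a b e" "\<And>t. t \<in> {2/3..7/3} \<Longrightarrow> \<exists>(c, a, b)\<in>C. a < t \<and> t < b"
  and cl: "\<And>c a b t. (c, a, b) \<in> C \<Longrightarrow> t \<in> {a..b} \<Longrightarrow> y t \<in> fst c \<and> dist (snd c (y t)) (snd c (x0 t)) < e"
 obtains z where "twisted z" "\<And>t. t \<in> {2/3..7/3} \<Longrightarrow> norm (z t) < \<rho>" "\<And>t. t \<in> {2/3..7/3} \<Longrightarrow> \<Psi> t (z t) = y t"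
  "\<And>t. t \<in> {5/6<..<13/6} \<Longrightarrow> (z has_vector_derivative G (\<tau>, t, z (t - \<tau>), z t)) (at t)"
proof -
 define z0 where "z0 t = (SOME v. norm v < \<rho> \<and> \<Psi> t v = y t)" for t
 have piece: "\<exists>c a b V g. c \<in> A \<and> a < t \<and> t < b \<and> open V \<and> smooth_on V g \<and>
   (\<forall>s\<in>{a..b}. y s \<in> fst c \<and> (s, snd c (y s)) \<in> V \<and> norm (g (s, snd c (y s))) < \<rho> \<and> \<Psi> s (g (s, snd c (y s))) = y s)"
  if t: "t \<in> {2/3..7/3}" for t
 proof -
  obtain c a b where c: "(c, a, b) \<in> C" "a < t" "t < b" using C(2)[OF t] by blast
  obtain U V g where n: "c \<in> A" "lift c U V g" "\<And>s w. s \<in> {a..b} \<Longrightarrow> dist w (snd c (x0 s)) < e \<Longrightarrow> (s, w) \<in> V \<and> norm (g (s, w)) < \<rho>"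
   using C(1)[OF c(1)] unfolding near_def by blast
  note lf = liftD[OF n(2)]
  have "y s \<in> fst c \<and> (s, snd c (y s)) \<in> V \<and> norm (g (s, snd c (y s))) < \<rho> \<and> \<Psi> s (g (s, snd c (y s))) = y s" if s: "s \<in> {a..b}" for s
  proof -
   note ys = cl[OF c(1) s]
   have V: "(s, snd c (y s)) \<in> V" "norm (g (s, snd c (y s))) < \<rho>" using n(3)[OF s conjunct2[OF ys]] by simp_all
   have "(s, g (s, snd c (y s))) \<in> cdom c" using lf(3) lf(8)[OF V(1)] by blast
   then have "\<Psi> s (g (s, snd c (y s))) = chart_inv c (snd c (\<Psi> s (g (s, snd c (y s)))))"
    using inv_chart[OF n(1)] by (simp add: mem_cdom)
   also have "\<dots> = y s" using lf(9)[OF V(1)] inv_chart[OF n(1)] ys by simp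
   finally show ?thesis using V ys by simp
  qed
  then show ?thesis using n(1) c(2,3) lf(4,5)
   by (intro exI[of _ c], rule_tac exI[of _ a], rule_tac exI[of _ b], rule_tac exI[of _ V], rule_tac exI[of _ g]) simp
 qed
 have z0: "norm (z0 t) < \<rho>" "\<Psi> t (z0 t) = y t" if t: "t \<in> {2/3..7/3}" for t
 proof -
  obtain c a b V g where p: "a < t" "t < b" "c \<in> A" "open V" "smooth_on V g" "\<forall>s\<in>{a..b}. y s \<in> fst c \<and> (s, snd c (y s)) \<in> V \<and> norm (g (s, snd c (y s))) < \<rho> \<and> \<Psi> s (g (s, snd c (y s))) = y s"
   using piece[OF t] by (elim exE conjE) (rule that)
  have "norm (g (t, snd c (y t))) < \<rho> \<and> \<Psi> t (g (t, snd c (y t))) = y t" using p(6)[rule_format, of t] p(1,2) by simp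
  then have "norm (z0 t) < \<rho> \<and> \<Psi> t (z0 t) = y t" unfolding z0_def by (rule someI)
  then show "norm (z0 t) < \<rho>" "\<Psi> t (z0 t) = y t" by simp_all
 qed
 have z0_eq: "z0 t = v" if "t \<in> {2/3..7/3}" "norm v < r1" "\<Psi> t v = y t" for t v
  by (rule inj_\<Psi>[OF that(1)]) (use z0[OF that(1)] that \<rho> in auto)
 have seam: "z0 t = Q (z0 (t + 1))" if t: "t \<in> {2/3..4/3}" for t
 proof (rule z0_eq)
  have t1: "t + 1 \<in> {2/3..7/3}" using t by auto
  show Qz: "norm (Q (z0 (t + 1))) < r1" by (rule \<rho>(2)[OF z0(1)[OF t1]])
  have "\<Psi> t (Q (z0 (t + 1))) = \<Psi> (t + 1) (z0 (t + 1))"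
   using less_le_trans[OF z0(1)[OF t1] \<rho>(1)] r1(2) less_le_trans[OF Qz r1(2)] t by (intro seam\<Psi>[symmetric]) auto
  then show "\<Psi> t (Q (z0 (t + 1))) = y t" using z0(2)[OF t1] y by (simp add: delay_solution_def)
 qed (use t in auto)
 \<comment> \<open>\<open>z0\<close> is meaningful on \<open>[2/3, 7/3]\<close> only; the extension
   agrees with it there and is twisted at all times.\<close>
 define z where "z = extend z0"
 have z: "z t = z0 t" if "t \<in> {2/3..7/3}" for t
  unfolding z_def using that seam[of t] seam[of "t - 1"] by (intro extend_eq_at) auto
 have zy: "norm (z t) < \<rho>" "\<Psi> t (z t) = y t" if "t \<in> {2/3..7/3}" for t using z0[OF that] z[OF that] by simp_all
 have "(z has_vector_derivative G (\<tau>, t, z (t - \<tau>), z t)) (at t)" if t: "t \<in> {5/6<..<13/6}" for t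
 proof -
  note tt = times[OF \<tau> t]
  obtain c a b V g where p: "c \<in> A" "a < t" "t < b" "open V" "smooth_on V g"
    "\<forall>s\<in>{a..b}. y s \<in> fst c \<and> (s, snd c (y s)) \<in> V \<and> norm (g (s, snd c (y s))) < \<rho> \<and> \<Psi> s (g (s, snd c (y s))) = y s"
   using piece[OF tt(3)] by (elim exE conjE) (rule that)
  define N where "N = {a<..<b} \<inter> {2/3<..<7/3}"
  have N: "open N" "t \<in> N" using p(2,3) t by (auto simp: N_def)
  have zN: "g (s, snd c (y s)) = z s" "y s \<in> fst c" "(s, snd c (y s)) \<in> V" if "s \<in> N" for s
  proof -
   have s: "s \<in> {a..b}" "s \<in> {2/3..7/3}" using that by (auto simp: N_def)
   note q = p(6)[rule_format, OF s(1)]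
   show "g (s, snd c (y s)) = z s" using z0_eq[OF s(2), of "g (s, snd c (y s))"] q \<rho>(1) z[OF s(2)] by simp
   show "y s \<in> fst c" "(s, snd c (y s)) \<in> V" using q by simp_all
  qed
  define v where "v = tangent_scale (f t (y (t - \<tau>))) (X t (y t))"
  have yd: "((\<lambda>s. snd c (y s)) has_vector_derivative v c) (at t)"
   using y p(1) zN(2)[OF N(2)] by (simp add: delay_solution_def has_velocity_def v_def o_def)
  define g' where "g' = fderiv g (t, snd c (y t)) (1, v c)"
  have Dg: "(g has_derivative fderiv g (t, snd c (y t))) (at (t, snd c (y t)))"
   by (rule smooth_on_has_derivative[OF p(5) zN(3)[OF N(2)]])
  have "((\<lambda>s. (s, snd c (y s))) has_derivative (\<lambda>k. k *\<^sub>R (1, v c))) (at t)"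
   using has_derivative_Pair[OF has_derivative_ident yd[unfolded has_vector_derivative_def]] by simp
  from has_derivative_compose[OF this Dg] have "((\<lambda>s. g (s, snd c (y s))) has_vector_derivative g') (at t)"
   unfolding has_vector_derivative_def g'_def linear_scale[OF has_derivative_linear[OF Dg]] .
  then have zd: "(z has_vector_derivative g') (at t)" by (rule has_vector_derivative_transform_within_open[OF _ N zN(1)])
  have zb: "z t \<in> ball 0 r1" "\<Psi> t (z t) \<in> fst c" using zy[OF tt(3)] \<rho>(1) zN(2)[OF N(2)] by auto
  have "((\<lambda>s. snd c (\<Psi> s (z s))) has_vector_derivative DF c (t, z t) (1, g')) (at t)"
   by (rule curve_derivative[OF p(1) in_cdom[OF tt(3) zb] zd])
  moreover have "((\<lambda>s. snd c (\<Psi> s (z s))) has_vector_derivative v c) (at t)"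
   by (rule has_vector_derivative_transform_within_open[OF yd N]) (use zy(2) in \<open>auto simp: N_def\<close>)
  ultimately have "DF c (t, z t) (1, g') = v c" by (rule vector_derivative_unique_at)
  moreover have "v = speed \<tau> t (z (t - \<tau>)) (z t)" using zy(2)[OF tt(3)] zy(2)[OF tt(4)] by (simp add: v_def speed_def)
  ultimately have "sol \<tau> t (z (t - \<tau>)) (z t) g'" by (intro solI[OF tt(3) zb(1) p(1) zb(2)]) simp
  then show ?thesis using zd G_eqI[OF tt(3) zb(1)] by simp
 qed
 then show thesis using that[OF _ zy] twisted_extend[of z0] by (simp add: z_def)
qed

text \<open>Closeness is measured here uniformly on finitely many chart pieces along the orbit; a
  Sobolev neighbourhood will be seen to imply it.\<close>

theorem delay_solutions:
 obtains \<tau>1 x C e where "0 < \<tau>1" "x 0 = x0" "\<And>\<tau>. \<bar>\<tau>\<bar> < \<tau>1 \<Longrightarrow> delay_solution A f X \<tau> (x \<tau>)"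
  "smooth_into ({-\<tau>1<..<\<tau>1} \<times> UNIV) (case_prod x)" "finite C" "C \<noteq> {}" "0 < e"
  "\<And>c a b. (c, a, b) \<in> C \<Longrightarrow> c \<in> A \<and> a < b \<and> x0 ` {a..b} \<subseteq> fst c"
  "\<And>\<tau> y. \<bar>\<tau>\<bar> < \<tau>1 \<Longrightarrow> delay_solution A f X \<tau> y \<Longrightarrow>
   (\<And>c a b t. (c, a, b) \<in> C \<Longrightarrow> t \<in> {a..b} \<Longrightarrow> y t \<in> fst c \<and> dist (snd c (y t)) (snd c (x0 t)) < e) \<Longrightarrow> y = x \<tau>"
proof -
 have six: "0 < (1/6::real)" "(1/6::real) \<le> 1/6" by simp_all
 have Gs: "smooth_on ({-(1/6)<..<1/6} \<times> {5/6<..<13/6} \<times> ball 0 r1 \<times> ball 0 r1) G" using G_smooth by simp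
 obtain \<tau>1 \<rho> z where \<tau>1': "\<tau>1 \<le> 1/6" "0 < \<tau>1" and \<rho>': "\<rho> < r1" "0 < \<rho>"
  and zs: "smooth_on ({-\<tau>1<..<\<tau>1} \<times> UNIV) (case_prod z)"
  and ztw: "\<And>\<tau>. \<bar>\<tau>\<bar> < \<tau>1 \<Longrightarrow> twisted (z \<tau>)" and z0: "\<And>t. z 0 t = 0"
  and zn: "\<And>\<tau> t. \<bar>\<tau>\<bar> < \<tau>1 \<Longrightarrow> t \<in> {0..3} \<Longrightarrow> norm (z \<tau> t) \<le> \<rho>"
  and zG: "\<And>\<tau> t. \<bar>\<tau>\<bar> < \<tau>1 \<Longrightarrow> t \<in> {5/6<..<13/6} \<Longrightarrow> (z \<tau> has_vector_derivative G (\<tau>, t, z \<tau> (t - \<tau>), z \<tau> t)) (at t)"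
  and zu: "\<And>\<tau> w t. \<bar>\<tau>\<bar> < \<tau>1 \<Longrightarrow> twisted w \<Longrightarrow> (\<And>t. t \<in> {2/3..7/3} \<Longrightarrow> norm (w t) \<le> \<rho>) \<Longrightarrow>
   (\<And>t. t \<in> {5/6<..<13/6} \<Longrightarrow> (w has_vector_derivative G (\<tau>, t, w (t - \<tau>), w t)) (at t)) \<Longrightarrow> w t = z \<tau> t"
  apply (rule delay_problem[OF six r1(1) Gs G_seam G_center G_derivative_center], assumption+)
  subgoal premises p for \<tau>1 \<rho> z by (rule that[of \<tau>1 \<rho> z]) (fact p)+
  done
 note \<tau>1 = \<tau>1'(2,1) and \<rho> = \<rho>'(2,1)
 \<comment> \<open>\<open>1 + frac t\<close> is the representative of \<open>t\<close> in
   \<open>[1, 2)\<close>, so the loop is periodic by construction. \<open>x_eq\<close> then shows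
   that every time in the domain of \<Psi> gives the same point.\<close>
 define x where "x \<tau> t = \<Psi> (1 + frac t) (z \<tau> (1 + frac t))" for \<tau> t
 have x_per: "x \<tau> (t + 1) = x \<tau> t" for \<tau> t by (simp add: x_def frac_def)
 have x_eq: "x \<tau> t = \<Psi> t (z \<tau> t)" if \<tau>: "\<bar>\<tau>\<bar> < \<tau>1" and t: "t \<in> {7/12<..<29/12}" for \<tau> t
 proof -
  have sm: "\<Psi> (s + 1) (z \<tau> (s + 1)) = \<Psi> s (z \<tau> s)" if s: "s \<in> {7/12<..<17/12}" for s
  proof -
   have Qz: "Q (z \<tau> (s + 1)) = z \<tau> s" using twistedD[OF ztw[OF \<tau>], of s] by (rule sym)
   have "\<Psi> (s + 1) (z \<tau> (s + 1)) = \<Psi> s (Q (z \<tau> (s + 1)))"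
    using zn[OF \<tau>, of s] zn[OF \<tau>, of "s + 1"] s \<rho> r1(2) by (intro seam\<Psi>) (auto simp: Qz)
   then show ?thesis by (simp add: Qz)
  qed
  consider "t < 1" | "1 \<le> t" "t < 2" | "2 \<le> t" by linarith
  then show ?thesis
  proof cases
   case 1
   then have "frac t = t" using t by (simp add: frac_eq)
   then show ?thesis using sm[of t] 1 t by (simp add: x_def add.commute)
  next
   case 2
   then have "\<lfloor>t\<rfloor> = 1" by (simp add: floor_eq_iff)
   then show ?thesis by (simp add: x_def frac_def)
  next
   case 3
   then have "\<lfloor>t\<rfloor> = 2" using t by (simp add: floor_eq_iff)
   then show ?thesis using sm[of "t - 1"] 3 t by (simp add: x_def frac_def)
  qed
 qed
 have x_int: "x \<tau> (t - of_int n) = x \<tau> t" for \<tau> t n using periodic_int[of "x \<tau>" t "- n"] x_per by simp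
 have "x 0 t = x0 t" for t
 proof -
  have "1 + frac t \<in> {7/12<..<29/12}" using frac_ge_0[of t] frac_lt_1[of t] unfolding greaterThanLessThan_iff by linarith
  then have "x 0 t = x0 (1 + frac t)" using center by (simp add: x_def z0)
  also have "1 + frac t = t + of_int (1 - \<lfloor>t\<rfloor>)" by (simp add: frac_def)
  finally show ?thesis unfolding periodic_int[of x0, OF x0_periodic] .
 qed
 then have x0: "x 0 = x0" by (rule ext)
 have sol: "delay_solution A f X \<tau> (x \<tau>)" if \<tau>: "\<bar>\<tau>\<bar> < \<tau>1" for \<tau>
  unfolding delay_solution_def
 proof (intro conjI allI x_per)
  fix t :: real
  \<comment> \<open>The time is moved into \<open>[1, 2)\<close>, where \<open>zG\<close> applies
    with room for the delay; periodicity of \<open>f\<close>, \<open>X\<close> and the loop moves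
    the velocity back.\<close>
  define n where "n = \<lfloor>t\<rfloor> - 1"
  define s where "s = t - of_int n"
  have s: "s \<in> {1..<2}" unfolding s_def n_def by (simp add: algebra_simps) linarith
  have \<tau>': "\<bar>\<tau>\<bar> < 1/6" using \<tau> \<tau>1 by simp
  have sI: "s \<in> {5/6<..<13/6}" "s \<in> {7/12<..<29/12}" using s by auto
  note ss = times[OF \<tau>' sI(1)]
  have b: "z \<tau> s \<in> ball 0 r1" using zn[OF \<tau>, of s] s \<rho> by auto
  obtain c where c: "c \<in> A" "\<Psi> s (z \<tau> s) \<in> fst c" using chart_at by blast
  have "sol \<tau> s (z \<tau> (s - \<tau>)) (z \<tau> s) (G (\<tau>, s, z \<tau> (s - \<tau>), z \<tau> s))" by (rule G_sol[OF ss(3) b])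
  then have "DF c (s, z \<tau> s) (1, G (\<tau>, s, z \<tau> (s - \<tau>), z \<tau> s)) = speed \<tau> s (z \<tau> (s - \<tau>)) (z \<tau> s) c"
   using c by (simp add: sol_def)
  from curve_velocity[OF c(1) in_cdom[OF ss(3) b c(2)] zG[OF \<tau> sI(1)] speed_tangent this]
  have "has_velocity A (\<lambda>s. \<Psi> s (z \<tau> s)) (speed \<tau> s (z \<tau> (s - \<tau>)) (z \<tau> s)) s UNIV" .
  then have "has_velocity A (x \<tau>) (speed \<tau> s (z \<tau> (s - \<tau>)) (z \<tau> s)) s UNIV"
   by (rule has_velocity_cong[where N = "{7/12<..<29/12}"]) (use sI x_eq[OF \<tau>] in auto)
  then have "has_velocity A (\<lambda>t. x \<tau> (t + - of_int n)) (speed \<tau> s (z \<tau> (s - \<tau>)) (z \<tau> s)) t UNIV"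
   by (intro has_velocity_shift) (simp add: s_def)
  moreover have "speed \<tau> s (z \<tau> (s - \<tau>)) (z \<tau> s) = tangent_scale (f t (x \<tau> (t - \<tau>))) (X t (x \<tau> t))"
  proof -
   have "\<Psi> s (z \<tau> s) = x \<tau> s" "\<Psi> (s - \<tau>) (z \<tau> (s - \<tau>)) = x \<tau> (s - \<tau>)"
    using x_eq[OF \<tau>, of s] x_eq[OF \<tau>, of "s - \<tau>"] sI ss(2) by (simp_all add: I_def)
   moreover have "x \<tau> s = x \<tau> t" "x \<tau> (s - \<tau>) = x \<tau> (t - \<tau>)"
    using x_int[of \<tau> t n] x_int[of \<tau> "t - \<tau>" n] by (simp_all add: s_def algebra_simps)
   moreover have "f s = f t" "X s = X t"
    using periodic_int[of f t "- n"] periodic_int[of X t "- n"] f_periodic X_periodic by (simp_all add: s_def)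
   ultimately show ?thesis by (simp add: speed_def)
  qed
  ultimately show "has_velocity A (x \<tau>) (tangent_scale (f t (x \<tau> (t - \<tau>))) (X t (x \<tau> t))) t UNIV"
   by (simp add: x_int)
 qed
 have sm: "smooth_into ({-\<tau>1<..<\<tau>1} \<times> UNIV) (case_prod x)"
 proof (rule smooth_into_locally)
  fix p assume p: "p \<in> {-\<tau>1<..<\<tau>1} \<times> (UNIV::real set)"
  define n where "n = \<lfloor>snd p\<rfloor> - 1"
  define N where "N = {-\<tau>1<..<\<tau>1} \<times> {7/12 + of_int n<..<29/12 + of_int n :: real}"
  have N: "open N" by (auto simp: N_def open_Times)
  define h where "h = (\<lambda>p::real \<times> real. (snd p - of_int n, z (fst p) (snd p - of_int n)))"
  have oP: "open ({-\<tau>1<..<\<tau>1} \<times> (UNIV::real set))" by (auto simp: open_Times)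
  have "smooth_on N (\<lambda>p. (case_prod z) (fst p, snd p - of_int n))"
   by (intro smooth_on_compose[OF N oP _ zs] smooth_on_Pair smooth_on_fst smooth_on_snd smooth_on_diff N smooth_on_id smooth_on_const) (auto simp: N_def)
  then have h: "smooth_on N h"
   unfolding h_def by (intro smooth_on_Pair smooth_on_snd smooth_on_diff N smooth_on_id smooth_on_const) simp
  have hN: "h p \<in> {7/12<..<29/12} \<times> ball 0 r0" if "p \<in> N" for p
  proof -
   have "norm (z (fst p) (snd p - of_int n)) \<le> \<rho>" using that by (intro zn) (auto simp: N_def)
   then show ?thesis using that \<rho> r1(2) by (auto simp: h_def N_def)
  qed
  have "smooth_into N (\<lambda>p. (case_prod \<Psi>) (h p))" by (rule smooth_into_compose[OF \<Psi> N h hN])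
  moreover have "p \<in> N"
  proof -
   have "of_int \<lfloor>snd p\<rfloor> \<le> snd p" "snd p < of_int \<lfloor>snd p\<rfloor> + 1" by (rule of_int_floor_le) linarith
   then have "snd p \<in> {7/12 + of_int n<..<29/12 + of_int n}" unfolding n_def greaterThanLessThan_iff by (simp del: of_int_floor_le) linarith
   then show ?thesis using p by (simp add: N_def mem_Times_iff)
  qed
  moreover have "(case_prod x) q = (case_prod \<Psi>) (h q)" if "q \<in> N" for q
  proof -
   have "x (fst q) (snd q - of_int n) = \<Psi> (snd q - of_int n) (z (fst q) (snd q - of_int n))"
    using that by (intro x_eq) (auto simp: N_def)
   then show ?thesis by (simp add: h_def case_prod_beta x_int)
  qed
  ultimately show "\<exists>N q'. p \<in> N \<and> smooth_into N q' \<and> (\<forall>q\<in>N. (case_prod x) q = q' q)"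
   by (intro exI[of _ N], rule_tac exI[of _ "\<lambda>p. (case_prod \<Psi>) (h p)"]) simp
 qed (auto simp: open_Times)
 obtain CQ where CQ: "CQ > 0" "\<And>v. norm (Q v) \<le> CQ * norm v" using Q_ball by blast
 \<comment> \<open>\<open>Q\<close> maps the ball of radius \<open>\<rho>'\<close> into the ball on which \<open>\<Psi>\<close> is injective.\<close>
 define \<rho>' where "\<rho>' = min \<rho> (r1 / CQ)"
 have \<rho>': "\<rho>' > 0" "\<rho>' \<le> \<rho>" "\<rho>' \<le> r1 / CQ" using \<rho> r1(1) CQ(1) by (simp_all add: \<rho>'_def)
 have Q\<rho>: "norm (Q v) < r1" if "norm v < \<rho>'" for v
 proof -
  have "norm v < r1 / CQ" using that \<rho>'(3) by simp
  then have "CQ * norm v < r1" using CQ(1) by (simp add: pos_less_divide_eq mult.commute)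
  then show ?thesis using CQ(2)[of v] by simp
 qed
 obtain C e where C: "finite C" "e > 0" "\<And>c a b. (c, a, b) \<in> C \<Longrightarrow> near \<rho>' c a b e"
  "\<And>t. t \<in> {2/3..7/3} \<Longrightarrow> \<exists>(c, a, b)\<in>C. a < t \<and> t < b"
  by (rule near_cover[OF \<rho>'(1)], rule that)
 have Cn: "c \<in> A \<and> a < b \<and> x0 ` {a..b} \<subseteq> fst c" if "(c, a, b) \<in> C" for c a b using C(3)[OF that] by (simp add: near_def)
 have uniq: "y = x \<tau>" if \<tau>: "\<bar>\<tau>\<bar> < \<tau>1" and y: "delay_solution A f X \<tau> y"
  and cl: "\<And>c a b t. (c, a, b) \<in> C \<Longrightarrow> t \<in> {a..b} \<Longrightarrow> y t \<in> fst c \<and> dist (snd c (y t)) (snd c (x0 t)) < e" for \<tau> y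
 proof -
  have \<tau>': "\<bar>\<tau>\<bar> < 1/6" "\<rho>' \<le> r1" using \<tau> \<tau>1 \<rho> \<rho>' by simp_all
  obtain w where w: "twisted w" "\<And>t. t \<in> {2/3..7/3} \<Longrightarrow> norm (w t) < \<rho>'" "\<And>t. t \<in> {2/3..7/3} \<Longrightarrow> \<Psi> t (w t) = y t"
   "\<And>t. t \<in> {5/6<..<13/6} \<Longrightarrow> (w has_vector_derivative G (\<tau>, t, w (t - \<tau>), w t)) (at t)"
   by (rule lifted_solution[OF \<tau>'(1) y \<tau>'(2) Q\<rho> C(3,4) cl]; (assumption | rule that))
  have wn: "norm (w t) \<le> \<rho>" if "t \<in> {2/3..7/3}" for t using w(2)[OF that] \<rho>'(2) by simp
  have wz: "w t = z \<tau> t" for t by (rule zu[OF \<tau> w(1) wn w(4)])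
  have yx: "y t = x \<tau> t" if "t \<in> {2/3..7/3}" for t using w(3)[OF that] x_eq[OF \<tau>, of t] wz[of t] that by simp
  show ?thesis
  proof
   fix t :: real
   have "1 + frac t \<in> {2/3..7/3}" using frac_ge_0[of t] frac_lt_1[of t] unfolding atLeastAtMost_iff by linarith
   moreover have e: "1 + frac t = t + of_int (1 - \<lfloor>t\<rfloor>)" by (simp add: frac_def)
   moreover have "y (t + of_int (1 - \<lfloor>t\<rfloor>)) = y t" using y by (intro periodic_int) (simp add: delay_solution_def)
   moreover have "x \<tau> (t + of_int (1 - \<lfloor>t\<rfloor>)) = x \<tau> t" by (intro periodic_int x_per)
   ultimately show "y t = x \<tau> t" using yx[of "1 + frac t"] by (simp only:)
  qed
 qed
 have "C \<noteq> {}" using C(4)[of 1] by auto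
 show thesis by (rule that[OF \<tau>1(1) x0 sol sm C(1) \<open>C \<noteq> {}\<close> C(2) Cn uniq])
qed

end

section \<open>The tube of a non-degenerate orbit\<close>

text \<open>The functions \<open>x\<^sup>-\<^sup>k exp(-1/x)\<close> span a space that is closed under differentiation.\<close>

definition flat :: "nat \<Rightarrow> real \<Rightarrow> real" where
 "flat k x = (if x > 0 then inverse x ^ k * exp (- inverse x) else 0)"

lemma flat_tendsto: "(flat k \<longlongrightarrow> 0) (at 0)"
proof (rule filterlim_split_at)
 show "(flat k \<longlongrightarrow> 0) (at_left 0)"
  by (rule tendsto_eventually) (auto simp: flat_def eventually_at_filter)
 have "((\<lambda>x. inverse x ^ k / exp (inverse x)) \<longlongrightarrow> 0) (at_right (0::real))"
  by (rule filterlim_compose[OF tendsto_power_div_exp_0 filterlim_inverse_at_top_right])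
 then show "(flat k \<longlongrightarrow> 0) (at_right 0)"
  by (rule Lim_transform_eventually) (auto simp: flat_def eventually_at_filter exp_minus divide_inverse)
qed

lemma flat_derivative: "(flat k has_real_derivative flat (k + 2) x - real k * flat (k + 1) x) (at x)"
proof -
 consider "x > 0" | "x = 0" | "x < 0" by linarith
 then show ?thesis
 proof cases
  case 1
  have "((\<lambda>x. inverse x ^ k * exp (- inverse x)) has_real_derivative flat (k + 2) x - real k * flat (k + 1) x) (at x)"
  proof (cases k)
   case 0
   then show ?thesis using 1 by (auto intro!: derivative_eq_intros simp: flat_def power2_eq_square)
  next
   case (Suc j)
   have "((\<lambda>x. inverse x ^ k) has_real_derivative - (real k * inverse x ^ Suc k)) (at x)"
    using DERIV_power_Suc[OF DERIV_inverse, of x j] 1 by (simp add: Suc algebra_simps)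
   moreover have "((\<lambda>x. exp (- inverse x)) has_real_derivative exp (- inverse x) * inverse x ^ 2) (at x)"
    using 1 by (auto intro!: derivative_eq_intros simp: power2_eq_square)
   ultimately have "((\<lambda>x. inverse x ^ k * exp (- inverse x)) has_real_derivative
     inverse x ^ k * (exp (- inverse x) * inverse x ^ 2) + - (real k * inverse x ^ Suc k) * exp (- inverse x)) (at x)"
    by (rule DERIV_mult')
   then show ?thesis using 1 by (simp add: flat_def power2_eq_square algebra_simps)
  qed
  then show ?thesis by (rule has_field_derivative_transform_within_open[of _ _ _ "{0<..}"]) (use 1 in \<open>auto simp: flat_def\<close>)
 next
  case 2
  \<comment> \<open>The difference quotient of \<open>flat k\<close> at \<open>0\<close> is
    \<open>flat (k + 1)\<close>.\<close>
  have "((\<lambda>h. (flat k (0 + h) - flat k 0) / h) \<longlongrightarrow> 0) (at 0)"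
   by (rule Lim_transform_eventually[OF flat_tendsto[of "k + 1"]])
    (auto simp: flat_def eventually_at_filter divide_inverse mult_ac)
  then show ?thesis using 2 by (simp add: DERIV_def flat_def)
 next
  case 3
  show ?thesis
   by (rule has_field_derivative_transform_within_open[of "\<lambda>x. 0" _ _ "{..<0}"]) (use 3 in \<open>auto simp: flat_def\<close>)
 qed
qed

lemma flat_smooth: "smooth_on UNIV (flat k)"
proof -
 have "Ck_on n UNIV (flat k)" for n
 proof (induction n arbitrary: k)
  case 0
  then show ?case using DERIV_isCont[OF flat_derivative] by (simp add: continuous_on_eq_continuous_at)
 next
  case (Suc n)
  show ?case
  proof (rule Ck_on_SucI)
   show "(flat k has_derivative (\<lambda>v. v *\<^sub>R (flat (k + 2) x - real k *\<^sub>R flat (k + 1) x))) (at x)" for x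
    using flat_derivative[of k x] by (simp add: has_field_derivative_def mult_commute_abs)
   show "Ck_on n UNIV (\<lambda>x. v *\<^sub>R (flat (k + 2) x - real k *\<^sub>R flat (k + 1) x))" for v
    by (intro Ck_on_scaleR Ck_on_diff Suc.IH open_UNIV Ck_on_const)
  qed simp
 qed
 then show ?thesis by (simp add: smooth_on_def)
qed

lemma smooth_step:
 fixes a b :: real
 assumes "a < b"
 obtains \<beta> where "smooth_on UNIV \<beta>" "\<And>t. t \<le> a \<Longrightarrow> \<beta> t = 0" "\<And>t. t \<ge> b \<Longrightarrow> \<beta> t = 1" "\<And>t. 0 \<le> \<beta> t" "\<And>t. \<beta> t \<le> (1::real)"
proof -
 define n where "n t = flat 0 (t - a) + flat 0 (b - t)" for t
 define \<beta> where "\<beta> t = flat 0 (t - a) / n t" for t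
 have ge: "flat 0 t \<ge> 0" for t by (simp add: flat_def)
 have gt: "t > 0 \<Longrightarrow> flat 0 t > 0" for t by (simp add: flat_def)
 have n: "n t > 0" for t
 proof (cases "t > a")
  case True
  then show ?thesis using gt[of "t - a"] ge[of "b - t"] by (simp add: n_def)
 next
  case False
  then show ?thesis using gt[of "b - t"] ge[of "t - a"] assms by (simp add: n_def)
 qed
 have s: "smooth_on UNIV (\<lambda>t. flat 0 (t - a))" "smooth_on UNIV (\<lambda>t. flat 0 (b - t))"
  by (intro smooth_on_compose[OF _ _ _ flat_smooth] smooth_on_diff smooth_on_const smooth_on_id open_UNIV UNIV_I)+
 have "smooth_on UNIV \<beta>"
  unfolding smooth_on_def
 proof
  fix k
  have sn: "Ck_on k UNIV n" using s unfolding n_def smooth_on_def by (intro Ck_on_add) auto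
  \<comment> \<open>Division by \<open>n\<close> is read as solving a linear equation for
    \<beta>.\<close>
  show "Ck_on k UNIV \<beta>"
  proof (rule Ck_on_solve_linear[OF open_UNIV, of "\<lambda>t h. n t *\<^sub>R (h::real)"])
   show "linear (\<lambda>h. n t *\<^sub>R (h::real))" for t by (simp add: linear_iff algebra_simps)
   show "inj (\<lambda>h. n t *\<^sub>R (h::real))" for t using less_imp_neq[OF n[of t]] by (simp add: inj_def)
   show "Ck_on k UNIV (\<lambda>t. n t *\<^sub>R (h::real))" for h by (intro Ck_on_scaleR sn Ck_on_const open_UNIV)
   show "Ck_on k UNIV (\<lambda>t. flat 0 (t - a))" using s by (simp add: smooth_on_def)
   show "n t *\<^sub>R \<beta> t = flat 0 (t - a)" for t using n[of t] by (simp add: \<beta>_def)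
  qed
 qed
 moreover have "\<beta> t = 0" if "t \<le> a" for t using that by (simp add: \<beta>_def flat_def)
 moreover have "\<beta> t = 1" if "t \<ge> b" for t using that n[of t] by (simp add: \<beta>_def n_def flat_def)
 moreover have "0 \<le> \<beta> t" for t using ge[of "t - a"] n[of t] by (simp add: \<beta>_def)
 moreover have "\<beta> t \<le> 1" for t using ge[of "b - t"] n[of t] by (simp add: \<beta>_def n_def)
 ultimately show thesis by (rule that)
qed

section \<open>The return map of the orbit in a chart\<close>

locale orbit_box = atlas A
 for A :: "('m::{t2_space, second_countable_topology}, 'e::euclidean_space) chart set" +
 fixes Y :: "real \<Rightarrow> 'm \<Rightarrow> ('m, 'e) tangent_vector" and x0 :: "real \<Rightarrow> 'm" and c0 :: "('m, 'e) chart"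
  and V :: "'e set" and \<epsilon> :: real and \<Phi> :: "real \<Rightarrow> 'e \<Rightarrow> 'm"
 assumes Y: "smooth_field Y" and Y_periodic: "\<And>t. Y (t + 1) = Y t" and orbit: "periodic_orbit A Y x0"
  and c0: "c0 \<in> A" "x0 0 \<in> fst c0" and V: "open V" "snd c0 (x0 0) \<in> V" "V \<subseteq> snd c0 ` fst c0"
  and \<epsilon>: "0 < \<epsilon>" and box: "flow_box Y {-\<epsilon><..<3 + \<epsilon>} V \<Phi>" and \<Phi>0: "\<And>u. u \<in> V \<Longrightarrow> \<Phi> 0 u = chart_inv c0 u"
begin

definition "u0 = snd c0 (x0 0)"

definition "T = {-\<epsilon><..<3 + \<epsilon>}"

lemma x0: "integral_curve_on A Y UNIV x0" "x0 1 = x0 0"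
proof -
 have "x0 (0 + 1) = x0 0" using orbit unfolding periodic_orbit_def by blast
 then show "x0 1 = x0 0" by simp
qed (use orbit in \<open>simp add: periodic_orbit_def\<close>)

lemma u0: "u0 \<in> V" "chart_inv c0 u0 = x0 0"
 using V(2) inv_chart[OF c0] by (simp_all add: u0_def)

lemma curve: "u \<in> V \<Longrightarrow> S \<subseteq> T \<Longrightarrow> integral_curve_on A Y S (\<lambda>t. \<Phi> t u)"
 unfolding T_def by (rule flow_box_curve[OF box])

lemma center: "t \<in> T \<Longrightarrow> \<Phi> t u0 = x0 t"
 by (rule integral_curve_unique[OF Y _ curve[OF u0(1) order_refl] integral_curve_subset[OF x0(1)], of 0])
  (use \<Phi>0[OF u0(1)] u0 \<epsilon> in \<open>auto simp: T_def\<close>)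

lemma slice: "t \<in> T \<Longrightarrow> smooth_into V (\<Phi> t)"
 unfolding T_def by (rule flow_box_at[OF box _ V(1)])

definition "N = V \<inter> \<Phi> 1 -` fst c0"

text \<open>The time-1-map of the flow read in the chart \<open>c0\<close>; periodicity of the orbit
  makes \<open>u0\<close> a fixed point.\<close>

definition "P = (\<lambda>u. snd c0 (\<Phi> 1 u))"

lemma T01: "0 \<in> T" "1 \<in> T"
 using \<epsilon> by (auto simp: T_def)

lemma N: "open N" "u0 \<in> N"
 unfolding N_def using smooth_into_open_vimage[OF slice[OF T01(2)] open_dom[OF c0(1)]] u0(1) center[OF T01(2)] x0(2) c0(2) by auto

lemma P: "smooth_on N P" "P u0 = u0"
 unfolding N_def P_def using smooth_into_chart[OF slice[OF T01(2)] c0(1)] center[OF T01(2)] x0(2) by (auto simp: u0_def)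

lemma slice_injective:
 assumes "t \<in> T" "c \<in> A" "x0 t \<in> fst c" "fderiv (\<lambda>u. snd c (\<Phi> t u)) u0 h = 0"
 shows "h = 0"
 using T01(1) assms(1) unfolding T_def
 by (rule flow_box_derivative_injective[OF Y x0(1) box V(1) u0(1) _ _ c0(1) V(3) \<Phi>0 u0_def c0(2) assms(2,3,4)])

lemma P_injective: "fderiv P u0 h = 0 \<Longrightarrow> h = 0"
 unfolding P_def using slice_injective[OF T01(2) c0(1)] x0(2) c0(2) by simp

lemma integral_curve_shift:
 assumes "integral_curve_on A Y {a + 1<..<b + 1} x"
 shows "integral_curve_on A Y {a<..<b} (\<lambda>t. x (t + 1))"
proof -
 have "has_velocity A (\<lambda>t. x (t + 1)) (Y t (x (t + 1))) t {a<..<b}" if t: "t \<in> {a<..<b}" for t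
 proof -
  have "t + 1 \<in> {a + 1<..<b + 1}" using t by simp
  then have v: "has_velocity A x (Y (t + 1) (x (t + 1))) (t + 1) {a + 1<..<b + 1}"
   using assms unfolding integral_curve_on_def by blast
  have "at (t + 1) within {a + 1<..<b + 1} = at (t + 1)" using t by (intro at_within_open) auto
  then have "has_velocity A x (Y t (x (t + 1))) (t + 1) UNIV"
   using v by (simp add: has_velocity_def Y_periodic)
  from has_velocity_within_subset[OF has_velocity_shift[OF this]] show ?thesis by blast
 qed
 then show ?thesis by (simp add: integral_curve_on_def)
qed

text \<open>Both sides are integral curves, the left one by periodicity of the field, and they agree
  at \<open>t = 0\<close>. The box reaches beyond time 3, so \<open>t + 1\<close> is available for
  all \<open>t\<close> in \<open>[0, 2]\<close>.\<close>

lemma return_map: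
 assumes "u \<in> N" "P u \<in> V" "t \<in> {0..2}"
 shows "\<Phi> (t + 1) u = \<Phi> t (P u)"
proof (rule integral_curve_unique[OF Y, of "{-\<epsilon><..<2 + \<epsilon>}" "\<lambda>t. \<Phi> (t + 1) u" "\<lambda>t. \<Phi> t (P u)" 0])
 have "u \<in> V" using assms(1) by (simp add: N_def)
 then show "integral_curve_on A Y {-\<epsilon><..<2 + \<epsilon>} (\<lambda>t. \<Phi> (t + 1) u)"
  by (intro integral_curve_shift curve) (auto simp: T_def)
 show "integral_curve_on A Y {-\<epsilon><..<2 + \<epsilon>} (\<lambda>t. \<Phi> t (P u))"
  using assms(2) by (intro curve) (auto simp: T_def)
 show "\<Phi> (0 + 1) u = \<Phi> 0 (P u)" using \<Phi>0[OF assms(2)] inv_chart[OF c0(1)] assms(1) by (simp add: P_def N_def)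
qed (use \<epsilon> assms(3) in auto)

lemma flow_one: "u \<in> V \<Longrightarrow> flow A Y 1 (chart_inv c0 u) = \<Phi> 1 u"
 by (rule flow_eq[OF Y curve]) (use \<Phi>0 \<epsilon> in \<open>auto simp: T_def closed_segment_eq_real_ivl\<close>)

text \<open>A fixed vector \<open>h\<close> in coordinates is spread over all charts by the
  transition maps; the resulting tangent vector is fixed by the differential of the time-1-map.
  \<open>differential\<close> computes in the chart picked by \<open>SOME\<close>, so
  \<open>c0\<close> has to be that chart.\<close>

lemma P_no_fixed:
 assumes nd: "\<not> (\<exists>v\<in>tangent_space A (x0 0). v \<noteq> (\<lambda>c. 0) \<and> differential A (flow A Y 1) (x0 0) v = v)"
  and c0_eq: "c0 = (SOME c. c \<in> A \<and> x0 0 \<in> fst c)" and h: "fderiv P u0 h = h"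
 shows "h = 0"
proof (rule ccontr)
 assume h0: "h \<noteq> 0"
 define tr where "tr c d = (\<lambda>y. snd d (chart_inv c y))" for c d :: "('m, 'e) chart"
 define p where "p = x0 0"
 have tr: "(tr c d has_derivative fderiv (tr c d) (snd c p)) (at (snd c p))"
  if "c \<in> A" "d \<in> A" "p \<in> fst c" "p \<in> fst d" for c d
  unfolding tr_def by (rule smooth_on_has_derivative[OF transition_smooth[OF that(1,2)]]) (use that in blast)
 define v where "v d = (if d \<in> A \<and> p \<in> fst d then fderiv (tr c0 d) u0 h else 0)" for d
 have vD: "v d = fderiv (tr c0 d) u0 h" if "d \<in> A" "p \<in> fst d" for d using that by (simp add: v_def)
 have vc0: "v c0 = h"
 proof -
  have "(tr c0 c0 has_derivative (\<lambda>h. h)) (at u0)"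
   by (rule has_derivative_transform_within_open[OF has_derivative_ident V(1) u0(1)])
    (use V(3) chart_inv_chart[OF c0(1)] in \<open>auto simp: tr_def\<close>)
  then have "fderiv (tr c0 c0) u0 = (\<lambda>h. h)" by (rule frechet_derivative_at[symmetric])
  then show ?thesis using c0 by (simp add: v_def p_def)
 qed
 have chain: "v d = fderiv (tr c d) (snd c p) (v c)" if cd: "c \<in> A" "d \<in> A" "p \<in> fst c" "p \<in> fst d" for c d
 proof -
  define W where "W = snd c0 ` (fst c0 \<inter> fst c)"
  have W: "open W" "u0 \<in> W" unfolding W_def using open_overlap[OF c0(1) cd(1)] c0(2) cd(3) by (auto simp: u0_def p_def)
  have 1: "(tr c0 c has_derivative fderiv (tr c0 c) u0) (at u0)" using tr[OF c0(1) cd(1)] c0(2) cd(3) by (simp add: u0_def p_def)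
  have e: "tr c0 c u0 = snd c p" using u0(2) by (simp add: tr_def p_def)
  have 2: "(tr c d has_derivative fderiv (tr c d) (snd c p)) (at (tr c0 c u0))" unfolding e by (rule tr[OF cd])
  have "((\<lambda>y. tr c d (tr c0 c y)) has_derivative (\<lambda>h. fderiv (tr c d) (snd c p) (fderiv (tr c0 c) u0 h))) (at u0)"
   by (rule has_derivative_compose[OF 1 2])
  then have "(tr c0 d has_derivative (\<lambda>h. fderiv (tr c d) (snd c p) (fderiv (tr c0 c) u0 h))) (at u0)"
  proof (rule has_derivative_transform_within_open[OF _ W])
   fix y assume "y \<in> W"
   then have "chart_inv c0 y \<in> fst c" using inv_chart[OF c0(1)] by (auto simp: W_def)
   then show "tr c d (tr c0 c y) = tr c0 d y" using inv_chart[OF cd(1)] by (simp add: tr_def)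
  qed
  from frechet_derivative_at[OF this] show ?thesis using vD[OF cd(1,3)] vD[OF cd(2,4)] by (simp add: fun_eq_iff)
 qed
 have vt: "v \<in> tangent_space A p"
  unfolding tangent_space_def mem_Collect_eq
 proof (intro conjI allI impI ballI)
  show "\<not> (c \<in> A \<and> p \<in> fst c) \<Longrightarrow> v c = 0" for c by (auto simp: v_def)
  show "v d = fderiv (snd d \<circ> chart_inv c) (snd c p) (v c)"
   if "c \<in> A" "d \<in> A" "p \<in> fst c \<and> p \<in> fst d" for c d
   using chain[of c d] that by (simp add: tr_def o_def)
 qed
 have "v \<noteq> (\<lambda>c. 0)" using vc0 h0 by (metis)
 moreover have "differential A (flow A Y 1) p v = v"
 proof
  fix d
  have Fp: "flow A Y 1 p = p" using flow_one[OF u0(1)] center[OF T01(2)] u0(2) x0(2) by (simp add: p_def)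
  have df: "differential A (flow A Y 1) p v d =
   (if d \<in> A \<and> p \<in> fst d then fderiv (\<lambda>y. snd d (flow A Y 1 (chart_inv c0 y))) u0 h else 0)"
   unfolding differential_def Let_def using Fp vc0 by (simp add: c0_eq[symmetric] p_def u0_def o_def)
  show "differential A (flow A Y 1) p v d = v d"
  proof (cases "d \<in> A \<and> p \<in> fst d")
   case True
   have 1: "(P has_derivative fderiv P u0) (at u0)" by (rule smooth_on_has_derivative[OF P(1) N(2)])
   have "(tr c0 d has_derivative fderiv (tr c0 d) u0) (at (P u0))"
    unfolding P(2) using tr[of c0 d] True c0 by (simp add: u0_def p_def)
   from has_derivative_compose[OF 1 this]
   have "((\<lambda>u. snd d (flow A Y 1 (chart_inv c0 u))) has_derivative (\<lambda>h. fderiv (tr c0 d) u0 (fderiv P u0 h))) (at u0)"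
   proof (rule has_derivative_transform_within_open[OF _ N])
    fix u assume u: "u \<in> N"
    then have "chart_inv c0 (P u) = \<Phi> 1 u" using inv_chart[OF c0(1)] by (simp add: P_def N_def)
    also have "\<dots> = flow A Y 1 (chart_inv c0 u)" using flow_one[of u] u by (simp add: N_def)
    finally show "tr c0 d (P u) = snd d (flow A Y 1 (chart_inv c0 u))" by (simp add: tr_def)
   qed
   from frechet_derivative_at[OF this, symmetric] show ?thesis using df True vD h by simp
  next
   case False
   then show ?thesis using df by (auto simp: v_def)
  qed
 qed
 ultimately show False using nd vt by (auto simp: p_def)
qed

end

section \<open>Construction of the tube\<close>

context orbit_box
begin

text \<open>Flowing \<open>u0 + v\<close> through one period leads to the nonlinear return map. If
  one starts instead from \<open>R (u0 + Q v)\<close>, with \<open>R\<close> a local inverse of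
  \<open>P\<close>, one arrives after a period exactly at \<open>u0 + Q v\<close>. So \<Psi> uses
  the first family at early times and the second at late times, joined by the cut-off, and the
  relation across one period is linear.\<close>

lemma tube_exists:
 assumes no_fixed: "\<And>h. fderiv P u0 h = h \<Longrightarrow> h = 0"
  and f: "smooth_periodic_function A f" and X: "smooth_periodic_vector_field A X"
  and Yf: "Y = (\<lambda>t p. tangent_scale (f t p) (X t p))"
 shows "\<exists>Q Qi \<Psi> r0. tube A Q Qi \<Psi> r0 x0 f X"
proof -
 obtain U W R where U: "open U" "U \<subseteq> N" "u0 \<in> U" and W: "open W" "homeomorphism U W P R" "smooth_on W R"
  by (rule smooth_local_inverse[OF N(1) P(1) N(2) P_injective], assumption, rule that)
 have PR: "P (R w) = w" "R w \<in> U" if "w \<in> W" for w using W(2) that by (auto simp: homeomorphism_def)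
 have RP: "R (P u) = u" "P u \<in> W" if "u \<in> U" for u using W(2) that by (auto simp: homeomorphism_def)
 have u0W: "u0 \<in> W" "R u0 = u0" using RP[OF U(3)] by (simp_all add: P(2))
 define Q where "Q = fderiv P u0"
 define Qi where "Qi = fderiv R u0"
 have DP: "(P has_derivative Q) (at u0)" unfolding Q_def by (rule smooth_on_has_derivative[OF P(1) N(2)])
 have DR: "(R has_derivative Qi) (at u0)" unfolding Qi_def by (rule smooth_on_has_derivative[OF W(3) u0W(1)])
 have "((\<lambda>w. P (R w)) has_derivative (\<lambda>h. Q (Qi h))) (at u0)"
  by (rule has_derivative_compose[OF DR]) (use DP u0W in simp)
 then have "((\<lambda>w. w) has_derivative (\<lambda>h. Q (Qi h))) (at u0)"
  by (rule has_derivative_transform_within_open[OF _ W(1) u0W(1)]) (use PR in simp)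
 from has_derivative_unique[OF this has_derivative_ident] have QQi: "Q (Qi h) = h" for h by (rule fun_cong)
 have "((\<lambda>u. R (P u)) has_derivative (\<lambda>h. Qi (Q h))) (at u0)"
  by (rule has_derivative_compose[OF DP]) (use DR P(2) in simp)
 then have "((\<lambda>w. w) has_derivative (\<lambda>h. Qi (Q h))) (at u0)"
  by (rule has_derivative_transform_within_open[OF _ U(1,3)]) (use RP in simp)
 from has_derivative_unique[OF this has_derivative_ident] have QiQ: "Qi (Q h) = h" for h by (rule fun_cong)
 have lin: "linear Q" "linear Qi" using DP DR has_derivative_linear by auto
 have tw: "twist Q Qi" by (rule twist.intro[OF lin QQi QiQ]) (use no_fixed in \<open>simp add: Q_def\<close>)
 have blQ: "bounded_linear Q" using lin linear_conv_bounded_linear by blast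
 have ab: "17/12 < (19/12::real)" by simp
 obtain \<beta> :: "real \<Rightarrow> real" where \<beta>: "smooth_on UNIV \<beta>" "\<And>t. t \<le> 17/12 \<Longrightarrow> \<beta> t = 0" "\<And>t. t \<ge> 19/12 \<Longrightarrow> \<beta> t = 1" "\<And>t. 0 \<le> \<beta> t" "\<And>t. \<beta> t \<le> (1::real)"
  by (rule smooth_step[OF ab], rule that)
 obtain r where r: "r > 0" "ball u0 r \<subseteq> V" using V(1) u0(1) by (auto simp: open_contains_ball)
 \<comment> \<open>The difference of the two starting points. Its value and its derivative vanish at
   \<open>0\<close>, since the derivative of \<open>R\<close> at \<open>u0\<close> is the inverse of
   \<open>Q\<close>.\<close>
 define k where "k v = R (u0 + Q v) - u0 - v" for v
 \<comment> \<open>Both starting points are kept in one ball inside \<open>V\<close>, whose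
   convexity keeps the interpolated points in \<open>V\<close>.\<close>
 define S where "S = (\<lambda>v. u0 + Q v) -` (W \<inter> V \<inter> R -` ball u0 r) \<inter> ball 0 r"
 have oS: "open S"
 proof -
  have "open (W \<inter> R -` ball u0 r)" by (rule continuous_open_preimage[OF smooth_on_continuous[OF W(3)] W(1) open_ball])
  from open_Int[OF this V(1)] have o: "open (W \<inter> V \<inter> R -` ball u0 r)" by (simp only: Int_ac)
  have "continuous_on UNIV (\<lambda>v. u0 + Q v)" by (intro continuous_intros bounded_linear.continuous_on[OF blQ])
  from open_Int[OF open_vimage[OF o this] open_ball] show ?thesis unfolding S_def .
 qed
 have S0: "0 \<in> S" using r u0W u0(1) by (simp add: S_def linear_0[OF lin(1)])
 obtain r0 where r0: "r0 > 0" "ball 0 r0 \<subseteq> S" using oS S0 by (auto simp: open_contains_ball)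
 define B where "B = ball (0::'e) r0"
 have B: "open B" "0 \<in> B" using r0 by (auto simp: B_def)
 have inB: "u0 + Q v \<in> W" "u0 + Q v \<in> V" "R (u0 + Q v) \<in> ball u0 r" "u0 + v \<in> ball u0 r" if "v \<in> B" for v
  using r0(2) that by (auto simp: S_def B_def dist_norm)
 have Qs: "smooth_on B (\<lambda>v. u0 + Q v)" by (intro smooth_on_add B(1) smooth_on_const smooth_on_linear[OF blQ] smooth_on_id)
 have ks: "smooth_on B k"
  unfolding k_def by (intro smooth_on_diff B(1) smooth_on_const smooth_on_id smooth_on_compose[OF B(1) W(1) Qs W(3) inB(1)])
 have k0: "k 0 = 0" using u0W by (simp add: k_def linear_0[OF lin(1)])
 have dk: "(k has_derivative (\<lambda>h. 0)) (at 0)"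
 proof -
  have "((\<lambda>v. u0 + Q v) has_derivative Q) (at 0)"
   using bounded_linear_imp_has_derivative[OF blQ] by (auto intro!: derivative_eq_intros)
  from has_derivative_compose[OF this, of R Qi] have "((\<lambda>v. R (u0 + Q v)) has_derivative (\<lambda>h. h)) (at 0)"
   using DR by (simp add: linear_0[OF lin(1)] QiQ)
  then show ?thesis unfolding k_def by (auto intro!: derivative_eq_intros)
 qed
 define J where "J = {7/12<..<29/12::real}"
 have JT: "J \<subseteq> T" using \<epsilon> by (auto simp: J_def T_def)
 have oJB: "open (J \<times> B)" using B by (simp add: J_def open_Times)
 have oTV: "open (T \<times> V)" using V by (simp add: T_def open_Times)
 \<comment> \<open>\<open>E\<close> interpolates between \<open>v\<close> and \<open>R (Q v)\<close>, which agree to first order at the orbit.\<close>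
 define E where "E = (\<lambda>x. (fst x, u0 + snd x + \<beta> (fst x) *\<^sub>R k (snd x)))"
 have Es: "smooth_on (J \<times> B) E"
 proof -
  have 1: "smooth_on (J \<times> B) (\<lambda>x. \<beta> (fst x))"
   by (rule smooth_on_compose[OF oJB open_UNIV _ \<beta>(1)]) (auto intro!: smooth_on_fst oJB smooth_on_id)
  have 2: "smooth_on (J \<times> B) (\<lambda>x. k (snd x))"
   by (rule smooth_on_compose[OF oJB B(1) _ ks]) (auto intro!: smooth_on_snd oJB smooth_on_id)
  show ?thesis unfolding E_def
   by (intro smooth_on_Pair smooth_on_add smooth_on_scaleR smooth_on_fst smooth_on_snd oJB smooth_on_id smooth_on_const 1 2)
 qed
 have EV: "snd (E (t, v)) \<in> V" if "v \<in> B" for t v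
 proof -
  have "snd (E (t, v)) = (1 - \<beta> t) *\<^sub>R (u0 + v) + \<beta> t *\<^sub>R R (u0 + Q v)" by (simp add: E_def k_def algebra_simps)
  also have "\<dots> \<in> ball u0 r" using inB(3,4)[OF that] \<beta>(4,5)[of t] by (intro convexD[OF convex_ball]) auto
  finally show ?thesis using r(2) by blast
 qed
 have ETV: "E x \<in> T \<times> V" if "x \<in> J \<times> B" for x using EV[of "snd x" "fst x"] that JT by (cases x) (auto simp: E_def)
 define \<Psi> where "\<Psi> t v = \<Phi> t (snd (E (t, v)))" for t v
 have E_pair: "E (t, v) = (t, snd (E (t, v)))" for t v by (simp add: E_def)
 have sb: "smooth_into (T \<times> V) (case_prod \<Phi>)" using box by (simp add: flow_box_def T_def)
 have "smooth_into (J \<times> B) (\<lambda>x. (case_prod \<Phi>) (E x))" by (rule smooth_into_compose[OF sb oJB Es ETV])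
 moreover have "(\<lambda>x. (case_prod \<Phi>) (E x)) = (case_prod \<Psi>)"
  by (simp add: fun_eq_iff \<Psi>_def E_def)
 ultimately have s\<Psi>: "smooth_into (J \<times> B) (case_prod \<Psi>)" by simp
 define DE where "DE x = fderiv E x" for x
 have DE: "(E has_derivative DE x) (at x)" if "x \<in> J \<times> B" for x unfolding DE_def by (rule smooth_on_has_derivative[OF Es that])
 \<comment> \<open>The time derivative of the interpolation is \<open>k v\<close> times a factor
   that depends on \<open>t\<close> alone.\<close>
 have DEt: "\<exists>b. DE (t, v) (1, 0) = (1, b *\<^sub>R k v) \<and> (\<forall>v\<in>B. DE (t, v) (1, 0) = (1, b *\<^sub>R k v))" if t: "t \<in> J" and "v \<in> B" for t v
 proof -
  have "(\<beta> has_derivative fderiv \<beta> t) (at t)" by (rule smooth_on_has_derivative[OF \<beta>(1)]) simp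
  then obtain b where b: "(\<beta> has_real_derivative b) (at t)"
   using has_real_derivative by blast
  have "DE (t, v) (1, 0) = (1, b *\<^sub>R k v)" if v: "v \<in> B" for v
  proof -
   have "((\<lambda>s. (s, v)) has_derivative (\<lambda>h. (h, 0))) (at t)" by (auto intro!: derivative_eq_intros)
   moreover have "(t, v) \<in> J \<times> B" using t v by simp
   ultimately have 1: "((\<lambda>s. E (s, v)) has_derivative (\<lambda>h. DE (t, v) (h, 0))) (at t)"
    by (rule has_derivative_compose[OF _ DE])
   have "((\<lambda>s. (s, u0 + v + \<beta> s *\<^sub>R k v)) has_derivative (\<lambda>h. (h, h *\<^sub>R b *\<^sub>R k v))) (at t)"
    using b unfolding has_field_derivative_def
    by (auto intro!: derivative_eq_intros simp: mult.commute)
   then have "((\<lambda>s. E (s, v)) has_derivative (\<lambda>h. (h, h *\<^sub>R b *\<^sub>R k v))) (at t)" by (simp add: E_def)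
   from fun_cong[OF has_derivative_unique[OF 1 this], of 1] show ?thesis by simp
  qed
  then show ?thesis using \<open>v \<in> B\<close> by blast
 qed
 have DEh: "DE (t, 0) (0, h) = (0, h)" if t: "t \<in> J" for t h
 proof -
  have "((\<lambda>v::'e. (t, v)) has_derivative (\<lambda>h. (0, h))) (at 0)" by (auto intro!: derivative_eq_intros)
  moreover have "(t, 0) \<in> J \<times> B" using t B by simp
  ultimately have 1: "((\<lambda>v. E (t, v)) has_derivative (\<lambda>h. DE (t, 0) (0, h))) (at 0)"
   by (rule has_derivative_compose[OF _ DE])
  have "((\<lambda>v. (t, u0 + v + \<beta> t *\<^sub>R k v)) has_derivative (\<lambda>h. (0, h))) (at 0)"
   using dk by (auto intro!: derivative_eq_intros)
  then have "((\<lambda>v. E (t, v)) has_derivative (\<lambda>h. (0, h))) (at 0)" by (simp add: E_def)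
  from fun_cong[OF has_derivative_unique[OF 1 this], of h] show ?thesis .
 qed
 have E0: "E (t, 0) = (t, u0)" for t by (simp add: E_def k0)
 have center\<Psi>: "\<Psi> t 0 = x0 t" if "t \<in> J" for t using center[of t] that JT by (auto simp: \<Psi>_def E0)
 define F\<Phi> where "F\<Phi> c = (\<lambda>(t, u). snd c (\<Phi> t u))" for c :: "('m, 'e) chart"
 define D where "D c = (T \<times> V) \<inter> (case_prod \<Phi>) -` fst c" for c :: "('m, 'e) chart"
 have oD: "open (D c)" if "c \<in> A" for c unfolding D_def by (rule smooth_into_open_vimage[OF sb open_dom[OF that]])
 have F\<Phi>s: "smooth_on (D c) (F\<Phi> c)" if "c \<in> A" for c
  using smooth_into_chart[OF sb that] by (simp add: D_def F\<Phi>_def case_prod_beta')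
 define L where "L c x = fderiv (F\<Phi> c) x" for c x
 have L: "(F\<Phi> c has_derivative L c x) (at x)" if "c \<in> A" "x \<in> D c" for c x
  unfolding L_def by (rule smooth_on_has_derivative[OF F\<Phi>s[OF that(1)] that(2)])
 have Ls: "smooth_on (D c) (\<lambda>x. L c x h)" if "c \<in> A" for c h
  unfolding smooth_on_def
 proof
  fix n
  have "Ck_on (Suc n) (D c) (F\<Phi> c)" using F\<Phi>s[OF that] by (simp only: smooth_on_def)
  then show "Ck_on n (D c) (\<lambda>x. L c x h)" by (simp add: L_def del: split_paired_All)
 qed
 have F\<Psi>: "fderiv (\<lambda>(t, v). snd c (\<Psi> t v)) (t, v) h = L c (E (t, v)) (DE (t, v) h)"
  if "c \<in> A" "t \<in> J" "v \<in> B" "\<Psi> t v \<in> fst c" for c t v h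
 proof -
  have x: "(t, v) \<in> J \<times> B" using that by simp
  have "E (t, v) \<in> D c" using ETV[OF x] that(4) by (subst (asm) (1) E_pair, subst E_pair) (simp add: D_def \<Psi>_def)
  from has_derivative_compose[OF DE[OF x] L[OF that(1) this]]
  have "((\<lambda>x. F\<Phi> c (E x)) has_derivative (\<lambda>h. L c (E (t, v)) (DE (t, v) h))) (at (t, v))" .
  moreover have "(\<lambda>x. F\<Phi> c (E x)) = (\<lambda>(t, v). snd c (\<Psi> t v))" by (simp add: fun_eq_iff F\<Phi>_def \<Psi>_def E_def)
  ultimately show ?thesis using frechet_derivative_at by metis
 qed
 have L_fibre: "L c (t, u0) (0, h) = fderiv (\<lambda>u. snd c (\<Phi> t u)) u0 h"
  if "c \<in> A" "t \<in> J" "x0 t \<in> fst c" for c t h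
 proof -
  have "(t, u0) \<in> D c" using that JT u0(1) center[of t] by (auto simp: D_def)
  moreover have "((\<lambda>u::'e. (t, u)) has_derivative (\<lambda>h. (0, h))) (at u0)" by (auto intro!: derivative_eq_intros)
  ultimately have "((\<lambda>u. F\<Phi> c (t, u)) has_derivative (\<lambda>h. L c (t, u0) (0, h))) (at u0)"
   by (intro has_derivative_compose[OF _ L[OF that(1)]])
  from frechet_derivative_at[OF this] show ?thesis by (simp add: F\<Phi>_def fun_eq_iff)
 qed
 have L_time: "L c (t, u) (1, 0) = Y t (\<Phi> t u) c" if c: "c \<in> A" "(t, u) \<in> D c" for c t u
 proof -
  have "((\<lambda>s. (s, u)) has_derivative (\<lambda>h. (h, 0))) (at t)" by (auto intro!: derivative_eq_intros)
  from has_derivative_compose[OF this L[OF c]]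
  have 1: "((\<lambda>s. snd c (\<Phi> s u)) has_derivative (\<lambda>h. L c (t, u) (h, 0))) (at t)" by (simp add: F\<Phi>_def)
  have "((\<lambda>s. snd c (\<Phi> s u)) has_vector_derivative Y t (\<Phi> t u) c) (at t)"
   using box c by (auto simp: flow_box_def D_def T_def has_velocity_def o_def)
  then have "((\<lambda>s. snd c (\<Phi> s u)) has_derivative (\<lambda>h. h *\<^sub>R Y t (\<Phi> t u) c)) (at t)" by (simp add: has_vector_derivative_def)
  from fun_cong[OF has_derivative_unique[OF 1 this], of 1] show ?thesis by simp
 qed
 have inj: "h = 0" if "c \<in> A" "t \<in> J" "x0 t \<in> fst c" "fderiv (\<lambda>(t, v). snd c (\<Psi> t v)) (t, 0) (0, h) = 0" for c t h
 proof (rule slice_injective)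
  show "t \<in> T" using that JT by blast
  have "\<Psi> t 0 \<in> fst c" using that center\<Psi> by simp
  from F\<Psi>[OF that(1,2) B(2) this, of "(0, h)"] that(4) L_fibre[OF that(1-3)] DEh[OF that(2)]
  show "fderiv (\<lambda>u. snd c (\<Phi> t u)) u0 h = 0" by (simp add: E0)
 qed (use that in auto)
 \<comment> \<open>The time derivative of \<Psi> is the field plus the image of
   \<open>b *\<^sub>R k v\<close> under the fibre derivative. The field cancels, and the rest has
   zero derivative because \<open>k\<close> has.\<close>
 have drift: "((\<lambda>v. Y t (\<Psi> t v) c - fderiv (\<lambda>(t, v). snd c (\<Psi> t v)) (t, v) (1, 0)) has_derivative (\<lambda>h. 0)) (at 0)"
  if c: "c \<in> A" and t: "t \<in> J" and x0c: "x0 t \<in> fst c" for c t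
 proof -
  obtain b where b: "\<And>v. v \<in> B \<Longrightarrow> DE (t, v) (1, 0) = (1, b *\<^sub>R k v)" using DEt[OF t B(2)] by blast
  define M where "M = B \<inter> (\<lambda>v. E (t, v)) -` D c"
  have Et: "smooth_on B (\<lambda>v. E (t, v))"
   by (rule smooth_on_compose[OF B(1) oJB _ Es]) (use t B in \<open>auto intro!: smooth_on_Pair\<close>)
  have M: "open M" unfolding M_def by (rule continuous_open_preimage[OF smooth_on_continuous[OF Et] B(1) oD[OF c]])
  have M0: "0 \<in> M" using B(2) t JT x0c u0(1) center[of t] by (auto simp: M_def D_def E0)
  have LM: "linear (L c (E (t, v)))" if "v \<in> M" for v
   using has_derivative_linear[OF L[OF c]] that by (simp add: M_def)
  have "((\<lambda>v. L c (E (t, v)) (0, - b *\<^sub>R k v)) has_derivative (\<lambda>h. L c (E (t, 0)) (0, - b *\<^sub>R 0))) (at 0)"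
  proof (rule has_derivative_apply_zero[OF M M0, of "\<lambda>v h. L c (E (t, v)) (0, - b *\<^sub>R h)"])
   show "linear (\<lambda>h. L c (E (t, v)) (0, - b *\<^sub>R h))" if "v \<in> M" for v
    using linear_compose[OF _ LM[OF that], of "\<lambda>h. (0, - b *\<^sub>R h)"] by (simp add: o_def linear_iff algebra_simps)
   show "(\<lambda>v. L c (E (t, v)) (0, - b *\<^sub>R h)) differentiable at 0" for h
   proof -
    have oM: "E (t, v) \<in> D c" if "v \<in> M" for v using that by (simp add: M_def)
    have "smooth_on M (\<lambda>v. L c (E (t, v)) (0, - b *\<^sub>R h))"
     by (rule smooth_on_compose[OF M oD[OF c] smooth_on_subset[OF Et] Ls[OF c] oM]) (simp add: M_def)
    from smooth_on_has_derivative[OF this M0] show ?thesis unfolding differentiable_def by blast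
   qed
  qed (use dk k0 in auto)
  then have "((\<lambda>v. L c (E (t, v)) (0, - b *\<^sub>R k v)) has_derivative (\<lambda>h. 0)) (at 0)"
   using linear_0[OF LM[OF M0]] by (simp add: zero_prod_def)
  then show ?thesis
  proof (rule has_derivative_transform_within_open[OF _ M M0])
   fix v assume v: "v \<in> M"
   then have vB: "v \<in> B" and ED: "E (t, v) \<in> D c" by (auto simp: M_def)
   have \<Psi>c: "\<Psi> t v \<in> fst c" using ED by (subst (asm) E_pair) (simp add: D_def \<Psi>_def)
   have "fderiv (\<lambda>(t, v). snd c (\<Psi> t v)) (t, v) (1, 0) = L c (E (t, v)) ((1, 0) - (0, - b *\<^sub>R k v))"
    using F\<Psi>[OF c t vB \<Psi>c] b[OF vB] by simp
   also have "\<dots> = L c (E (t, v)) (1, 0) - L c (E (t, v)) (0, - b *\<^sub>R k v)" by (rule linear_diff[OF LM[OF v]])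
   also have "L c (E (t, v)) (1, 0) = Y t (\<Psi> t v) c" using L_time[OF c, of t "snd (E (t, v))"] ED E_pair[of t v] by (simp add: \<Psi>_def)
   finally show "L c (E (t, v)) (0, - b *\<^sub>R k v) = Y t (\<Psi> t v) c - fderiv (\<lambda>(t, v). snd c (\<Psi> t v)) (t, v) (1, 0)" by simp
  qed
 qed
 \<comment> \<open>For these times the cut-off has not begun at \<open>t\<close> and is complete at
   \<open>t + 1\<close>.\<close>
 have seam: "\<Psi> (t + 1) v = \<Psi> t (Q v)" if t: "t \<in> {7/12<..<17/12}" and v: "v \<in> B" for t v
 proof -
  have "\<beta> (t + 1) = 1" "\<beta> t = 0" using t by (auto intro!: \<beta>(2,3))
  then have "\<Psi> (t + 1) v = \<Phi> (t + 1) (R (u0 + Q v))" "\<Psi> t (Q v) = \<Phi> t (u0 + Q v)" by (simp_all add: \<Psi>_def E_def k_def)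
  moreover have "\<Phi> (t + 1) (R (u0 + Q v)) = \<Phi> t (P (R (u0 + Q v)))"
   using PR[OF inB(1)[OF v]] U(2) inB(2)[OF v] t by (intro return_map) auto
  ultimately show ?thesis using PR[OF inB(1)[OF v]] by simp
 qed
 interpret twist Q Qi by (rule tw)
 have "tube A Q Qi \<Psi> r0 x0 f X"
 proof unfold_locales
  show "0 < r0" by (rule r0)
  show "smooth_into ({7/12<..<29/12} \<times> ball 0 r0) (case_prod \<Psi>)" using s\<Psi> by (simp add: J_def B_def)
  show "\<Psi> t 0 = x0 t" if "t \<in> {7/12<..<29/12}" for t using center\<Psi>[of t] that by (simp add: J_def)
  show "\<Psi> (t + 1) v = \<Psi> t (Q v)" if "t \<in> {7/12<..<17/12}" "v \<in> ball 0 r0" for t v using seam[OF that(1)] that(2) by (simp add: B_def)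
  show "h = 0" if "c \<in> A" "t \<in> {7/12<..<29/12}" "x0 t \<in> fst c" "fderiv (\<lambda>(t, v). snd c (\<Psi> t v)) (t, 0) (0, h) = 0" for c t h
   using inj[OF that(1) _ that(3,4)] that(2) by (simp add: J_def)
  show "((\<lambda>v. f t (\<Psi> t v) *\<^sub>R X t (\<Psi> t v) c - fderiv (\<lambda>(t, v). snd c (\<Psi> t v)) (t, v) (1, 0)) has_derivative (\<lambda>h. 0)) (at 0)"
   if "c \<in> A" "t \<in> {7/12<..<29/12}" "x0 t \<in> fst c" for c t
   using drift[OF that(1) _ that(3)] that(2) by (simp add: J_def Yf tangent_scale_def)
 qed (use f X orbit Yf in auto)
 then show ?thesis by (intro exI)
qed

end

theorem (in atlas) nondegenerate_delay_solutions:
 assumes f: "smooth_periodic_function A f" and X: "smooth_periodic_vector_field A X"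
  and nd: "nondegenerate_orbit A (\<lambda>t p. tangent_scale (f t p) (X t p)) x0"
 obtains \<tau>1 x C e where "0 < \<tau>1" "x 0 = x0" "\<And>\<tau>. \<bar>\<tau>\<bar> < \<tau>1 \<Longrightarrow> delay_solution A f X \<tau> (x \<tau>)"
  "smooth_into ({-\<tau>1<..<\<tau>1} \<times> UNIV) (case_prod x)" "finite C" "C \<noteq> {}" "0 < e"
  "\<And>c a b. (c, a, b) \<in> C \<Longrightarrow> c \<in> A \<and> a < b \<and> x0 ` {a..b} \<subseteq> fst c"
  "\<And>\<tau> y. \<bar>\<tau>\<bar> < \<tau>1 \<Longrightarrow> delay_solution A f X \<tau> y \<Longrightarrow>
   (\<And>c a b t. (c, a, b) \<in> C \<Longrightarrow> t \<in> {a..b} \<Longrightarrow> y t \<in> fst c \<and> dist (snd c (y t)) (snd c (x0 t)) < e) \<Longrightarrow> y = x \<tau>"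
proof -
 define Y where "Y = (\<lambda>t p. tangent_scale (f t p) (X t p))"
 \<comment> \<open>The same choice as in the definition of \<open>differential\<close>, as
   \<open>P_no_fixed\<close> demands.\<close>
 define c0 where "c0 = (SOME c. c \<in> A \<and> x0 0 \<in> fst c)"
 have "\<exists>c. c \<in> A \<and> x0 0 \<in> fst c" using chart_at by blast
 from someI_ex[OF this] have c0: "c0 \<in> A" "x0 0 \<in> fst c0" by (simp_all add: c0_def)
 have Y: "smooth_field Y"
  unfolding smooth_field_def
 proof (intro conjI allI ballI)
  show "Y t p \<in> tangent_space A p" for t p
   using X unfolding Y_def smooth_periodic_vector_field_def by (intro tangent_scale_closed) simp
  fix c assume c: "c \<in> A"
  have o: "open (UNIV \<times> snd c ` fst c :: (real \<times> 'e) set)" by (intro open_Times open_UNIV open_img c)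
  have "smooth_on (UNIV \<times> snd c ` fst c) (\<lambda>x. (\<lambda>(t, y). f t (chart_inv c y)) x *\<^sub>R (\<lambda>(t, y). X t (chart_inv c y) c) x)"
   using f X c by (intro smooth_on_scaleR o) (simp_all add: smooth_periodic_function_def smooth_periodic_vector_field_def)
  then show "smooth_on (UNIV \<times> snd c ` fst c) (\<lambda>(t, y). Y t (chart_inv c y) c)"
   by (simp add: Y_def tangent_scale_def case_prod_beta')
 qed
 have per: "Y (t + 1) = Y t" for t using f X by (simp add: Y_def smooth_periodic_function_def smooth_periodic_vector_field_def)
 have orbit: "periodic_orbit A Y x0"
  and nf: "\<not> (\<exists>v\<in>tangent_space A (x0 0). v \<noteq> (\<lambda>c. 0) \<and> differential A (flow A Y 1) (x0 0) v = v)"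
  using nd unfolding nondegenerate_orbit_def Y_def by blast+
 have ic: "integral_curve_on A Y UNIV x0" using orbit by (simp add: periodic_orbit_def)
 have q: "smooth_into (snd c0 ` fst c0) (chart_inv c0)"
  using smooth_into_chart_inv[OF open_img[OF c0(1)] smooth_on_id c0(1)] by simp
 have le: "(0::real) \<le> 3" "(0::real) \<in> {0..3}" by simp_all
 have im: "snd c0 (x0 0) \<in> snd c0 ` fst c0" "chart_inv c0 (snd c0 (x0 0)) = x0 0" using c0 inv_chart[OF c0] by auto
 obtain V \<epsilon> \<Phi> where V: "open V" "snd c0 (x0 0) \<in> V" "V \<subseteq> snd c0 ` fst c0" and \<epsilon>: "0 < \<epsilon>"
  and box: "flow_box Y {0 - \<epsilon><..<3 + \<epsilon>} V \<Phi>" "\<And>u. u \<in> V \<Longrightarrow> \<Phi> 0 u = chart_inv c0 u"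
  by (rule flowableD[OF flowable[OF Y ic le(1)] le(2) q im], rule that)
 interpret orbit_box A Y x0 c0 V \<epsilon> \<Phi>
  by unfold_locales (use Y per orbit c0 V \<epsilon> box in simp_all)
 have nf': "h = 0" if "fderiv P u0 h = h" for h by (rule P_no_fixed[OF nf c0_def that])
 have ex: "\<exists>Q Qi \<Psi> r0. tube A Q Qi \<Psi> r0 x0 f X" by (rule tube_exists[OF _ f X Y_def]) (rule nf')
 obtain Q Qi \<Psi> r0 where "tube A Q Qi \<Psi> r0 x0 f X"
  using ex by (elim exE) (rule that)
 then interpret tube A Q Qi \<Psi> r0 x0 f X .
 show thesis
  apply (rule delay_solutions)
  subgoal premises p for \<tau>1 x C e by (rule that[of \<tau>1 x C e]) (fact p)+
  done
qed

section \<open>Sobolev norms of smooth functions\<close>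

lemma continuous_L2:
 assumes "continuous_on {a..b} u"
 shows "L2_on a b u"
 unfolding L2_on_def
proof
 show "set_borel_measurable lborel {a..b} u"
  using borel_integrable_atLeastAtMost'[OF assms] unfolding set_borel_measurable_def set_integrable_def by (rule borel_measurable_integrable)
 show "set_integrable lborel {a..b} (\<lambda>t. (norm (u t))\<^sup>2)"
  by (intro borel_integrable_atLeastAtMost' continuous_intros assms)
qed

lemma L2_set_integrable:
 assumes "L2_on a b v"
 shows "set_integrable lborel {a..b} v"
 unfolding set_integrable_def
proof (rule Bochner_Integration.integrable_bound)
 have "set_integrable lborel {a..b} (\<lambda>t. 1 + (norm (v t))\<^sup>2)"
  using assms by (intro set_integral_add(1) borel_integrable_atLeastAtMost'[of _ _ "\<lambda>t. 1"]) (simp_all add: L2_on_def)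
 then show "integrable lborel (\<lambda>t. indicat_real {a..b} t *\<^sub>R (1 + (norm (v t))\<^sup>2))" by (simp add: set_integrable_def)
 show "(\<lambda>t. indicat_real {a..b} t *\<^sub>R v t) \<in> borel_measurable lborel" using assms by (simp add: L2_on_def set_borel_measurable_def)
 have "x \<le> 1 + x\<^sup>2" for x :: real using zero_le_power2[of "x - 1/2"] by (simp add: power2_eq_square algebra_simps)
 then show "AE t in lborel. norm (indicat_real {a..b} t *\<^sub>R v t) \<le> norm (indicat_real {a..b} t *\<^sub>R (1 + (norm (v t))\<^sup>2))"
  by (intro AE_I2) (auto simp: indicator_def intro: order_trans[OF _ abs_ge_self])
qed

lemma test_function_derivative:
 assumes "test_function a b \<psi>"
 shows "(\<psi> has_vector_derivative deriv \<psi> t) (at t)" "continuous_on UNIV (deriv \<psi>)" "continuous_on UNIV \<psi>"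
proof -
 obtain D where D: "\<And>t. (\<psi> has_vector_derivative D t) (at t)" "continuous_on UNIV D"
  using assms by (auto simp: test_function_def C1_differentiable_on_def)
 have "deriv \<psi> = D"
  using D(1) by (auto simp: has_real_derivative_iff_has_vector_derivative[symmetric] intro: DERIV_imp_deriv)
 then show "(\<psi> has_vector_derivative deriv \<psi> t) (at t)" "continuous_on UNIV (deriv \<psi>)" using D by simp_all
 show "continuous_on UNIV \<psi>" using D(1) by (intro continuous_on_vector_derivative) (auto intro: has_vector_derivative_at_within)
qed

lemma set_integrable_continuous_mult:
 fixes v :: "real \<Rightarrow> 'e::euclidean_space"
 assumes "continuous_on UNIV \<psi>" "set_integrable lborel {a..b} v"
 shows "set_integrable lborel {a..b} (\<lambda>t. \<psi> t *\<^sub>R v t)"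
proof -
 have "compact (\<psi> ` {a..b})" by (intro compact_continuous_image continuous_on_subset[OF assms(1)]) auto
 then obtain B where B: "\<And>t. t \<in> {a..b} \<Longrightarrow> norm (\<psi> t) \<le> B" by (meson compact_imp_bounded bounded_iff imageI)
 have v: "integrable lborel (\<lambda>t. indicat_real {a..b} t *\<^sub>R v t)" using assms(2) by (simp add: set_integrable_def)
 have "integrable lborel (\<lambda>t. \<psi> t *\<^sub>R (indicat_real {a..b} t *\<^sub>R v t))"
 proof (rule Bochner_Integration.integrable_bound)
  show "integrable lborel (\<lambda>t. B *\<^sub>R (indicat_real {a..b} t *\<^sub>R v t))" using v by (rule integrable_scaleR_right)
  have "\<psi> \<in> borel_measurable lborel" using borel_measurable_continuous_onI[OF assms(1)] by simp
  then show "(\<lambda>t. \<psi> t *\<^sub>R (indicat_real {a..b} t *\<^sub>R v t)) \<in> borel_measurable lborel"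
   using borel_measurable_integrable[OF v] by (rule borel_measurable_scaleR)
  show "AE t in lborel. norm (\<psi> t *\<^sub>R (indicat_real {a..b} t *\<^sub>R v t)) \<le> norm (B *\<^sub>R (indicat_real {a..b} t *\<^sub>R v t))"
   using B by (intro AE_I2) (auto simp: indicator_def intro!: mult_right_mono order_trans[OF _ abs_ge_self])
 qed
 then show ?thesis by (simp add: set_integrable_def mult.commute)
qed

lemma classical_weak_derivative:
 fixes u u' :: "real \<Rightarrow> 'e::euclidean_space"
 assumes "a \<le> b" "\<And>t. t \<in> {a..b} \<Longrightarrow> (u has_vector_derivative u' t) (at t within {a..b})" "continuous_on {a..b} u'"
 shows "has_weak_derivative a b u u'"
 unfolding has_weak_derivative_def
proof (intro allI impI)
 fix \<psi> assume t: "test_function a b \<psi>"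
 note d = test_function_derivative[OF t]
 have u: "continuous_on {a..b} u" using assms(2) by (rule continuous_on_vector_derivative)
 have "\<psi> a = 0" "\<psi> b = 0" using t by (auto simp: test_function_def)
 have i: "set_integrable lborel {a..b} (\<lambda>t. \<psi> t *\<^sub>R u' t)" "set_integrable lborel {a..b} (\<lambda>t. deriv \<psi> t *\<^sub>R u t)"
  by (intro set_integrable_continuous_mult d borel_integrable_atLeastAtMost' assms u)+
 have "(\<integral>t. indicator {a..b} t *\<^sub>R (\<psi> t *\<^sub>R u' t + deriv \<psi> t *\<^sub>R u t) \<partial>lborel) = \<psi> b *\<^sub>R u b - \<psi> a *\<^sub>R u a"
 proof (rule integral_FTC_atLeastAtMost[OF assms(1)])
  show "((\<lambda>t. \<psi> t *\<^sub>R u t) has_vector_derivative \<psi> t *\<^sub>R u' t + deriv \<psi> t *\<^sub>R u t) (at t within {a..b})" if "a \<le> t" "t \<le> b" for t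
   using has_vector_derivative_scaleR[of \<psi> "deriv \<psi> t" t "{a..b}" u "u' t"] d(1)[of t] assms(2)[of t] that
   by (simp add: has_real_derivative_iff_has_vector_derivative has_vector_derivative_at_within)
  show "continuous_on {a..b} (\<lambda>t. \<psi> t *\<^sub>R u' t + deriv \<psi> t *\<^sub>R u t)"
   by (intro continuous_intros assms u continuous_on_subset[OF d(2)] continuous_on_subset[OF d(3)]) auto
 qed
 then have "(LINT t:{a..b}|lborel. \<psi> t *\<^sub>R u' t + deriv \<psi> t *\<^sub>R u t) = 0" using \<open>\<psi> a = 0\<close> \<open>\<psi> b = 0\<close> by (simp add: set_lebesgue_integral_def)
 then show "(LINT t:{a..b}|lborel. deriv \<psi> t *\<^sub>R u t) = - (LINT t:{a..b}|lborel. \<psi> t *\<^sub>R u' t)"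
  using set_integral_add(2)[OF i] by (simp add: add_eq_0_iff)
qed

text \<open>Open intervals generate the Borel sets and are closed under intersections, so the
  vanishing of the integral spreads to all Borel sets; \<open>tot\<close> takes care of
  complements.\<close>

lemma integrable_zero_on_intervals:
 fixes w :: "real \<Rightarrow> 'e::euclidean_space"
 assumes w: "integrable lborel w" and 0: "\<And>c d. (LINT t:{c<..<d}|lborel. w t) = 0" and tot: "integral\<^sup>L lborel w = 0"
 shows "AE t in lborel. w t = 0"
proof (rule sigma_finite_measure.density_zero[OF sigma_finite_lborel w])
 fix B :: "real set" assume "B \<in> sets lborel"
 then have B: "B \<in> sigma_sets UNIV (range (\<lambda>(a, b). box a b))" by (simp add: borel_eq_box)
 have Is: "Int_stable (range (\<lambda>(a, b). box a (b::real)))"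
  unfolding Int_stable_def by (auto simp: box_Int_box) (metis case_prod_conv range_eqI box_real(1))
 have si: "set_integrable lborel S w" if "S \<in> sets lborel" for S
  unfolding set_integrable_def using integrable_mult_indicator[OF that w] .
 have bs: "sigma_sets UNIV (range (\<lambda>(a, b). box a (b::real))) = sets lborel" by (simp add: borel_eq_box)
 have "(LINT t:UNIV|lborel. w t) = 0" using tot by (simp add: set_lebesgue_integral_def)
 show "(LINT t:B|lborel. w t) = 0"
  using Is _ B
 proof (rule sigma_sets_induct_disjoint)
  show "(LINT t:S|lborel. w t) = 0" if "S \<in> range (\<lambda>(a, b). box a (b::real))" for S
   using that 0 by auto
  show "(LINT t:{}|lborel. w t) = 0" by (simp add: set_lebesgue_integral_def)
  show "(LINT t:UNIV - S|lborel. w t) = 0" if "S \<in> sigma_sets UNIV (range (\<lambda>(a, b). box a b))" "(LINT t:S|lborel. w t) = 0" for S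
  proof -
   have S: "S \<in> sets lborel" using that bs by simp
   have "(LINT t:S \<union> (UNIV - S)|lborel. w t) = (LINT t:S|lborel. w t) + (LINT t:UNIV - S|lborel. w t)"
    by (rule set_integral_Un) (use S si in auto)
   then show ?thesis using that(2) \<open>(LINT t:UNIV|lborel. w t) = 0\<close> by simp
  qed
  show "(LINT t:\<Union> (range C)|lborel. w t) = 0"
   if "disjoint_family C" "range C \<subseteq> sigma_sets UNIV (range (\<lambda>(a, b). box a b))" "\<And>i::nat. (LINT t:C i|lborel. w t) = 0" for C
  proof -
   have C: "C i \<in> sets lborel" for i using that(2) bs by blast
   have "(LINT t:(\<Union>i. C i)|lborel. w t) = (\<Sum>i. (LINT t:C i|lborel. w t))"
   proof (rule lebesgue_integral_countable_add)
    show "set_integrable lborel (\<Union>i. C i) w" using C by (intro si sets.countable_UN) auto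
   qed (use C that(1) in \<open>auto simp: disjoint_family_on_def\<close>)
   then show ?thesis using that(3) by simp
  qed
 qed simp
qed

text \<open>The difference of two weak derivatives integrates to zero against all test functions.
  Smooth test functions that converge boundedly to the indicator of an interval show that its
  integral over every interval is zero.\<close>

lemma weak_derivative_unique:
 fixes v1 v2 :: "real \<Rightarrow> 'e::euclidean_space"
 assumes L: "L2_on a b v1" "L2_on a b v2" and wd: "has_weak_derivative a b u v1" "has_weak_derivative a b u v2"
 shows "AE t in lborel. t \<in> {a..b} \<longrightarrow> v1 t = v2 t"
proof -
 define w where "w t = indicat_real {a..b} t *\<^sub>R (v1 t - v2 t)" for t
 note i = L2_set_integrable[OF L(1)] L2_set_integrable[OF L(2)]
 have w: "integrable lborel w" using set_integral_diff(1)[OF i] by (simp add: w_def[abs_def] set_integrable_def)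
 have wm: "w \<in> borel_measurable lborel" using w by (rule borel_measurable_integrable)
 have test: "(\<integral>t. \<psi> t *\<^sub>R w t \<partial>lborel) = 0" if t: "test_function a b \<psi>" for \<psi>
 proof -
  note c = test_function_derivative(3)[OF t]
  have "(LINT t:{a..b}|lborel. \<psi> t *\<^sub>R v1 t - \<psi> t *\<^sub>R v2 t) = (LINT t:{a..b}|lborel. \<psi> t *\<^sub>R v1 t) - (LINT t:{a..b}|lborel. \<psi> t *\<^sub>R v2 t)"
   by (intro set_integral_diff set_integrable_continuous_mult c i)
  also have "\<dots> = 0" using wd t by (simp add: has_weak_derivative_def)
  finally show ?thesis by (simp add: set_lebesgue_integral_def w_def scaleR_diff_right mult.commute)
 qed
 obtain s :: "real \<Rightarrow> real" where s: "smooth_on UNIV s" "\<And>t. t \<le> 0 \<Longrightarrow> s t = 0" "\<And>t. t \<ge> 1 \<Longrightarrow> s t = 1" "\<And>t. 0 \<le> s t" "\<And>t. s t \<le> (1::real)"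
  by (rule smooth_step[OF zero_less_one], rule that)
 have intervals: "(LINT t:{c<..<d}|lborel. w t) = 0" for c d
 proof -
  define c' where "c' = max c a"
  define d' where "d' = min d b"
  \<comment> \<open>Zero up to distance \<open>1 / Suc n\<close> from the end points and
    \<open>1\<close> from distance \<open>2 / Suc n\<close> on: admissible as a test function, and
    convergent to the indicator.\<close>
  define \<psi> where "\<psi> n t = s (real (Suc n) * (t - c') - 1) * s (real (Suc n) * (d' - t) - 1)" for n t
  have \<psi>s: "smooth_on UNIV (\<psi> n)" for n
  proof -
   have l: "smooth_on UNIV (\<lambda>t. real (Suc n) * (t - c') - 1)" "smooth_on UNIV (\<lambda>t. real (Suc n) * (d' - t) - 1)"
    by (intro smooth_on_diff smooth_on_linear[OF bounded_linear_mult_right] open_UNIV smooth_on_const smooth_on_id)+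
   have "smooth_on UNIV (\<lambda>t. s (real (Suc n) * (t - c') - 1) *\<^sub>R s (real (Suc n) * (d' - t) - 1))"
    by (intro smooth_on_scaleR open_UNIV smooth_on_compose[OF open_UNIV open_UNIV _ s(1)] l) auto
   then show ?thesis by (simp add: \<psi>_def[abs_def])
  qed
  have tf: "test_function a b (\<psi> n)" for n
   unfolding test_function_def
  proof (intro conjI exI allI impI)
   have "continuous_on UNIV (\<lambda>t. fderiv (\<psi> n) t 1)"
    using \<psi>s[of n] unfolding smooth_on_def by (drule_tac spec[of _ 1]) simp
   moreover have "(\<psi> n has_vector_derivative fderiv (\<psi> n) t 1) (at t)" for t
   proof -
    have d: "(\<psi> n has_derivative fderiv (\<psi> n) t) (at t)" using smooth_on_has_derivative[OF \<psi>s] by simp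
    have "h *\<^sub>R fderiv (\<psi> n) t 1 = fderiv (\<psi> n) t h" for h
     using linear_scale[OF has_derivative_linear[OF d], of h 1] by simp
    then show ?thesis using d unfolding has_vector_derivative_def by simp
   qed
   ultimately show "\<psi> n C1_differentiable_on UNIV"
    unfolding C1_differentiable_on_def by (intro exI[of _ "\<lambda>t. fderiv (\<psi> n) t 1"]) simp
   show "a < c' + 1 / real (Suc n)" "d' - 1 / real (Suc n) < b"
    using add_le_less_mono[of a c' 0 "1 / real (Suc n)"] diff_strict_left_mono[of 0 "1 / real (Suc n)" d']
    by (simp_all add: c'_def d'_def min_less_iff_disj)
   fix t assume "t \<notin> {c' + 1 / real (Suc n)..d' - 1 / real (Suc n)}"
   then have "real (Suc n) * (t - c') - 1 \<le> 0 \<or> real (Suc n) * (d' - t) - 1 \<le> 0" by (auto simp: field_simps)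
   then show "\<psi> n t = 0" using s(2) by (auto simp: \<psi>_def)
  qed
  have "(\<lambda>n. \<integral>t. \<psi> n t *\<^sub>R w t \<partial>lborel) \<longlonglongrightarrow> (\<integral>t. indicat_real {c<..<d} t *\<^sub>R w t \<partial>lborel)"
  proof (rule integral_dominated_convergence[where w = "\<lambda>t. norm (w t)"])
   show "(\<lambda>t. indicat_real {c<..<d} t *\<^sub>R w t) \<in> borel_measurable lborel" using wm by measurable
   show "(\<lambda>t. \<psi> n t *\<^sub>R w t) \<in> borel_measurable lborel" for n
    using borel_measurable_continuous_onI[OF test_function_derivative(3)[OF tf]] wm by (intro borel_measurable_scaleR) simp_all
   show "integrable lborel (\<lambda>t. norm (w t))" using w by (rule integrable_norm)
   show "AE t in lborel. norm (\<psi> n t *\<^sub>R w t) \<le> norm (w t)" for n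
    using s(4,5) by (intro AE_I2) (simp add: \<psi>_def abs_mult mult_le_one mult_left_le_one_le)
   \<comment> \<open>At \<open>a\<close> and \<open>b\<close> all these test functions vanish,
     whereas \<open>w\<close> and the indicator need not.\<close>
   have "AE t in lborel. t \<noteq> a" "AE t in lborel. t \<noteq> b" by (rule AE_lborel_singleton)+
   then show "AE t in lborel. (\<lambda>n. \<psi> n t *\<^sub>R w t) \<longlonglongrightarrow> indicat_real {c<..<d} t *\<^sub>R w t"
   proof eventually_elim
    fix t assume t: "t \<noteq> a" "t \<noteq> b"
    show "(\<lambda>n. \<psi> n t *\<^sub>R w t) \<longlonglongrightarrow> indicat_real {c<..<d} t *\<^sub>R w t"
    proof (cases "t \<in> {a<..<b}")
     case False
     then have "w t = 0" using t by (auto simp: w_def)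
     then show ?thesis by simp
    next
     case True
     show ?thesis
     proof (cases "t \<in> {c<..<d}")
      case cd: True
      then have p: "t - c' > 0" "d' - t > 0" using True by (auto simp: c'_def d'_def)
      obtain N where N: "2 / (t - c') < real N" "2 / (d' - t) < real N"
       using reals_Archimedean2[of "max (2 / (t - c')) (2 / (d' - t))"] by auto
      have "\<psi> n t = 1" if "n \<ge> N" for n
      proof -
       have "2 / (t - c') \<le> real (Suc n)" "2 / (d' - t) \<le> real (Suc n)" using N that by linarith+
       then have "2 \<le> real (Suc n) * (t - c')" "2 \<le> real (Suc n) * (d' - t)" using p by (simp_all only: pos_divide_le_eq)
       then show ?thesis using s(3) by (simp add: \<psi>_def)
      qed
      then have "\<forall>\<^sub>F n in sequentially. \<psi> n t *\<^sub>R w t = indicat_real {c<..<d} t *\<^sub>R w t"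
       using cd by (intro eventually_sequentiallyI[of N]) simp
      then show ?thesis by (rule tendsto_eventually)
     next
      case False
      have "\<psi> n t = 0" for n
      proof -
       have "t - c' \<le> 0 \<or> d' - t \<le> 0" using False True by (auto simp: c'_def d'_def)
       then have "real (Suc n) * (t - c') \<le> 0 \<or> real (Suc n) * (d' - t) \<le> 0" by (auto intro: mult_nonneg_nonpos)
       then show ?thesis using s(2)[of "real (Suc n) * (t - c') - 1"] s(2)[of "real (Suc n) * (d' - t) - 1"] by (auto simp: \<psi>_def)
      qed
      then show ?thesis using False by simp
     qed
    qed
   qed
  qed
  then show ?thesis using test[OF tf] by (simp add: set_lebesgue_integral_def LIMSEQ_const_iff)
 qed
 have "AE t in lborel. w t = 0"
 proof (rule integrable_zero_on_intervals[OF w intervals])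
  have "indicat_real {a - 1<..<b + 1} t *\<^sub>R w t = w t" for t by (simp add: w_def indicator_def)
  then show "integral\<^sup>L lborel w = 0" using intervals[of "a - 1" "b + 1"] by (simp add: set_lebesgue_integral_def)
 qed
 then show ?thesis by eventually_elim (auto simp: w_def indicator_def)
qed

text \<open>\<open>weak_derivative\<close> picks a representative, so after one step a function is
  known only up to a null set.\<close>

lemma has_weak_derivative_AE:
 fixes u u' :: "real \<Rightarrow> 'e::euclidean_space"
 assumes L: "L2_on a b u" "L2_on a b u'" and eq: "AE t in lborel. t \<in> {a..b} \<longrightarrow> u t = u' t" and wd: "has_weak_derivative a b u v"
 shows "has_weak_derivative a b u' v"
 unfolding has_weak_derivative_def
proof (intro allI impI)
 fix \<psi> assume t: "test_function a b \<psi>"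
 note c = test_function_derivative(2)[OF t]
 have m: "(\<lambda>t. indicat_real {a..b} t *\<^sub>R (deriv \<psi> t *\<^sub>R u t)) \<in> borel_measurable lborel" if "L2_on a b u" for u :: "real \<Rightarrow> 'e"
  using set_integrable_continuous_mult[OF c L2_set_integrable[OF that]] unfolding set_integrable_def by (rule borel_measurable_integrable)
 have "(LINT t:{a..b}|lborel. deriv \<psi> t *\<^sub>R u' t) = (LINT t:{a..b}|lborel. deriv \<psi> t *\<^sub>R u t)"
  unfolding set_lebesgue_integral_def
 proof (rule integral_cong_AE[OF m[OF L(2)] m[OF L(1)]])
  show "AE t in lborel. indicat_real {a..b} t *\<^sub>R (deriv \<psi> t *\<^sub>R u' t) = indicat_real {a..b} t *\<^sub>R (deriv \<psi> t *\<^sub>R u t)"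
   using eq by eventually_elim (simp add: indicator_def)
 qed
 then show "(LINT t:{a..b}|lborel. deriv \<psi> t *\<^sub>R u' t) = - (LINT t:{a..b}|lborel. \<psi> t *\<^sub>R v t)"
  using wd t by (simp add: has_weak_derivative_def)
qed

section \<open>Sobolev norms of classically differentiable curves\<close>

definition derivatives_on :: "real \<Rightarrow> real \<Rightarrow> nat \<Rightarrow> (nat \<Rightarrow> real \<Rightarrow> 'e::euclidean_space) \<Rightarrow> bool" where
 "derivatives_on a b k D \<longleftrightarrow> a < b \<and> (\<forall>i<k. \<forall>t\<in>{a..b}. (D i has_vector_derivative D (Suc i) t) (at t within {a..b})) \<and>
  continuous_on {a..b} (D k)"

lemma derivatives_on_continuous:
 assumes "derivatives_on a b k D" "i \<le> k"
 shows "continuous_on {a..b} (D i)"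
proof (cases "i = k")
 case False
 then show ?thesis using assms unfolding derivatives_on_def by (intro continuous_on_vector_derivative[of _ _ "D (Suc i)"]) auto
qed (use assms in \<open>simp add: derivatives_on_def\<close>)

lemma derivatives_on_weak:
 assumes "derivatives_on a b k D" "i < k"
 shows "has_weak_derivative a b (D i) (D (Suc i))"
 using assms derivatives_on_continuous[OF assms(1), of "Suc i"] unfolding derivatives_on_def
 by (intro classical_weak_derivative) auto

text \<open>The iterates are chosen by \<open>SOME\<close>. Uniqueness of weak derivatives
  identifies each of them almost everywhere with the classical derivative of the same order, and
  this is what makes Sobolev norms computable.\<close>

lemma iterated_weak_derivative:
 assumes D: "derivatives_on a b k D" and "i \<le> k"
 shows "L2_on a b ((weak_derivative a b ^^ i) (D 0)) \<and> (AE t in lborel. t \<in> {a..b} \<longrightarrow> (weak_derivative a b ^^ i) (D 0) t = D i t)"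
 using assms(2)
proof (induction i)
 case 0
 then show ?case using continuous_L2[OF derivatives_on_continuous[OF D]] by simp
next
 case (Suc i)
 define u where "u = (weak_derivative a b ^^ i) (D 0)"
 have u: "L2_on a b u" "AE t in lborel. t \<in> {a..b} \<longrightarrow> u t = D i t" using Suc by (auto simp: u_def)
 have L: "L2_on a b (D i)" "L2_on a b (D (Suc i))" using continuous_L2[OF derivatives_on_continuous[OF D]] Suc.prems by auto
 have e: "AE t in lborel. t \<in> {a..b} \<longrightarrow> D i t = u t" using u(2) by eventually_elim simp
 have wD: "has_weak_derivative a b u (D (Suc i))"
  using has_weak_derivative_AE[OF L(1) u(1) e] derivatives_on_weak[OF D] Suc.prems by simp
 have w: "L2_on a b (weak_derivative a b u) \<and> has_weak_derivative a b u (weak_derivative a b u)"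
  unfolding weak_derivative_def by (rule someI[of _ "D (Suc i)"]) (use L(2) wD in simp)
 have "AE t in lborel. t \<in> {a..b} \<longrightarrow> weak_derivative a b u t = D (Suc i) t"
  by (rule weak_derivative_unique[OF _ L(2) _ wD]) (use w in auto)
 then show ?case using w by (simp add: u_def)
qed

lemma sobolev_norm_eq:
 assumes D: "derivatives_on a b k D"
 shows "sobolev_norm k a b (D 0) = sqrt (\<Sum>i\<le>k. LINT t:{a..b}|lborel. (norm (D i t))\<^sup>2)"
proof -
 have "(LINT t:{a..b}|lborel. (norm ((weak_derivative a b ^^ i) (D 0) t))\<^sup>2) = (LINT t:{a..b}|lborel. (norm (D i t))\<^sup>2)" if "i \<le> k" for i
  unfolding set_lebesgue_integral_def
 proof (rule integral_cong_AE)
  have m: "(\<lambda>t. indicat_real {a..b} t *\<^sub>R (norm (u t))\<^sup>2) \<in> borel_measurable lborel" if "L2_on a b u" for u :: "real \<Rightarrow> 'a"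
   using that unfolding L2_on_def set_integrable_def by (blast intro: borel_measurable_integrable)
  note iw = iterated_weak_derivative[OF D that]
  show "(\<lambda>t. indicat_real {a..b} t *\<^sub>R (norm ((weak_derivative a b ^^ i) (D 0) t))\<^sup>2) \<in> borel_measurable lborel" using m iw by blast
  show "(\<lambda>t. indicat_real {a..b} t *\<^sub>R (norm (D i t))\<^sup>2) \<in> borel_measurable lborel" by (intro m continuous_L2 derivatives_on_continuous[OF D that])
  have "AE t in lborel. t \<in> {a..b} \<longrightarrow> (weak_derivative a b ^^ i) (D 0) t = D i t" using iw by blast
  then show "AE t in lborel. indicat_real {a..b} t *\<^sub>R (norm ((weak_derivative a b ^^ i) (D 0) t))\<^sup>2 = indicat_real {a..b} t *\<^sub>R (norm (D i t))\<^sup>2"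
   by eventually_elim (simp add: indicator_def)
 qed
 then show ?thesis by (simp add: sobolev_norm_def)
qed

lemma sobolev_on_derivatives:
 "derivatives_on a b k D \<Longrightarrow> sobolev_on k a b (D 0)"
proof (induction k arbitrary: D)
 case 0
 then show ?case using continuous_L2[OF derivatives_on_continuous[OF 0]] by simp
next
 case (Suc k)
 have "derivatives_on a b k (\<lambda>i. D (Suc i))" using Suc.prems by (auto simp: derivatives_on_def)
 from Suc.IH[OF this] have "sobolev_on k a b (D (Suc 0))" by simp
 moreover have "has_weak_derivative a b (D 0) (D (Suc 0))" using derivatives_on_weak[OF Suc.prems] by simp
 ultimately show ?case using continuous_L2[OF derivatives_on_continuous[OF Suc.prems]] by auto
qed

lemma sobolev_norm_le:
 assumes D: "derivatives_on a b k D" and M: "\<And>i t. i \<le> k \<Longrightarrow> t \<in> {a..b} \<Longrightarrow> norm (D i t) \<le> M"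
 shows "sobolev_norm k a b (D 0) \<le> sqrt (real (Suc k) * (b - a)) * M"
proof -
 have ab: "a < b" using D by (simp add: derivatives_on_def)
 have M0: "M \<ge> 0" using order_trans[OF norm_ge_zero M[of 0 a]] ab by simp
 have "(LINT t:{a..b}|lborel. (norm (D i t))\<^sup>2) \<le> (b - a) * M\<^sup>2" if "i \<le> k" for i
 proof -
  have "(LINT t:{a..b}|lborel. (norm (D i t))\<^sup>2) \<le> (LINT t:{a..b}|lborel. M\<^sup>2)"
   using M[OF that] by (intro set_integral_mono borel_integrable_atLeastAtMost' continuous_intros derivatives_on_continuous[OF D that] power_mono) auto
  also have "\<dots> = (b - a) * M\<^sup>2" using ab by (simp add: set_lebesgue_integral_def)
  finally show ?thesis .
 qed
 then have "(\<Sum>i\<le>k. LINT t:{a..b}|lborel. (norm (D i t))\<^sup>2) \<le> (\<Sum>i\<le>k. (b - a) * M\<^sup>2)" by (intro sum_mono) simp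
 then have "sobolev_norm k a b (D 0) \<le> sqrt ((real (Suc k) * (b - a)) * M\<^sup>2)"
  unfolding sobolev_norm_eq[OF D] by (intro real_sqrt_le_mono) (simp add: mult.assoc)
 also have "\<dots> = sqrt (real (Suc k) * (b - a)) * M" using M0 by (simp only: real_sqrt_mult real_sqrt_abs abs_of_nonneg)
 finally show ?thesis .
qed

text \<open>The Sobolev embedding for C^1 curves: \<open>norm (u t)\<close> is at most
  \<open>norm (u s)\<close> plus the integral of \<open>norm (u' r)\<close> over \<open>r\<close>,
  and this is averaged over \<open>s\<close>. Both L^1 norms are at most
  \<open>(b - a + 1) / 2 * e\<close>, whence the constant.\<close>

lemma sup_le_sobolev_norm:
 fixes u u' :: "real \<Rightarrow> 'e::euclidean_space"
 assumes ab: "a < b" and u: "\<And>t. t \<in> {a..b} \<Longrightarrow> (u has_vector_derivative u' t) (at t within {a..b})" and u': "continuous_on {a..b} u'"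
  and e: "sobolev_norm 1 a b u < e" and t: "t \<in> {a..b}"
 shows "norm (u t) \<le> ((b - a + 1) / 2 * (1 / (b - a) + 1)) * e"
proof -
 define D where "D i = (if i = 0 then u else u')" for i :: nat
 have D: "derivatives_on a b 1 D" using ab u u' by (simp add: derivatives_on_def D_def)
 have uc: "continuous_on {a..b} u" using derivatives_on_continuous[OF D, of 0] by (simp add: D_def)
 define I where "I v = (LINT t:{a..b}|lborel. (norm (v t))\<^sup>2)" for v :: "real \<Rightarrow> 'e"
 have Ige: "I v \<ge> 0" for v unfolding I_def set_lebesgue_integral_def by (intro Bochner_Integration.integral_nonneg) simp
 have "sqrt (I u + I u') < e" using e sobolev_norm_eq[OF D] by (simp add: D_def I_def)
 moreover have e0: "e > 0" using le_less_trans[OF _ calculation, of 0] Ige[of u] Ige[of u'] by simp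
 ultimately have "I u + I u' < e\<^sup>2" by (metis real_sqrt_less_iff real_sqrt_abs abs_of_pos)
 then have Ie: "I u \<le> e\<^sup>2" "I u' \<le> e\<^sup>2" using Ige[of u] Ige[of u'] by linarith+
 have L1: "integral {a..b} (\<lambda>t. norm (v t)) \<le> (b - a + 1) / 2 * e" if v: "continuous_on {a..b} v" "I v \<le> e\<^sup>2" for v :: "real \<Rightarrow> 'e"
 proof -
  have iv: "I v = integral {a..b} (\<lambda>t. (norm (v t))\<^sup>2)"
   unfolding I_def by (intro set_borel_integral_eq_integral(2) borel_integrable_atLeastAtMost' continuous_intros v)
  \<comment> \<open>AM-GM instead of the Cauchy-Schwarz inequality\<close>
  have am: "x \<le> e / 2 + x\<^sup>2 / (2 * e)" for x :: real
  proof -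
   have "0 \<le> (x - e)\<^sup>2 / (2 * e)" using e0 by simp
   also have "\<dots> = e / 2 + x\<^sup>2 / (2 * e) - x" using e0 by (simp add: field_simps power2_eq_square)
   finally show ?thesis by simp
  qed
  have "integral {a..b} (\<lambda>t. norm (v t)) \<le> integral {a..b} (\<lambda>t. e / 2 + (norm (v t))\<^sup>2 / (2 * e))"
   using e0 by (intro integral_le integrable_continuous_real continuous_intros v am) simp
  also have "\<dots> = (b - a) * (e / 2) + I v / (2 * e)"
   unfolding iv using ab e0 by (subst Henstock_Kurzweil_Integration.integral_add) (auto intro!: integrable_continuous_real continuous_intros v)
  also have "\<dots> \<le> (b - a) * (e / 2) + e\<^sup>2 / (2 * e)" using v e0 by (intro add_left_mono divide_right_mono) auto
  also have "\<dots> = (b - a + 1) / 2 * e" using e0 by (simp add: field_simps power2_eq_square)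
  finally show ?thesis .
 qed
 define S where "S = (b - a + 1) / 2 * e"
 have step: "norm (u t) \<le> norm (u s) + S" if s: "s \<in> {a..b}" for s
 proof -
  have diff: "norm (u y - u x) \<le> S" if xy: "x \<in> {a..b}" "y \<in> {a..b}" "x \<le> y" for x y
  proof -
   have sub: "{x..y} \<subseteq> {a..b}" using xy by auto
   have "(u' has_integral (u y - u x)) {x..y}"
   proof (rule fundamental_theorem_of_calculus[OF xy(3)])
    fix r assume "r \<in> {x..y}"
    then show "(u has_vector_derivative u' r) (at r within {x..y})"
     using has_vector_derivative_within_subset[OF u sub] sub by blast
   qed
   then have "norm (u y - u x) = norm (integral {x..y} u')" by (simp add: integral_unique)
   also have "\<dots> \<le> integral {x..y} (\<lambda>t. norm (u' t))"
    by (intro Henstock_Kurzweil_Integration.integral_norm_bound_integral integrable_continuous_real continuous_on_norm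
      continuous_on_subset[OF u' sub] order_refl)
   also have "\<dots> \<le> integral {a..b} (\<lambda>t. norm (u' t))"
    by (intro integral_subset_le sub integrable_continuous_real continuous_intros u' continuous_on_subset[OF u' sub]) auto
   also have "\<dots> \<le> S" unfolding S_def by (rule L1[OF u' Ie(2)])
   finally show ?thesis .
  qed
  have "norm (u t - u s) \<le> S"
   using diff[OF s t] diff[OF t s] by (cases "s \<le> t") (simp_all add: norm_minus_commute)
  then show ?thesis using norm_triangle_sub[of "u t" "u s"] by simp
 qed
 have "(b - a) * norm (u t) = integral {a..b} (\<lambda>s. norm (u t))" using ab by simp
 also have "\<dots> \<le> integral {a..b} (\<lambda>s. norm (u s) + S)"
  by (intro integral_le integrable_continuous_real continuous_intros uc step)
 also have "\<dots> = integral {a..b} (\<lambda>s. norm (u s)) + (b - a) * S"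
  using ab by (subst Henstock_Kurzweil_Integration.integral_add) (auto intro!: integrable_continuous_real continuous_intros uc)
 also have "\<dots> \<le> S + (b - a) * S" using L1[OF uc Ie(1)] by (simp add: S_def)
 finally have "norm (u t) \<le> (S + (b - a) * S) / (b - a)" using ab by (simp add: field_simps)
 also have "\<dots> = ((b - a + 1) / 2 * (1 / (b - a) + 1)) * e" unfolding S_def using ab by (simp add: field_simps)
 finally show ?thesis .
qed

section \<open>Families depending smoothly on a parameter\<close>

definition pd :: "real \<times> real \<Rightarrow> (real \<times> real \<Rightarrow> 'e::euclidean_space) \<Rightarrow> real \<times> real \<Rightarrow> 'e" where
 "pd u F = (\<lambda>x. fderiv F x u)"

lemma pd_smooth: "smooth_on S F \<Longrightarrow> smooth_on S (pd u F)"
 unfolding smooth_on_def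
proof
 fix k assume "\<forall>k. Ck_on k S F"
 then have "Ck_on (Suc k) S F" by (rule spec)
 then show "Ck_on k S (pd u F)" by (simp add: pd_def del: split_paired_All)
qed

lemma pd_pow_smooth: "smooth_on S F \<Longrightarrow> smooth_on S ((pd u ^^ n) F)"
 by (induction n) (simp_all add: pd_smooth)

lemma pd_cong:
 assumes "open S" "smooth_on S F" "\<And>x. x \<in> S \<Longrightarrow> F x = G x" "x \<in> S"
 shows "pd u F x = pd u G x"
proof -
 have "(G has_derivative fderiv F x) (at x)"
  by (rule has_derivative_transform_within_open[OF smooth_on_has_derivative[OF assms(2,4)] assms(1,4,3)])
 from frechet_derivative_at[OF this] show ?thesis by (simp add: pd_def)
qed

lemma pd_lines:
 assumes "smooth_on S F" "(s, y) \<in> S"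
 shows "((\<lambda>s. F (s, y)) has_vector_derivative pd (1, 0) F (s, y)) (at s)"
  and "((\<lambda>y. F (s, y)) has_vector_derivative pd (0, 1) F (s, y)) (at y)"
proof -
 define D where "D = fderiv F (s, y)"
 have D: "(F has_derivative D) (at (s, y))" unfolding D_def by (rule smooth_on_has_derivative[OF assms])
 note lin = linear_scale[OF has_derivative_linear[OF D]]
 have "((\<lambda>s. (s, y)) has_derivative (\<lambda>h. h *\<^sub>R (1, 0))) (at s)" "((\<lambda>y. (s, y)) has_derivative (\<lambda>h. h *\<^sub>R (0, 1))) (at y)"
  by (auto intro!: derivative_eq_intros)
 from has_derivative_compose[OF this(1) D] has_derivative_compose[OF this(2) D]
 show "((\<lambda>s. F (s, y)) has_vector_derivative pd (1, 0) F (s, y)) (at s)" "((\<lambda>y. F (s, y)) has_vector_derivative pd (0, 1) F (s, y)) (at y)"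
  unfolding has_vector_derivative_def pd_def D_def[symmetric] lin .
qed

text \<open>The mean value inequality is applied in one variable after the other. The same second
  difference thus approximates both mixed derivatives, which is how \<open>pd_commute\<close> gets
  their symmetry.\<close>

lemma second_difference:
 fixes F F1 F12 :: "real \<Rightarrow> real \<Rightarrow> 'e::euclidean_space"
 assumes h: "h > 0"
  and F: "\<And>s y. s \<in> {a..a + h} \<Longrightarrow> y \<in> {b..b + h} \<Longrightarrow> ((\<lambda>s. F s y) has_vector_derivative F1 s y) (at s)"
  and F1: "\<And>s y. s \<in> {a..a + h} \<Longrightarrow> y \<in> {b..b + h} \<Longrightarrow> (F1 s has_vector_derivative F12 s y) (at y)"
  and e: "\<And>s y. s \<in> {a..a + h} \<Longrightarrow> y \<in> {b..b + h} \<Longrightarrow> norm (F12 s y - A) \<le> e"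
 shows "norm ((F (a + h) (b + h) - F (a + h) b) - (F a (b + h) - F a b) - h *\<^sub>R h *\<^sub>R A) \<le> e * h * h"
proof -
 have sa: "closed_segment a (a + h) = {a..a + h}" "closed_segment b (b + h) = {b..b + h}" using h by (auto simp: closed_segment_eq_real_ivl)
 have inner: "norm (F1 s (b + h) - F1 s b - h *\<^sub>R A) \<le> e * h" if s: "s \<in> {a..a + h}" for s
  using vector_mvt_bound[of b "b + h" "F1 s" "F12 s" A e] F1[OF s] e[OF s] h by (auto simp: sa intro: has_vector_derivative_at_within)
 have "norm ((F (a + h) (b + h) - F (a + h) b) - (F a (b + h) - F a b) - ((a + h) - a) *\<^sub>R h *\<^sub>R A) \<le> (e * h) * \<bar>(a + h) - a\<bar>"
 proof (rule vector_mvt_bound[where f = "\<lambda>s. F s (b + h) - F s b" and f' = "\<lambda>s. F1 s (b + h) - F1 s b"])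
  fix s assume "s \<in> closed_segment a (a + h)"
  then have s: "s \<in> {a..a + h}" by (simp add: sa)
  show "((\<lambda>s. F s (b + h) - F s b) has_vector_derivative F1 s (b + h) - F1 s b) (at s within closed_segment a (a + h))"
   using h by (intro has_vector_derivative_at_within[OF has_vector_derivative_diff[OF F[OF s] F[OF s]]]) simp_all
  show "norm (F1 s (b + h) - F1 s b - h *\<^sub>R A) \<le> e * h" by (rule inner[OF s])
 qed
 then show ?thesis using h by simp
qed

lemma pd_commute:
 fixes F :: "real \<times> real \<Rightarrow> 'e::euclidean_space"
 assumes S: "open S" and F: "smooth_on S F" and x: "x \<in> S"
 shows "pd (1, 0) (pd (0, 1) F) x = pd (0, 1) (pd (1, 0) F) x"
proof -
 obtain a b where ab: "x = (a, b)" by (cases x)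
 define A where "A = pd (0, 1) (pd (1, 0) F)"
 define B where "B = pd (1, 0) (pd (0, 1) F)"
 have cA: "continuous_on S A" and cB: "continuous_on S B" unfolding A_def B_def by (intro smooth_on_continuous pd_smooth F)+
 have *: "norm (B x - A x) \<le> e" if e: "e > 0" for e
 proof -
  have K: "compact {x}" "{x} \<subseteq> S" "e / 2 > 0" using x e by auto
  obtain d1 where d1: "d1 > 0" "\<And>q q'. q \<in> {x} \<Longrightarrow> dist q' q < d1 \<Longrightarrow> q' \<in> S \<and> dist (A q') (A q) < e / 2"
   by (rule continuous_near_compact[OF K(1) S K(2) cA K(3)], rule that)
  obtain d2 where d2: "d2 > 0" "\<And>q q'. q \<in> {x} \<Longrightarrow> dist q' q < d2 \<Longrightarrow> q' \<in> S \<and> dist (B q') (B q) < e / 2"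
   by (rule continuous_near_compact[OF K(1) S K(2) cB K(3)], rule that)
  define h where "h = min d1 d2 / 3"
  have h: "h > 0" "2 * h < d1" "2 * h < d2" using d1(1) d2(1) by (auto simp: h_def)
  have near: "(s, y) \<in> S" "norm (A (s, y) - A x) \<le> e / 2" "norm (B (s, y) - B x) \<le> e / 2" if sy: "s \<in> {a..a + h}" "y \<in> {b..b + h}" for s y
  proof -
   have "dist (s, y) x \<le> dist s a + dist y b" unfolding ab dist_Pair_Pair by (rule sqrt_sum_squares_le_sum) auto
   also have "\<dots> \<le> 2 * h" using sy by (auto simp: dist_real_def)
   finally have "dist (s, y) x < d1" "dist (s, y) x < d2" using h by simp_all
   then show "(s, y) \<in> S" "norm (A (s, y) - A x) \<le> e / 2" "norm (B (s, y) - B x) \<le> e / 2"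
    using d1(2)[of x "(s, y)"] d2(2)[of x "(s, y)"] by (simp_all add: dist_norm)
  qed
  define \<Delta> where "\<Delta> = (F (a + h, b + h) - F (a + h, b)) - (F (a, b + h) - F (a, b))"
  have 1: "norm (\<Delta> - h *\<^sub>R h *\<^sub>R A x) \<le> (e / 2) * h * h"
   unfolding \<Delta>_def by (rule second_difference[where F = "\<lambda>s y. F (s, y)" and ?F1.0 = "\<lambda>s y. pd (1, 0) F (s, y)" and ?F12.0 = "\<lambda>s y. A (s, y)"])
    (use h near pd_lines(1)[OF F] pd_lines(2)[OF pd_smooth[OF F]] in \<open>simp_all add: A_def\<close>)
  have "norm ((F (a + h, b + h) - F (a, b + h)) - (F (a + h, b) - F (a, b)) - h *\<^sub>R h *\<^sub>R B x) \<le> (e / 2) * h * h"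
   by (rule second_difference[where F = "\<lambda>y s. F (s, y)" and ?F1.0 = "\<lambda>y s. pd (0, 1) F (s, y)" and ?F12.0 = "\<lambda>y s. B (s, y)"])
    (use h near pd_lines(2)[OF F] pd_lines(1)[OF pd_smooth[OF F]] in \<open>simp_all add: B_def\<close>)
  then have 2: "norm (\<Delta> - h *\<^sub>R h *\<^sub>R B x) \<le> (e / 2) * h * h" by (simp add: \<Delta>_def algebra_simps)
  have "norm (h *\<^sub>R h *\<^sub>R (B x - A x)) = norm ((\<Delta> - h *\<^sub>R h *\<^sub>R A x) - (\<Delta> - h *\<^sub>R h *\<^sub>R B x))" by (simp add: scaleR_diff_right)
  also have "\<dots> \<le> (e / 2) * h * h + (e / 2) * h * h" by (rule order_trans[OF norm_triangle_ineq4 add_mono[OF 1 2]])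
  also have "\<dots> = h * h * e" by simp
  finally have "h * h * norm (B x - A x) \<le> h * h * e" using h by (simp add: mult.assoc)
  then show ?thesis using h by (simp add: mult_le_cancel_left_pos)
 qed
 have "norm (B x - A x) \<le> 0" by (rule field_le_epsilon) (simp add: *)
 then show ?thesis by (simp add: A_def B_def)
qed

lemma pd_pow_commute:
 assumes S: "open S" and F: "smooth_on S F" and x: "x \<in> S"
 shows "pd (1, 0) ((pd (0, 1) ^^ i) F) x = (pd (0, 1) ^^ i) (pd (1, 0) F) x"
 using x
proof (induction i arbitrary: x)
 case (Suc i)
 have "pd (1, 0) (pd (0, 1) ((pd (0, 1) ^^ i) F)) x = pd (0, 1) (pd (1, 0) ((pd (0, 1) ^^ i) F)) x"
  by (rule pd_commute[OF S pd_pow_smooth[OF F] Suc.prems])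
 also have "\<dots> = pd (0, 1) ((pd (0, 1) ^^ i) (pd (1, 0) F)) x"
  by (rule pd_cong[OF S pd_smooth[OF pd_pow_smooth[OF F]] Suc.IH Suc.prems])
 finally show ?case by simp
qed simp

lemma derivatives_on_slice:
 assumes "smooth_on S F" "a < b" "{\<tau>} \<times> {a..b} \<subseteq> S"
 shows "derivatives_on a b k (\<lambda>i t. (pd (0, 1) ^^ i) F (\<tau>, t))"
 unfolding derivatives_on_def
proof (intro conjI allI impI ballI assms(2))
 fix i t assume "t \<in> {a..b}"
 then have "(\<tau>, t) \<in> S" using assms(3) by blast
 from has_vector_derivative_at_within[OF pd_lines(2)[OF pd_pow_smooth[OF assms(1)] this]]
 show "((\<lambda>t. (pd (0, 1) ^^ i) F (\<tau>, t)) has_vector_derivative (pd (0, 1) ^^ Suc i) F (\<tau>, t)) (at t within {a..b})" by simp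
next
 show "continuous_on {a..b} (\<lambda>t. (pd (0, 1) ^^ k) F (\<tau>, t))"
  by (rule continuous_on_compose2[OF smooth_on_continuous[OF pd_pow_smooth[OF assms(1)]]])
   (use assms(3) in \<open>auto intro!: continuous_intros\<close>)
qed

lemma derivatives_on_diff: "derivatives_on a b k D \<Longrightarrow> derivatives_on a b k E \<Longrightarrow> derivatives_on a b k (\<lambda>i t. D i t - E i t)"
 and derivatives_on_scale: "derivatives_on a b k D \<Longrightarrow> derivatives_on a b k (\<lambda>i t. c *\<^sub>R D i t)"
 by (auto simp: derivatives_on_def intro!: continuous_intros has_vector_derivative_diff
   bounded_linear.has_vector_derivative[OF bounded_linear_scaleR_right])

lemma sobolev_norm_ge_0: "0 \<le> sobolev_norm k a b u"
 unfolding sobolev_norm_def set_lebesgue_integral_def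
 by (intro real_sqrt_ge_zero sum_nonneg Bochner_Integration.integral_nonneg) simp

lemma sobolev_norm_tendsto_0:
 assumes ab: "a < b" and D: "\<forall>\<^sub>F r in L. derivatives_on a b k (D r)"
  and lim: "\<And>i e. i \<le> k \<Longrightarrow> e > 0 \<Longrightarrow> \<forall>\<^sub>F r in L. \<forall>t\<in>{a..b}. norm (D r i t) \<le> e"
 shows "((\<lambda>r. sobolev_norm k a b (D r 0)) \<longlongrightarrow> 0) L"
proof (rule tendstoI)
 fix \<epsilon> :: real assume \<epsilon>: "\<epsilon> > 0"
 define M where "M = sqrt (real (Suc k) * (b - a))"
 have M: "M \<ge> 0" using ab by (simp add: M_def)
 define e where "e = \<epsilon> / (M + 1)"
 have e: "e > 0" "M * e < \<epsilon>" using \<epsilon> M by (auto simp: e_def field_simps)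
 have "\<forall>\<^sub>F r in L. \<forall>i\<in>{..k}. \<forall>t\<in>{a..b}. norm (D r i t) \<le> e" by (rule eventually_ball_finite) (use lim e in auto)
 then show "\<forall>\<^sub>F r in L. dist (sobolev_norm k a b (D r 0)) 0 < \<epsilon>"
  using D
 proof eventually_elim
  case (elim r)
  have "sobolev_norm k a b (D r 0) \<le> M * e" unfolding M_def by (rule sobolev_norm_le[OF elim(2)]) (use elim(1) in auto)
  then show ?case using e(2) sobolev_norm_ge_0[of k a b "D r 0"] by simp
 qed
qed

text \<open>The derivatives in \<tau> are the pointwise ones. The Sobolev norm sees \<open>t\<close>
  derivatives of the difference quotients; since partial derivatives commute these are difference
  quotients of \<open>t\<close> derivatives, and they converge uniformly on the compact set
  \<open>{\<tau>} \<times> {a..b}\<close>.\<close>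

lemma smooth_curve_sobolevI:
 fixes F :: "real \<times> real \<Rightarrow> 'e::euclidean_space"
 assumes S: "open S" and F: "smooth_on S F" and ab: "a < b" and J: "J \<times> {a..b} \<subseteq> S"
 shows "smooth_curve_sobolev k a b J (\<lambda>\<tau> t. F (\<tau>, t))"
 unfolding smooth_curve_sobolev_def
proof (rule exI[of _ "\<lambda>j \<tau> t. (pd (1, 0) ^^ j) F (\<tau>, t)"], intro conjI ballI allI)
 fix j \<tau> assume \<tau>: "\<tau> \<in> J"
 define d where "d i j = (pd (0, 1) ^^ i) ((pd (1, 0) ^^ j) F)" for i j
 have ds: "smooth_on S (d i j)" for i j unfolding d_def by (intro pd_pow_smooth F)
 have sl: "derivatives_on a b k (\<lambda>i t. d i j (r, t))" if "r \<in> J" for r j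
  unfolding d_def by (rule derivatives_on_slice[OF pd_pow_smooth[OF F] ab]) (use J that in blast)
 show "sobolev_on k a b (\<lambda>t. (pd (1, 0) ^^ j) F (\<tau>, t))" using sobolev_on_derivatives[OF sl[OF \<tau>], of j] by (simp add: d_def)
 define q where "q r i t = (1 / (r - \<tau>)) *\<^sub>R (d i j (r, t) - d i j (\<tau>, t)) - d i (Suc j) (\<tau>, t)" for r i t
 have "((\<lambda>r. sobolev_norm k a b (q r 0)) \<longlongrightarrow> 0) (at \<tau> within J)"
 proof (rule sobolev_norm_tendsto_0[OF ab])
  have "\<forall>\<^sub>F r in at \<tau> within J. r \<in> J" by (simp add: eventually_at_filter)
  then show "\<forall>\<^sub>F r in at \<tau> within J. derivatives_on a b k (q r)"
   unfolding q_def[abs_def] by eventually_elim (intro derivatives_on_diff derivatives_on_scale sl \<tau>)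
  fix i and e :: real assume e: "e > 0"
  have K: "compact ({\<tau>} \<times> {a..b})" "{\<tau>} \<times> {a..b} \<subseteq> S" using J \<tau> by (auto intro: compact_Times)
  have C1: "Ck_on 1 S (d i j)" using ds unfolding smooth_on_def by blast
  obtain \<delta> where \<delta>: "\<delta> > 0" "\<And>x h. x \<in> {\<tau>} \<times> {a..b} \<Longrightarrow> norm h < \<delta> \<Longrightarrow>
    x + h \<in> S \<and> norm (d i j (x + h) - d i j x - fderiv (d i j) x h) \<le> e * norm h"
   by (rule C1_uniformly_differentiable[OF K(1) S K(2) C1 e], rule that)
  show "\<forall>\<^sub>F r in at \<tau> within J. \<forall>t\<in>{a..b}. norm (q r i t) \<le> e"
   unfolding eventually_at
  proof (intro exI[of _ \<delta>] conjI \<delta>(1) ballI impI)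
   fix r t assume r: "r \<in> J" "r \<noteq> \<tau> \<and> dist r \<tau> < \<delta>" and t: "t \<in> {a..b}"
   define h where "h = r - \<tau>"
   have h: "h \<noteq> 0" "\<bar>h\<bar> < \<delta>" "(\<tau>, t) + (h, 0) = (r, t)" using r by (auto simp: h_def dist_real_def)
   have x: "(\<tau>, t) \<in> {\<tau>} \<times> {a..b}" "(\<tau>, t) \<in> S" using t K(2) by auto
   have "(h, 0) = h *\<^sub>R (1::real, 0::real)" by simp
   then have "fderiv (d i j) (\<tau>, t) (h, 0) = h *\<^sub>R pd (1, 0) (d i j) (\<tau>, t)"
    unfolding pd_def by (simp only: linear_scale[OF has_derivative_linear[OF smooth_on_has_derivative[OF ds x(2)]]])
   also have "pd (1, 0) (d i j) (\<tau>, t) = d i (Suc j) (\<tau>, t)"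
    using pd_pow_commute[OF S pd_pow_smooth[OF F] x(2)] by (simp add: d_def)
   finally have "norm (d i j (r, t) - d i j (\<tau>, t) - h *\<^sub>R d i (Suc j) (\<tau>, t)) \<le> e * \<bar>h\<bar>"
    using \<delta>(2)[OF x(1), of "(h, 0)"] h by simp
   moreover have "q r i t = (1 / h) *\<^sub>R (d i j (r, t) - d i j (\<tau>, t) - h *\<^sub>R d i (Suc j) (\<tau>, t))"
    using h(1) by (simp add: q_def h_def[symmetric] scaleR_diff_right)
   ultimately have "norm (q r i t) \<le> (1 / \<bar>h\<bar>) * (e * \<bar>h\<bar>)"
    by (simp only: norm_scaleR real_norm_def abs_divide abs_one) (rule mult_left_mono, simp_all)
   then show "norm (q r i t) \<le> e" using h(1) by simp
  qed
 qed
 then show "((\<lambda>r. sobolev_norm k a b (\<lambda>t. (1 / (r - \<tau>)) *\<^sub>R ((pd (1, 0) ^^ j) F (r, t) - (pd (1, 0) ^^ j) F (\<tau>, t)) -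
   (pd (1, 0) ^^ Suc j) F (\<tau>, t))) \<longlongrightarrow> 0) (at \<tau> within J)"
  by (simp add: q_def[abs_def] d_def)
qed simp

text \<open>Nearby members of the family stay in the chart and are close in the Sobolev norm; this
  places them in the neighbourhood on which uniqueness is stated.\<close>

lemma sobolev_norm_slice_tendsto_0:
 fixes F :: "real \<times> real \<Rightarrow> 'e::euclidean_space"
 assumes S: "open S" and F: "smooth_on S F" and ab: "a < b" and K: "{\<tau>} \<times> {a..b} \<subseteq> S"
 shows "\<forall>\<^sub>F r in nhds \<tau>. {r} \<times> {a..b} \<subseteq> S" and "((\<lambda>r. sobolev_norm k a b (\<lambda>t. F (r, t) - F (\<tau>, t))) \<longlongrightarrow> 0) (nhds \<tau>)"
proof -
 define d where "d i = (pd (0, 1) ^^ i) F" for i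
 have K': "compact ({\<tau>} \<times> {a..b})" by (intro compact_Times) auto
 have ev: "\<forall>\<^sub>F r in nhds \<tau>. \<forall>t\<in>{a..b}. (r, t) \<in> S \<and> norm (d i (r, t) - d i (\<tau>, t)) \<le> e" if e: "e > 0" for i e
 proof -
  have c: "continuous_on S (d i)" unfolding d_def by (intro smooth_on_continuous pd_pow_smooth F)
  obtain \<delta> where \<delta>: "\<delta> > 0" "\<And>q q'. q \<in> {\<tau>} \<times> {a..b} \<Longrightarrow> dist q' q < \<delta> \<Longrightarrow> q' \<in> S \<and> dist (d i q') (d i q) < e"
   by (rule continuous_near_compact[OF K' S K c e], rule that)
  show ?thesis
   unfolding eventually_nhds_metric
  proof (intro exI[of _ \<delta>] conjI \<delta>(1) allI impI ballI)
   fix r t assume "dist r \<tau> < \<delta>" "t \<in> {a..b}"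
   then show "(r, t) \<in> S" "norm (d i (r, t) - d i (\<tau>, t)) \<le> e"
    using \<delta>(2)[of "(\<tau>, t)" "(r, t)"] by (simp_all add: dist_Pair_Pair dist_norm)
  qed
 qed
 show 1: "\<forall>\<^sub>F r in nhds \<tau>. {r} \<times> {a..b} \<subseteq> S"
  using ev[OF zero_less_one, of 0] by eventually_elim auto
 have "((\<lambda>r. sobolev_norm k a b ((\<lambda>r i t. d i (r, t) - d i (\<tau>, t)) r 0)) \<longlongrightarrow> 0) (nhds \<tau>)"
 proof (rule sobolev_norm_tendsto_0[OF ab])
  show "\<forall>\<^sub>F r in nhds \<tau>. derivatives_on a b k (\<lambda>i t. d i (r, t) - d i (\<tau>, t))"
   using 1 unfolding d_def by eventually_elim (intro derivatives_on_diff derivatives_on_slice[OF F ab] K)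
  show "\<forall>\<^sub>F r in nhds \<tau>. \<forall>t\<in>{a..b}. norm (d i (r, t) - d i (\<tau>, t)) \<le> e" if "e > 0" for i e
   using ev[OF that, of i] by eventually_elim blast
 qed
 then show "((\<lambda>r. sobolev_norm k a b (\<lambda>t. F (r, t) - F (\<tau>, t))) \<longlongrightarrow> 0) (nhds \<tau>)" by (simp add: d_def)
qed

section \<open>The main theorem\<close>

context atlas
begin

lemma isCont_chart:
 assumes "isCont q t" "c \<in> A" "q t \<in> fst c"
 shows "isCont (\<lambda>t. snd c (q t)) t" "\<forall>\<^sub>F s in nhds t. q s \<in> fst c"
proof -
 have "isCont (snd c) (q t)"
  using chart_continuous[OF assms(2)] open_dom[OF assms(2)] assms(3) by (simp add: continuous_on_eq_continuous_at)
 from isCont_o2[OF assms(1) this] show "isCont (\<lambda>t. snd c (q t)) t" .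
 show "\<forall>\<^sub>F s in nhds t. q s \<in> fst c"
  using assms(1,3) open_dom[OF assms(2)] by (auto simp: isCont_def tendsto_def eventually_at_filter elim!: allE[of _ "fst c"] eventually_mono)
qed

lemma isCont_in_chart:
 fixes F :: "real \<Rightarrow> 'm \<Rightarrow> 'b::real_normed_vector" and q :: "real \<Rightarrow> 'm"
 assumes "c \<in> A" "smooth_on (UNIV \<times> snd c ` fst c) (\<lambda>(t, y). F t (chart_inv c y))" "isCont q t" "q t \<in> fst c"
 shows "isCont (\<lambda>t. F t (q t)) t"
proof -
 have o: "open (UNIV \<times> snd c ` fst c :: (real \<times> 'e) set)" by (intro open_Times open_UNIV open_img assms)
 have 1: "isCont (\<lambda>(t, y). F t (chart_inv c y)) (t, snd c (q t))"
  using smooth_on_continuous[OF assms(2)] o assms(4) by (simp add: continuous_on_eq_continuous_at)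
 have 2: "isCont (\<lambda>t. (t, snd c (q t))) t" by (rule isCont_Pair[OF continuous_ident isCont_chart(1)[OF assms(3,1,4)]])
 have "isCont (\<lambda>t. F t (chart_inv c (snd c (q t)))) t" using isCont_o2[of t "\<lambda>t. (t, snd c (q t))", OF 2 1] by simp
 moreover have "\<forall>\<^sub>F s in nhds t. F s (chart_inv c (snd c (q s))) = F s (q s)"
  using isCont_chart(2)[OF assms(3,1,4)] by eventually_elim (simp add: inv_chart[OF assms(1)])
 ultimately show ?thesis by (simp only: isCont_cong)
qed

text \<open>Solutions are C^1 in charts, because the right-hand side is continuous along a
  continuous curve; this is the regularity that \<open>sup_le_sobolev_norm\<close> asks for.\<close>

lemma delay_solution_in_chart:
 assumes f: "smooth_periodic_function A f" and X: "smooth_periodic_vector_field A X"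
  and y: "delay_solution A f X \<tau> y" and c: "c \<in> A" "y ` {a..b} \<subseteq> fst c"
 obtains u' where "\<And>t. t \<in> {a..b} \<Longrightarrow> ((\<lambda>t. snd c (y t)) has_vector_derivative u' t) (at t within {a..b})" "continuous_on {a..b} u'"
proof (rule that)
 have vel: "has_velocity A y (tangent_scale (f t (y (t - \<tau>))) (X t (y t))) t UNIV" for t using y by (simp add: delay_solution_def)
 have yc: "isCont y t" for t using vel[of t] by (simp add: has_velocity_def)
 show "((\<lambda>t. snd c (y t)) has_vector_derivative f t (y (t - \<tau>)) *\<^sub>R X t (y t) c) (at t within {a..b})" if "t \<in> {a..b}" for t
 proof (rule has_vector_derivative_at_within)
  have "y t \<in> fst c" using c(2) that by blast
  then show "((\<lambda>t. snd c (y t)) has_vector_derivative f t (y (t - \<tau>)) *\<^sub>R X t (y t) c) (at t)"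
   using vel[of t] c(1) unfolding has_velocity_def tangent_scale_def o_def by blast
 qed
 show "continuous_on {a..b} (\<lambda>t. f t (y (t - \<tau>)) *\<^sub>R X t (y t) c)"
 proof (rule continuous_at_imp_continuous_on, rule ballI)
  fix t assume t: "t \<in> {a..b}"
  have q: "isCont (\<lambda>t. y (t - \<tau>)) t" using isCont_o2[OF _ yc, of t "\<lambda>t. t - \<tau>"] by simp
  obtain d where d: "d \<in> A" "y (t - \<tau>) \<in> fst d" using chart_at by blast
  have "isCont (\<lambda>t. f t (y (t - \<tau>))) t"
   by (rule isCont_in_chart[OF d(1) _ q d(2)]) (use f d in \<open>simp add: smooth_periodic_function_def\<close>)
  moreover have "isCont (\<lambda>t. X t (y t) c) t"
   by (rule isCont_in_chart[where F = "\<lambda>t p. X t p c", OF c(1) _ yc])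
    (use X c t in \<open>auto simp: smooth_periodic_vector_field_def\<close>)
  ultimately show "isCont (\<lambda>t. f t (y (t - \<tau>)) *\<^sub>R X t (y t) c) t" by (rule isCont_scaleR)
 qed
qed

section \<open>The family as a curve of Sobolev loops\<close>

definition family_dom :: "real \<Rightarrow> (real \<Rightarrow> real \<Rightarrow> 'm) \<Rightarrow> ('m, 'e) chart \<Rightarrow> (real \<times> real) set" where
 "family_dom \<tau>1 x c = ({-\<tau>1<..<\<tau>1} \<times> UNIV) \<inter> (case_prod x) -` fst c"

lemma family_chart:
 fixes x :: "real \<Rightarrow> real \<Rightarrow> 'm"
 assumes x: "smooth_into ({-\<tau>1<..<\<tau>1} \<times> UNIV) (case_prod x)" and c: "c \<in> A"
 shows "open (family_dom \<tau>1 x c)" "smooth_on (family_dom \<tau>1 x c) (\<lambda>(\<tau>, t). snd c (x \<tau> t))"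
 unfolding family_dom_def
 using smooth_into_open_vimage[OF x open_dom[OF c]] smooth_into_chart[OF x c] by (simp_all add: case_prod_beta')

lemma family_sobolev_loop:
 fixes x :: "real \<Rightarrow> real \<Rightarrow> 'm"
 assumes x: "smooth_into ({-\<tau>1<..<\<tau>1} \<times> UNIV) (case_prod x)" and \<tau>: "\<bar>\<tau>\<bar> < \<tau>1" and per: "\<And>t. x \<tau> (t + 1) = x \<tau> t"
 shows "smooth_loop A (x \<tau>)" "x \<tau> \<in> sobolev_loops k A"
proof -
 have "continuous_on ({-\<tau>1<..<\<tau>1} \<times> UNIV) (case_prod x)" using x by (simp add: smooth_into_def)
 then have "continuous_on UNIV (\<lambda>t. (case_prod x) (\<tau>, t))"
  by (rule continuous_on_compose2) (use \<tau> in \<open>auto simp: abs_less_iff intro!: continuous_intros\<close>)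
 then have cont: "continuous_on UNIV (x \<tau>)" by simp
 have "smooth_on {t. x \<tau> t \<in> fst c} (\<lambda>t. snd c (x \<tau> t))" if c: "c \<in> A" for c
 proof -
  have o: "open {t. x \<tau> t \<in> fst c}" using open_vimage[OF open_dom[OF c] cont] by (simp add: vimage_def)
  have "smooth_on {t. x \<tau> t \<in> fst c} (\<lambda>t. (\<lambda>(\<tau>, t). snd c (x \<tau> t)) (\<tau>, t))"
   by (rule smooth_on_compose[OF o family_chart(1)[OF x c] _ family_chart(2)[OF x c]])
    (use \<tau> o in \<open>auto simp: family_dom_def intro!: smooth_on_Pair\<close>)
  then show ?thesis by simp
 qed
 then show "smooth_loop A (x \<tau>)" using per cont by (simp add: smooth_loop_def o_def)
 have "sobolev_on k a b (snd c \<circ> x \<tau>)" if c: "c \<in> A" and ab: "a < b" "x \<tau> ` {a..b} \<subseteq> fst c" for c a b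
 proof -
  have "{\<tau>} \<times> {a..b} \<subseteq> family_dom \<tau>1 x c" using ab \<tau> by (auto simp: family_dom_def)
  from sobolev_on_derivatives[OF derivatives_on_slice[OF family_chart(2)[OF x c] ab(1) this]] show ?thesis by (simp add: o_def)
 qed
 then show "x \<tau> \<in> sobolev_loops k A" using per cont by (simp add: sobolev_loops_def)
qed

lemma family_smooth_curve:
 fixes x :: "real \<Rightarrow> real \<Rightarrow> 'm"
 assumes x: "smooth_into ({-\<tau>1<..<\<tau>1} \<times> UNIV) (case_prod x)" and \<tau>0: "\<tau>0 < \<tau>1"
  and per: "\<And>\<tau> t. \<bar>\<tau>\<bar> \<le> \<tau>0 \<Longrightarrow> x \<tau> (t + 1) = x \<tau> t"
 shows "smooth_curve_sobolev_loops k A {-\<tau>0..\<tau>0} x"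
 unfolding smooth_curve_sobolev_loops_def
proof (intro conjI ballI allI impI)
 show "x \<tau> \<in> sobolev_loops k A" if "\<tau> \<in> {-\<tau>0..\<tau>0}" for \<tau>
  using that \<tau>0 per[of \<tau>] by (intro family_sobolev_loop(2)[OF x]) auto
 fix r c a b assume r: "r \<in> {-\<tau>0..\<tau>0}" and c: "c \<in> A" and ab: "a < b \<and> x r ` {a..b} \<subseteq> fst c"
 note fc = family_chart[OF x c]
 have "{r} \<times> {a..b} \<subseteq> family_dom \<tau>1 x c" using ab r \<tau>0 by (auto simp: family_dom_def)
 from sobolev_norm_slice_tendsto_0(1)[OF fc conjunct1[OF ab] this]
 obtain e where e: "e > 0" "\<And>\<tau>. dist \<tau> r < e \<Longrightarrow> {\<tau>} \<times> {a..b} \<subseteq> family_dom \<tau>1 x c" by (auto simp: eventually_nhds_metric)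
 have sub: "(ball r e) \<times> {a..b} \<subseteq> family_dom \<tau>1 x c" using e(2) by (force simp: dist_commute)
 have "smooth_curve_sobolev k a b ({-\<tau>0..\<tau>0} \<inter> ball r e) (\<lambda>\<tau> t. (\<lambda>(\<tau>, t). snd c (x \<tau> t)) (\<tau>, t))"
  by (rule smooth_curve_sobolevI[OF fc]) (use ab sub in auto)
 then have "smooth_curve_sobolev k a b ({-\<tau>0..\<tau>0} \<inter> ball r e) (\<lambda>\<tau>. snd c \<circ> x \<tau>)" by (simp add: o_def)
 moreover have "\<forall>\<tau>\<in>{-\<tau>0..\<tau>0} \<inter> ball r e. x \<tau> ` {a..b} \<subseteq> fst c" using sub by (auto simp: family_dom_def)
 ultimately show "\<exists>e>0. (\<forall>\<tau>\<in>{-\<tau>0..\<tau>0} \<inter> ball r e. x \<tau> ` {a..b} \<subseteq> fst c) \<and>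
   smooth_curve_sobolev k a b ({-\<tau>0..\<tau>0} \<inter> ball r e) (\<lambda>\<tau>. snd c \<circ> x \<tau>)"
  using e(1) by (intro exI[of _ e]) simp
qed

end

theorem theorem8p6:
 fixes A :: "('m::{t2_space, second_countable_topology}, 'e::euclidean_space) chart set"
  and f :: "real \<Rightarrow> 'm \<Rightarrow> real"
  and X :: "real \<Rightarrow> 'm \<Rightarrow> ('m, 'e) tangent_vector"
  and x0 :: "real \<Rightarrow> 'm"
 assumes "smooth_atlas A"
  and "smooth_periodic_function A f"
  and "smooth_periodic_vector_field A X"
  and "nondegenerate_orbit A (\<lambda>t p. tangent_scale (f t p) (X t p)) x0"
 shows "\<exists>\<tau>0>0. \<exists>x :: real \<Rightarrow> real \<Rightarrow> 'm.
  x 0 = x0 \<and>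
  (\<forall>\<tau>. \<bar>\<tau>\<bar> \<le> \<tau>0 \<longrightarrow> smooth_loop A (x \<tau>) \<and> delay_solution A f X \<tau> (x \<tau>)) \<and>
  (\<exists>N U. openin (prod_topology euclideanreal (sobolev_loop_topology 1 A)) U \<and>
    (0, x0) \<in> U \<and> U \<subseteq> N \<and> N \<subseteq> UNIV \<times> sobolev_loops 1 A \<and>
    {(\<tau>, y) \<in> N. delay_solution A f X \<tau> y} = {(\<tau>, x \<tau>) | \<tau>. \<bar>\<tau>\<bar> \<le> \<tau>0}) \<and>
  (\<forall>m. smooth_curve_sobolev_loops (1 + m) A {-\<tau>0..\<tau>0} x)"
proof -
 interpret atlas A by unfold_locales (rule assms(1))
 obtain \<tau>1 x C e where \<tau>1: "0 < \<tau>1" and x0: "x 0 = x0" and sol: "\<And>\<tau>. \<bar>\<tau>\<bar> < \<tau>1 \<Longrightarrow> delay_solution A f X \<tau> (x \<tau>)"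
  and x: "smooth_into ({-\<tau>1<..<\<tau>1} \<times> UNIV) (case_prod x)" and C: "finite C" "C \<noteq> {}" and e: "0 < e"
  and Cc: "\<And>c a b. (c, a, b) \<in> C \<Longrightarrow> c \<in> A \<and> a < b \<and> x0 ` {a..b} \<subseteq> fst c"
  and uniq: "\<And>\<tau> y. \<bar>\<tau>\<bar> < \<tau>1 \<Longrightarrow> delay_solution A f X \<tau> y \<Longrightarrow>
   (\<And>c a b t. (c, a, b) \<in> C \<Longrightarrow> t \<in> {a..b} \<Longrightarrow> y t \<in> fst c \<and> dist (snd c (y t)) (snd c (x0 t)) < e) \<Longrightarrow> y = x \<tau>"
  apply (rule nondegenerate_delay_solutions[OF assms(2-4)])
  subgoal premises p for \<tau>1 x C e by (rule that[of \<tau>1 x C e]) (fact p)+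
  done
 have per: "x \<tau> (t + 1) = x \<tau> t" if "\<bar>\<tau>\<bar> < \<tau>1" for \<tau> t using sol[OF that] by (simp add: delay_solution_def)
 have \<tau>1': "\<bar>0\<bar> < \<tau>1" using \<tau>1 by simp
 have sol0: "delay_solution A f X 0 x0" using sol[OF \<tau>1'] x0 by simp
 have loop: "smooth_loop A (x \<tau>)" "x \<tau> \<in> sobolev_loops k A" if "\<bar>\<tau>\<bar> < \<tau>1" for \<tau> k
  by (rule family_sobolev_loop[OF x that], rule per[OF that])+
 have x0_loop: "x0 \<in> sobolev_loops 1 A" using loop(2)[OF \<tau>1', of 1] by (simp only: x0)
 \<comment> \<open>The embedding constant times \<eta> is \<open>e / 2\<close>, so Sobolev distance
   below \<eta> implies the uniform closeness for which uniqueness is known.\<close>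
 define \<eta> where "\<eta> a b = e / (2 * ((b - a + 1) / 2 * (1 / (b - a) + 1)))" for a b
 have \<eta>: "\<eta> a b > 0" "((b - a + 1) / 2 * (1 / (b - a) + 1)) * \<eta> a b < e" if "a < b" for a b
 proof -
  have k: "(b - a + 1) / 2 * (1 / (b - a) + 1) > 0" using that by (intro mult_pos_pos add_pos_pos) auto
  have "k * (e / (2 * k)) < e" "e / (2 * k) > 0" if "k > 0" for k using that e by simp_all
  from this[OF k] show "\<eta> a b > 0" "((b - a + 1) / 2 * (1 / (b - a) + 1)) * \<eta> a b < e" by (simp_all only: \<eta>_def)
 qed
 define W where "W = (\<lambda>(c, a, b). sobolev_nbhd 1 A x0 c a b (\<eta> a b))"
 define V where "V = \<Inter> (W ` C)"
 have "openin (sobolev_loop_topology 1 A) (W p)" if "p \<in> C" for p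
 proof -
  obtain c a b where p: "p = (c, a, b)" by (cases p)
  show ?thesis unfolding W_def p prod.case sobolev_loop_topology_def
   by (rule topology_generated_by_Basis) (use Cc that p x0_loop \<eta> in blast)
 qed
 then have V: "openin (sobolev_loop_topology 1 A) V" unfolding V_def using C by (intro openin_Inter) auto
 have Vl: "V \<subseteq> sobolev_loops 1 A" using C(2) by (auto simp: V_def W_def sobolev_nbhd_def)
 have "\<forall>\<^sub>F \<tau> in nhds 0. x \<tau> \<in> W p" if p: "p \<in> C" for p
 proof -
  obtain c a b where p': "p = (c, a, b)" by (cases p)
  have c: "c \<in> A" "a < b" "x0 ` {a..b} \<subseteq> fst c" using Cc p p' by blast+
  have "{0} \<times> {a..b} \<subseteq> family_dom \<tau>1 x c" using c(3) \<tau>1 x0 by (auto simp: family_dom_def)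
  note sl = sobolev_norm_slice_tendsto_0[OF family_chart[OF x c(1)] c(2) this]
  have "\<forall>\<^sub>F \<tau> in nhds 0. sobolev_norm 1 a b (\<lambda>t. (\<lambda>(\<tau>, t). snd c (x \<tau> t)) (\<tau>, t) - (\<lambda>(\<tau>, t). snd c (x \<tau> t)) (0, t)) < \<eta> a b"
   by (rule order_tendstoD(2)[OF sl(2) \<eta>(1)[OF c(2)]])
  moreover have "\<forall>\<^sub>F \<tau> in nhds 0. \<tau> \<in> ball 0 \<tau>1" using \<tau>1 by (intro eventually_nhds_in_open) auto
  ultimately show ?thesis
   using sl(1)
  proof eventually_elim
   case (elim \<tau>)
   then have "\<bar>\<tau>\<bar> < \<tau>1" "x \<tau> ` {a..b} \<subseteq> fst c" by (auto simp: family_dom_def)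
   then show ?case using elim loop(2)[of \<tau> 1] by (simp add: p' W_def sobolev_nbhd_def x0)
  qed
 qed
 then have "\<forall>\<^sub>F \<tau> in nhds 0. \<forall>p\<in>C. x \<tau> \<in> W p" by (intro eventually_ball_finite C) blast
 then obtain \<delta> where \<delta>: "\<delta> > 0" "\<And>\<tau>. dist \<tau> 0 < \<delta> \<Longrightarrow> \<forall>p\<in>C. x \<tau> \<in> W p" unfolding eventually_nhds_metric by blast
 \<comment> \<open>Halved, so that the closed interval of delays stays strictly inside both
   bounds.\<close>
 define \<tau>0 where "\<tau>0 = min \<delta> \<tau>1 / 2"
 have \<tau>0: "\<tau>0 > 0" "\<tau>0 < \<delta>" "\<tau>0 < \<tau>1" using \<delta>(1) \<tau>1 by (auto simp: \<tau>0_def)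
 have xV: "x \<tau> \<in> V" if "\<bar>\<tau>\<bar> \<le> \<tau>0" for \<tau> using \<delta>(2)[of \<tau>] that \<tau>0 by (auto simp: V_def)
 \<comment> \<open>Membership in \<open>V\<close> gives Sobolev closeness on each piece, the
   embedding gives uniform closeness, and for solutions this determines the curve.\<close>
 have yx: "y = x \<tau>" if y: "y \<in> V" "delay_solution A f X \<tau> y" and \<tau>: "\<bar>\<tau>\<bar> \<le> \<tau>0" for \<tau> y
 proof (rule uniq[OF _ y(2)])
  show "\<bar>\<tau>\<bar> < \<tau>1" using \<tau> \<tau>0 by simp
  fix c a b t assume cab: "(c, a, b) \<in> C" and t: "t \<in> {a..b}"
  have c: "c \<in> A" "a < b" "x0 ` {a..b} \<subseteq> fst c" using Cc[OF cab] by auto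
  have yW: "y ` {a..b} \<subseteq> fst c" "sobolev_norm 1 a b (\<lambda>t. snd c (y t) - snd c (x0 t)) < \<eta> a b"
  proof -
   have "y \<in> W (c, a, b)" using y(1) cab unfolding V_def by blast
   then show "y ` {a..b} \<subseteq> fst c" "sobolev_norm 1 a b (\<lambda>t. snd c (y t) - snd c (x0 t)) < \<eta> a b"
    by (simp_all add: W_def sobolev_nbhd_def)
  qed
  obtain u' where u': "\<And>t. t \<in> {a..b} \<Longrightarrow> ((\<lambda>t. snd c (y t)) has_vector_derivative u' t) (at t within {a..b})" "continuous_on {a..b} u'"
   by (rule delay_solution_in_chart[OF assms(2,3) y(2) c(1) yW(1)], rule that)
  obtain w' where w': "\<And>t. t \<in> {a..b} \<Longrightarrow> ((\<lambda>t. snd c (x0 t)) has_vector_derivative w' t) (at t within {a..b})" "continuous_on {a..b} w'"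
   by (rule delay_solution_in_chart[OF assms(2,3) sol0 c(1,3)], rule that)
  have "norm (snd c (y t) - snd c (x0 t)) \<le> ((b - a + 1) / 2 * (1 / (b - a) + 1)) * \<eta> a b"
   by (rule sup_le_sobolev_norm[OF c(2) has_vector_derivative_diff[OF u'(1) w'(1)] continuous_on_diff[OF u'(2) w'(2)] yW(2) t])
  then show "y t \<in> fst c \<and> dist (snd c (y t)) (snd c (x0 t)) < e" using yW(1) t \<eta>(2)[OF c(2)] by (auto simp: dist_norm)
 qed
 \<comment> \<open>The closed interval makes the solutions in \<open>N\<close> match the delays with
   \<open>\<bar>\<tau>\<bar> \<le> \<tau>0\<close> exactly; the open set \<open>U\<close> inside
   shows that \<open>N\<close> is a neighbourhood.\<close>
 define N where "N = {-\<tau>0..\<tau>0} \<times> V"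
 define U where "U = {-\<tau>0<..<\<tau>0} \<times> V"
 have "openin (prod_topology euclideanreal (sobolev_loop_topology 1 A)) U"
  unfolding U_def using V by (simp add: openin_prod_Times_iff)
 moreover have "(0, x0) \<in> U" using xV[of 0] x0 \<tau>0 by (simp add: U_def)
 moreover have "U \<subseteq> N" by (auto simp: U_def N_def)
 moreover have "N \<subseteq> UNIV \<times> sobolev_loops 1 A" using Vl by (auto simp: N_def)
 moreover have "{(\<tau>, y) \<in> N. delay_solution A f X \<tau> y} = {(\<tau>, x \<tau>) | \<tau>. \<bar>\<tau>\<bar> \<le> \<tau>0}"
 proof (intro equalityI subsetI)
  fix p assume "p \<in> {(\<tau>, y) \<in> N. delay_solution A f X \<tau> y}"
  then obtain \<tau> y where p: "p = (\<tau>, y)" "y \<in> V" "\<bar>\<tau>\<bar> \<le> \<tau>0" "delay_solution A f X \<tau> y" by (auto simp: N_def)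
  then show "p \<in> {(\<tau>, x \<tau>) | \<tau>. \<bar>\<tau>\<bar> \<le> \<tau>0}" using yx[OF p(2,4,3)] by auto
 next
  fix p assume "p \<in> {(\<tau>, x \<tau>) | \<tau>. \<bar>\<tau>\<bar> \<le> \<tau>0}"
  then obtain \<tau> where p: "p = (\<tau>, x \<tau>)" "\<bar>\<tau>\<bar> \<le> \<tau>0" by auto
  then show "p \<in> {(\<tau>, y) \<in> N. delay_solution A f X \<tau> y}" using xV sol[of \<tau>] \<tau>0 by (auto simp: N_def)
 qed
 ultimately have nbhd: "\<exists>N U. openin (prod_topology euclideanreal (sobolev_loop_topology 1 A)) U \<and>
    (0, x0) \<in> U \<and> U \<subseteq> N \<and> N \<subseteq> UNIV \<times> sobolev_loops 1 A \<and>
    {(\<tau>, y) \<in> N. delay_solution A f X \<tau> y} = {(\<tau>, x \<tau>) | \<tau>. \<bar>\<tau>\<bar> \<le> \<tau>0}" by blast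
 have loops: "\<forall>\<tau>. \<bar>\<tau>\<bar> \<le> \<tau>0 \<longrightarrow> smooth_loop A (x \<tau>) \<and> delay_solution A f X \<tau> (x \<tau>)"
  using \<tau>0 loop(1) sol by auto
 have curve: "\<forall>m. smooth_curve_sobolev_loops (1 + m) A {-\<tau>0..\<tau>0} x"
  using \<tau>0 per by (intro allI family_smooth_curve[OF x]) auto
 show ?thesis by (rule exI[of _ \<tau>0], rule conjI[OF \<tau>0(1)], rule exI[of _ x], intro conjI x0 loops nbhd curve)
qed

end
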